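(* (a) Let $K$ be a number field. Then the following map is a bijection: $$\Phi:\mathrm{Rep}^f(K)\to\mathrm{Pic}^0(K),\quad ([\mathfrak b]_\sim,(t_1,\dots,t_n))\mapsto\Bigl[\mathrm{div}(\mathfrak b)+\sum_{i=1}^n t_i\mathfrak p_i-\tfrac{\deg\mathrm{div}(\mathfrak b)+\sum_{i=1}^n t_i\deg\mathfrak p_i}{\deg\mathfrak p_{n+1}}\,\mathfrak p_{n+1}\Bigr].$$ (b) Let $K$ be a function field. Then the following map is a bijection: $$\Phi:\mathrm{Rep}^f(K)\to\mathrm{Pic}(K)/\langle[\mathfrak p_{n+1}]\rangle,\quad ([\mathfrak b]_\sim,(t_1,\dots,t_n))\mapsto\Bigl[\mathrm{div}(\mathfrak b)+\sum_{i=1}^n t_i\mathfrak p_i\Bigr]+\langle[\mathfrak p_{n+1}]\rangle.$$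
   Context: **Fields and places.** $K$ is either a number field, or an algebraic function field in one variable with exact field of constants $k$ ($k$ not assumed finite). *Number field case:* $\mathcal O_K$ is the ring of integers, $S$ the set of archimedean places, $\mathbb G=\mathbb R$, $q=e$; for $\mathfrak p\in S$ corresponding to an embedding $\sigma:K\to\mathbb C$, $\deg\mathfrak p=1$ if $\sigma(K)\subseteq\mathbb R$ and $\deg\mathfrak p=2$ otherwise, and $\nu_{\mathfrak p}(f)=-\log|\sigma(f)|$ for $f\in K^*$; for a finite place $\mathfrak p$, $\nu_{\mathfrak p}$ is the normalized valuation and $\deg\mathfrak p=\log|\mathcal O_{\mathfrak p}/\mathfrak m_{\mathfrak p}|$, where $\mathcal O_{\mathfrak p}$ is the valuation ring of $\mathfrak p$ and $\mathfrak m_{\mathfrak p}$ its maximal ideal. *Function field case:* $x\in K$ is a fixed element transcendental over $k$, $\mathcal O_K$ is the integral closure of $k[x]$ in $K$, $S$ is the set of places of $K$ above the infinite place of $k(x)$, $\mathbb G=\mathbb Z$, $q=|k|$ if $k$ is finite and otherwise $q>1$ is an arbitrary fixed real number; $\nu_{\mathfrak p}$ is the normalized valuation and $\deg\mathfrak p$ the usual degree over $k$. In both cases $|f|_{\mathfrak p}=q^{-\nu_{\mathfrak p}(f)\deg\mathfrak p}$ for $f\in K^*$ and $|0|_{\mathfrak p}=0$. Write $S=\{\mathfrak p_1,\dots,\mathfrak p_{n+1}\}$ with $n=|S|-1$ (fixed ordering). **Divisors.** For a function field, $\mathrm{Div}(K)$ is the free abelian group on all places. For a number field, $\mathrm{Div}(K)$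 is the direct product of the free abelian group on the finite places and $\mathbb R^S$ (so coefficients at archimedean places are real). $\deg\sum n_{\mathfrak p}\mathfrak p=\sum n_{\mathfrak p}\deg\mathfrak p$; $(f)=\sum_{\mathfrak p}\nu_{\mathfrak p}(f)\mathfrak p$ for $f\in K^*$ (degree $0$). $\mathrm{Pic}(K)$ is $\mathrm{Div}(K)$ modulo principal divisors $(f)$, and $\mathrm{Pic}^0(K)$ is the subgroup of classes of degree $0$; $[D]$ is the class of $D$, and $\langle[D]\rangle$ the subgroup it generates. For an ideal $\mathfrak b=\prod_{\mathfrak p\notin S}(\mathfrak m_{\mathfrak p}\cap\mathcal O_K)^{n_{\mathfrak p}}$ put $\mathrm{div}(\mathfrak b)=-\sum_{\mathfrak p\notin S}n_{\mathfrak p}\mathfrak p$, where $\mathfrak m_{\mathfrak p}$ is the valuation ideal of $\mathfrak p$. **Ideals.** "Ideal" means nonzero fractional ideal of $\mathcal O_K$; $\mathrm{Id}(\mathcal O_K)$ is the group of these. For an ideal $\mathfrak b$ and $t_1,\dots,t_{n+1}\in\mathbb G$ let $B(\mathfrak b,(t_1,\dots,t_{n+1}))=\{h\in\mathfrak b: |h|_{\mathfrak p_i}\le q^{t_i\deg\mathfrak p_i},\ 1\le i\le n+1\}$. An ideal $\mathfrak b$ is *reduced* if $1\in\mathfrak b$ and every nonzero $h\in B(\mathfrak b,(0,\dots,0))$ satisfies $|h|_{\mathfrak p}=1$ for all $\mathfrak p\in S$. $\mathrm{Red}(\mathfrak a)$ is the set of reduced ideals of the form $\frac1\mu\mathfrak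 a$, $\mu\in K^*$. Define $\mathfrak b\sim\mathfrak b'$ iff there is $h\in K^*$ with $\mathfrak b=h\mathfrak b'$ and $|h|_{\mathfrak p}=1$ for all $\mathfrak p\in S$; $[\mathfrak b]_\sim$ is the class. **$f$-representations.** Define a total preorder on $K^*$ by $h\le h'$ iff $(|h|_{\mathfrak p_{n+1}},|h|_{\mathfrak p_1},\dots,|h|_{\mathfrak p_n})\le_{lex}(|h'|_{\mathfrak p_{n+1}},|h'|_{\mathfrak p_1},\dots,|h'|_{\mathfrak p_n})$ in the lexicographic order on $\mathbb R^{n+1}$. $\mathrm{Rep}^{f}(\mathfrak a)$ is the set of $([\mathfrak b]_\sim,(t_1,\dots,t_n))\in\mathrm{Red}(\mathfrak a)/_\sim\times\mathbb G^n$ such that $1$ is an element of $B(\mathfrak b,(t_1,\dots,t_n,0))\setminus\{0\}$ and is a smallest element of this set with respect to $\le$ (this does not depend on the representative $\mathfrak b$). $\mathrm{Rep}^f(K)=\bigcup_{\mathfrak a\in\mathrm{Id}(\mathcal O_K)}\mathrm{Rep}^f(\mathfrak a)$. *)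

theory Defs
  imports
    Complex_Main
    "HOL-Computational_Algebra.Polynomial"
    "HOL-Algebra.Coset"
    "HOL-Algebra.FiniteProduct"
    "HOL-Algebra.QuotRing"
    "HOL-Algebra.Ideal_Product"
    "HOL-Algebra.Embedded_Algebras"
    "HOL-Algebra.Generated_Groups"
begin

text \<open>
  The field K is a whole type of class field; the groups attached to it (fractional ideals,
  divisors, divisor classes) and the residue fields are HOL-Algebra structures.
\<close>

definition struct_on :: "'a::field set \<Rightarrow> 'a ring" where
  "struct_on A = \<lparr>carrier = A, monoid.mult = (*), one = 1, ring.zero = 0, add = (+)\<rparr>"

definition number_field :: "'a::field_char_0 itself \<Rightarrow> bool" where
  "number_field _ \<longleftrightarrow> ring.finite_dimension (struct_on (UNIV :: 'a set)) \<rat> UNIV"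

definition algebraic_over :: "'a::field set \<Rightarrow> 'a \<Rightarrow> bool" where
  "algebraic_over k z \<longleftrightarrow> (\<exists>f. f \<noteq> 0 \<and> (\<forall>i. Polynomial.coeff f i \<in> k) \<and> poly f z = 0)"

definition poly_ring_at :: "'a::field set \<Rightarrow> 'a \<Rightarrow> 'a set" where
  "poly_ring_at k x = {poly f x |f. \<forall>i. Polynomial.coeff f i \<in> k}"

definition rat_field_at :: "'a::field set \<Rightarrow> 'a \<Rightarrow> 'a set" where
  "rat_field_at k x = {a / b |a b. a \<in> poly_ring_at k x \<and> b \<in> poly_ring_at k x \<and> b \<noteq> 0}"

definition integral_closure :: "'a::field set \<Rightarrow> 'a set" where
  "integral_closure A = {z. \<exists>f. lead_coeff f = 1 \<and> (\<forall>i. Polynomial.coeff f i \<in> A) \<and> poly f z = 0}"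

text \<open>Algebraic function field in one variable; the last conjunct makes \<open>k\<close> the exact constant field.\<close>

definition function_field :: "'a::field set \<Rightarrow> bool" where
  "function_field k \<longleftrightarrow>
     subfield k (struct_on UNIV) \<and>
     (\<exists>x. \<not> algebraic_over k x \<and>
          ring.finite_dimension (struct_on UNIV) (rat_field_at k x) UNIV) \<and>
     (\<forall>z. algebraic_over k z \<longrightarrow> z \<in> k)"

text \<open>
  A non-archimedean place is identified with its normalized (surjective) discrete valuation,
  an archimedean place with a pair of conjugate embeddings into the complex numbers.
  Valuations take the junk value 0 at 0, so that a place is a single function.
\<close>

datatype 'a place = Nonarch "'a \<Rightarrow> int" | Arch "('a \<Rightarrow> complex) set"

definition normalized_valuation :: "('a::field \<Rightarrow> int) \<Rightarrow> bool" where
  "normalized_valuation v \<longleftrightarrow>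
     v 0 = 0 \<and>
     (\<forall>a b. a \<noteq> 0 \<longrightarrow> b \<noteq> 0 \<longrightarrow> v (a * b) = v a + v b) \<and>
     (\<forall>a b. a \<noteq> 0 \<longrightarrow> b \<noteq> 0 \<longrightarrow> a + b \<noteq> 0 \<longrightarrow> min (v a) (v b) \<le> v (a + b)) \<and>
     v ` (UNIV - {0}) = UNIV"

definition val_ring :: "('a::field \<Rightarrow> int) \<Rightarrow> 'a set" where
  "val_ring v = {z. z = 0 \<or> 0 \<le> v z}"

definition val_ideal :: "('a::field \<Rightarrow> int) \<Rightarrow> 'a set" where
  "val_ideal v = {z. z = 0 \<or> 0 < v z}"

definition residue_field :: "('a::field \<Rightarrow> int) \<Rightarrow> 'a set ring" where
  "residue_field v = struct_on (val_ring v) Quot val_ideal v"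

fun place_val :: "'a::field place \<Rightarrow> 'a \<Rightarrow> real" where
  "place_val (Nonarch v) f = real_of_int (v f)"
| "place_val (Arch s) f = - ln (cmod ((SOME \<sigma>. \<sigma> \<in> s) f))"

record 'a arith_data =
  int_ring :: "'a set"             \<comment> \<open>\<open>\<O>\<^sub>K\<close>\<close>
  all_places :: "'a place set"
  inf_places :: "'a place list"    \<comment> \<open>\<open>\<pp>\<^sub>1, \<dots>, \<pp>\<^sub>n\<^sub>+\<^sub>1\<close>, an enumeration of \<open>S\<close>\<close>
  coef_group :: "real set"         \<comment> \<open>the group \<open>\<real>\<close> or \<open>\<int>\<close>, as a subset of the reals\<close>
  abs_base :: real                 \<comment> \<open>\<open>q\<close>\<close>
  place_deg :: "'a place \<Rightarrow> real"

definition arch_places :: "'a::field place set" where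
  "arch_places =
     {Arch {\<sigma>, cnj \<circ> \<sigma>} |\<sigma>. \<sigma> \<in> ring_hom (struct_on UNIV) (struct_on UNIV)}"

fun nf_deg :: "'a::field_char_0 place \<Rightarrow> real" where
  "nf_deg (Nonarch v) = ln (real (card (carrier (residue_field v))))"
| "nf_deg (Arch s) = (if \<forall>\<sigma>\<in>s. range \<sigma> \<subseteq> \<real> then 1 else 2)"

definition nf_data :: "'a::field_char_0 place list \<Rightarrow> 'a arith_data" where
  "nf_data ps =
     \<lparr>int_ring = {z. algebraic_int z},
      all_places = arch_places \<union> {Nonarch v |v. normalized_valuation v},
      inf_places = ps,
      coef_group = UNIV,
      abs_base = exp 1,
      place_deg = nf_deg\<rparr>"

definition ff_places :: "'a::field set \<Rightarrow> 'a place set" where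
  "ff_places k = {Nonarch v |v. normalized_valuation v \<and> (\<forall>c\<in>k - {0}. v c = 0)}"

definition inf_val_ring :: "'a::field set \<Rightarrow> 'a \<Rightarrow> 'a set" where
  "inf_val_ring k x =
     {poly f x / poly g x |f g. (\<forall>i. Polynomial.coeff f i \<in> k) \<and> (\<forall>i. Polynomial.coeff g i \<in> k) \<and>
                                g \<noteq> 0 \<and>
                                Polynomial.degree f \<le> Polynomial.degree g}"

definition ff_inf_places :: "'a::field set \<Rightarrow> 'a \<Rightarrow> 'a place set" where
  "ff_inf_places k x =
     {Nonarch v |v. Nonarch v \<in> ff_places k \<and>
                    val_ring v \<inter> rat_field_at k x = inf_val_ring k x}"

text \<open>The second argument of \<open>ring.dim\<close> is the image of \<open>k\<close> in the residue field.\<close>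

fun ff_deg :: "'a::field set \<Rightarrow> 'a place \<Rightarrow> real" where
  "ff_deg k (Nonarch v) =
     real (ring.dim (residue_field v)
             ((\<lambda>c. val_ideal v +>\<^bsub>struct_on (val_ring v)\<^esub> c) ` k)
             (carrier (residue_field v)))"
| "ff_deg k (Arch s) = 0"

definition ff_data :: "'a::field set \<Rightarrow> 'a \<Rightarrow> real \<Rightarrow> 'a place list \<Rightarrow> 'a arith_data" where
  "ff_data k x q ps =
     \<lparr>int_ring = integral_closure (poly_ring_at k x),
      all_places = ff_places k,
      inf_places = ps,
      coef_group = \<int>,
      abs_base = q,
      place_deg = ff_deg k\<rparr>"

definition place_abs :: "'a::field arith_data \<Rightarrow> 'a place \<Rightarrow> 'a \<Rightarrow> real" where
  "place_abs X p f =
     (if f = 0 then 0 else abs_base X powr (- place_val p f * place_deg X p))"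

definition frac_ideal :: "'a::field arith_data \<Rightarrow> 'a set \<Rightarrow> bool" where
  "frac_ideal X I \<longleftrightarrow>
     0 \<in> I \<and> I \<noteq> {0} \<and>
     (\<forall>a\<in>I. \<forall>b\<in>I. a + b \<in> I) \<and>
     (\<forall>r\<in>int_ring X. \<forall>a\<in>I. r * a \<in> I) \<and>
     (\<exists>d\<in>int_ring X. d \<noteq> 0 \<and> (\<forall>a\<in>I. d * a \<in> int_ring X))"

definition ideal_group :: "'a::field arith_data \<Rightarrow> 'a set monoid" where
  "ideal_group X =
     \<lparr>carrier = {I. frac_ideal X I},
      monoid.mult = ideal_prod (struct_on UNIV),
      one = int_ring X\<rparr>"

fun prime_at :: "'a::field arith_data \<Rightarrow> 'a place \<Rightarrow> 'a set" where
  "prime_at X (Nonarch v) = val_ideal v \<inter> int_ring X"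
| "prime_at X (Arch s) = {}"

definition ideal_exponents :: "'a::field arith_data \<Rightarrow> 'a set \<Rightarrow> 'a place \<Rightarrow> int" where
  "ideal_exponents X I =
     (THE n. finite {p. n p \<noteq> 0} \<and>
             {p. n p \<noteq> 0} \<subseteq> all_places X - set (inf_places X) \<and>
             I = finprod (ideal_group X) (\<lambda>p. prime_at X p [^]\<^bsub>ideal_group X\<^esub> n p) {p. n p \<noteq> 0})"

definition ideal_div :: "'a::field arith_data \<Rightarrow> 'a set \<Rightarrow> 'a place \<Rightarrow> real" where
  "ideal_div X I = (\<lambda>p. - real_of_int (ideal_exponents X I p))"

definition box :: "'a::field arith_data \<Rightarrow> 'a set \<Rightarrow> real list \<Rightarrow> 'a set" where
  "box X I t =
     {h \<in> I. \<forall>i < length (inf_places X).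
        place_abs X (inf_places X ! i) h
          \<le> abs_base X powr (t ! i * place_deg X (inf_places X ! i))}"

definition reduced :: "'a::field arith_data \<Rightarrow> 'a set \<Rightarrow> bool" where
  "reduced X I \<longleftrightarrow>
     1 \<in> I \<and>
     (\<forall>h \<in> box X I (replicate (length (inf_places X)) 0) - {0}.
        \<forall>p \<in> set (inf_places X). place_abs X p h = 1)"

definition Red :: "'a::field arith_data \<Rightarrow> 'a set \<Rightarrow> 'a set set" where
  "Red X A = {I. reduced X I \<and> (\<exists>\<mu>. \<mu> \<noteq> 0 \<and> I = (\<lambda>z. 1 / \<mu> * z) ` A)}"

definition ideal_sim :: "'a::field arith_data \<Rightarrow> 'a set \<Rightarrow> 'a set \<Rightarrow> bool" where
  "ideal_sim X I J \<longleftrightarrow>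
     (\<exists>h. h \<noteq> 0 \<and> I = (\<lambda>z. h * z) ` J \<and> (\<forall>p \<in> set (inf_places X). place_abs X p h = 1))"

definition Red_classes :: "'a::field arith_data \<Rightarrow> 'a set \<Rightarrow> 'a set set set" where
  "Red_classes X A =
     Red X A // {(I, J). I \<in> Red X A \<and> J \<in> Red X A \<and> ideal_sim X I J}"

definition elt_le :: "'a::field arith_data \<Rightarrow> 'a \<Rightarrow> 'a \<Rightarrow> bool" where
  "elt_le X h h' \<longleftrightarrow>
     (let ps = last (inf_places X) # butlast (inf_places X)
      in lexordp_eq (map (\<lambda>p. place_abs X p h) ps) (map (\<lambda>p. place_abs X p h') ps))"

definition Rep_of :: "'a::field arith_data \<Rightarrow> 'a set \<Rightarrow> ('a set set \<times> real list) set" where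
  "Rep_of X A =
     {(C, t). C \<in> Red_classes X A \<and>
              length t = length (inf_places X) - 1 \<and> set t \<subseteq> coef_group X \<and>
              (\<exists>I \<in> C. 1 \<in> box X I (t @ [0]) - {0} \<and>
                        (\<forall>h \<in> box X I (t @ [0]) - {0}. elt_le X 1 h))}"

definition Rep :: "'a::field arith_data \<Rightarrow> ('a set set \<times> real list) set" where
  "Rep X = (\<Union>A \<in> carrier (ideal_group X). Rep_of X A)"

text \<open>The additive group of divisors is a multiplicatively written HOL-Algebra group.\<close>

definition Div :: "'a::field arith_data \<Rightarrow> ('a place \<Rightarrow> real) monoid" where
  "Div X =
     \<lparr>carrier = {D. finite {p. D p \<noteq> 0} \<and> {p. D p \<noteq> 0} \<subseteq> all_places X \<and>
                    (\<forall>p. D p \<in> (if p \<in> set (inf_places X) then coef_group X else \<int>))},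
      monoid.mult = (\<lambda>D E p. D p + E p),
      one = (\<lambda>p. 0)\<rparr>"

definition div_deg :: "'a::field arith_data \<Rightarrow> ('a place \<Rightarrow> real) \<Rightarrow> real" where
  "div_deg X D = (\<Sum>p | D p \<noteq> 0. D p * place_deg X p)"

definition prime_div :: "'a place \<Rightarrow> 'a place \<Rightarrow> real" where
  "prime_div p = (\<lambda>r. if r = p then 1 else 0)"

definition principal_div :: "'a::field arith_data \<Rightarrow> 'a \<Rightarrow> 'a place \<Rightarrow> real" where
  "principal_div X f = (\<lambda>p. if p \<in> all_places X then place_val p f else 0)"

definition Princ :: "'a::field arith_data \<Rightarrow> ('a place \<Rightarrow> real) set" where
  "Princ X = principal_div X ` (UNIV - {0})"

definition Pic :: "'a::field arith_data \<Rightarrow> ('a place \<Rightarrow> real) set monoid" where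
  "Pic X = Div X Mod Princ X"

definition div_class :: "'a::field arith_data \<Rightarrow> ('a place \<Rightarrow> real) \<Rightarrow> ('a place \<Rightarrow> real) set" where
  "div_class X D = Princ X #>\<^bsub>Div X\<^esub> D"

definition Pic0 :: "'a::field arith_data \<Rightarrow> ('a place \<Rightarrow> real) set set" where
  "Pic0 X = {div_class X D |D. D \<in> carrier (Div X) \<and> div_deg X D = 0}"

definition last_class_group :: "'a::field arith_data \<Rightarrow> ('a place \<Rightarrow> real) set set" where
  "last_class_group X = generate (Pic X) {div_class X (prime_div (last (inf_places X)))}"

definition Pic_mod_last :: "'a::field arith_data \<Rightarrow> ('a place \<Rightarrow> real) set set monoid" where
  "Pic_mod_last X = Pic X Mod last_class_group X"

text \<open>
  The maps \<open>\<Phi>\<close>: first their values computed from a representative \<open>I\<close> of the class,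
  then the induced maps on classes. An index \<open>i < n\<close> here is \<open>i + 1\<close> in the paper.
\<close>

definition nf_value :: "'a::field arith_data \<Rightarrow> 'a set \<Rightarrow> real list \<Rightarrow> ('a place \<Rightarrow> real) set" where
  "nf_value X I t =
     (let ps = inf_places X; n = length ps - 1; pl = last ps in
      div_class X (\<lambda>p. ideal_div X I p + (\<Sum>i<n. t ! i * prime_div (ps ! i) p)
        - (div_deg X (ideal_div X I) + (\<Sum>i<n. t ! i * place_deg X (ps ! i)))
            / place_deg X pl * prime_div pl p))"

definition ff_value :: "'a::field arith_data \<Rightarrow> 'a set \<Rightarrow> real list \<Rightarrow> ('a place \<Rightarrow> real) set set" where
  "ff_value X I t =
     (let ps = inf_places X; n = length ps - 1 in
      last_class_group X #>\<^bsub>Pic X\<^esub>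
        div_class X (\<lambda>p. ideal_div X I p + (\<Sum>i<n. t ! i * prime_div (ps ! i) p)))"

definition Phi_nf :: "'a::field arith_data \<Rightarrow> 'a set set \<times> real list \<Rightarrow> ('a place \<Rightarrow> real) set" where
  "Phi_nf X = (\<lambda>(C, t). the_elem ((\<lambda>I. nf_value X I t) ` C))"

definition Phi_ff :: "'a::field arith_data \<Rightarrow> 'a set set \<times> real list \<Rightarrow> ('a place \<Rightarrow> real) set set" where
  "Phi_ff X = (\<lambda>(C, t). the_elem ((\<lambda>I. ff_value X I t) ` C))"

end

theory Submission
  imports Defs "HOL-Algebra.Finite_Extensions" "HOL-Computational_Algebra.Fundamental_Theorem_Algebra"
begin

text \<open>
  A pair \<open>(I, t)\<close> determines the divisor \<open>div(I) + \<Sum> t\<^sub>i \<pp>\<^sub>i\<close>, and every class modulo \<open>\<pp>\<^sub>n\<^sub>+\<^sub>1\<close> is represented by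
  such a pair up to multiplication of \<open>I\<close> by elements of \<open>K\<^sup>*\<close>. For a given divisor the nonzero elements of the
  box have finitely many vectors of absolute values, so there is a smallest one, and dividing by it
  makes \<open>1\<close> smallest and \<open>I\<close> reduced; this gives surjectivity. If two pairs give the same class, they differ by
  some \<open>h\<close>, and minimality of \<open>1\<close> on both sides forces \<open>|h| = 1\<close> at all places of \<open>S\<close>; this gives injectivity.

  Ideals are treated through valuations: by Chevalley's extension theorem, integral closures of principal
  ideal domains in \<open>K\<close> are intersections of discrete valuation rings, and strong approximation turns fractional
  ideals into exponent vectors. What remains is the existence of elements that are small at all places of \<open>S\<close>
  but one. For function fields this is a dimension count, for number fields a pigeonhole argument on lattice points
  in \<open>d = [K : \<rat>]\<close> real coordinates.

  The same pigeonhole bound gives \<open>\<Prod> |\<sigma>(f)| \<le> c |\<O>/f\<O>|\<close> for integral \<open>f\<close>; applied to powers of \<open>f\<close>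
  it makes the homomorphism \<open>log |\<O>/f\<O>| - \<Sum> log |\<sigma>(f)|\<close> nonnegative on \<open>\<O>\<close>. As it vanishes on \<open>\<int>\<close>,
  which contains a multiple of every \<open>f\<close>, it is zero: the product formula.
\<close>

hide_const (open) up_ring.coeff up_ring.monom Polynomials.degree Polynomials.lead_coeff
  module.smult Coset.order Divisibility.prime

text \<open>The obstacle is that the constant field \<open>k\<close> may be infinite and
  \<open>K\<close> may be inseparable over \<open>k(x)\<close>, so that neither counting of residues
  nor traces control the places over \<open>k[x]\<close>. Both cases are therefore driven by one
  finiteness statement: any \<open>N + 1\<close> elements of \<open>K\<close> are linearly dependent
  over \<open>A\<close>, where \<open>A\<close> is \<int>, \<open>k[x]\<close> or
  \<open>k[1/x]\<close>. Discreteness of the valuation rings, finiteness of the set of places over a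
  prime, finiteness of residue degrees and the index bound \<open>p ^ N\<close> all arise by
  exhibiting elements whose dependence relation, made primitive at a prime of \<open>A\<close>, is
  impossible. The same device gives the dimension count for function fields: one more power of
  \<open>1/x\<close> at all infinite places except one costs at most \<open>N - 1\<close>
  conditions, whereas one more power of \<open>x\<close> in front of a basis supplies
  \<open>N\<close> new elements. A smallest element exists because the one place left unbounded is
  the place that \<open>elt_le\<close> compares first: elements that are larger there lose the
  comparison anyway.\<close>

definition subring_set :: "'a::field set \<Rightarrow> bool" where
  "subring_set A \<longleftrightarrow> 1 \<in> A \<and> (\<forall>a\<in>A. \<forall>b\<in>A. a - b \<in> A \<and> a * b \<in> A)"

definition ideal_in :: "'a::field set \<Rightarrow> 'a set \<Rightarrow> bool" where
  "ideal_in A M \<longleftrightarrow> M \<subseteq> A \<and> 0 \<in> M \<and> (\<forall>a\<in>M. \<forall>b\<in>M. a + b \<in> M) \<and> (\<forall>r\<in>A. \<forall>a\<in>M. r * a \<in> M)"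

definition valuation_subring :: "'a::field set \<Rightarrow> bool" where
  "valuation_subring R \<longleftrightarrow> subring_set R \<and> (\<forall>z. z \<in> R \<or> inverse z \<in> R)"

section \<open>Subrings, ideals and rings of polynomial values inside a fixed field\<close>

lemma subring_setD:
  assumes "subring_set A"
  shows subring_1: "1 \<in> A" and subring_0: "0 \<in> A"
    and subring_diff: "a \<in> A \<Longrightarrow> b \<in> A \<Longrightarrow> a - b \<in> A"
    and subring_mult: "a \<in> A \<Longrightarrow> b \<in> A \<Longrightarrow> a * b \<in> A"
    and subring_uminus: "a \<in> A \<Longrightarrow> - a \<in> A"
    and subring_add: "a \<in> A \<Longrightarrow> b \<in> A \<Longrightarrow> a + b \<in> A"
proof -
  show 1: "1 \<in> A" using assms by (simp add: subring_set_def)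
  have d: "a - b \<in> A" if "a \<in> A" "b \<in> A" for a b using assms that by (simp add: subring_set_def)
  show 0: "0 \<in> A" using d[OF 1 1] by simp
  have u: "- a \<in> A" if "a \<in> A" for a using d[OF 0 that] by simp
  show "a - b \<in> A" "a * b \<in> A" if "a \<in> A" "b \<in> A" using assms that by (auto simp: subring_set_def)
  show "- a \<in> A" if "a \<in> A" by (rule u[OF that])
  show "a + b \<in> A" if "a \<in> A" "b \<in> A" using d[OF that(1) u[OF that(2)]] by simp
qed

lemma subring_power: "subring_set A \<Longrightarrow> a \<in> A \<Longrightarrow> a ^ n \<in> A"
  by (induction n) (auto intro: subring_1 subring_mult)

lemma subring_sum: "subring_set A \<Longrightarrow> (\<And>i. i \<in> I \<Longrightarrow> f i \<in> A) \<Longrightarrow> sum f I \<in> A"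
  by (induction I rule: infinite_finite_induct) (auto intro: subring_0 subring_add)

lemma subring_prod: "subring_set A \<Longrightarrow> (\<And>i. i \<in> I \<Longrightarrow> f i \<in> A) \<Longrightarrow> prod f I \<in> A"
  by (induction I rule: infinite_finite_induct) (auto intro: subring_1 subring_mult)

lemma ideal_inD:
  assumes "ideal_in A M"
  shows ideal_in_0: "0 \<in> M" and ideal_in_add: "a \<in> M \<Longrightarrow> b \<in> M \<Longrightarrow> a + b \<in> M"
    and ideal_in_mult: "r \<in> A \<Longrightarrow> a \<in> M \<Longrightarrow> r * a \<in> M" and ideal_in_subset: "M \<subseteq> A"
  using assms by (auto simp: ideal_in_def)

lemma ideal_in_sum: "ideal_in A M \<Longrightarrow> (\<And>i. i \<in> I \<Longrightarrow> f i \<in> M) \<Longrightarrow> sum f I \<in> M"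
  by (induction I rule: infinite_finite_induct) (auto intro: ideal_in_0 ideal_in_add)

lemma valuation_subringD:
  assumes "valuation_subring R"
  shows "subring_set R" and "z \<notin> R \<Longrightarrow> inverse z \<in> R"
  using assms by (auto simp: valuation_subring_def)

lemma poly_eq_sum_upto:
  fixes f :: "'a::comm_semiring_1 poly"
  assumes "degree f \<le> n"
  shows "poly f z = (\<Sum>i\<le>n. coeff f i * z ^ i)"
  unfolding poly_altdef by (rule sum.mono_neutral_left) (use assms in \<open>auto simp: coeff_eq_0\<close>)

lemma poly_in_subring:
  assumes "subring_set R" "\<And>i. coeff f i \<in> R" "z \<in> R"
  shows "poly f z \<in> R"
  using assms by (auto simp: poly_altdef intro!: subring_sum subring_mult subring_power)

lemma subset_poly_ring_at:
  assumes "0 \<in> M" shows "M \<subseteq> poly_ring_at M z"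
proof
  fix m assume "m \<in> M"
  hence "\<forall>i. coeff [:m:] i \<in> M" using assms by (simp add: coeff_pCons split: nat.split)
  thus "m \<in> poly_ring_at M z" unfolding poly_ring_at_def by (intro CollectI exI[of _ "[:m:]"]) auto
qed

lemma generator_in_poly_ring_at:
  assumes "subring_set A" shows "z \<in> poly_ring_at A z"
proof -
  have "\<forall>i. coeff [:0, 1:] i \<in> A"
    using assms by (auto simp: coeff_pCons subring_0 subring_1 split: nat.split)
  thus ?thesis unfolding poly_ring_at_def by (intro CollectI exI[of _ "[:0, 1:]"]) auto
qed

lemma ideal_in_poly_ring_at:
  assumes "subring_set R" "ideal_in R M"
  shows "ideal_in (poly_ring_at R z) (poly_ring_at M z)"
  unfolding ideal_in_def
proof (intro conjI ballI)
  show "poly_ring_at M z \<subseteq> poly_ring_at R z"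
    using ideal_in_subset[OF assms(2)] unfolding poly_ring_at_def by blast
  show "0 \<in> poly_ring_at M z"
    using subset_poly_ring_at[OF ideal_in_0[OF assms(2)]] ideal_in_0[OF assms(2)] by blast
next
  fix a b assume "a \<in> poly_ring_at M z" "b \<in> poly_ring_at M z"
  then obtain f g where "a = poly f z" "b = poly g z" "\<forall>i. coeff f i \<in> M" "\<forall>i. coeff g i \<in> M"
    unfolding poly_ring_at_def by blast
  thus "a + b \<in> poly_ring_at M z" unfolding poly_ring_at_def
    by (intro CollectI exI[of _ "f + g"]) (auto intro: ideal_in_add[OF assms(2)])
next
  fix r a assume "r \<in> poly_ring_at R z" "a \<in> poly_ring_at M z"
  then obtain f g where "r = poly f z" "a = poly g z" "\<forall>i. coeff f i \<in> R" "\<forall>i. coeff g i \<in> M"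
    unfolding poly_ring_at_def by blast
  thus "r * a \<in> poly_ring_at M z" unfolding poly_ring_at_def
    by (intro CollectI exI[of _ "f * g"])
      (auto simp: coeff_mult intro!: ideal_in_sum[OF assms(2)] ideal_in_mult[OF assms(2)])
qed

lemma subring_poly_ring_at:
  assumes "subring_set R" shows "subring_set (poly_ring_at R z)"
proof -
  have "ideal_in R R" using assms by (auto simp: ideal_in_def intro: subring_0 subring_add subring_mult)
  note id = ideal_in_poly_ring_at[OF assms this, of z]
  have 1: "1 \<in> poly_ring_at R z"
    using subset_poly_ring_at[OF subring_0[OF assms]] subring_1[OF assms] by blast
  have "- 1 \<in> R" using assms by (simp add: subring_1 subring_uminus)
  hence m1: "- 1 \<in> poly_ring_at R z"
    using subset_poly_ring_at[OF subring_0[OF assms]] by blast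
  show ?thesis unfolding subring_set_def
  proof (intro conjI ballI 1)
    fix a b assume ab: "a \<in> poly_ring_at R z" "b \<in> poly_ring_at R z"
    have "- 1 * b \<in> poly_ring_at R z" by (rule ideal_in_mult[OF id m1 ab(2)])
    from ideal_in_add[OF id ab(1) this] show "a - b \<in> poly_ring_at R z" by simp
    show "a * b \<in> poly_ring_at R z" by (rule ideal_in_mult[OF id ab])
  qed
qed

section \<open>Extension of valuation rings\<close>

text \<open>Zorn's lemma for pairs of a ring and a proper ideal of it. A pair is coded as one set of
  elements tagged by a Boolean, \<open>False\<close> for the ring and \<open>True\<close> for the
  ideal, so that the componentwise order on pairs becomes plain inclusion of sets.\<close>

lemma maximal_ring_ideal_pair:
  fixes R0 C :: "'a::field set"
  assumes "subring_set R0" "ideal_in R0 C" "1 \<notin> C"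
  obtains R M where "subring_set R" "ideal_in R M" "1 \<notin> M" "R0 \<subseteq> R" "C \<subseteq> M"
    "\<And>R' M'. subring_set R' \<Longrightarrow> ideal_in R' M' \<Longrightarrow> 1 \<notin> M' \<Longrightarrow> R \<subseteq> R' \<Longrightarrow> M \<subseteq> M' \<Longrightarrow> R' = R \<and> M' = M"
proof -
  define F :: "('a \<times> bool) set set" where
    "F = {G. subring_set {z. (z, False) \<in> G} \<and> ideal_in {z. (z, False) \<in> G} {z. (z, True) \<in> G} \<and>
             1 \<notin> {z. (z, True) \<in> G} \<and> R0 \<subseteq> {z. (z, False) \<in> G} \<and> C \<subseteq> {z. (z, True) \<in> G}}"
  have "\<exists>G\<in>F. \<forall>Y\<in>F. G \<subseteq> Y \<longrightarrow> Y = G"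
  proof (rule subset_Zorn_nonempty)
    have "{z. (z, False) \<in> R0 \<times> {False} \<union> C \<times> {True}} = R0" "{z. (z, True) \<in> R0 \<times> {False} \<union> C \<times> {True}} = C"
      by auto
    hence "R0 \<times> {False} \<union> C \<times> {True} \<in> F" using assms by (simp add: F_def)
    thus "F \<noteq> {}" by blast
  next
    fix \<C> :: "('a \<times> bool) set set" assume ne: "\<C> \<noteq> {}" and ch: "subset.chain F \<C>"
    have CF: "\<C> \<subseteq> F" and lin: "\<And>G Y. G \<in> \<C> \<Longrightarrow> Y \<in> \<C> \<Longrightarrow> G \<subseteq> Y \<or> Y \<subseteq> G"
      using ch by (auto simp: subset_chain_def)
    have two: "\<exists>G\<in>\<C>. a \<in> G \<and> b \<in> G" if "a \<in> \<Union>\<C>" "b \<in> \<Union>\<C>" for a b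
      using that lin by (meson UnionE subsetD)
    obtain X0 where X0: "X0 \<in> \<C>" using ne by blast
    have FD: "subring_set {z. (z, False) \<in> G}" "ideal_in {z. (z, False) \<in> G} {z. (z, True) \<in> G}"
       "(1, True) \<notin> G" "\<And>z. z \<in> R0 \<Longrightarrow> (z, False) \<in> G" "\<And>z. z \<in> C \<Longrightarrow> (z, True) \<in> G" if "G \<in> \<C>" for G
      using that CF by (auto simp: F_def)
    have sub: "subring_set {z. (z, False) \<in> \<Union>\<C>}"
      unfolding subring_set_def
    proof (intro conjI ballI)
      show "1 \<in> {z. (z, False) \<in> \<Union>\<C>}" using subring_1[OF FD(1)[OF X0]] X0 by blast
    next
      fix a b assume "a \<in> {z. (z, False) \<in> \<Union>\<C>}" "b \<in> {z. (z, False) \<in> \<Union>\<C>}"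
      then obtain G where G: "G \<in> \<C>" "(a, False) \<in> G" "(b, False) \<in> G" using two by blast
      show "a - b \<in> {z. (z, False) \<in> \<Union>\<C>}" using subring_diff[OF FD(1)[OF G(1)], of a b] G by blast
      show "a * b \<in> {z. (z, False) \<in> \<Union>\<C>}" using subring_mult[OF FD(1)[OF G(1)], of a b] G by blast
    qed
    have idl: "ideal_in {z. (z, False) \<in> \<Union>\<C>} {z. (z, True) \<in> \<Union>\<C>}"
      unfolding ideal_in_def
    proof (intro conjI ballI subsetI)
      show "0 \<in> {z. (z, True) \<in> \<Union>\<C>}" using ideal_in_0[OF FD(2)[OF X0]] X0 by blast
    next
      fix a assume "a \<in> {z. (z, True) \<in> \<Union>\<C>}"
      thus "a \<in> {z. (z, False) \<in> \<Union>\<C>}" using ideal_in_subset[OF FD(2)] by blast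
    next
      fix a b assume "a \<in> {z. (z, True) \<in> \<Union>\<C>}" "b \<in> {z. (z, True) \<in> \<Union>\<C>}"
      then obtain G where G: "G \<in> \<C>" "(a, True) \<in> G" "(b, True) \<in> G" using two by blast
      show "a + b \<in> {z. (z, True) \<in> \<Union>\<C>}" using ideal_in_add[OF FD(2)[OF G(1)], of a b] G by blast
    next
      fix a b assume "a \<in> {z. (z, False) \<in> \<Union>\<C>}" "b \<in> {z. (z, True) \<in> \<Union>\<C>}"
      then obtain G where G: "G \<in> \<C>" "(a, False) \<in> G" "(b, True) \<in> G" using two by blast
      show "a * b \<in> {z. (z, True) \<in> \<Union>\<C>}" using ideal_in_mult[OF FD(2)[OF G(1)], of a b] G by blast
    qed
    show "\<Union>\<C> \<in> F" using sub idl X0 FD by (fastforce simp: F_def)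
  qed
  then obtain G where G: "G \<in> F" and mx: "\<And>Y. Y \<in> F \<Longrightarrow> G \<subseteq> Y \<Longrightarrow> Y = G" by blast
  show thesis
  proof (rule that[of "{z. (z, False) \<in> G}" "{z. (z, True) \<in> G}"])
    fix R' M' assume a: "subring_set R'" "ideal_in R' M'" "1 \<notin> M'" "{z. (z, False) \<in> G} \<subseteq> R'" "{z. (z, True) \<in> G} \<subseteq> M'"
    have eq: "{z. (z, False) \<in> R' \<times> {False} \<union> M' \<times> {True}} = R'" "{z. (z, True) \<in> R' \<times> {False} \<union> M' \<times> {True}} = M'"
      by auto
    have "R0 \<subseteq> R'" "C \<subseteq> M'" using G a(4,5) by (auto simp: F_def)
    hence "R' \<times> {False} \<union> M' \<times> {True} \<in> F" using a eq by (simp add: F_def)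
    moreover have "G \<subseteq> R' \<times> {False} \<union> M' \<times> {True}"
    proof
      fix y assume "y \<in> G" thus "y \<in> R' \<times> {False} \<union> M' \<times> {True}" using a(4,5) by (cases y; cases "snd y") auto
    qed
    ultimately have "R' \<times> {False} \<union> M' \<times> {True} = G" by (rule mx)
    thus "R' = {z. (z, False) \<in> G} \<and> M' = {z. (z, True) \<in> G}" using eq by auto
  qed (use G in \<open>auto simp: F_def\<close>)
qed

text \<open>Given relations \<open>g(z) = 1\<close> and \<open>h(1/z) = 1\<close> with coefficients in \<open>M\<close>, the one of
  larger degree can be shortened, because \<open>1 - h(0)\<close> is invertible.\<close>

lemma shorten_unit_relation:
  fixes z :: "'a::field"
  assumes R: "subring_set R" "ideal_in R M" and z: "z \<noteq> 0"
    and units: "\<And>m. m \<in> M \<Longrightarrow> inverse (1 - m) \<in> R" and M1: "1 \<notin> M"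
    and g: "\<And>i. coeff g i \<in> M" "poly g z = 1"
    and h: "\<And>i. coeff h i \<in> M" "poly h (inverse z) = 1"
    and deg: "degree h \<le> degree g"
  shows "\<exists>g'. (\<forall>i. coeff g' i \<in> M) \<and> poly g' z = 1 \<and> degree g' < degree g"
proof -
  define n where "n = degree g"
  have n0: "n \<noteq> 0"
  proof
    assume "n = 0"
    then obtain a where "g = [:a:]" unfolding n_def by (metis degree_eq_zeroE)
    hence "coeff g 0 = 1" using g(2) by simp
    thus False using g(1)[of 0] M1 by simp
  qed
  define m0 where "m0 = coeff h 0"
  have m0: "m0 \<in> M" "1 - m0 \<noteq> 0" using h(1)[of 0] M1 by (auto simp: m0_def)
  define c where "c j = inverse (1 - m0) * coeff h j" for j
  have cM: "c j \<in> M" for j unfolding c_def by (intro ideal_in_mult[OF R(2)] units m0 h)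
  have "(\<Sum>j\<le>n. coeff h j * inverse z ^ j) = 1"
    using h(2) deg poly_eq_sum_upto[of h n "inverse z"] by (simp add: n_def)
  moreover have "{..n} = insert 0 {1..n}" by auto
  ultimately have "m0 + (\<Sum>j=1..n. coeff h j * inverse z ^ j) = 1" by (simp add: m0_def)
  hence "(\<Sum>j=1..n. coeff h j * inverse z ^ j) = 1 - m0" by (simp add: algebra_simps)
  hence "inverse (1 - m0) * (\<Sum>j=1..n. coeff h j * inverse z ^ j) = 1" using m0(2) by simp
  hence c1: "(\<Sum>j=1..n. c j * inverse z ^ j) = 1" by (simp add: c_def sum_distrib_left mult.assoc)
  have "z ^ n = (\<Sum>j=1..n. c j * inverse z ^ j) * z ^ n" using c1 by simp
  also have "\<dots> = (\<Sum>j=1..n. c j * z ^ (n - j))" unfolding sum_distrib_right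
  proof (rule sum.cong)
    fix j assume "j \<in> {1..n}"
    hence "z ^ n = z ^ j * z ^ (n - j)" by (simp flip: power_add)
    thus "c j * inverse z ^ j * z ^ n = c j * z ^ (n - j)" using z by (simp add: field_simps)
  qed simp
  finally have zn: "z ^ n = (\<Sum>j=1..n. c j * z ^ (n - j))" .
  define g' where "g' = (\<Sum>i<n. monom (coeff g i) i) + (\<Sum>j=1..n. monom (coeff g n * c j) (n - j))"
  have "poly g z = (\<Sum>i<n. coeff g i * z ^ i) + coeff g n * z ^ n"
    by (simp add: poly_altdef n_def flip: lessThan_Suc_atMost)
  also have "\<dots> = poly g' z"
    unfolding zn by (simp add: g'_def poly_sum poly_monom sum_distrib_left mult.assoc)
  finally have 1: "poly g' z = 1" using g(2) by simp
  have "coeff g' i \<in> M" for i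
    unfolding g'_def coeff_add coeff_sum coeff_monom
    by (intro ideal_in_add[OF R(2)] ideal_in_sum[OF R(2)])
      (auto intro!: g cM ideal_in_0[OF R(2)] ideal_in_mult[OF R(2)] subsetD[OF ideal_in_subset[OF R(2)]])
  moreover have "degree g' < n" unfolding g'_def
    using n0 by (intro degree_add_less degree_sum_less) (auto intro!: le_less_trans[OF Polynomial.degree_monom_le])
  ultimately show ?thesis using 1 n_def by blast
qed

text \<open>Chevalley's theorem. In a maximal pair \<open>(R, M)\<close>, an element
  \<open>z\<close> outside \<open>R\<close> cannot be adjoined, so \<open>1\<close> lies in the
  ideal generated by \<open>M\<close> in \<open>R[z]\<close>. If both \<open>z\<close> and
  \<open>1/z\<close> are outside \<open>R\<close>, relations of least degree for the two exist, and
  the longer one can be shortened by the other. The elements of \<open>C\<close> end up in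
  \<open>M\<close> and hence become nonunits.\<close>

lemma valuation_ring_extension:
  fixes R0 C :: "'a::field set"
  assumes "subring_set R0" "ideal_in R0 C" "1 \<notin> C"
  obtains R where "valuation_subring R" "R0 \<subseteq> R" "\<And>c. c \<in> C \<Longrightarrow> c = 0 \<or> inverse c \<notin> R"
proof -
  obtain R M where R: "subring_set R" "ideal_in R M" "1 \<notin> M" "R0 \<subseteq> R" "C \<subseteq> M" and
    mx: "\<And>R' M'. subring_set R' \<Longrightarrow> ideal_in R' M' \<Longrightarrow> 1 \<notin> M' \<Longrightarrow> R \<subseteq> R' \<Longrightarrow> M \<subseteq> M' \<Longrightarrow> R' = R \<and> M' = M"
    using maximal_ring_ideal_pair[OF assms] by metis
  have adj: "\<exists>g. (\<forall>i. coeff g i \<in> M) \<and> poly g z = 1" if "z \<notin> R" for z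
  proof (rule ccontr)
    assume "\<not> ?thesis"
    hence "1 \<notin> poly_ring_at M z" by (auto simp: poly_ring_at_def)
    hence "poly_ring_at R z = R"
      using mx[OF subring_poly_ring_at[OF R(1)] ideal_in_poly_ring_at[OF R(1,2)]]
        subset_poly_ring_at[OF subring_0[OF R(1)]] subset_poly_ring_at[OF ideal_in_0[OF R(2)]] by blast
    thus False using that generator_in_poly_ring_at[OF R(1), of z] by simp
  qed
  \<comment> \<open>With \<open>u = 1 - m\<close>, a relation for \<open>1/u\<close> multiplied by
    \<open>u ^ n\<close> puts \<open>u ^ n\<close> into \<open>M\<close>; but \<open>u\<close> is
    congruent to \<open>1\<close> modulo \<open>M\<close>, so \<open>1 - u ^ n\<close> is in
    \<open>M\<close> as well.\<close>
  have units: "inverse (1 - m) \<in> R" if m: "m \<in> M" for m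
  proof (rule ccontr)
    assume "inverse (1 - m) \<notin> R"
    then obtain g where g: "\<And>i. coeff g i \<in> M" "poly g (inverse (1 - m)) = 1" using adj by metis
    define u where "u = 1 - m"
    have u: "u \<in> R" "u \<noteq> 0" using m R ideal_in_subset[OF R(2)] by (auto simp: u_def intro: subring_diff subring_1)
    define n where "n = degree g"
    have "u ^ n = (\<Sum>i\<le>n. coeff g i * inverse u ^ i) * u ^ n"
      using g(2) by (simp add: poly_altdef n_def u_def)
    also have "\<dots> = (\<Sum>i\<le>n. u ^ (n - i) * coeff g i)" unfolding sum_distrib_right
    proof (rule sum.cong)
      fix j assume "j \<in> {..n}"
      hence "u ^ n = u ^ j * u ^ (n - j)" by (simp flip: power_add)
      thus "coeff g j * inverse u ^ j * u ^ n = u ^ (n - j) * coeff g j" using u by (simp add: field_simps)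
    qed simp
    also have "\<dots> \<in> M" by (intro ideal_in_sum[OF R(2)] ideal_in_mult[OF R(2)] subring_power R u g)
    finally have un: "u ^ n \<in> M" .
    have "1 - u ^ k \<in> M" for k
    proof (induction k)
      case (Suc k)
      have "1 - u ^ Suc k = m + u * (1 - u ^ k)" by (simp add: u_def algebra_simps)
      thus ?case using Suc m u R(2) by (auto intro: ideal_in_add ideal_in_mult)
    qed (simp add: ideal_in_0[OF R(2)])
    from ideal_in_add[OF R(2) this[of n] un] show False using R(3) by simp
  qed
  have val: "z \<in> R \<or> inverse z \<in> R" for z
  proof (rule ccontr)
    assume "\<not> (z \<in> R \<or> inverse z \<in> R)"
    hence z: "z \<notin> R" "inverse z \<notin> R" by auto
    have z0: "z \<noteq> 0" using z R(1) subring_0 by blast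
    define P where "P w g \<longleftrightarrow> (\<forall>i. coeff g i \<in> M) \<and> poly g w = 1" for w g
    define g where "g = arg_min degree (P z)"
    define h where "h = arg_min degree (P (inverse z))"
    have ex: "Ex (P z)" "Ex (P (inverse z))" using adj z unfolding P_def by auto
    have g: "P z g" "\<And>g'. P z g' \<Longrightarrow> degree g \<le> degree g'"
      unfolding g_def using arg_min_nat_lemma[of "P z" _ degree] ex(1) by auto
    have h: "P (inverse z) h" "\<And>g'. P (inverse z) g' \<Longrightarrow> degree h \<le> degree g'"
      unfolding h_def using arg_min_nat_lemma[of "P (inverse z)" _ degree] ex(2) by auto
    show False
    proof (cases "degree h \<le> degree g")
      case True
      then obtain g' where "P z g'" "degree g' < degree g"
        using shorten_unit_relation[OF R(1,2) z0 units R(3), of g h] g h by (auto simp: P_def)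
      thus False using g(2) by fastforce
    next
      case False
      then obtain g' where "P (inverse z) g'" "degree g' < degree h"
        using shorten_unit_relation[OF R(1,2), of "inverse z" h g] units R(3) g h z0 by (auto simp: P_def)
      thus False using h(2) by fastforce
    qed
  qed
  show thesis
  proof (rule that[of R])
    show "valuation_subring R" using R val by (simp add: valuation_subring_def)
    fix c assume c: "c \<in> C"
    show "c = 0 \<or> inverse c \<notin> R"
    proof (rule ccontr)
      assume "\<not> ?thesis"
      hence "inverse c * c = 1" "inverse c * c \<in> M" using ideal_in_mult[OF R(2), of "inverse c" c] c R(5) by auto
      thus False using R(3) by simp
    qed
  qed (rule R)
qed

text \<open>Put \<open>w = 1/z\<close>. The ideal generated by \<open>w\<close> in
  \<open>A[w]\<close> is proper: an equation \<open>1 = w * f(w)\<close>, multiplied by a power of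
  \<open>z\<close>, would be a monic equation for \<open>z\<close> over \<open>A\<close>.
  Chevalley's theorem then yields a valuation ring in which \<open>w\<close> is a nonunit, and this
  ring misses \<open>z\<close>.\<close>

lemma not_integral_imp_valuation_ring:
  assumes A: "subring_set A" and z: "z \<notin> integral_closure A"
  obtains R where "valuation_subring R" "A \<subseteq> R" "z \<notin> R"
proof -
  have z0: "z \<noteq> 0"
  proof
    assume "z = 0"
    have "z \<in> integral_closure A" unfolding integral_closure_def
      by (intro CollectI exI[of _ "[:0, 1:]"])
        (use A \<open>z = 0\<close> in \<open>auto simp: coeff_pCons subring_0 subring_1 split: nat.split\<close>)
    thus False using z by simp
  qed
  define w where "w = inverse z"
  define B where "B = poly_ring_at A w"
  have B: "subring_set B" "A \<subseteq> B" "w \<in> B"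
    using subring_poly_ring_at[OF A] subset_poly_ring_at[OF subring_0[OF A]] generator_in_poly_ring_at[OF A]
    by (auto simp: B_def)
  define C where "C = (\<lambda>b. w * b) ` B"
  have C: "ideal_in B C" unfolding ideal_in_def C_def
  proof (intro conjI ballI)
    show "(*) w ` B \<subseteq> B" using B by (auto intro: subring_mult)
    show "0 \<in> (*) w ` B" using subring_0[OF B(1)] by (intro image_eqI[of _ _ 0]) auto
    fix a b assume "a \<in> (*) w ` B" "b \<in> (*) w ` B"
    thus "a + b \<in> (*) w ` B" using subring_add[OF B(1)] by (auto simp flip: distrib_left)
  next
    fix a b assume "a \<in> B" "b \<in> (*) w ` B"
    thus "a * b \<in> (*) w ` B" using subring_mult[OF B(1)] by (auto simp: mult.left_commute)
  qed
  have "1 \<notin> C"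
  proof
    assume "1 \<in> C"
    then obtain f where f: "\<And>i. coeff f i \<in> A" "1 = w * poly f w" unfolding C_def B_def poly_ring_at_def by blast
    define n where "n = Suc (degree f)"
    have zw: "z * w = 1" using z0 by (simp add: w_def)
    have "z ^ n = (\<Sum>i<n. coeff f i * z ^ (n - Suc i))"
    proof -
      have "z ^ n = (\<Sum>i<n. w * (coeff f i * w ^ i)) * z ^ n"
        using f(2) by (simp add: poly_altdef n_def lessThan_Suc_atMost flip: sum_distrib_left)
      also have "\<dots> = (\<Sum>i<n. coeff f i * z ^ (n - Suc i))" unfolding sum_distrib_right
      proof (rule sum.cong)
        fix j assume "j \<in> {..<n}"
        hence e: "z ^ n = z ^ Suc j * z ^ (n - Suc j)" by (simp flip: power_add power_Suc)
        have "w * (coeff f j * w ^ j) * z ^ n = (z * w) ^ Suc j * (coeff f j * z ^ (n - Suc j))"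
          unfolding e by (simp add: power_mult_distrib)
        thus "w * (coeff f j * w ^ j) * z ^ n = coeff f j * z ^ (n - Suc j)" using zw by simp
      qed simp
      finally show ?thesis .
    qed
    define p where "p = monom 1 n - (\<Sum>i<n. monom (coeff f i) (n - Suc i))"
    have dl: "degree (\<Sum>i<n. monom (coeff f i) (n - Suc i)) < n"
      by (intro degree_sum_less) (auto simp: n_def intro!: le_less_trans[OF Polynomial.degree_monom_le])
    have dp: "degree p = n"
      unfolding p_def diff_conv_add_uminus using dl by (subst degree_add_eq_left) (auto simp: Polynomial.degree_monom_eq)
    have "coeff p n = 1" unfolding p_def using dl by (simp add: coeff_eq_0)
    moreover have "coeff p i \<in> A" for i
      unfolding p_def coeff_diff coeff_sum coeff_monom
      by (intro subring_diff[OF A] subring_sum[OF A]) (auto intro: subring_0[OF A] subring_1[OF A] f)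
    moreover have "poly p z = 0"
      using \<open>z ^ n = _\<close> by (simp add: p_def poly_sum poly_monom)
    ultimately have "z \<in> integral_closure A" unfolding integral_closure_def using dp by (auto intro!: exI[of _ p])
    thus False using z by simp
  qed
  from valuation_ring_extension[OF B(1) C this] obtain R where R: "valuation_subring R" "B \<subseteq> R"
    "\<And>c. c \<in> C \<Longrightarrow> c = 0 \<or> inverse c \<notin> R" by metis
  have "w \<in> C" using subring_1[OF B(1)] by (auto simp: C_def)
  hence "z \<notin> R" using R(3)[of w] z0 by (auto simp: w_def)
  thus thesis using that[of R] R B by auto
qed

text \<open>If \<open>z\<close> were outside \<open>R\<close>, then \<open>1/z\<close> would be
  inside, and the monic equation divided by \<open>z ^ (n - 1)\<close> expresses \<open>z\<close> as
  a polynomial in \<open>1/z\<close>.\<close>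

lemma integral_in_valuation_ring:
  assumes R: "valuation_subring R" "A \<subseteq> R" and z: "z \<in> integral_closure A"
  shows "z \<in> R"
proof (rule ccontr)
  assume nz: "z \<notin> R"
  note S = valuation_subringD(1)[OF R(1)]
  have iz: "inverse z \<in> R" "z \<noteq> 0" using valuation_subringD(2)[OF R(1) nz] nz subring_0[OF S] by auto
  obtain f where f: "lead_coeff f = 1" "\<And>i. coeff f i \<in> R" "poly f z = 0"
    using z R(2) unfolding integral_closure_def by blast
  define n where "n = degree f"
  have n0: "n \<noteq> 0"
  proof
    assume "n = 0"
    then obtain a where "f = [:a:]" unfolding n_def by (metis degree_eq_zeroE)
    thus False using f by simp
  qed
  have "poly f z = (\<Sum>i<n. coeff f i * z ^ i) + z ^ n"
    using f(1) by (simp add: poly_altdef n_def flip: lessThan_Suc_atMost)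
  hence "z ^ n = - (\<Sum>i<n. coeff f i * z ^ i)" using f(3) by (simp add: eq_neg_iff_add_eq_0 add.commute)
  hence "z ^ n * inverse z ^ (n - 1) = - (\<Sum>i<n. coeff f i * z ^ i * inverse z ^ (n - 1))"
    by (simp add: sum_distrib_right)
  also have "(\<Sum>i<n. coeff f i * z ^ i * inverse z ^ (n - 1)) = (\<Sum>i<n. coeff f i * inverse z ^ (n - 1 - i))"
  proof (rule sum.cong)
    fix i assume "i \<in> {..<n}"
    hence "inverse z ^ (n - 1) = inverse z ^ i * inverse z ^ (n - 1 - i)" by (simp flip: power_add)
    thus "coeff f i * z ^ i * inverse z ^ (n - 1) = coeff f i * inverse z ^ (n - 1 - i)"
      using iz(2) by (simp add: power_inverse)
  qed simp
  also have "- \<dots> \<in> R" by (intro subring_uminus[OF S] subring_sum[OF S] subring_mult[OF S] subring_power[OF S] f iz)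
  also have "z ^ n * inverse z ^ (n - 1) = z" using n0 iz(2) by (cases n) (auto simp: power_inverse field_simps)
  finally show False using nz by simp
qed

section \<open>Weak approximation\<close>

text \<open>The relation \<open>v z \<ge> c\<close> under the convention that \<open>0\<close> has
  infinite valuation; the default value \<open>v 0 = 0\<close> would make the bare inequality wrong
  at \<open>0\<close> for positive \<open>c\<close>.\<close>

definition vge :: "('a::field \<Rightarrow> int) \<Rightarrow> int \<Rightarrow> 'a \<Rightarrow> bool" where
  "vge v c z \<longleftrightarrow> z = 0 \<or> c \<le> v z"

lemma vge_0 [simp]: "vge v c 0"
  by (simp add: vge_def)

lemma vge_mono: "vge v c z \<Longrightarrow> d \<le> c \<Longrightarrow> vge v d z"
  by (auto simp: vge_def)

lemma vge_refl [simp]: "vge v (v z) z"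
  by (simp add: vge_def)

lemma in_val_ring_iff: "z \<in> val_ring v \<longleftrightarrow> vge v 0 z"
  by (simp add: val_ring_def vge_def)

lemma in_val_ideal_iff: "z \<in> val_ideal v \<longleftrightarrow> vge v 1 z"
  by (auto simp: val_ideal_def vge_def)

lemma nv_0: "normalized_valuation v \<Longrightarrow> v 0 = 0"
  by (simp add: normalized_valuation_def)

lemma nv_mult: "normalized_valuation v \<Longrightarrow> a \<noteq> 0 \<Longrightarrow> b \<noteq> 0 \<Longrightarrow> v (a * b) = v a + v b"
  by (simp add: normalized_valuation_def)

lemma nv_surj: "normalized_valuation v \<Longrightarrow> \<exists>z. z \<noteq> 0 \<and> v z = n"
  unfolding normalized_valuation_def
  by (metis DiffD2 UNIV_I image_iff singletonI)

lemma nv_1: "normalized_valuation v \<Longrightarrow> v 1 = 0"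
  using nv_mult[of v 1 1] by simp

lemma nv_uminus: assumes "normalized_valuation v" shows "v (- a) = v a"
proof (cases "a = 0")
  case False
  have "v ((-1) * (-1)) = v (-1) + v (-1)" using assms by (intro nv_mult) auto
  hence "v (-1) = 0" using nv_1[OF assms] by simp
  thus ?thesis using nv_mult[OF assms, of "-1" a] False by simp
qed simp

lemma nv_inverse: assumes "normalized_valuation v" shows "v (inverse a) = - v a"
proof (cases "a = 0")
  case False
  hence "v (a * inverse a) = v a + v (inverse a)" using assms by (intro nv_mult) auto
  thus ?thesis using False nv_1[OF assms] by simp
qed (simp add: nv_0 assms)

lemma nv_divide: "normalized_valuation v \<Longrightarrow> a \<noteq> 0 \<Longrightarrow> b \<noteq> 0 \<Longrightarrow> v (a / b) = v a - v b"
  by (simp add: divide_inverse nv_mult nv_inverse)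

lemma nv_power: "normalized_valuation v \<Longrightarrow> v (a ^ n) = int n * v a"
  by (cases "a = 0"; induction n) (auto simp: nv_mult nv_1 nv_0 algebra_simps)

lemma nv_power_int: "normalized_valuation v \<Longrightarrow> v (a powi n) = n * v a"
  by (auto simp: power_int_def nv_power nv_inverse)

lemma nv_prod:
  assumes v: "normalized_valuation v" and "finite I" "\<And>i. i \<in> I \<Longrightarrow> f i \<noteq> 0"
  shows "v (prod f I) = (\<Sum>i\<in>I. v (f i))"
  using assms(2,3) by (induction I) (auto simp: nv_1 v nv_mult)

lemma vge_add:
  assumes "normalized_valuation v" "vge v c a" "vge v c b" shows "vge v c (a + b)"
proof -
  consider "a = 0" | "b = 0" | "a + b = 0" | "a \<noteq> 0" "b \<noteq> 0" "a + b \<noteq> 0" by blast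
  thus ?thesis
  proof cases
    case 4
    hence "min (v a) (v b) \<le> v (a + b)" using assms(1) by (simp add: normalized_valuation_def)
    thus ?thesis using assms(2,3) 4 by (auto simp: vge_def)
  qed (use assms in auto)
qed

lemma vge_uminus: "normalized_valuation v \<Longrightarrow> vge v c (- a) \<longleftrightarrow> vge v c a"
  by (simp add: vge_def nv_uminus)

lemma vge_diff: "normalized_valuation v \<Longrightarrow> vge v c a \<Longrightarrow> vge v c b \<Longrightarrow> vge v c (a - b)"
  using vge_add[of v c a "- b"] by (simp add: vge_uminus)

lemma vge_mult:
  assumes "normalized_valuation v" "vge v c a" "vge v d b" shows "vge v (c + d) (a * b)"
  using assms(2,3) by (cases "a = 0 \<or> b = 0") (auto simp: vge_def nv_mult[OF assms(1)])

lemma vge_sum: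
  assumes "normalized_valuation v" "\<And>i. i \<in> I \<Longrightarrow> vge v c (f i)" shows "vge v c (sum f I)"
  using assms(2) by (induction I rule: infinite_finite_induct) (auto intro: vge_add[OF assms(1)])

lemma nv_add_eq:
  assumes "normalized_valuation v" "a \<noteq> 0" "vge v (v a + 1) b"
  shows "a + b \<noteq> 0" "v (a + b) = v a"
proof -
  show n0: "a + b \<noteq> 0"
  proof
    assume "a + b = 0"
    hence "b = - a" by (simp add: eq_neg_iff_add_eq_0 add.commute)
    thus False using assms by (simp add: vge_def nv_uminus)
  qed
  have 1: "vge v (v a) (a + b)" using assms by (intro vge_add) (auto intro: vge_mono)
  show "v (a + b) = v a"
  proof (rule ccontr)
    assume "\<not> ?thesis"
    hence "vge v (v a + 1) (a + b)" using 1 n0 by (auto simp: vge_def)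
    from vge_diff[OF assms(1) this assms(3)] have "vge v (v a + 1) a" by simp
    thus False using assms(2) by (simp add: vge_def)
  qed
qed

lemma valuation_subring_val_ring:
  assumes v: "normalized_valuation v" shows "valuation_subring (val_ring v)" "val_ring v \<noteq> UNIV"
proof -
  show "valuation_subring (val_ring v)" unfolding valuation_subring_def subring_set_def in_val_ring_iff
  proof (intro conjI ballI allI)
    show "vge v 0 1" by (simp add: vge_def nv_1 v)
    fix a b assume "a \<in> val_ring v" "b \<in> val_ring v"
    thus "vge v 0 (a - b)" "vge v 0 (a * b)"
      using vge_diff[OF v, of 0 a b] vge_mult[OF v, of 0 a 0 b] by (auto simp: in_val_ring_iff)
  next
    fix z show "vge v 0 z \<or> vge v 0 (inverse z)" by (auto simp: vge_def nv_inverse v)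
  qed
  obtain z where "z \<noteq> 0" "v z = -1" using nv_surj[OF v] by blast
  hence "z \<notin> val_ring v" by (simp add: val_ring_def)
  thus "val_ring v \<noteq> UNIV" by blast
qed

text \<open>An inclusion of the two valuation rings would send units of \<open>v\<close> to units of
  \<open>w\<close>, so that \<open>w\<close> is \<open>v\<close> times the constant
  \<open>w \<pi>\<close> for a uniformizer \<pi> of \<open>v\<close>. Surjectivity of
  \<open>w\<close> makes this constant \<open>1\<close>.\<close>

lemma val_ring_not_subset:
  assumes v: "normalized_valuation v" and w: "normalized_valuation w" and ne: "v \<noteq> w"
  shows "\<exists>z. z \<noteq> 0 \<and> 0 \<le> v z \<and> w z < 0"
proof (rule ccontr)
  assume "\<not> ?thesis"
  hence pos: "0 \<le> w z" if "z \<noteq> 0" "0 \<le> v z" for z using that by force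
  have unit: "w z = 0" if "z \<noteq> 0" "v z = 0" for z
    using pos[OF that(1)] pos[of "inverse z"] that by (simp add: nv_inverse v w)
  obtain \<pi> where \<pi>: "\<pi> \<noteq> 0" "v \<pi> = 1" using nv_surj[OF v] by blast
  have eq: "w z = v z * w \<pi>" if z: "z \<noteq> 0" for z
  proof -
    have "v (z / \<pi> powi v z) = 0" using z \<pi> by (simp add: nv_divide v nv_power_int)
    hence "w (z / \<pi> powi v z) = 0" using z \<pi> by (intro unit) auto
    thus ?thesis using z \<pi> by (simp add: nv_divide w nv_power_int)
  qed
  obtain y where "y \<noteq> 0" "w y = 1" using nv_surj[OF w] by blast
  hence "v y * w \<pi> = 1" using eq by force
  moreover have "0 \<le> w \<pi>" using pos \<pi> by simp
  ultimately have "w \<pi> = 1" by (auto simp: zmult_eq_1_iff)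
  hence "w z = v z" for z using eq[of z] by (cases "z = 0") (auto simp: nv_0 v w)
  thus False using ne by auto
qed

lemma valuations_separated:
  assumes v: "normalized_valuation v" and w: "normalized_valuation w" and ne: "v \<noteq> w"
  shows "\<exists>y. y \<noteq> 0 \<and> v y < 0 \<and> 0 < w y"
proof -
  obtain z where z: "z \<noteq> 0" "0 \<le> v z" "w z < 0" using val_ring_not_subset[OF v w ne] by blast
  obtain z' where z': "z' \<noteq> 0" "0 \<le> w z'" "v z' < 0" using val_ring_not_subset[OF w v] ne by metis
  show ?thesis using z z' by (intro exI[of _ "z' / z"]) (simp add: nv_divide v w)
qed

lemma large_multiple:
  assumes "finite W" "\<And>w. w \<in> W \<Longrightarrow> (0::int) < g w"
  shows "\<exists>m\<ge>1. \<forall>w\<in>W. M < f w + int m * g w"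
proof -
  define m where "m = Suc (nat \<bar>M\<bar> + nat (\<Sum>w\<in>W. \<bar>f w\<bar>))"
  have "M < f w + int m * g w" if w: "w \<in> W" for w
  proof -
    have "\<bar>f w\<bar> \<le> (\<Sum>w\<in>W. \<bar>f w\<bar>)" using assms(1) w by (intro member_le_sum) auto
    hence "\<bar>M\<bar> + \<bar>f w\<bar> < int m" by (simp add: m_def sum_nonneg)
    also have "int m \<le> int m * g w" using assms(2)[OF w] by (simp add: mult_le_cancel_left1)
    finally show ?thesis by linarith
  qed
  thus ?thesis by (intro exI[of _ m]) (auto simp: m_def)
qed

text \<open>Induction on \<open>W\<close>. The candidate \<open>y\<close> for \<open>W\<close> is
  corrected at a new valuation \<open>r\<close> by an element \<open>z\<close> that separates
  \<open>v\<close> from \<open>r\<close>. If \<open>y\<close> has a pole at \<open>r\<close>, the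
  power \<open>y ^ m\<close> is replaced by \<open>y ^ m / (1 + y ^ m)\<close>, which is a unit at
  the poles of \<open>y\<close> and keeps the high order of vanishing on \<open>W\<close>.\<close>

lemma valuations_separated_finite:
  assumes v: "normalized_valuation v" and "finite W" "\<And>w. w \<in> W \<Longrightarrow> normalized_valuation w" "v \<notin> W"
  shows "\<exists>y. y \<noteq> 0 \<and> v y < 0 \<and> (\<forall>w\<in>W. 0 < w y)"
  using assms(2-4)
proof (induction W)
  case empty
  obtain y where "y \<noteq> 0" "v y = -1" using nv_surj[OF v] by blast
  thus ?case by auto
next
  case (insert r W)
  then obtain y where y: "y \<noteq> 0" "v y < 0" "\<And>w. w \<in> W \<Longrightarrow> 0 < w y" by auto
  have r: "normalized_valuation r" and W: "\<And>w. w \<in> W \<Longrightarrow> normalized_valuation w" and "v \<noteq> r" using insert.prems by auto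
  obtain z where z: "z \<noteq> 0" "v z < 0" "0 < r z" using valuations_separated[OF v r \<open>v \<noteq> r\<close>] by blast
  obtain m where m: "m \<ge> 1" "\<And>w. w \<in> W \<Longrightarrow> 0 < w z + int m * w y"
    using large_multiple[of W "\<lambda>w. w y" 0 "\<lambda>w. w z"] insert.hyps y by auto
  consider "0 < r y" | "r y = 0" | "r y < 0" by linarith
  thus ?case
  proof cases
    case 1
    thus ?thesis using y by auto
  next
    case 2
    have "v (z * y ^ m) < 0" using y(1,2) z(1,2) by (simp add: nv_mult v nv_power add_neg_nonpos mult_nonneg_nonpos)
    moreover have "0 < r (z * y ^ m)" using y z 2 by (simp add: nv_mult r nv_power)
    moreover have "0 < w (z * y ^ m)" if "w \<in> W" for w using y z m(2)[OF that] by (simp add: nv_mult W[OF that] nv_power)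
    ultimately show ?thesis using y z by (intro exI[of _ "z * y ^ m"]) auto
  next
    case 3
    have big: "1 + y ^ m \<noteq> 0 \<and> u (1 + y ^ m) = u (y ^ m)" if "normalized_valuation u" "u y < 0" for u
    proof -
      have "u (y ^ m) < 0" using that m(1) by (simp add: nv_power mult_pos_neg)
      hence "vge u (u (y ^ m) + 1) 1" by (simp add: vge_def nv_1 that)
      from nv_add_eq[OF that(1) _ this] y(1) show ?thesis by (simp add: add.commute)
    qed
    have small: "1 + y ^ m \<noteq> 0 \<and> w (1 + y ^ m) = 0" if "w \<in> W" for w
    proof -
      have "vge w (w 1 + 1) (y ^ m)" using y(3)[OF that] m(1) by (auto simp: vge_def nv_1 W[OF that] nv_power int_one_le_iff_zero_less)
      from nv_add_eq[OF W[OF that] _ this] show ?thesis by (simp add: nv_1 W[OF that])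
    qed
    have 0: "1 + y ^ m \<noteq> 0" using big[OF v y(2)] by blast
    define x where "x = z * y ^ m / (1 + y ^ m)"
    have x: "u x = u z + u (y ^ m) - u (1 + y ^ m)" if "normalized_valuation u" for u
      using 0 y z that by (simp add: x_def nv_divide nv_mult)
    have "v x < 0" using x[OF v] big[OF v y(2)] z by simp
    moreover have "0 < r x" using x[OF r] big[OF r 3] z by simp
    moreover have "0 < w x" if "w \<in> W" for w using x[OF W[OF that]] small[OF that] m(2)[OF that] by (simp add: nv_power W[OF that])
    moreover have "x \<noteq> 0" using 0 y z by (simp add: x_def)
    ultimately show ?thesis by (intro exI[of _ x]) auto
  qed
qed

text \<open>The witness is \<open>y ^ m / (1 + y ^ m)\<close>: close to \<open>1\<close> where
  \<open>y\<close> has a pole and close to \<open>0\<close> where \<open>y\<close> vanishes.\<close>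

lemma approximate_indicator:
  assumes v: "normalized_valuation v" and "finite W" and W: "\<And>w. w \<in> W \<Longrightarrow> normalized_valuation w" and "v \<notin> W"
  shows "\<exists>e. vge v M (e - 1) \<and> (\<forall>w\<in>W. vge w M e)"
proof -
  obtain y where y: "y \<noteq> 0" "v y < 0" "\<And>w. w \<in> W \<Longrightarrow> 0 < w y" using valuations_separated_finite[OF assms] by blast
  obtain m where m: "m \<ge> 1" "\<And>w. w \<in> insert v W \<Longrightarrow> M < 0 + int m * \<bar>w y\<bar>"
    using large_multiple[of "insert v W" "\<lambda>w. \<bar>w y\<bar>" M "\<lambda>_. 0"] assms(2) y by force
  have "v (y ^ m) < 0" using v y m(1) by (simp add: nv_power mult_pos_neg)
  hence "vge v (v (y ^ m) + 1) 1" by (simp add: vge_def nv_1 v)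
  from nv_add_eq[OF v _ this] y(1) have v1: "1 + y ^ m \<noteq> 0" "v (1 + y ^ m) = int m * v y"
    by (simp_all add: add.commute nv_power v)
  define e where "e = y ^ m / (1 + y ^ m)"
  have "e - 1 = - (inverse (1 + y ^ m))" using v1(1) by (simp add: e_def field_simps)
  hence "vge v M (e - 1)" using m(2)[of v] y(2) v1 by (simp add: vge_def nv_inverse nv_uminus v)
  moreover have "vge w M e" if w: "w \<in> W" for w
  proof -
    have "vge w (w 1 + 1) (y ^ m)" using y(3)[OF w] m(1) by (auto simp: vge_def nv_1 W[OF w] nv_power int_one_le_iff_zero_less)
    from nv_add_eq[OF W[OF w] _ this] have "w (1 + y ^ m) = 0" by (simp add: nv_1 W[OF w])
    hence "w e = int m * w y" using y(1) v1 by (simp add: e_def nv_divide W[OF w] nv_power)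
    thus ?thesis using m(2)[of w] w y(3)[OF w] by (simp add: vge_def)
  qed
  ultimately show ?thesis by blast
qed

lemma weak_approximation:
  assumes W: "finite W" "\<And>w. w \<in> W \<Longrightarrow> normalized_valuation w"
  shows "\<exists>z. \<forall>w\<in>W. vge w M (z - a w)"
proof -
  \<comment> \<open>The sum dominates every possible pole order of the prescribed values, so
    precision \<open>M'\<close> in the indicators leaves precision \<open>M\<close> after
    multiplication by \<open>a u\<close>.\<close>
  define M' where "M' = \<bar>M\<bar> + (\<Sum>(w, u)\<in>W \<times> W. \<bar>w (a u)\<bar>)"
  have M': "M \<le> w (a u) + M'" if "w \<in> W" "u \<in> W" for w u
  proof -
    have "\<bar>w (a u)\<bar> \<le> (\<Sum>(w, u)\<in>W \<times> W. \<bar>w (a u)\<bar>)"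
      using member_le_sum[of "(w, u)" "W \<times> W" "\<lambda>(w, u). \<bar>w (a u)\<bar>"] W(1) that by force
    thus ?thesis unfolding M'_def by linarith
  qed
  have "\<forall>u\<in>W. \<exists>e. vge u M' (e - 1) \<and> (\<forall>w\<in>W - {u}. vge w M' e)"
    using W by (intro ballI approximate_indicator) auto
  then obtain e where e: "\<And>u. u \<in> W \<Longrightarrow> vge u M' (e u - 1)" "\<And>u w. u \<in> W \<Longrightarrow> w \<in> W - {u} \<Longrightarrow> vge w M' (e u)"
    by metis
  have "vge w M ((\<Sum>u\<in>W. a u * e u) - a w)" if w: "w \<in> W" for w
  proof -
    have "(\<Sum>u\<in>W. a u * e u) - a w = a w * (e w - 1) + (\<Sum>u\<in>W - {w}. a u * e u)"
      using W(1) w by (simp add: sum.remove algebra_simps)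
    moreover have "vge w M (a w * (e w - 1))"
      by (rule vge_mono[OF vge_mult[OF W(2)[OF w] vge_refl e(1)[OF w]] M'[OF w w]])
    moreover have "vge w M (a u * e u)" if "u \<in> W - {w}" for u
    proof -
      have "vge w M' (e u)" using e(2)[of u w] that w by auto
      from vge_mult[OF W(2)[OF w] vge_refl this, of "a u"] show ?thesis
        using M'[OF w, of u] that by (auto intro: vge_mono)
    qed
    ultimately show ?thesis by (auto intro!: vge_add vge_sum W(2)[OF w])
  qed
  thus ?thesis by blast
qed

section \<open>Valuation rings in finite extensions of a principal ideal domain\<close>

definition nonunits :: "'a::field set \<Rightarrow> 'a set" where
  "nonunits R = {z \<in> R. z = 0 \<or> inverse z \<notin> R}"

lemma nonunits_mult:
  assumes R: "valuation_subring R" and "r \<in> R" "a \<in> nonunits R" shows "r * a \<in> nonunits R"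
proof (cases "r * a = 0")
  case True
  thus ?thesis using subring_0[OF valuation_subringD(1)[OF R]] by (auto simp: nonunits_def)
next
  case False
  note S = valuation_subringD(1)[OF R]
  have "inverse (r * a) \<notin> R"
  proof
    assume "inverse (r * a) \<in> R"
    hence "r * inverse (r * a) \<in> R" using assms S by (intro subring_mult)
    moreover have "r * inverse (r * a) = inverse a" using False by (simp add: field_simps)
    ultimately have "inverse a \<in> R" by metis
    thus False using assms(3) False by (simp add: nonunits_def)
  qed
  thus ?thesis using assms S by (auto simp: nonunits_def intro: subring_mult)
qed

lemma nonunits_add:
  assumes R: "valuation_subring R" and a: "a \<in> nonunits R" and b: "b \<in> nonunits R"
  shows "a + b \<in> nonunits R"
proof -
  note S = valuation_subringD(1)[OF R]
  have *: "a + b \<in> nonunits R" if "a \<in> nonunits R" "b \<in> nonunits R" "b \<noteq> 0" "a / b \<in> R" for a b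
  proof -
    have "a + b = (a / b + 1) * b" using that by (simp add: field_simps)
    moreover have "a / b + 1 \<in> R" using that S by (auto intro: subring_add subring_1)
    ultimately show ?thesis using nonunits_mult[OF R _ that(2)] by simp
  qed
  consider "a = 0" | "b = 0" | "a \<noteq> 0" "b \<noteq> 0" "a / b \<in> R" | "a \<noteq> 0" "b \<noteq> 0" "b / a \<in> R"
    using valuation_subringD(2)[OF R, of "a / b"] by auto
  thus ?thesis
    by cases (use a b *[of a b] *[of b a] in \<open>auto simp: add.commute\<close>)
qed

lemma nonunits_sum:
  assumes R: "valuation_subring R" and "\<And>i. i \<in> I \<Longrightarrow> f i \<in> nonunits R"
  shows "sum f I \<in> nonunits R"
  using assms(2)
proof (induction I rule: infinite_finite_induct)
  case (insert x F)
  thus ?case by (auto intro: nonunits_add[OF R])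
qed (use subring_0[OF valuation_subringD(1)[OF R]] in \<open>auto simp: nonunits_def\<close>)

text \<open>The ultrametric principle before any value group exists: \<open>t i / t j\<close> being
  a nonunit says that \<open>t i\<close> has strictly larger value than \<open>t j\<close>. The
  values are pairwise distinct, hence one term dominates and the sum cannot vanish.\<close>

lemma sum_distinct_values_nonzero:
  fixes R :: "'a::field set"
  assumes R: "valuation_subring R" and I: "finite I" "I \<noteq> {}" and t0: "\<And>i. i \<in> I \<Longrightarrow> t i \<noteq> 0"
    and t: "\<And>i j. i \<in> I \<Longrightarrow> j \<in> I \<Longrightarrow> i \<noteq> j \<Longrightarrow> t i / t j \<in> nonunits R \<or> t j / t i \<in> nonunits R"
  shows "sum t I \<noteq> 0"
proof -
  note S = valuation_subringD(1)[OF R]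
  have *: "\<exists>j\<in>J. \<forall>i\<in>J - {j}. t i / t j \<in> nonunits R" if "finite J" "J \<noteq> {}" "J \<subseteq> I" for J
    using that
  proof (induction J rule: finite_ne_induct)
    case (insert x J)
    then obtain j where j: "j \<in> J" "\<And>i. i \<in> J \<Longrightarrow> i \<noteq> j \<Longrightarrow> t i / t j \<in> nonunits R" by auto
    have "x \<noteq> j" "x \<in> I" "j \<in> I" using insert j by auto
    from t[OF this(2,3,1)] show ?case
    proof
      assume "t x / t j \<in> nonunits R"
      thus ?thesis using j by (intro bexI[of _ j]) auto
    next
      assume a: "t j / t x \<in> nonunits R"
      have "t i / t x \<in> nonunits R" if "i \<in> J" for i
      proof (cases "i = j")
        case False
        have "(t i / t j) * (t j / t x) \<in> nonunits R"
          using j(2)[OF that False] a by (intro nonunits_mult[OF R]) (auto simp: nonunits_def)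
        thus ?thesis using t0[OF \<open>j \<in> I\<close>] by simp
      qed (use a in simp)
      thus ?thesis by (intro bexI[of _ x]) auto
    qed
  qed auto
  obtain j where j: "j \<in> I" "\<And>i. i \<in> I - {j} \<Longrightarrow> t i / t j \<in> nonunits R"
    using *[OF I order_refl] by auto
  have "(\<Sum>i\<in>I - {j}. t i / t j) \<in> nonunits R" by (rule nonunits_sum[OF R j(2)])
  moreover have "- 1 \<notin> nonunits R"
    using subring_uminus[OF S subring_1[OF S]] by (simp add: nonunits_def)
  ultimately have "(\<Sum>i\<in>I - {j}. t i / t j) \<noteq> - 1" by metis
  hence "1 + (\<Sum>i\<in>I - {j}. t i / t j) \<noteq> 0" by (simp add: add_eq_0_iff)
  hence "t j * (1 + (\<Sum>i\<in>I - {j}. t i / t j)) \<noteq> 0" using t0[OF j(1)] by simp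
  moreover have "t j * (1 + (\<Sum>i\<in>I - {j}. t i / t j)) = t j + (\<Sum>i\<in>I - {j}. t i)"
    using t0[OF j(1)] by (simp add: distrib_left sum_distrib_left)
  ultimately show ?thesis using I(1) j(1) by (simp add: sum.remove)
qed

text \<open>Instances are \<int>, \<open>k[x]\<close> and \<open>k[1/x]\<close>. The last assumption
  is the only form in which the finiteness of the field over the fractions of \<open>A\<close>
  enters. It is stated for sequences, so that it applies directly to powers of one element and to
  families with repetitions.\<close>

locale pid_extension =
  fixes A :: "'a::field set" and N :: nat
  assumes A: "subring_set A"
    and principal: "ideal_in A J \<Longrightarrow> \<exists>d\<in>A. J = (\<lambda>a. d * a) ` A"
    and dependent_seq: "\<exists>c. (\<forall>i. c i \<in> A) \<and> (\<exists>i\<le>N. c i \<noteq> 0) \<and> (\<Sum>i\<le>N. c i * u (i::nat)) = 0"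
begin

text \<open>The ascending chain condition: the ideals generated by the \<open>a j\<close> increase,
  their union is principal, and its generator already lies in some stage \<open>j\<close>. That
  makes the factor \<open>p j\<close> a unit of \<open>A\<close>.\<close>

lemma no_infinite_division:
  assumes a: "\<And>j::nat. a j \<in> A" "\<And>j. a j \<noteq> 0" and p: "\<And>j. p j \<in> A" "\<And>j. inverse (p j) \<notin> A"
    and eq: "\<And>j. a j = p j * a (Suc j)"
  shows False
proof -
  define J where "J = (\<Union>j. (\<lambda>b. a j * b) ` A)"
  have mono: "(\<lambda>b. a i * b) ` A \<subseteq> (\<lambda>b. a j * b) ` A" if "i \<le> j" for i j
    using that
  proof (rule lift_Suc_mono_le[where f = "\<lambda>i. (\<lambda>b. a i * b) ` A", rotated])
    fix n show "(*) (a n) ` A \<subseteq> (*) (a (Suc n)) ` A"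
    proof
      fix x assume "x \<in> (*) (a n) ` A"
      then obtain b where "b \<in> A" "x = a n * b" by blast
      hence "x = a (Suc n) * (p n * b)" "p n * b \<in> A" using eq[of n] p(1) A by (auto intro: subring_mult)
      thus "x \<in> (*) (a (Suc n)) ` A" by blast
    qed
  qed
  have "ideal_in A J" unfolding ideal_in_def
  proof (intro conjI ballI)
    show "J \<subseteq> A" using a A by (auto simp: J_def intro: subring_mult)
    show "0 \<in> J" using subring_0[OF A] by (auto simp: J_def intro!: image_eqI[of _ _ 0])
    fix x y assume "x \<in> J" "y \<in> J"
    then obtain i j where "x \<in> (\<lambda>b. a i * b) ` A" "y \<in> (\<lambda>b. a j * b) ` A" by (auto simp: J_def)
    hence "x \<in> (\<lambda>b. a (max i j) * b) ` A" "y \<in> (\<lambda>b. a (max i j) * b) ` A"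
      using mono[of i "max i j"] mono[of j "max i j"] by auto
    then obtain b c where "b \<in> A" "c \<in> A" "x = a (max i j) * b" "y = a (max i j) * c" by blast
    hence "x + y = a (max i j) * (b + c)" "b + c \<in> A" using A by (auto simp: distrib_left intro: subring_add)
    thus "x + y \<in> J" unfolding J_def by blast
  next
    fix r x assume "r \<in> A" "x \<in> J"
    then obtain i b where "b \<in> A" "x = a i * b" by (auto simp: J_def)
    hence "r * x = a i * (r * b)" "r * b \<in> A" using A \<open>r \<in> A\<close> by (auto intro: subring_mult)
    thus "r * x \<in> J" unfolding J_def by blast
  qed
  then obtain d where d: "d \<in> A" "J = (\<lambda>a. d * a) ` A" using principal by blast
  have "d \<in> J" using d subring_1[OF A] by (auto intro!: image_eqI[of _ _ 1])
  then obtain j b where b: "b \<in> A" "d = a j * b" by (auto simp: J_def)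
  have "a (Suc j) \<in> J" using subring_1[OF A] unfolding J_def by (intro UN_I[of "Suc j"] image_eqI[of _ _ 1]) auto
  then obtain c where c: "c \<in> A" "a (Suc j) = d * c" using d by auto
  have "a (Suc j) * 1 = a (Suc j) * (p j * (b * c))" using c(2) b(2) eq[of j] by (simp add: algebra_simps)
  hence "p j * (b * c) = 1" using a(2)[of "Suc j"] by (metis mult_cancel_left)
  hence "inverse (p j) = b * c" by (metis inverse_unique)
  thus False using p(2)[of j] b c A subring_mult by metis
qed

lemma bounded_power_division:
  assumes "p \<in> A" "inverse p \<notin> A" "a \<noteq> 0"
  shows "\<exists>n. a / p ^ n \<notin> A"
proof (rule ccontr)
  assume n: "\<not> ?thesis"
  have "p \<noteq> 0" using assms subring_0[OF A] by auto
  thus False using n assms by (intro no_infinite_division[of "\<lambda>n. a / p ^ n" "\<lambda>_. p"]) auto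
qed

lemma factor_power:
  assumes "p \<in> A" "inverse p \<notin> A" "a \<in> A" "a \<noteq> 0"
  obtains n u where "u \<in> A" "a = p ^ n * u" "u / p \<notin> A"
proof -
  have p: "p \<noteq> 0" using assms subring_0[OF A] by auto
  define m where "m = (LEAST n. a / p ^ n \<notin> A)"
  have m: "a / p ^ m \<notin> A" unfolding m_def using bounded_power_division[OF assms(1,2,4)] by (rule LeastI_ex)
  have "m \<noteq> 0" using m assms(3) by (metis div_by_1 power_0)
  then obtain n where n: "m = Suc n" using not0_implies_Suc by blast
  have "a / p ^ n \<in> A" using not_less_Least[of n "\<lambda>n. a / p ^ n \<notin> A"] n m_def by auto
  thus thesis using m n p by (intro that[of "a / p ^ n" n]) (auto simp: field_simps)
qed

lemma dependent:
  assumes "finite I" "card I > N"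
  shows "\<exists>c. (\<forall>i\<in>I. c i \<in> A) \<and> (\<exists>i\<in>I. c i \<noteq> 0) \<and> (\<Sum>i\<in>I. c i * u i) = 0"
proof -
  obtain J where J: "J \<subseteq> I" "card J = Suc N" using assms by (metis Suc_leI obtain_subset_with_card_n)
  have fJ: "finite J" using J assms finite_subset by blast
  obtain h where h: "bij_betw h {..N} J"
    using finite_same_card_bij[of "{..N}" J] fJ J by auto
  obtain c where c: "\<And>i. c i \<in> A" "\<exists>i\<le>N. c i \<noteq> 0" "(\<Sum>i\<le>N. c i * u (h i)) = 0"
    using dependent_seq[of "\<lambda>i. u (h i)"] by blast
  define g where "g = the_inv_into {..N} h"
  have g: "g (h i) = i" if "i \<le> N" for i using h that by (simp add: g_def bij_betw_def the_inv_into_f_f)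
  define d where "d j = (if j \<in> J then c (g j) else 0)" for j
  have "(\<Sum>i\<in>I. d i * u i) = (\<Sum>i\<in>J. d i * u i)"
    using J assms by (intro sum.mono_neutral_right) (auto simp: d_def)
  also have "\<dots> = (\<Sum>i\<le>N. d (h i) * u (h i))" by (rule sum.reindex_bij_betw[OF h, symmetric])
  also have "\<dots> = (\<Sum>i\<le>N. c i * u (h i))"
    using h g by (intro sum.cong) (auto simp: d_def bij_betw_def)
  finally have "(\<Sum>i\<in>I. d i * u i) = 0" using c by simp
  moreover have "\<exists>i\<in>I. d i \<noteq> 0"
  proof -
    obtain i where "i \<le> N" "c i \<noteq> 0" using c by blast
    moreover have "h i \<in> J" using h \<open>i \<le> N\<close> by (auto simp: bij_betw_def)
    ultimately show ?thesis using J g by (intro bexI[of _ "h i"]) (auto simp: d_def)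
  qed
  ultimately show ?thesis using c(1) subring_0[OF A] by (intro exI[of _ d]) (auto simp: d_def)
qed

text \<open>Dividing a relation by the highest power of \<open>p\<close> that all coefficients share
  leaves a relation that is nontrivial modulo \<open>p\<close>. Through this statement the rank
  bound \<open>N\<close> reaches residue fields.\<close>

lemma primitive_dependent:
  assumes p: "p \<in> A" "inverse p \<notin> A" and I: "finite I" "card I > N"
  obtains c where "\<And>i. i \<in> I \<Longrightarrow> c i \<in> A" "\<exists>i\<in>I. c i / p \<notin> A" "(\<Sum>i\<in>I. c i * u i) = 0"
proof -
  have p0: "p \<noteq> 0" using p subring_0[OF A] by auto
  obtain c where c: "\<forall>i\<in>I. c i \<in> A" "\<exists>i\<in>I. c i \<noteq> 0" "(\<Sum>i\<in>I. c i * u i) = 0"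
    using dependent[OF I] by blast
  obtain k where k: "k \<in> I" "c k \<noteq> 0" using c by blast
  define P where "P n \<longleftrightarrow> (\<exists>i\<in>I. c i / p ^ n \<notin> A)" for n
  have "\<exists>n. P n" using bounded_power_division[OF p k(2)] k(1) by (auto simp: P_def)
  hence m: "P (LEAST n. P n)" by (rule LeastI_ex)
  have "\<not> P 0" using c by (auto simp: P_def)
  then obtain n where n: "(LEAST n. P n) = Suc n" using m by (metis not0_implies_Suc)
  have np: "\<not> P n" using not_less_Least[of n P] n by simp
  show thesis
  proof (rule that[of "\<lambda>i. c i / p ^ n"])
    show "c i / p ^ n \<in> A" if "i \<in> I" for i using np that by (auto simp: P_def)
    show "\<exists>i\<in>I. c i / p ^ n / p \<notin> A" using m n by (auto simp: P_def mult.commute)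
    have "(\<Sum>i\<in>I. c i / p ^ n * u i) = (\<Sum>i\<in>I. c i * u i) / p ^ n" by (simp add: sum_divide_distrib)
    thus "(\<Sum>i\<in>I. c i / p ^ n * u i) = 0" using c by simp
  qed
qed

lemma algebraic_relation:
  obtains c where "\<And>i::nat. c i \<in> A" "\<exists>i\<le>N. c i \<noteq> 0" "(\<Sum>i\<le>N. c i * z ^ i) = 0"
  using dependent_seq[of "\<lambda>i. z ^ i"] by blast

text \<open>The leading coefficient of an algebraic equation for \<open>z\<close> clears its
  denominator. Membership in all valuation rings over \<open>A\<close> takes the place of a monic
  equation for \<open>a * z\<close>.\<close>

lemma integral_multiple:
  obtains a where "a \<in> A" "a \<noteq> 0" "\<And>R. valuation_subring R \<Longrightarrow> A \<subseteq> R \<Longrightarrow> a * z \<in> R"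
proof -
  obtain c where c: "\<And>i::nat. c i \<in> A" "\<exists>i\<le>N. c i \<noteq> 0" "(\<Sum>i\<le>N. c i * z ^ i) = 0"
    using algebraic_relation by metis
  define D where "D = {i. i \<le> N \<and> c i \<noteq> 0}"
  define d where "d = Max D"
  have D: "finite D" "D \<noteq> {}" using c by (auto simp: D_def)
  have d: "d \<le> N" "c d \<noteq> 0" using Max_in[OF D] by (auto simp: d_def D_def)
  have eq: "(\<Sum>i\<le>d. c i * z ^ i) = 0"
  proof -
    have "c i = 0" if "i \<le> N" "i > d" for i
      using Max_ge[OF D(1), of i] that by (fastforce simp: D_def d_def)
    hence "(\<Sum>i\<le>N. c i * z ^ i) = (\<Sum>i\<le>d. c i * z ^ i)"
      using d by (intro sum.mono_neutral_right) auto
    thus ?thesis using c by simp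
  qed
  show thesis
  proof (rule that[of "c d"])
    fix R assume R: "valuation_subring R" "A \<subseteq> R"
    note S = valuation_subringD(1)[OF R(1)]
    have cR: "c i \<in> R" for i using c R by auto
    show "c d * z \<in> R"
    proof (rule ccontr)
      assume nR: "c d * z \<notin> R"
      hence i: "inverse (c d * z) \<in> R" using valuation_subringD(2)[OF R(1)] by blast
      have z: "z \<noteq> 0" using nR subring_0[OF S] by auto
      have "z \<notin> R" using nR cR subring_mult[OF S] by blast
      hence iz: "inverse z \<in> R" using valuation_subringD(2)[OF R(1)] by blast
      obtain e where e: "d = Suc e"
        using eq d by (cases d) auto
      have "c d * z ^ d = - (\<Sum>i\<le>e. c i * z ^ i)"
        using eq unfolding e by (simp add: eq_neg_iff_add_eq_0 add.commute)
      hence "c d * z = - (\<Sum>i\<le>e. c i * z ^ i) * inverse z ^ e" using z unfolding e by (simp add: power_inverse field_simps)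
      also have "\<dots> = - (\<Sum>i\<le>e. c i * inverse z ^ (e - i))"
      proof -
        have "c i * z ^ i * inverse z ^ e = c i * inverse z ^ (e - i)" if "i \<le> e" for i
        proof -
          have "inverse z ^ e = inverse z ^ i * inverse z ^ (e - i)" using that by (simp flip: power_add)
          thus ?thesis using z by (simp add: power_inverse)
        qed
        hence "(\<Sum>i\<le>e. c i * z ^ i * inverse z ^ e) = (\<Sum>i\<le>e. c i * inverse z ^ (e - i))"
          by (intro sum.cong) auto
        thus ?thesis by (simp only: mult_minus_left sum_distrib_right)
      qed
      also have "\<dots> \<in> R" by (intro subring_uminus[OF S] subring_sum[OF S] subring_mult[OF S] cR subring_power[OF S] iz)
      finally show False using nR by blast
    qed
  qed (use c d in auto)
qed

text \<open>The generator of the ideal of those elements of \<open>A\<close> that are nonunits in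
  \<open>R\<close>. This ideal is nonzero: for \<open>z\<close> outside \<open>R\<close> and
  \<open>a * z\<close> in \<open>R\<close>, the element \<open>a\<close> cannot be a unit of
  \<open>R\<close>.\<close>

lemma prime_below:
  assumes R: "valuation_subring R" "A \<subseteq> R" "R \<noteq> UNIV"
  obtains p where "p \<in> A" "p \<noteq> 0" "inverse p \<notin> R" "\<And>a. a \<in> A \<Longrightarrow> inverse a \<notin> R \<Longrightarrow> a / p \<in> A"
proof -
  note S = valuation_subringD(1)[OF R(1)]
  define P where "P = A \<inter> nonunits R"
  have "ideal_in A P" unfolding ideal_in_def
  proof (intro conjI ballI)
    show "0 \<in> P" using subring_0[OF A] subring_0[OF S] by (simp add: P_def nonunits_def)
    show "a + b \<in> P" if "a \<in> P" "b \<in> P" for a b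
      using that subring_add[OF A] nonunits_add[OF R(1)] by (simp add: P_def)
    show "r * a \<in> P" if "r \<in> A" "a \<in> P" for r a
      using that subring_mult[OF A] nonunits_mult[OF R(1)] R(2) by (simp add: P_def subset_iff)
  qed (simp add: P_def)
  then obtain p where p: "p \<in> A" "P = (\<lambda>a. p * a) ` A" using principal by blast
  have pP: "p \<in> P" using p subring_1[OF A] by (auto intro!: image_eqI[of _ _ 1])
  obtain z where z: "z \<notin> R" using R(3) by blast
  obtain a where a: "a \<in> A" "a \<noteq> 0" "a * z \<in> R" using integral_multiple[of z] R by metis
  have "inverse a \<notin> R"
  proof
    assume "inverse a \<in> R"
    hence "inverse a * (a * z) \<in> R" using a subring_mult[OF S] by blast
    moreover have "inverse a * (a * z) = z" using a by simp
    ultimately show False using z by simp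
  qed
  hence aP: "a \<in> P" using a R by (auto simp: P_def nonunits_def)
  have p0: "p \<noteq> 0" using aP a p by auto
  show thesis
  proof (rule that[of p])
    show "inverse p \<notin> R" using pP p0 by (auto simp: P_def nonunits_def)
    fix b assume "b \<in> A" "inverse b \<notin> R"
    hence "b \<in> P" using R by (auto simp: P_def nonunits_def)
    thus "b / p \<in> A" using p p0 by auto
  qed (use p p0 in auto)
qed

text \<open>A bound on the ramification. The values of the chain decrease strictly from that of
  \<open>p\<close> and stay positive, so they are distinct modulo multiples of the value of
  \<open>p\<close>. Nonzero elements of \<open>A\<close> have multiples of the value of
  \<open>p\<close> as values, hence the \<open>N + 1\<close> members of the chain are independent
  over \<open>A\<close>, against the rank bound.\<close>

lemma no_long_chain:
  assumes R: "valuation_subring R" "A \<subseteq> R" and p: "p \<in> A" "p \<noteq> 0" "inverse p \<notin> R" "\<And>a. a \<in> A \<Longrightarrow> inverse a \<notin> R \<Longrightarrow> a / p \<in> A"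
    and f: "f 0 = p" "\<And>i. i \<le> N \<Longrightarrow> f i \<noteq> 0 \<and> f i \<in> nonunits R" "\<And>i. i < N \<Longrightarrow> f i / f (Suc i) \<in> nonunits R"
  shows False
proof -
  note S = valuation_subringD(1)[OF R(1)]
  have pA: "inverse p \<notin> A" using R p by auto
  have ff: "f i / f j \<in> nonunits R" if "i < j" "j \<le> N" for i j
    using that
  proof (induction j)
    case (Suc j)
    show ?case
    proof (cases "i = j")
      case False
      hence "f i / f j \<in> R" using Suc by (simp add: nonunits_def)
      hence "(f i / f j) * (f j / f (Suc j)) \<in> nonunits R" using Suc by (intro nonunits_mult[OF R(1)] f) auto
      thus ?thesis using f(2)[of j] Suc by simp
    qed (use Suc f(3) in simp)
  qed simp
  obtain c where c: "\<And>i::nat. c i \<in> A" "\<exists>i\<le>N. c i \<noteq> 0" "(\<Sum>i\<le>N. c i * f i) = 0" using dependent_seq[of f] by blast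
  define I where "I = {i. i \<le> N \<and> c i \<noteq> 0}"
  have I: "finite I" "I \<noteq> {}" using c by (auto simp: I_def)
  have "\<forall>i\<in>I. \<exists>n u. u \<in> A \<and> c i = p ^ n * u \<and> u / p \<notin> A"
    using factor_power[OF p(1) pA c(1)] by (metis (mono_tags, lifting) I_def mem_Collect_eq)
  then obtain n u where nu: "\<And>i. i \<in> I \<Longrightarrow> u i \<in> A \<and> c i = p ^ n i * u i \<and> u i / p \<notin> A" by metis
  \<comment> \<open>The cofactor \<open>u i\<close> is not divisible by \<open>p\<close> in
    \<open>A\<close>, which by the choice of \<open>p\<close> means that it is a unit of
    \<open>R\<close>; only the power of \<open>p\<close> contributes to the value of
    \<open>c i\<close>.\<close>
  have u: "u i \<in> R" "inverse (u i) \<in> R" "u i \<noteq> 0" if "i \<in> I" for i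
    using nu[OF that] p(4)[of "u i"] R subring_0[OF A] by auto
  have pR: "p \<in> R" using p R by auto
  have main: "c i * f i / (c j * f j) \<in> nonunits R \<or> c j * f j / (c i * f i) \<in> nonunits R" if ij: "i \<in> I" "j \<in> I" "i < j" for i j
  proof (cases "n j \<le> n i")
    case True
    have "c i * f i / (c j * f j) = (p ^ (n i - n j) * (u i * inverse (u j))) * (f i / f j)"
      using nu ij True p(2) by (simp add: power_diff field_simps)
    moreover have "p ^ (n i - n j) * (u i * inverse (u j)) \<in> R"
      using u ij pR by (intro subring_mult[OF S] subring_power[OF S]) auto
    moreover have "f i / f j \<in> nonunits R" using ff[OF ij(3)] ij by (auto simp: I_def)
    ultimately have "c i * f i / (c j * f j) \<in> nonunits R" using nonunits_mult[OF R(1)] by metis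
    thus ?thesis ..
  next
    case False
    then obtain m where m: "n j = Suc (n i + m)" by (metis less_iff_Suc_add not_le)
    have fi: "f i \<noteq> 0" "f j \<noteq> 0" "f j \<in> nonunits R" using f(2) ij by (auto simp: I_def)
    have "c j * f j / (c i * f i) = (p ^ m * (u j * inverse (u i)) * (p / f i)) * f j"
      using nu ij p(2) m by (simp add: power_add field_simps)
    moreover have "p / f i \<in> R"
    proof (cases "i = 0")
      case True
      thus ?thesis using f(1) p(2) subring_1[OF S] by simp
    next
      case False
      thus ?thesis using ff[of 0 i] f(1) ij by (auto simp: I_def nonunits_def)
    qed
    moreover have "p ^ m * (u j * inverse (u i)) \<in> R"
      using u ij pR by (intro subring_mult[OF S] subring_power[OF S]) auto
    ultimately have "c j * f j / (c i * f i) \<in> nonunits R"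
      using nonunits_mult[OF R(1) _ fi(3)] subring_mult[OF S] by metis
    thus ?thesis ..
  qed
  have "(\<Sum>i\<in>I. c i * f i) \<noteq> 0"
  proof (rule sum_distinct_values_nonzero[OF R(1) I])
    show "c i * f i \<noteq> 0" if "i \<in> I" for i using that f(2) by (auto simp: I_def)
    fix i j assume "i \<in> I" "j \<in> I" "i \<noteq> j"
    thus "c i * f i / (c j * f j) \<in> nonunits R \<or> c j * f j / (c i * f i) \<in> nonunits R"
      using main[of i j] main[of j i] by (cases "i < j") auto
  qed
  moreover have "(\<Sum>i\<in>I. c i * f i) = (\<Sum>i\<le>N. c i * f i)"
    by (intro sum.mono_neutral_left) (auto simp: I_def)
  ultimately show False using c by simp
qed

text \<open>If every nonunit had another nonunit of strictly smaller value below it, descending from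
  \<open>p\<close> would produce a chain longer than the ramification bound allows.\<close>

lemma exists_uniformizer:
  assumes R: "valuation_subring R" "A \<subseteq> R" "R \<noteq> UNIV"
  obtains \<pi> where "\<pi> \<in> nonunits R" "\<pi> \<noteq> 0" "\<And>z. z \<in> nonunits R \<Longrightarrow> z / \<pi> \<in> R"
proof (rule ccontr)
  assume nt: "\<not> thesis"
  note gen = that
  have nex: "\<exists>z\<in>nonunits R. z / \<pi> \<notin> R" if "\<pi> \<in> nonunits R" "\<pi> \<noteq> 0" for \<pi>
    using gen[OF that] nt by blast
  obtain p where p: "p \<in> A" "p \<noteq> 0" "inverse p \<notin> R" "\<And>a. a \<in> A \<Longrightarrow> inverse a \<notin> R \<Longrightarrow> a / p \<in> A"
    using prime_below[OF R] by metis
  have "\<exists>f. \<forall>n. (f n \<in> nonunits R \<and> f n \<noteq> 0 \<and> (n = 0 \<longrightarrow> f n = p)) \<and> f n / f (Suc n) \<in> nonunits R"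
  proof (rule dependent_nat_choice)
    show "\<exists>x. x \<in> nonunits R \<and> x \<noteq> 0 \<and> (0 = (0::nat) \<longrightarrow> x = p)" using p R(2) by (auto simp: nonunits_def)
    fix x :: 'a and n :: nat assume x: "x \<in> nonunits R \<and> x \<noteq> 0 \<and> (n = 0 \<longrightarrow> x = p)"
    then obtain z where z: "z \<in> nonunits R" "z / x \<notin> R" using nex by blast
    have "x / z \<in> R" using valuation_subringD(2)[OF R(1) z(2)] by simp
    hence "x / z \<in> nonunits R" using z(2) by (simp add: nonunits_def)
    moreover have "z \<noteq> 0" using z subring_0[OF valuation_subringD(1)[OF R(1)]] by auto
    ultimately show "\<exists>y. (y \<in> nonunits R \<and> y \<noteq> 0 \<and> (Suc n = 0 \<longrightarrow> y = p)) \<and> x / y \<in> nonunits R" using z by auto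
  qed
  then obtain f where f: "\<And>n. f n \<in> nonunits R \<and> f n \<noteq> 0" "f 0 = p" "\<And>n. f n / f (Suc n) \<in> nonunits R" by blast
  show False by (rule no_long_chain[OF R(1,2) p, of f]) (use f in auto)
qed

text \<open>Infinitely large values have to be excluded. First \<open>p\<close> has a finite value
  \<open>e\<close>, since otherwise \<open>p\<close> and the powers of \<pi> form a forbidden chain.
  Next, the algebraic equation of any nonzero \<open>z\<close> in \<open>R\<close> shows that
  \<open>z\<close> divides a power of \<open>p\<close>, so its value is finite too.\<close>

lemma uniformizer_powers:
  assumes R: "valuation_subring R" "A \<subseteq> R" "R \<noteq> UNIV"
    and \<pi>: "\<pi> \<in> nonunits R" "\<pi> \<noteq> 0" "\<And>z. z \<in> nonunits R \<Longrightarrow> z / \<pi> \<in> R"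
    and z: "z \<noteq> 0"
  shows "\<exists>n. z / \<pi> powi n \<in> R \<and> inverse (z / \<pi> powi n) \<in> R"
proof -
  note S = valuation_subringD(1)[OF R(1)]
  obtain p where p: "p \<in> A" "p \<noteq> 0" "inverse p \<notin> R" "\<And>a. a \<in> A \<Longrightarrow> inverse a \<notin> R \<Longrightarrow> a / p \<in> A"
    using prime_below[OF R] by metis
  have pR: "p \<in> R" using p R by auto
  have \<pi>R: "\<pi> \<in> R" "inverse \<pi> \<notin> R" using \<pi> by (auto simp: nonunits_def)
  have step: "\<exists>n::nat. z / \<pi> ^ n \<in> R \<and> inverse (z / \<pi> ^ n) \<in> R" if z: "z \<in> R" "\<exists>n. z / \<pi> ^ n \<notin> R" for z
  proof -
    define m where "m = (LEAST n. z / \<pi> ^ n \<notin> R)"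
    have m: "z / \<pi> ^ m \<notin> R" unfolding m_def using z(2) by (rule LeastI_ex)
    have "m \<noteq> 0" using m z(1) by (metis div_by_1 power_0)
    then obtain n where n: "m = Suc n" using not0_implies_Suc by blast
    have "z / \<pi> ^ n \<in> R" using not_less_Least[of n "\<lambda>n. z / \<pi> ^ n \<notin> R"] n m_def by auto
    moreover have "inverse (z / \<pi> ^ n) \<in> R"
    proof (rule ccontr)
      assume "inverse (z / \<pi> ^ n) \<notin> R"
      hence "z / \<pi> ^ n \<in> nonunits R" using \<open>z / \<pi> ^ n \<in> R\<close> by (simp add: nonunits_def)
      from \<pi>(3)[OF this] show False using m n by (simp add: field_simps)
    qed
    ultimately show ?thesis by blast
  qed
  have "\<exists>n. p / \<pi> ^ n \<notin> R"
  proof (rule ccontr)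
    assume a: "\<not> ?thesis"
    \<comment> \<open>The chain is \<open>p\<close>, \<open>\<pi> ^ N\<close>, ...,
      \<open>\<pi>\<close>. Its first quotient is a nonunit because \<open>p\<close> is divisible
      even by \<open>\<pi> ^ (N + 1)\<close>.\<close>
    define f where "f i = (if i = 0 then p else \<pi> ^ (Suc N - i))" for i
    show False
    proof (rule no_long_chain[OF R(1,2) p, of f])
      show "f 0 = p" by (simp add: f_def)
      fix i
      show "f i \<noteq> 0 \<and> f i \<in> nonunits R" if "i \<le> N"
      proof (cases "i = 0")
        case False
        have "\<pi> ^ (N - i) * \<pi> \<in> nonunits R" by (intro nonunits_mult[OF R(1) _ \<pi>(1)] subring_power[OF S] \<pi>R)
        thus ?thesis using False \<pi>(2) that by (simp add: f_def Suc_diff_le mult.commute)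
      qed (use p pR in \<open>auto simp: f_def nonunits_def\<close>)
      show "f i / f (Suc i) \<in> nonunits R" if "i < N"
      proof (cases "i = 0")
        case True
        have "(p / \<pi> ^ Suc N) * \<pi> \<in> nonunits R" using a by (intro nonunits_mult[OF R(1) _ \<pi>(1)]) blast
        thus ?thesis using True \<pi>(2) by (simp add: f_def)
      next
        case False
        have "Suc N - i = Suc (N - i)" using that by simp
        thus ?thesis using False \<pi> by (simp add: f_def)
      qed
    qed
  qed
  from step[OF pR this] obtain e :: nat where e: "p / \<pi> ^ e \<in> R" "inverse (p / \<pi> ^ e) \<in> R" by blast
  have R_case: "\<exists>n::nat. z / \<pi> ^ n \<in> R \<and> inverse (z / \<pi> ^ n) \<in> R" if z: "z \<in> R" "z \<noteq> 0" for z
  proof (rule step[OF z(1)], rule ccontr)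
    assume "\<not> (\<exists>n. z / \<pi> ^ n \<notin> R)"
    hence div: "z / \<pi> ^ n \<in> R" for n by blast
    have pA: "inverse p \<notin> A" using R p by auto
    obtain c where c: "\<And>i::nat. c i \<in> A" "\<exists>i\<le>N. c i \<noteq> 0" "(\<Sum>i\<le>N. c i * z ^ i) = 0"
      using algebraic_relation by metis
    define I where "I = {i. i \<le> N \<and> c i \<noteq> 0}"
    have I: "finite I" "I \<noteq> {}" using c by (auto simp: I_def)
    have "(\<Sum>i\<in>I. c i * z ^ i) = (\<Sum>i\<le>N. c i * z ^ i)"
      by (intro sum.mono_neutral_left) (auto simp: I_def)
    hence "(\<Sum>i\<in>I. c i * z ^ i) = 0" using c by simp
    hence "\<not> (\<forall>i\<in>I. \<forall>j\<in>I. i \<noteq> j \<longrightarrow> c i * z ^ i / (c j * z ^ j) \<in> nonunits R \<or> c j * z ^ j / (c i * z ^ i) \<in> nonunits R)"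
      using sum_distinct_values_nonzero[OF R(1) I, of "\<lambda>i. c i * z ^ i"] z by (fastforce simp: I_def)
    then obtain i j where ij: "i \<in> I" "j \<in> I" "i < j" and
      nn: "c i * z ^ i / (c j * z ^ j) \<notin> nonunits R" "c j * z ^ j / (c i * z ^ i) \<notin> nonunits R"
      by (metis linorder_neqE_nat)
    have q: "c i * z ^ i / (c j * z ^ j) \<in> R"
    proof (rule ccontr)
      assume a: "c i * z ^ i / (c j * z ^ j) \<notin> R"
      from valuation_subringD(2)[OF R(1) a] have "c j * z ^ j / (c i * z ^ i) \<in> R" by simp
      thus False using a nn by (simp add: nonunits_def)
    qed
    have q': "c i \<noteq> 0" "c j \<noteq> 0" using ij by (auto simp: I_def)
    from factor_power[OF p(1) pA c(1) q'(1)] obtain n u where nu: "u \<in> A" "c i = p ^ n * u" "u / p \<notin> A" by metis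
    have u: "inverse u \<in> R" "u \<noteq> 0" using p(4)[of u] nu subring_0[OF A] by auto
    \<comment> \<open>Two terms of the equation for \<open>z\<close> have equal value. With
      \<open>i < j\<close> this makes \<open>z\<close> a divisor of \<open>c i\<close> in
      \<open>R\<close>, and \<open>c i\<close> is \<open>p ^ n\<close> up to the unit
      \<open>u\<close>.\<close>
    have "p ^ n / z = (c i * z ^ i / (c j * z ^ j)) * c j * inverse u * z ^ (j - i - 1)"
    proof -
      have "z ^ j = z ^ i * z ^ Suc (j - i - 1)" using ij by (subst power_add[symmetric]) simp
      thus ?thesis using nu u q' z by (simp add: field_simps)
    qed
    also have "\<dots> \<in> R" using c(1) R by (intro subring_mult[OF S] q u subring_power[OF S] z) auto
    finally have pz: "p ^ n / z \<in> R" .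
    \<comment> \<open>The exponent \<open>e * n + 1\<close> exceeds the value \<open>e * n\<close>
      of \<open>p ^ n\<close> by one, so the product collapses to
      \<open>inverse \<pi>\<close>.\<close>
    have "(inverse (p / \<pi> ^ e)) ^ n * (p ^ n / z) * (z / \<pi> ^ (e * n + 1)) \<in> R"
      by (intro subring_mult[OF S] subring_power[OF S] e pz div)
    moreover have "(inverse (p / \<pi> ^ e)) ^ n * (p ^ n / z) * (z / \<pi> ^ (e * n + 1)) = inverse \<pi>"
      using p z \<pi> by (simp add: power_divide field_simps power_mult)
    ultimately show False using \<pi>R by simp
  qed
  show ?thesis
  proof (cases "z \<in> R")
    case True
    then obtain n :: nat where "z / \<pi> ^ n \<in> R \<and> inverse (z / \<pi> ^ n) \<in> R" using R_case z by blast
    thus ?thesis by (intro exI[of _ "int n"]) simp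
  next
    case False
    hence "inverse z \<in> R" using valuation_subringD(2)[OF R(1)] by blast
    then obtain n :: nat where "inverse z / \<pi> ^ n \<in> R \<and> inverse (inverse z / \<pi> ^ n) \<in> R" using R_case[of "inverse z"] z by auto
    thus ?thesis by (intro exI[of _ "- int n"]) (simp add: power_int_minus field_simps)
  qed
qed

text \<open>The valuation is the exponent of the uniformizer. The exponent is unique because
  \<open>\<pi> powi n\<close> lies in \<open>R\<close> only for \<open>n \<ge> 0\<close>, and it
  takes every integer value on the powers of \<pi>.\<close>

lemma valuation_ring_discrete:
  assumes R: "valuation_subring R" "A \<subseteq> R" "R \<noteq> UNIV"
  obtains v where "normalized_valuation v" "val_ring v = R"
proof -
  note S = valuation_subringD(1)[OF R(1)]
  obtain \<pi> where \<pi>: "\<pi> \<in> nonunits R" "\<pi> \<noteq> 0" "\<And>z. z \<in> nonunits R \<Longrightarrow> z / \<pi> \<in> R"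
    using exists_uniformizer[OF R] by metis
  define unit where "unit u \<longleftrightarrow> u \<noteq> 0 \<and> u \<in> R \<and> inverse u \<in> R" for u
  have "\<exists>n. z \<noteq> 0 \<longrightarrow> unit (z / \<pi> powi n)" for z
    using uniformizer_powers[OF R \<pi>, of z] \<pi>(2) by (auto simp: unit_def)
  then obtain w where w: "\<And>z. z \<noteq> 0 \<Longrightarrow> unit (z / \<pi> powi (w z))" by metis
  have \<pi>R: "\<pi> \<in> R" "inverse \<pi> \<notin> R" using \<pi> by (auto simp: nonunits_def)
  have powR: "\<pi> powi n \<in> R \<longleftrightarrow> 0 \<le> n" for n
  proof
    assume "\<pi> powi n \<in> R"
    show "0 \<le> n"
    proof (rule ccontr)
      assume "\<not> 0 \<le> n"
      define k where "k = nat (- n - 1)"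
      have k: "n = - int (Suc k)" using \<open>\<not> 0 \<le> n\<close> by (simp add: k_def)
      have "\<pi> powi n * \<pi> ^ k \<in> R" using \<open>\<pi> powi n \<in> R\<close> \<pi>R by (intro subring_mult[OF S] subring_power[OF S])
      moreover have "\<pi> powi n * \<pi> ^ k = inverse \<pi>" unfolding k power_int_minus power_int_of_nat using \<pi>(2) by simp
      ultimately show False using \<pi>R by simp
    qed
  next
    assume "0 \<le> n"
    thus "\<pi> powi n \<in> R" using \<pi>R by (auto simp: power_int_def intro: subring_power[OF S])
  qed
  define v where "v z = (if z = 0 then 0 else w z)" for z
  have in_R: "z \<in> R \<longleftrightarrow> 0 \<le> v z" if "z \<noteq> 0" for z
  proof -
    define u where "u = z / \<pi> powi (v z)"
    have u: "unit u" using w[OF that] that by (simp add: u_def v_def)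
    have z: "z = u * \<pi> powi (v z)" "\<pi> powi (v z) = inverse u * z" using \<pi>(2) that by (auto simp: u_def)
    have "z \<in> R \<longleftrightarrow> \<pi> powi (v z) \<in> R"
      using u z subring_mult[OF S] unfolding unit_def by metis
    thus ?thesis using powR by simp
  qed
  have v_eq: "v z = n" if "unit (z / \<pi> powi n)" for z n
  proof -
    have z0: "z \<noteq> 0" using that by (auto simp: unit_def)
    have u: "unit (z / \<pi> powi (v z))" using w[OF z0] z0 by (simp add: v_def)
    have "\<pi> powi (n - v z) = (z / \<pi> powi (v z)) * inverse (z / \<pi> powi n)"
      "\<pi> powi (v z - n) = (z / \<pi> powi n) * inverse (z / \<pi> powi (v z))"
      using z0 \<pi>(2) by (simp_all add: power_int_diff)
    hence "\<pi> powi (n - v z) \<in> R" "\<pi> powi (v z - n) \<in> R"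
      using u that subring_mult[OF S] unfolding unit_def by metis+
    thus ?thesis using powR by simp
  qed
  have mult: "v (a * b) = v a + v b" if "a \<noteq> 0" "b \<noteq> 0" for a b
  proof (rule v_eq)
    have e: "a * b / \<pi> powi (v a + v b) = (a / \<pi> powi (v a)) * (b / \<pi> powi (v b))" using \<pi>(2) by (simp add: power_int_add)
    have "unit (a / \<pi> powi (v a))" "unit (b / \<pi> powi (v b))" using w that by (auto simp: v_def)
    moreover have "unit (x * y)" if "unit x" "unit y" for x y
      using that subring_mult[OF S] unfolding unit_def inverse_mult_distrib by simp
    ultimately show "unit (a * b / \<pi> powi (v a + v b))" unfolding e by blast
  qed
  have pow: "v (\<pi> powi n) = n" for n by (rule v_eq) (use \<pi>(2) subring_1[OF S] in \<open>auto simp: unit_def\<close>)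
  have add: "v a \<le> v (a + b)" if "a \<noteq> 0" "b \<noteq> 0" "a + b \<noteq> 0" "v a \<le> v b" for a b
  proof -
    have "v b = v (b / a) + v a" using mult[of "b / a" a] that by simp
    hence "b / a \<in> R" using in_R[of "b / a"] that by simp
    hence "1 + b / a \<in> R" using subring_add[OF S subring_1[OF S]] by blast
    moreover have e: "1 + b / a = (a + b) / a" using that by (simp add: field_simps)
    ultimately have "0 \<le> v ((a + b) / a)" using in_R that by simp
    moreover have "v (a + b) = v ((a + b) / a) + v a" using mult[of "(a + b) / a" a] that by simp
    ultimately show ?thesis by simp
  qed
  have "normalized_valuation v" unfolding normalized_valuation_def
  proof (intro conjI allI impI)
    fix a b :: 'a assume ab: "a \<noteq> 0" "b \<noteq> 0" "a + b \<noteq> 0"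
    show "min (v a) (v b) \<le> v (a + b)"
      using add[OF ab] add[of b a] ab by (cases "v a \<le> v b") (auto simp: add.commute)
  next
    have "n \<in> v ` (UNIV - {0})" for n using pow[of n] \<pi>(2) by (intro image_eqI[of _ _ "\<pi> powi n"]) auto
    thus "v ` (UNIV - {0}) = UNIV" by blast
  qed (use mult in \<open>auto simp: v_def\<close>)
  moreover have "z \<in> val_ring v \<longleftrightarrow> z \<in> R" for z
    using in_R[of z] subring_0[OF S] by (cases "z = 0") (auto simp: val_ring_def)
  hence "val_ring v = R" by blast
  ultimately show thesis by (rule that)
qed

end

section \<open>Valuations that are nonnegative on the base ring: integral closure, finiteness,
  strong approximation\<close>

context pid_extension
begin

text \<open>These valuations stand for the maximal ideals of the integral closure of
  \<open>A\<close>.\<close>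

definition V :: "('a \<Rightarrow> int) set" where
  "V = {v. normalized_valuation v \<and> A \<subseteq> val_ring v}"

lemma V_nv: "v \<in> V \<Longrightarrow> normalized_valuation v"
  by (simp add: V_def)

lemma V_nonneg: "v \<in> V \<Longrightarrow> a \<in> A \<Longrightarrow> vge v 0 a"
  unfolding V_def by (auto simp flip: in_val_ring_iff)

lemma V_nonneg': "v \<in> V \<Longrightarrow> a \<in> A \<Longrightarrow> 0 \<le> v a"
  using V_nonneg[of v a] by (cases "a = 0") (auto simp: vge_def nv_0 V_nv)

lemma V_prime:
  assumes v: "v \<in> V"
  obtains p where "p \<in> A" "p \<noteq> 0" "inverse p \<notin> A" "0 < v p" "\<And>a. a \<in> A \<Longrightarrow> vge v 1 a \<Longrightarrow> a / p \<in> A"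
proof -
  note nv = V_nv[OF v]
  have AR: "A \<subseteq> val_ring v" using v by (simp add: V_def)
  from prime_below[OF valuation_subring_val_ring(1)[OF nv] AR valuation_subring_val_ring(2)[OF nv]]
  obtain p where p: "p \<in> A" "p \<noteq> 0" "inverse p \<notin> val_ring v" "\<And>a. a \<in> A \<Longrightarrow> inverse a \<notin> val_ring v \<Longrightarrow> a / p \<in> A"
    by metis
  show thesis
  proof (rule that[OF p(1,2)])
    show "0 < v p" using p by (simp add: in_val_ring_iff vge_def nv_inverse nv)
    show "inverse p \<notin> A" using p AR by auto
    fix a assume "a \<in> A" "vge v 1 a"
    thus "a / p \<in> A" using p(4)[of a] subring_0[OF A]
      by (cases "a = 0") (auto simp: in_val_ring_iff vge_def nv_inverse nv)
  qed
qed

text \<open>Plays the part of the existence of maximal ideals: a proper nonzero ideal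
  \<open>C\<close> of a ring over \<open>A\<close> is contained in the ideal of positive elements of
  some \<open>v\<close>. The nonzero element \<open>c\<close> guarantees that the valuation ring is
  not the whole field.\<close>

lemma V_exists:
  assumes B: "subring_set B" "A \<subseteq> B" "ideal_in B C" "1 \<notin> C" "c \<in> C" "c \<noteq> 0"
  obtains v where "v \<in> V" "B \<subseteq> val_ring v" "\<And>a. a \<in> C \<Longrightarrow> vge v 1 a"
proof -
  obtain R where R: "valuation_subring R" "B \<subseteq> R" "\<And>c. c \<in> C \<Longrightarrow> c = 0 \<or> inverse c \<notin> R"
    using valuation_ring_extension[OF B(1,3,4)] by metis
  have "R \<noteq> UNIV" using R(3)[OF B(5)] B(6) by auto
  then obtain v where v: "normalized_valuation v" "val_ring v = R"
    using valuation_ring_discrete[OF R(1)] B(2) R(2) by blast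
  show thesis
  proof (rule that[of v])
    show "v \<in> V" "B \<subseteq> val_ring v" using v R B by (auto simp: V_def)
    fix a assume "a \<in> C"
    hence "a = 0 \<or> \<not> vge v 0 (inverse a)" using R(3) v by (simp flip: in_val_ring_iff)
    thus "vge v 1 a" by (auto simp: vge_def nv_inverse v)
  qed
qed

lemma integral_iff: "z \<in> integral_closure A \<longleftrightarrow> (\<forall>v\<in>V. vge v 0 z)"
proof
  assume z: "z \<in> integral_closure A"
  show "\<forall>v\<in>V. vge v 0 z"
    using integral_in_valuation_ring[OF valuation_subring_val_ring(1) _ z] by (auto simp: V_def in_val_ring_iff)
next
  assume a: "\<forall>v\<in>V. vge v 0 z"
  show "z \<in> integral_closure A"
  proof (rule ccontr)
    assume "z \<notin> integral_closure A"
    then obtain R where R: "valuation_subring R" "A \<subseteq> R" "z \<notin> R"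
      using not_integral_imp_valuation_ring[OF A] by metis
    then obtain v where v: "normalized_valuation v" "val_ring v = R"
      using valuation_ring_discrete[OF R(1,2)] by blast
    hence "vge v 0 z" using a R by (auto simp: V_def)
    thus False using v R by (simp flip: in_val_ring_iff)
  qed
qed

lemma subring_integral_closure: "subring_set (integral_closure A)"
  unfolding subring_set_def
proof (intro conjI ballI)
  show "1 \<in> integral_closure A" by (auto simp: integral_iff vge_def nv_1 V_nv)
  fix a b assume "a \<in> integral_closure A" "b \<in> integral_closure A"
  thus "a - b \<in> integral_closure A" "a * b \<in> integral_closure A"
    using vge_mult[of _ 0 a 0 b] by (auto simp: integral_iff intro: vge_diff[OF V_nv] V_nv)
qed

lemma A_subset_integral: "A \<subseteq> integral_closure A"
  using V_nonneg by (auto simp: integral_iff)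

text \<open>Nonzero primes of \<open>A\<close> are maximal. The generator \<open>r\<close> of the
  prime below \<open>w\<close> divides \<open>p\<close>; since \<open>p\<close> generates a prime,
  either \<open>p\<close> divides \<open>r\<close>, or \<open>p\<close> divides \<open>p / r\<close>
  and \<open>r\<close> is a unit, which is impossible.\<close>

lemma prime_below_unique:
  assumes v: "v \<in> V" and w: "w \<in> V"
    and p: "p \<in> A" "p \<noteq> 0" "0 < v p" "\<And>a. a \<in> A \<Longrightarrow> vge v 1 a \<Longrightarrow> a / p \<in> A"
    and wp: "0 < w p" and a: "a \<in> A" "vge w 1 a"
  shows "a / p \<in> A"
proof -
  obtain r where r: "r \<in> A" "r \<noteq> 0" "inverse r \<notin> A" "0 < w r" "\<And>a. a \<in> A \<Longrightarrow> vge w 1 a \<Longrightarrow> a / r \<in> A"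
    using V_prime[OF w] by metis
  have pr: "p / r \<in> A" using r(5)[OF p(1)] wp by (simp add: vge_def)
  have "v p = v r + v (p / r)" using p(2) r(2) by (simp add: nv_divide V_nv v)
  moreover have "0 \<le> v r" "0 \<le> v (p / r)" using V_nonneg'[OF v] r pr by auto
  ultimately consider "0 < v r" | "0 < v (p / r)" using p(3) by linarith
  thus ?thesis
  proof cases
    case 1
    hence "r / p \<in> A" using p(4)[OF r(1)] by (simp add: vge_def)
    hence "(a / r) * (r / p) \<in> A" using r(5)[OF a] by (intro subring_mult[OF A])
    thus ?thesis using r(2) by simp
  next
    case 2
    hence "p / r / p \<in> A" using p(4)[OF pr] by (simp add: vge_def)
    moreover have "p / r / p = inverse r" using p(2) by (simp add: field_simps)
    ultimately show ?thesis using r(3) by simp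
  qed
qed

text \<open>At most \<open>N\<close> valuations lie over \<open>p\<close>. Given
  \<open>N + 1\<close> of them, take an indicator \<open>e u\<close> for each. In a primitive
  relation between the indicators, evaluation at \<open>u\<close> forces the coefficient
  \<open>c u\<close> to be divisible by \<open>p\<close>, for every \<open>u\<close>.\<close>

lemma finite_V_over_prime:
  assumes v: "v \<in> V" and p: "p \<in> A" "p \<noteq> 0" "0 < v p" "\<And>a. a \<in> A \<Longrightarrow> vge v 1 a \<Longrightarrow> a / p \<in> A"
  shows "finite {w \<in> V. 0 < w p}"
proof (rule ccontr)
  assume "infinite {w \<in> V. 0 < w p}"
  then obtain T where T: "T \<subseteq> {w \<in> V. 0 < w p}" "finite T" "card T = Suc N"
    using infinite_arbitrarily_large[of "{w \<in> V. 0 < w p}" "Suc N"] by blast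
  have "\<forall>u\<in>T. \<exists>e. vge u 1 (e - 1) \<and> (\<forall>w\<in>T - {u}. vge w 1 e)"
    using T by (intro ballI approximate_indicator) (auto simp: V_nv)
  then obtain e where e: "\<And>u. u \<in> T \<Longrightarrow> vge u 1 (e u - 1)" "\<And>u w. u \<in> T \<Longrightarrow> w \<in> T - {u} \<Longrightarrow> vge w 1 (e u)"
    by metis
  have pA: "inverse p \<notin> A" using V_nonneg[OF v, of "inverse p"] p by (auto simp: vge_def nv_inverse V_nv v)
  have "card T > N" using T by simp
  from primitive_dependent[OF p(1) pA T(2) this, of e]
  obtain c where c: "\<And>i. i \<in> T \<Longrightarrow> c i \<in> A" "\<exists>i\<in>T. c i / p \<notin> A" "(\<Sum>i\<in>T. c i * e i) = 0"
    by metis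
  then obtain u where u: "u \<in> T" "c u / p \<notin> A" by blast
  have uV: "u \<in> V" "0 < u p" and nu: "normalized_valuation u" using T u by (auto intro: V_nv)
  have eq: "c u = - (c u * (e u - 1) + (\<Sum>i\<in>T - {u}. c i * e i))"
    using c(3) T(2) u(1) by (simp add: sum.remove algebra_simps eq_neg_iff_add_eq_0)
  have 1: "vge u 1 (c u * (e u - 1))"
    using vge_mult[OF nu V_nonneg[OF uV(1) c(1)[OF u(1)]] e(1)[OF u(1)]] by simp
  have 2: "vge u 1 (c i * e i)" if "i \<in> T - {u}" for i
    using vge_mult[OF nu V_nonneg[OF uV(1) c(1)] e(2)[of i u], of i] that u by auto
  have "vge u 1 (c u)"
    by (subst eq, subst vge_uminus[OF nu]) (intro vge_add[OF nu] vge_sum[OF nu] 1 2)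
  thus False using prime_below_unique[OF v uV(1) p uV(2) c(1)[OF u(1)]] u by blast
qed

text \<open>Dividing by a prime of \<open>A\<close> below one of the zeros removes only finitely
  many zeros. Infinitely many zeros would thus permit endless division in \<open>A\<close>.\<close>

lemma finite_V_over:
  assumes "a \<in> A" "a \<noteq> 0"
  shows "finite {v \<in> V. 0 < v a}"
proof (rule ccontr)
  assume inf: "infinite {v \<in> V. 0 < v a}"
  have "\<exists>f. \<forall>n. (f n \<in> A \<and> f n \<noteq> 0 \<and> infinite {v \<in> V. 0 < v (f n)}) \<and>
     (f n / f (Suc n) \<in> A \<and> inverse (f n / f (Suc n)) \<notin> A)"
  proof (rule dependent_nat_choice)
    show "\<exists>x. x \<in> A \<and> x \<noteq> 0 \<and> infinite {v \<in> V. 0 < v x}" using assms inf by blast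
    fix x and n :: nat assume x: "x \<in> A \<and> x \<noteq> 0 \<and> infinite {v \<in> V. 0 < v x}"
    then obtain v where v: "v \<in> V" "0 < v x" by (metis (mono_tags, lifting) Collect_empty_eq infinite_imp_nonempty)
    obtain p where p: "p \<in> A" "p \<noteq> 0" "inverse p \<notin> A" "0 < v p" "\<And>a. a \<in> A \<Longrightarrow> vge v 1 a \<Longrightarrow> a / p \<in> A"
      using V_prime[OF v(1)] by metis
    have "x / p \<in> A" using p(5)[of x] x v by (simp add: vge_def)
    moreover have "x / p \<noteq> 0" using x p by simp
    moreover have "{v \<in> V. 0 < v x} \<subseteq> {v \<in> V. 0 < v p} \<union> {v \<in> V. 0 < v (x / p)}"
      using x p by (auto simp: nv_divide V_nv)
    hence "infinite {v \<in> V. 0 < v (x / p)}"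
      using x finite_V_over_prime[OF v(1) p(1,2,4,5)] by (meson finite_UnI finite_subset)
    moreover have "x / (x / p) = p" using x p by (simp add: field_simps)
    ultimately show "\<exists>y. (y \<in> A \<and> y \<noteq> 0 \<and> infinite {v \<in> V. 0 < v y}) \<and> x / y \<in> A \<and> inverse (x / y) \<notin> A"
      using p by (intro exI[of _ "x / p"]) metis
  qed
  then obtain f where f: "\<And>n. f n \<in> A \<and> f n \<noteq> 0" "\<And>n. f n / f (Suc n) \<in> A \<and> inverse (f n / f (Suc n)) \<notin> A"
    by blast
  show False by (rule no_infinite_division[of f "\<lambda>n. f n / f (Suc n)"]) (use f in auto)
qed

lemma integral_multiple_V:
  obtains a where "a \<in> A" "a \<noteq> 0" "\<And>v. v \<in> V \<Longrightarrow> vge v 0 (a * z)"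
proof -
  obtain a where a: "a \<in> A" "a \<noteq> 0" "\<And>R. valuation_subring R \<Longrightarrow> A \<subseteq> R \<Longrightarrow> a * z \<in> R"
    using integral_multiple[of z] by metis
  show thesis
    by (rule that[OF a(1,2)]) (use a(3)[OF valuation_subring_val_ring(1)] in \<open>auto simp: V_def in_val_ring_iff\<close>)
qed

lemma finite_poles: "finite {v \<in> V. v z < 0}"
proof (cases "z = 0")
  case False
  obtain a where a: "a \<in> A" "a \<noteq> 0" "\<And>v. v \<in> V \<Longrightarrow> vge v 0 (a * z)" using integral_multiple_V[of z] by metis
  have "{v \<in> V. v z < 0} \<subseteq> {v \<in> V. 0 < v a}"
    using a False by (force simp: vge_def nv_mult V_nv)
  thus ?thesis using finite_V_over[OF a(1,2)] finite_subset by blast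
qed (simp add: nv_0 V_nv cong: conj_cong)

lemma finite_support: "finite {v \<in> V. v z \<noteq> 0}"
proof -
  have "{v \<in> V. v z \<noteq> 0} \<subseteq> {v \<in> V. v z < 0} \<union> {v \<in> V. v (inverse z) < 0}"
    by (auto simp: nv_inverse V_nv)
  thus ?thesis using finite_poles by (meson finite_UnI finite_subset)
qed

text \<open>The product of the primes of \<open>A\<close> below \<open>T\<close>. The last
  conclusion says that every zero \<open>w\<close> of \<open>c\<close> has the same centre in
  \<open>A\<close> as some member of \<open>T\<close>, where the centre is the prime of those
  elements of \<open>A\<close> that are positive.\<close>

lemma exists_multiple_of_primes:
  assumes "finite T" "T \<subseteq> V"
  obtains c where "c \<in> A" "c \<noteq> 0" "\<And>v. v \<in> T \<Longrightarrow> 0 < v c"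
    "\<And>w. w \<in> V \<Longrightarrow> 0 < w c \<Longrightarrow> \<exists>v\<in>T. \<forall>a\<in>A. vge w 1 a \<longleftrightarrow> vge v 1 a"
proof -
  have "\<forall>v\<in>T. \<exists>p. p \<in> A \<and> p \<noteq> 0 \<and> 0 < v p \<and> (\<forall>a\<in>A. vge v 1 a \<longrightarrow> a / p \<in> A)"
    using V_prime assms by (metis subsetD)
  then obtain p where p: "\<And>v. v \<in> T \<Longrightarrow> p v \<in> A \<and> p v \<noteq> 0 \<and> 0 < v (p v) \<and> (\<forall>a\<in>A. vge v 1 a \<longrightarrow> a / p v \<in> A)"
    by metis
  define c where "c = (\<Prod>v\<in>T. p v)"
  have vc: "w c = (\<Sum>v\<in>T. w (p v))" if "w \<in> V" for w
    unfolding c_def using p assms by (intro nv_prod V_nv that) auto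
  show thesis
  proof (rule that[of c])
    show "c \<in> A" unfolding c_def using p by (intro subring_prod[OF A]) auto
    show "c \<noteq> 0" unfolding c_def using p assms by (simp add: prod_zero_iff)
    show "0 < v c" if "v \<in> T" for v
    proof -
      have vV: "v \<in> V" using that assms by auto
      have "v (p v) \<le> (\<Sum>u\<in>T. v (p u))"
        using that assms p V_nonneg'[OF vV] by (intro member_le_sum) auto
      thus ?thesis using vc[OF vV] p[OF that] by simp
    qed
    fix w assume w: "w \<in> V" "0 < w c"
    then obtain v where v: "v \<in> T" "0 < w (p v)"
      using vc[OF w(1)] by (metis not_less sum_nonpos)
    have vV: "v \<in> V" using v assms by auto
    have "vge w 1 a \<longleftrightarrow> vge v 1 a" if a: "a \<in> A" for a
    proof -
      have dv: "vge u 1 a" if "a / p v \<in> A" "u \<in> V" "0 < u (p v)" for u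
      proof -
        have "a = p v * (a / p v)" using p[OF v(1)] by simp
        moreover have "vge u (1 + 0) (p v * (a / p v))"
          using that V_nonneg[OF that(2,1)] by (intro vge_mult V_nv) (auto simp: vge_def[of u 1])
        ultimately show ?thesis by simp
      qed
      show ?thesis
        using dv[OF _ w(1) v(2)] dv[OF _ vV] p[OF v(1)] a
          prime_below_unique[OF vV w(1), of "p v" a] v(2) by blast
    qed
    thus "\<exists>v\<in>T. \<forall>a\<in>A. vge w 1 a \<longleftrightarrow> vge v 1 a" using v(1) by blast
  qed
qed

lemma exists_large_integral:
  assumes "finite T" "T \<subseteq> V"
  obtains c where "c \<in> A" "c \<noteq> 0" "\<And>v. v \<in> T \<Longrightarrow> M \<le> v c"
    "\<And>w. w \<in> V \<Longrightarrow> 0 < w c \<Longrightarrow> \<exists>v\<in>T. \<forall>a\<in>A. vge w 1 a \<longleftrightarrow> vge v 1 a"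
proof -
  obtain c where c: "c \<in> A" "c \<noteq> 0" "\<And>v. v \<in> T \<Longrightarrow> 0 < v c"
    "\<And>w. w \<in> V \<Longrightarrow> 0 < w c \<Longrightarrow> \<exists>v\<in>T. \<forall>a\<in>A. vge w 1 a \<longleftrightarrow> vge v 1 a"
    by (rule exists_multiple_of_primes[OF assms]) blast
  obtain m :: nat where m: "\<And>v. v \<in> T \<Longrightarrow> M < 0 + int m * v c"
    using large_multiple[of T "\<lambda>v. v c" M "\<lambda>_. 0"] assms(1) c(3) by blast
  show thesis
  proof (rule that[of "c ^ m"])
    show "M \<le> v (c ^ m)" if "v \<in> T" for v using m[OF that] that assms by (auto simp: nv_power V_nv)
    show "c ^ m \<in> A" using c by (intro subring_power[OF A])
    show "\<exists>v\<in>T. \<forall>a\<in>A. vge w 1 a \<longleftrightarrow> vge v 1 a" if "w \<in> V" "0 < w (c ^ m)" for w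
      using that c(4)[of w] by (simp add: nv_power V_nv zero_less_mult_iff)
  qed (use c in simp)
qed

text \<open>Weak approximation gives \<open>z\<close> with unwanted poles in a finite set
  \<open>W\<close>. Choose \<open>b\<close> in \<open>A\<close> vanishing highly on \<open>W\<close>
  and \<open>c\<close> vanishing highly on \<open>T'\<close>. No prime of \<open>A\<close> lies
  below both sets, so \<open>b\<close> and \<open>c\<close> are coprime; with
  \<open>s * b + t * c = 1\<close> the element \<open>s * b * z\<close> is integral on
  \<open>W\<close> and unchanged on \<open>T'\<close> to the required precision.\<close>

lemma strong_approximation:
  assumes T: "finite T" "T \<subseteq> V"
  shows "\<exists>z. (\<forall>v\<in>T. vge v M (z - a v)) \<and> (\<forall>w\<in>V - T. vge w 0 z)"
proof -
  obtain c0 where c0: "c0 \<in> A" "c0 \<noteq> 0" "\<And>v. v \<in> T \<Longrightarrow> 1 \<le> v c0" using exists_large_integral[OF T, of 1] by metis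
  \<comment> \<open>\<open>T\<close> is enlarged to all zeros of an element of \<open>A\<close>. A
    valuation with the same centre as a member of \<open>T'\<close> then belongs to
    \<open>T'\<close> as well, which separates \<open>T'\<close> from \<open>W\<close> already over
    \<open>A\<close>.\<close>
  define T' where "T' = {v \<in> V. 0 < v c0}"
  have "0 < v c0" if "v \<in> T" for v using c0(3)[OF that] by simp
  hence T': "finite T'" "T \<subseteq> T'" "T' \<subseteq> V" using finite_V_over[OF c0(1,2)] T by (auto simp: T'_def)
  define a' where "a' v = (if v \<in> T then a v else 0)" for v
  \<comment> \<open>Nonnegative, so that approximating \<open>0\<close> on \<open>T' - T\<close>
    amounts to integrality there.\<close>
  define M' where "M' = max M 0"
  obtain z where z: "\<And>v. v \<in> T' \<Longrightarrow> vge v M' (z - a' v)"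
    using weak_approximation[of T' M' a'] T' V_nv by blast
  define W where "W = {w \<in> V. w z < 0} - T'"
  have W: "finite W" "W \<subseteq> V" using finite_poles by (auto simp: W_def)
  obtain b where b: "b \<in> A" "b \<noteq> 0" "\<And>w. w \<in> W \<Longrightarrow> (\<Sum>w\<in>W. \<bar>w z\<bar>) \<le> w b"
    "\<And>w. w \<in> V \<Longrightarrow> 0 < w b \<Longrightarrow> \<exists>v\<in>W. \<forall>a\<in>A. vge w 1 a \<longleftrightarrow> vge v 1 a"
    by (rule exists_large_integral[OF W, of "\<Sum>w\<in>W. \<bar>w z\<bar>"]) blast
  obtain c where c: "c \<in> A" "c \<noteq> 0" "\<And>v. v \<in> T' \<Longrightarrow> M' + (\<Sum>v\<in>T'. \<bar>v (a' v)\<bar>) \<le> v c"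
    "\<And>w. w \<in> V \<Longrightarrow> 0 < w c \<Longrightarrow> \<exists>v\<in>T'. \<forall>a\<in>A. vge w 1 a \<longleftrightarrow> vge v 1 a"
    by (rule exists_large_integral[OF T'(1,3), of "M' + (\<Sum>v\<in>T'. \<bar>v (a' v)\<bar>)"]) blast
  have "\<exists>s\<in>A. \<exists>t\<in>A. s * b + t * c = 1"
  proof (rule ccontr)
    assume n: "\<not> ?thesis"
    define C where "C = {s * b + t * c |s t. s \<in> A \<and> t \<in> A}"
    have id: "ideal_in A C" unfolding ideal_in_def C_def
    proof (intro conjI ballI)
      show "{s * b + t * c |s t. s \<in> A \<and> t \<in> A} \<subseteq> A" using b c by (auto intro!: subring_add[OF A] subring_mult[OF A])
      show "0 \<in> {s * b + t * c |s t. s \<in> A \<and> t \<in> A}" using subring_0[OF A] by force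
      fix x y assume "x \<in> {s * b + t * c |s t. s \<in> A \<and> t \<in> A}" "y \<in> {s * b + t * c |s t. s \<in> A \<and> t \<in> A}"
      then obtain s t s' t' where "s \<in> A" "t \<in> A" "s' \<in> A" "t' \<in> A" "x = s * b + t * c" "y = s' * b + t' * c" by blast
      thus "x + y \<in> {s * b + t * c |s t. s \<in> A \<and> t \<in> A}" using subring_add[OF A]
        by (intro CollectI exI[of _ "s + s'"] exI[of _ "t + t'"]) (auto simp: algebra_simps)
    next
      fix r x assume "r \<in> A" "x \<in> {s * b + t * c |s t. s \<in> A \<and> t \<in> A}"
      then obtain s t where "s \<in> A" "t \<in> A" "x = s * b + t * c" by blast
      thus "r * x \<in> {s * b + t * c |s t. s \<in> A \<and> t \<in> A}" using subring_mult[OF A] \<open>r \<in> A\<close>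
        by (intro CollectI exI[of _ "r * s"] exI[of _ "r * t"]) (auto simp: algebra_simps)
    qed
    have "1 * b + 0 * c \<in> C" "0 * b + 1 * c \<in> C" unfolding C_def using subring_0[OF A] subring_1[OF A] by blast+
    hence bc: "b \<in> C" "c \<in> C" by simp_all
    have "1 \<notin> C" using n by (auto simp: C_def)
    then obtain v where v: "v \<in> V" "\<And>a. a \<in> C \<Longrightarrow> vge v 1 a"
      using V_exists[OF A order_refl id _ bc(1) b(2)] by metis
    have "0 < v b" "0 < v c" using v(2)[OF bc(1)] v(2)[OF bc(2)] b(2) c(2) by (auto simp: vge_def)
    then obtain w u where wu: "w \<in> W" "u \<in> T'" "\<forall>a\<in>A. vge w 1 a \<longleftrightarrow> vge u 1 a"
      using b(4)[OF v(1)] c(4)[OF v(1)] by metis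
    have "vge w 1 c0" using wu c0(1) by (auto simp: T'_def vge_def)
    hence "w \<in> T'" using wu c0(2) by (auto simp: T'_def W_def vge_def)
    thus False using wu by (simp add: W_def)
  qed
  then obtain s t where st: "s \<in> A" "t \<in> A" "s * b + t * c = 1" by blast
  define y where "y = s * b * z"
  have vT: "vge v M' (y - a' v)" if v: "v \<in> T'" for v
  proof -
    have vV: "v \<in> V" and nv: "normalized_valuation v" using v T' V_nv by auto
    have "t * c = 1 - s * b" using st(3) by (simp add: algebra_simps)
    hence "t * (c * a' v) = (1 - s * b) * a' v" by (simp flip: mult.assoc)
    hence "y - a' v = s * b * (z - a' v) - t * (c * a' v)" unfolding y_def by (simp add: algebra_simps)
    moreover have "vge v (0 + M') (s * b * (z - a' v))"
      by (intro vge_mult[OF nv] z v V_nonneg[OF vV] subring_mult[OF A] st b)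
    moreover have "vge v (0 + M') (t * (c * a' v))"
    proof (intro vge_mult[OF nv] V_nonneg[OF vV] st)
      have "\<bar>v (a' v)\<bar> \<le> (\<Sum>v\<in>T'. \<bar>v (a' v)\<bar>)"
        using member_le_sum[of v T' "\<lambda>v. \<bar>v (a' v)\<bar>"] v T'(1) by simp
      hence "M' \<le> v c + v (a' v)" using c(3)[OF v] by linarith
      thus "vge v M' (c * a' v)" by (cases "a' v = 0") (auto simp: vge_def nv_mult nv c(2))
    qed
    ultimately show ?thesis using vge_diff[OF nv] by simp
  qed
  have wO: "vge w 0 y" if w: "w \<in> V - T" for w
  proof -
    have wV: "w \<in> V" and nw: "normalized_valuation w" using w V_nv by auto
    show ?thesis
    proof (cases "w \<in> T'")
      case True
      hence "vge w M' y" using vT[OF True] w by (simp add: a'_def)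
      thus ?thesis by (rule vge_mono) (simp add: M'_def)
    next
      case False
      have "vge w 0 (b * z)"
      proof (cases "w \<in> W")
        case True
        have "\<bar>w z\<bar> \<le> (\<Sum>w\<in>W. \<bar>w z\<bar>)"
          using member_le_sum[of w W "\<lambda>w. \<bar>w z\<bar>"] True W(1) by simp
        hence "0 \<le> w b + w z" using b(3)[OF True] by linarith
        thus ?thesis by (cases "z = 0") (auto simp: vge_def nv_mult nw b(2))
      next
        case F: False
        hence "vge w 0 z" using False wV by (auto simp: W_def vge_def)
        from vge_mult[OF nw V_nonneg[OF wV b(1)] this] show ?thesis by simp
      qed
      from vge_mult[OF nw V_nonneg[OF wV st(1)] this] show ?thesis by (simp add: y_def mult.assoc)
    qed
  qed
  show ?thesis
  proof (intro exI[of _ y] conjI ballI wO)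
    fix v assume v: "v \<in> T"
    hence "vge v M' (y - a v)" using vT[of v] T' by (auto simp: a'_def)
    thus "vge v M (y - a v)" by (rule vge_mono) (simp add: M'_def)
  qed
qed

end

section \<open>Factorization of fractional ideals\<close>

context pid_extension
begin

definition fin_supp :: "(('a \<Rightarrow> int) \<Rightarrow> int) \<Rightarrow> bool" where
  "fin_supp n \<longleftrightarrow> finite {v \<in> V. n v \<noteq> 0}"

text \<open>For \<open>n\<close> of finite support this is the product of the prime ideals of the
  valuations \<open>v\<close> to the powers \<open>n v\<close>.\<close>

definition ideal_of :: "(('a \<Rightarrow> int) \<Rightarrow> int) \<Rightarrow> 'a set" where
  "ideal_of n = {z. \<forall>v\<in>V. vge v (n v) z}"

definition fractional :: "'a set \<Rightarrow> bool" where
  "fractional I \<longleftrightarrow>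
     0 \<in> I \<and> I \<noteq> {0} \<and> (\<forall>a\<in>I. \<forall>b\<in>I. a + b \<in> I) \<and> (\<forall>r\<in>integral_closure A. \<forall>a\<in>I. r * a \<in> I) \<and>
     (\<exists>d\<in>integral_closure A. d \<noteq> 0 \<and> (\<forall>a\<in>I. d * a \<in> integral_closure A))"

lemma fractionalD:
  assumes "fractional I"
  shows "0 \<in> I" "a \<in> I \<Longrightarrow> b \<in> I \<Longrightarrow> a + b \<in> I" "r \<in> integral_closure A \<Longrightarrow> a \<in> I \<Longrightarrow> r * a \<in> I"
    "\<exists>z\<in>I. z \<noteq> 0" "\<exists>d\<in>integral_closure A. d \<noteq> 0 \<and> (\<forall>a\<in>I. d * a \<in> integral_closure A)"
  using assms unfolding fractional_def by auto

lemma fin_supp_add: "fin_supp n \<Longrightarrow> fin_supp m \<Longrightarrow> fin_supp (\<lambda>v. n v + m v)"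
  unfolding fin_supp_def
  by (rule finite_subset[of _ "{v \<in> V. n v \<noteq> 0} \<union> {v \<in> V. m v \<noteq> 0}"]) auto

lemma fin_supp_mult: "fin_supp n \<Longrightarrow> fin_supp (\<lambda>v. k * n v)"
  unfolding fin_supp_def by (rule finite_subset) auto

lemma fin_supp_minus: "fin_supp n \<Longrightarrow> fin_supp (\<lambda>v. - n v)"
  unfolding fin_supp_def by (rule finite_subset) auto

lemma fin_supp_0: "fin_supp (\<lambda>v. 0)"
  by (simp add: fin_supp_def)

lemma fin_supp_val: "fin_supp (\<lambda>v. v z)"
  using finite_support by (simp add: fin_supp_def)

lemma ideal_of_0: "ideal_of (\<lambda>v. 0) = integral_closure A"
  by (auto simp: ideal_of_def integral_iff)

lemma in_ideal_of_iff: "z \<in> ideal_of n \<longleftrightarrow> (\<forall>v\<in>V. vge v (n v) z)"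
  by (simp add: ideal_of_def)

text \<open>Strong approximation with precision beyond every \<open>n w\<close> produces an element
  whose value equals \<open>n w\<close> on the whole support, and also at \<open>v\<close>.\<close>

lemma ideal_of_value_attained:
  assumes n: "fin_supp n" and v: "v \<in> V"
  obtains z where "z \<in> ideal_of n" "z \<noteq> 0" "v z = n v"
proof -
  define T where "T = insert v {v \<in> V. n v \<noteq> 0}"
  have T: "finite T" "T \<subseteq> V" using n v by (auto simp: T_def fin_supp_def)
  have "\<forall>w\<in>T. \<exists>a. a \<noteq> 0 \<and> w a = n w" using nv_surj V_nv T by blast
  then obtain a where a: "\<And>w. w \<in> T \<Longrightarrow> a w \<noteq> 0 \<and> w (a w) = n w" by metis
  define M where "M = (\<Sum>w\<in>T. \<bar>n w\<bar>) + 1"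
  have M: "n w < M" if "w \<in> T" for w
    using member_le_sum[of w T "\<lambda>w. \<bar>n w\<bar>"] T(1) that unfolding M_def by auto
  obtain z where z: "\<And>w. w \<in> T \<Longrightarrow> vge w M (z - a w)" "\<And>w. w \<in> V - T \<Longrightarrow> vge w 0 z"
    using strong_approximation[OF T, of M a] by blast
  have *: "z \<noteq> 0 \<and> w z = n w" if w: "w \<in> T" for w
  proof -
    have "vge w (w (a w) + 1) (z - a w)" using z(1)[OF w] M[OF w] a[OF w] by (auto intro: vge_mono)
    from nv_add_eq[OF V_nv _ this] w T a[OF w] show ?thesis by auto
  qed
  show thesis
  proof (rule that[of z])
    show "z \<noteq> 0" "v z = n v" using *[of v] by (auto simp: T_def)
    have "vge w (n w) z" if w: "w \<in> V" for w
    proof (cases "w \<in> T")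
      case False
      thus ?thesis using z(2)[of w] w by (auto simp: T_def)
    qed (use * in \<open>auto simp: vge_def\<close>)
    thus "z \<in> ideal_of n" by (simp add: ideal_of_def)
  qed
qed

lemma ideal_of_nonzero:
  assumes n: "fin_supp n"
  obtains z where "z \<in> A" "z \<noteq> 0" "z \<in> ideal_of n"
proof -
  define T where "T = {v \<in> V. n v \<noteq> 0}"
  have T: "finite T" "T \<subseteq> V" using n by (auto simp: T_def fin_supp_def)
  obtain z where z: "z \<in> A" "z \<noteq> 0" "\<And>v. v \<in> T \<Longrightarrow> (\<Sum>w\<in>T. \<bar>n w\<bar>) \<le> v z"
    by (rule exists_large_integral[OF T, of "\<Sum>w\<in>T. \<bar>n w\<bar>"]) blast
  have "vge w (n w) z" if w: "w \<in> V" for w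
  proof (cases "w \<in> T")
    case True
    have "n w \<le> (\<Sum>w\<in>T. \<bar>n w\<bar>)" using member_le_sum[of w T "\<lambda>w. \<bar>n w\<bar>"] T(1) True by auto
    thus ?thesis using z(3)[OF True] by (auto simp: vge_def)
  next
    case False
    thus ?thesis using V_nonneg[OF w z(1)] w by (simp add: T_def)
  qed
  thus thesis using that[of z] z by (simp add: ideal_of_def)
qed

lemma fractional_ideal_of:
  assumes n: "fin_supp n" shows "fractional (ideal_of n)"
proof -
  obtain z where z: "z \<in> A" "z \<noteq> 0" "z \<in> ideal_of n" using ideal_of_nonzero[OF n] by metis
  obtain d where d: "d \<in> A" "d \<noteq> 0" "d \<in> ideal_of (\<lambda>v. - n v)" using ideal_of_nonzero[OF fin_supp_minus[OF n]] by metis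
  show ?thesis unfolding fractional_def
  proof (intro conjI ballI)
    show "ideal_of n \<noteq> {0}" using z by auto
    show "0 \<in> ideal_of n" by (simp add: ideal_of_def)
    show "a + b \<in> ideal_of n" if "a \<in> ideal_of n" "b \<in> ideal_of n" for a b
      using that vge_add[OF V_nv] by (auto simp: ideal_of_def)
    show "r * a \<in> ideal_of n" if "r \<in> integral_closure A" "a \<in> ideal_of n" for r a
      using that vge_mult[OF V_nv, of _ 0 r _ a] by (auto simp: ideal_of_def integral_iff)
    have "d * a \<in> integral_closure A" if "a \<in> ideal_of n" for a
      unfolding integral_iff
    proof
      fix v assume v: "v \<in> V"
      have "vge v (- n v + n v) (d * a)"
        using that d(3) v by (intro vge_mult V_nv) (auto simp: ideal_of_def)
      thus "vge v 0 (d * a)" by simp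
    qed
    thus "\<exists>d\<in>integral_closure A. d \<noteq> 0 \<and> (\<forall>a\<in>ideal_of n. d * a \<in> integral_closure A)"
      using d A_subset_integral by blast
  qed
qed

lemma fractional_min_value:
  assumes I: "fractional I" and v: "v \<in> V"
  shows "\<exists>c. (\<exists>z\<in>I. z \<noteq> 0 \<and> v z = c) \<and> (\<forall>z\<in>I. vge v c z)"
proof -
  obtain d where d: "d \<in> integral_closure A" "d \<noteq> 0" "\<And>a. a \<in> I \<Longrightarrow> d * a \<in> integral_closure A"
    using fractionalD(5)[OF I] by blast
  have lb: "0 \<le> v d + v z" if "z \<in> I" "z \<noteq> 0" for z
    using d(3)[OF that(1)] d(2) that v by (auto simp: integral_iff vge_def nv_mult V_nv)
  obtain z0 where z0: "z0 \<in> I" "z0 \<noteq> 0" using fractionalD(4)[OF I] by blast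
  define P where "P z \<longleftrightarrow> z \<in> I \<and> z \<noteq> 0" for z
  define z where "z = arg_min (\<lambda>z. nat (v d + v z)) P"
  have z: "P z" "\<And>y. P y \<Longrightarrow> nat (v d + v z) \<le> nat (v d + v y)"
    using arg_min_nat_lemma[of P z0 "\<lambda>z. nat (v d + v z)"] z0 by (auto simp: z_def P_def)
  have "v z \<le> v y" if "y \<in> I" "y \<noteq> 0" for y
    using z(2)[of y] lb[OF that] lb[of z] z(1) that by (auto simp: P_def)
  thus ?thesis using z(1) by (intro exI[of _ "v z"]) (auto simp: P_def vge_def)
qed

text \<open>Local to global: an ideal is determined by its least values. For \<open>z\<close>
  satisfying all the bounds, let \<open>C\<close> be the ideal of multipliers \<open>r\<close> with
  \<open>r * z\<close> in \<open>I\<close>. For every \<open>v\<close> it contains an element of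
  value \<open>0\<close>, so it lies in no prime and therefore contains \<open>1\<close>.\<close>

lemma fractional_eq_ideal_of:
  assumes I: "fractional I"
    and min: "\<And>v. v \<in> V \<Longrightarrow> \<exists>z\<in>I. z \<noteq> 0 \<and> v z = n v" "\<And>v z. v \<in> V \<Longrightarrow> z \<in> I \<Longrightarrow> vge v (n v) z"
  shows "I = ideal_of n"
proof
  show "I \<subseteq> ideal_of n" using min(2) by (auto simp: ideal_of_def)
  show "ideal_of n \<subseteq> I"
  proof
    fix z assume z: "z \<in> ideal_of n"
    show "z \<in> I"
    proof (cases "z = 0")
      case False
      define C where "C = {r \<in> integral_closure A. r * z \<in> I}"
      note SO = subring_integral_closure
      have id: "ideal_in (integral_closure A) C" unfolding ideal_in_def C_def
        using subring_0[OF SO] subring_add[OF SO] subring_mult[OF SO] fractionalD(1,2,3)[OF I]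
        by (auto simp: distrib_right mult.assoc)
      have unit: "\<exists>r\<in>C. r \<noteq> 0 \<and> v r = 0" if v: "v \<in> V" for v
      proof -
        obtain a where a: "a \<in> I" "a \<noteq> 0" "v a = n v" using min(1)[OF v] by blast
        \<comment> \<open>The multiplier will be \<open>r = a * s / z\<close> with \<open>s\<close>
          of divisor at least \<open>m\<close>. The exact exponent at \<open>v\<close> gives
          \<open>v r = 0\<close>, the exponents elsewhere keep \<open>r\<close> integral, and the
          maximum with \<open>0\<close> keeps \<open>s\<close> integral.\<close>
        define m where "m w = (if w = v then v z - v a else max 0 (w z - w a))" for w
        have "{w \<in> V. m w \<noteq> 0} \<subseteq> insert v {w \<in> V. w z \<noteq> 0} \<union> {w \<in> V. w a \<noteq> 0}"
          by (auto simp: m_def max_def split: if_splits)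
        hence "fin_supp m" unfolding fin_supp_def using finite_support by (meson finite_UnI finite_insert finite_subset)
        then obtain s where s: "s \<in> ideal_of m" "s \<noteq> 0" "v s = m v" using ideal_of_value_attained[OF _ v] by metis
        have "v a \<le> v z" using z a v False by (auto simp: ideal_of_def vge_def)
        hence mz: "0 \<le> m w" "w z - w a \<le> m w" for w by (auto simp: m_def)
        have sO: "s \<in> integral_closure A" using s(1) mz by (auto simp: ideal_of_def integral_iff intro: vge_mono)
        define r where "r = a * s / z"
        have wr: "w r = w a + w s - w z" if "w \<in> V" for w
          using a s False by (simp add: r_def nv_divide nv_mult V_nv that)
        have "vge w 0 r" if "w \<in> V" for w
          using wr[OF that] s(1,2) mz(2)[of w] that by (auto simp: ideal_of_def vge_def)
        hence "r \<in> integral_closure A" by (simp add: integral_iff)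
        moreover have "r * z \<in> I" using fractionalD(3)[OF I sO a(1)] False by (simp add: r_def mult.commute)
        moreover have "v r = 0" using wr[OF v] s(3) by (simp add: m_def)
        moreover have "r \<noteq> 0" using a s False by (simp add: r_def)
        ultimately show ?thesis by (auto simp: C_def)
      qed
      \<comment> \<open>A nonzero element of \<open>C\<close> is constructed, as
        \<open>V_exists\<close> demands one.\<close>
      obtain a where a: "a \<in> I" "a \<noteq> 0" using fractionalD(4)[OF I] by blast
      obtain b where b: "b \<in> A" "b \<noteq> 0" "b \<in> ideal_of (\<lambda>v. v (z / a))" using ideal_of_nonzero[OF fin_supp_val] by metis
      have "b * a / z \<in> integral_closure A"
        using b(2,3) a False by (auto simp: ideal_of_def integral_iff vge_def nv_divide nv_mult V_nv)
      moreover have "b * a / z * z \<in> I" using fractionalD(3)[OF I _ a(1)] b(1) A_subset_integral False by auto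
      ultimately have c: "b * a / z \<in> C" "b * a / z \<noteq> 0" using a b False by (auto simp: C_def)
      have "1 \<in> C"
      proof (rule ccontr)
        assume "1 \<notin> C"
        from V_exists[OF SO A_subset_integral id this c]
        obtain v where v: "v \<in> V" "\<And>a. a \<in> C \<Longrightarrow> vge v 1 a" by metis
        thus False using unit[OF v(1)] by (force simp: vge_def)
      qed
      thus ?thesis by (simp add: C_def)
    qed (use fractionalD(1)[OF I] in simp)
  qed
qed

lemma fractionalE:
  assumes I: "fractional I"
  obtains n where "fin_supp n" "I = ideal_of n"
proof -
  obtain n where n: "\<And>v. v \<in> V \<Longrightarrow> (\<exists>z\<in>I. z \<noteq> 0 \<and> v z = n v) \<and> (\<forall>z\<in>I. vge v (n v) z)"
    using fractional_min_value[OF I] by metis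
  obtain d where d: "d \<in> integral_closure A" "d \<noteq> 0" "\<And>a. a \<in> I \<Longrightarrow> d * a \<in> integral_closure A"
    using fractionalD(5)[OF I] by blast
  obtain a where a: "a \<in> I" "a \<noteq> 0" using fractionalD(4)[OF I] by blast
  have "n v = 0" if "v \<in> V" "v d = 0" "v a = 0" for v
  proof -
    note nv = n[OF that(1)]
    obtain z where z: "z \<in> I" "z \<noteq> 0" "v z = n v" using nv by blast
    have "0 \<le> v d + v z" using d(3)[OF z(1)] d(2) z(2) that(1) by (auto simp: integral_iff vge_def nv_mult V_nv)
    moreover have "n v \<le> v a" using nv a by (auto simp: vge_def)
    ultimately show ?thesis using that z by simp
  qed
  hence "{v \<in> V. n v \<noteq> 0} \<subseteq> {v \<in> V. v d \<noteq> 0} \<union> {v \<in> V. v a \<noteq> 0}" by auto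
  hence "fin_supp n" unfolding fin_supp_def using finite_support by (meson finite_UnI finite_subset)
  moreover have "I = ideal_of n" using n by (intro fractional_eq_ideal_of[OF I]) auto
  ultimately show thesis by (rule that)
qed

lemma ideal_of_mono_iff:
  assumes "fin_supp n" shows "ideal_of n \<subseteq> ideal_of m \<longleftrightarrow> (\<forall>v\<in>V. m v \<le> n v)"
proof
  assume s: "ideal_of n \<subseteq> ideal_of m"
  show "\<forall>v\<in>V. m v \<le> n v"
  proof
    fix v assume v: "v \<in> V"
    obtain z where "z \<in> ideal_of n" "z \<noteq> 0" "v z = n v" using ideal_of_value_attained[OF assms v] by metis
    hence "z \<in> ideal_of m" using s by blast
    thus "m v \<le> n v" using \<open>z \<noteq> 0\<close> \<open>v z = n v\<close> v by (force simp: ideal_of_def vge_def)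
  qed
qed (auto simp: ideal_of_def intro: vge_mono)

lemma ideal_of_inj: "fin_supp n \<Longrightarrow> fin_supp m \<Longrightarrow> ideal_of n = ideal_of m \<Longrightarrow> v \<in> V \<Longrightarrow> n v = m v"
  using ideal_of_mono_iff[of n m] ideal_of_mono_iff[of m n] by (simp add: order_antisym)

lemma ideal_of_cong: "(\<And>v. v \<in> V \<Longrightarrow> n v = m v) \<Longrightarrow> ideal_of n = ideal_of m"
  by (simp add: ideal_of_def)

lemma scale_ideal_of:
  assumes h: "h \<noteq> 0" shows "(\<lambda>z. h * z) ` ideal_of n = ideal_of (\<lambda>v. n v + v h)"
proof -
  have "vge v (n v + v h) (h * z) \<longleftrightarrow> vge v (n v) z" if "v \<in> V" for v z
    using h by (cases "z = 0") (auto simp: vge_def nv_mult V_nv that)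
  hence *: "h * z \<in> ideal_of (\<lambda>v. n v + v h) \<longleftrightarrow> z \<in> ideal_of n" for z by (simp add: ideal_of_def)
  show ?thesis
  proof
    show "(\<lambda>z. h * z) ` ideal_of n \<subseteq> ideal_of (\<lambda>v. n v + v h)" using * by auto
    show "ideal_of (\<lambda>v. n v + v h) \<subseteq> (\<lambda>z. h * z) ` ideal_of n"
    proof
      fix y assume "y \<in> ideal_of (\<lambda>v. n v + v h)"
      thus "y \<in> (\<lambda>z. h * z) ` ideal_of n" using *[of "y / h"] h by (intro image_eqI[of _ _ "y / h"]) auto
    qed
  qed
qed

text \<open>The least value of a product ideal is the sum of the least values: it is attained by a
  product of two elements of least value, and the ultrametric inequality bounds all sums of products
  from below.\<close>

lemma ideal_prod_ideal_of:
  assumes n: "fin_supp n" and m: "fin_supp m"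
  shows "ideal_prod (struct_on UNIV) (ideal_of n) (ideal_of m) = ideal_of (\<lambda>v. n v + m v)"
proof -
  let ?P = "ideal_prod (struct_on UNIV) (ideal_of n) (ideal_of m)"
  have prod: "a * b \<in> ?P" if "a \<in> ideal_of n" "b \<in> ideal_of m" for a b
    using ideal_prod.prod[OF that, of "struct_on UNIV"] by (simp add: struct_on_def)
  have sum: "a + b \<in> ?P" if "a \<in> ?P" "b \<in> ?P" for a b
    using ideal_prod.sum[OF that] by (simp add: struct_on_def)
  have sub: "z \<in> ideal_of (\<lambda>v. n v + m v)" if "z \<in> ?P" for z
    using that
  proof induction
    case (prod i j)
    thus ?case by (auto simp: struct_on_def ideal_of_def intro: vge_mult V_nv)
  next
    case (sum s1 s2)
    thus ?case by (auto simp: struct_on_def ideal_of_def intro: vge_add V_nv)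
  qed
  have f: "fractional (ideal_of (\<lambda>v. n v + m v))" "fractional (ideal_of n)" "fractional (ideal_of m)"
    using fractional_ideal_of fin_supp_add n m by auto
  have "fractional ?P" unfolding fractional_def
  proof (intro conjI ballI)
    show "0 \<in> ?P" using prod[OF fractionalD(1)[OF f(2)] fractionalD(1)[OF f(3)]] by simp
    obtain a b where "a \<in> ideal_of n" "a \<noteq> 0" "b \<in> ideal_of m" "b \<noteq> 0" using fractionalD(4)[OF f(2)] fractionalD(4)[OF f(3)] by blast
    hence "a * b \<in> ?P" "a * b \<noteq> 0" using prod by auto
    thus "?P \<noteq> {0}" by (metis singletonD)
    show "a + b \<in> ?P" if "a \<in> ?P" "b \<in> ?P" for a b using sum that .
    show "r * a \<in> ?P" if r: "r \<in> integral_closure A" and "a \<in> ?P" for r a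
      using that(2)
    proof induction
      case (prod i j)
      thus ?case using fractionalD(3)[OF f(2) r, of i] \<open>\<And>a b. \<lbrakk>a \<in> ideal_of n; b \<in> ideal_of m\<rbrakk> \<Longrightarrow> a * b \<in> ?P\<close>[of "r * i" j]
        by (simp add: struct_on_def mult.assoc)
    next
      case (sum s1 s2)
      thus ?case using \<open>\<And>a b. \<lbrakk>a \<in> ?P; b \<in> ?P\<rbrakk> \<Longrightarrow> a + b \<in> ?P\<close>[of "r * s1" "r * s2"]
        by (simp add: struct_on_def distrib_left)
    qed
    show "\<exists>d\<in>integral_closure A. d \<noteq> 0 \<and> (\<forall>a\<in>?P. d * a \<in> integral_closure A)"
      using fractionalD(5)[OF f(1)] sub by blast
  qed
  thus ?thesis
  proof (rule fractional_eq_ideal_of)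
    fix v assume v: "v \<in> V"
    obtain a where a: "a \<in> ideal_of n" "a \<noteq> 0" "v a = n v" using ideal_of_value_attained[OF n v] by metis
    obtain b where b: "b \<in> ideal_of m" "b \<noteq> 0" "v b = m v" using ideal_of_value_attained[OF m v] by metis
    show "\<exists>z\<in>?P. z \<noteq> 0 \<and> v z = n v + m v"
      using a b prod by (intro bexI[of _ "a * b"]) (auto simp: nv_mult V_nv v)
  qed (use sub in \<open>auto simp: ideal_of_def\<close>)
qed

text \<open>Denominators in \<open>A\<close> make the \<open>b i\<close> integral, and a common
  nonzero factor from \<open>I\<close> moves them into \<open>I\<close>; neither operation destroys
  independence over \<open>A\<close>.\<close>

lemma basis_in_fractional:
  assumes I: "fractional I"
    and b: "\<And>c i. (\<And>i. c i \<in> A) \<Longrightarrow> (\<Sum>i<n. c i * b i) = 0 \<Longrightarrow> i < n \<Longrightarrow> c i = 0"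
  obtains b' :: "nat \<Rightarrow> 'a" where "\<And>i. b' i \<in> I"
    "\<And>c i. (\<And>i. c i \<in> A) \<Longrightarrow> (\<Sum>i<n. c i * b' i) = 0 \<Longrightarrow> i < n \<Longrightarrow> c i = 0"
proof -
  obtain a where a: "a \<in> I" "a \<noteq> 0" using fractionalD(4)[OF I] by blast
  have "\<forall>i. \<exists>d. d \<in> A \<and> d \<noteq> 0 \<and> (\<forall>v\<in>V. vge v 0 (d * b i))"
    using integral_multiple_V by metis
  then obtain d where d: "\<And>i. d i \<in> A" "\<And>i. d i \<noteq> 0" "\<And>i v. v \<in> V \<Longrightarrow> vge v 0 (d i * b i)" by metis
  show thesis
  proof (rule that[of "\<lambda>i. d i * b i * a"])
    show "d i * b i * a \<in> I" for i using fractionalD(3)[OF I _ a(1)] d(3) by (simp add: integral_iff)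
    fix c :: "nat \<Rightarrow> 'a" and i assume c: "\<And>i. c i \<in> A" "(\<Sum>i<n. c i * (d i * b i * a)) = 0" "i < n"
    have "(\<Sum>i<n. c i * (d i * b i * a)) = a * (\<Sum>i<n. (c i * d i) * b i)" by (simp add: sum_distrib_left mult_ac)
    hence "(\<Sum>i<n. (c i * d i) * b i) = 0" using c a by simp
    hence "c i * d i = 0" using b[of "\<lambda>i. c i * d i" i] c d subring_mult[OF A] by blast
    thus "c i = 0" using d by simp
  qed
qed

end

section \<open>The group of fractional ideals and prime factorization\<close>

locale arith_setting = pid_extension A N for A :: "'a::field set" and N +
  fixes K :: "'a arith_data"
  assumes int_ring: "int_ring K = integral_closure A"
    and finite_places: "all_places K - set (inf_places K) = Nonarch ` V"
begin

lemma frac_ideal_iff: "frac_ideal K I \<longleftrightarrow> fractional I"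
  unfolding frac_ideal_def fractional_def int_ring ..

lemma ideal_group_simps:
  "carrier (ideal_group K) = {I. fractional I}" "\<one>\<^bsub>ideal_group K\<^esub> = ideal_of (\<lambda>v. 0)"
  by (simp_all add: ideal_group_def frac_ideal_iff int_ring ideal_of_0)

lemma ideal_group_mult:
  "fin_supp n \<Longrightarrow> fin_supp m \<Longrightarrow> ideal_of n \<otimes>\<^bsub>ideal_group K\<^esub> ideal_of m = ideal_of (\<lambda>v. n v + m v)"
  by (simp add: ideal_group_def ideal_prod_ideal_of)

lemma comm_group_ideal_group: "comm_group (ideal_group K)"
proof (rule comm_groupI)
  fix x y assume "x \<in> carrier (ideal_group K)" "y \<in> carrier (ideal_group K)"
  then obtain n m where nm: "fin_supp n" "x = ideal_of n" "fin_supp m" "y = ideal_of m"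
    unfolding ideal_group_simps using fractionalE by (metis mem_Collect_eq)
  show "x \<otimes>\<^bsub>ideal_group K\<^esub> y \<in> carrier (ideal_group K)"
    using nm by (simp add: ideal_group_mult ideal_group_simps fractional_ideal_of fin_supp_add)
  show "x \<otimes>\<^bsub>ideal_group K\<^esub> y = y \<otimes>\<^bsub>ideal_group K\<^esub> x"
    using nm by (simp add: ideal_group_mult add.commute)
  fix z assume "z \<in> carrier (ideal_group K)"
  then obtain l where l: "fin_supp l" "z = ideal_of l"
    unfolding ideal_group_simps using fractionalE by (metis mem_Collect_eq)
  show "x \<otimes>\<^bsub>ideal_group K\<^esub> y \<otimes>\<^bsub>ideal_group K\<^esub> z = x \<otimes>\<^bsub>ideal_group K\<^esub> (y \<otimes>\<^bsub>ideal_group K\<^esub> z)"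
    using nm l by (simp add: ideal_group_mult fin_supp_add add.assoc)
next
  show "\<one>\<^bsub>ideal_group K\<^esub> \<in> carrier (ideal_group K)"
    by (simp add: ideal_group_simps fractional_ideal_of fin_supp_0)
next
  fix x assume "x \<in> carrier (ideal_group K)"
  then obtain n where n: "fin_supp n" "x = ideal_of n"
    unfolding ideal_group_simps using fractionalE by (metis mem_Collect_eq)
  show "\<one>\<^bsub>ideal_group K\<^esub> \<otimes>\<^bsub>ideal_group K\<^esub> x = x"
    using n by (simp add: ideal_group_simps(2) ideal_group_mult fin_supp_0)
  show "\<exists>y\<in>carrier (ideal_group K). y \<otimes>\<^bsub>ideal_group K\<^esub> x = \<one>\<^bsub>ideal_group K\<^esub>"
    using n by (intro bexI[of _ "ideal_of (\<lambda>v. - n v)"])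
      (simp_all add: ideal_group_simps ideal_group_mult fin_supp_minus fractional_ideal_of)
qed

lemma ideal_group_pow:
  assumes n: "fin_supp n"
  shows "ideal_of n [^]\<^bsub>ideal_group K\<^esub> (k::int) = ideal_of (\<lambda>v. k * n v)"
proof -
  interpret G: comm_group "ideal_group K" by (rule comm_group_ideal_group)
  have car: "ideal_of m \<in> carrier (ideal_group K)" if "fin_supp m" for m
    using that by (simp add: ideal_group_simps fractional_ideal_of)
  have nat: "ideal_of n [^]\<^bsub>ideal_group K\<^esub> (j::nat) = ideal_of (\<lambda>v. int j * n v)" for j
  proof (induction j)
    case 0
    thus ?case by (simp add: ideal_group_simps)
  next
    case (Suc j)
    thus ?case using n by (simp add: ideal_group_mult fin_supp_mult algebra_simps)
  qed
  show ?thesis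
  proof (cases k)
    case (nonneg j)
    thus ?thesis using nat[of j] by (simp add: int_pow_int)
  next
    case (neg j)
    have "ideal_of (\<lambda>v. k * n v) \<otimes>\<^bsub>ideal_group K\<^esub> ideal_of (\<lambda>v. int (Suc j) * n v) = \<one>\<^bsub>ideal_group K\<^esub>"
      using n neg by (simp only: ideal_group_mult fin_supp_mult ideal_group_simps(2)) (simp flip: distrib_right)
    hence "inv\<^bsub>ideal_group K\<^esub> ideal_of (\<lambda>v. int (Suc j) * n v) = ideal_of (\<lambda>v. k * n v)"
      using n by (intro G.inv_equality car fin_supp_mult)
    thus ?thesis using nat[of "Suc j"] neg G.int_pow_neg_int[OF car[OF n], of "Suc j"] by simp
  qed
qed

lemma prime_at_eq:
  assumes v: "v \<in> V" shows "prime_at K (Nonarch v) = ideal_of (\<lambda>w. if w = v then 1 else 0)"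
  by (auto simp: int_ring integral_iff ideal_of_def in_val_ideal_iff v intro: vge_mono)
    (metis (full_types) v vge_mono zero_le_one)

lemma finprod_primes:
  assumes "finite S" "S \<subseteq> Nonarch ` V"
  shows "finprod (ideal_group K) (\<lambda>p. prime_at K p [^]\<^bsub>ideal_group K\<^esub> n p) S =
    ideal_of (\<lambda>v. if Nonarch v \<in> S then n (Nonarch v) else 0)"
  using assms
proof (induction S)
  case empty
  interpret G: comm_group "ideal_group K" by (rule comm_group_ideal_group)
  show ?case by (simp add: ideal_group_simps)
next
  case (insert p S)
  interpret G: comm_group "ideal_group K" by (rule comm_group_ideal_group)
  have fs: "fin_supp (\<lambda>w. if w = v then 1 else 0)" for v
    unfolding fin_supp_def by (rule finite_subset[of _ "{v}"]) auto
  have pow: "prime_at K (Nonarch v) [^]\<^bsub>ideal_group K\<^esub> k = ideal_of (\<lambda>w. if w = v then k else 0)" if "v \<in> V" for v and k :: int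
    by (simp del: prime_at.simps add: prime_at_eq[OF that] ideal_group_pow[OF fs] if_distrib[of "\<lambda>x. k * x"] cong: if_cong)
  have fsk: "fin_supp (\<lambda>w. if w = v then k else 0)" for v k
    using fin_supp_mult[OF fs, of k] by (simp add: if_distrib[of "\<lambda>x. k * x"] cong: if_cong)
  have car: "prime_at K q [^]\<^bsub>ideal_group K\<^esub> n q \<in> carrier (ideal_group K)" if "q \<in> insert p S" for q
    using that insert.prems pow fsk by (auto simp: ideal_group_simps fractional_ideal_of)
  obtain v where v: "v \<in> V" "p = Nonarch v" using insert by auto
  have "{w \<in> V. (if Nonarch w \<in> S then n (Nonarch w) else 0) \<noteq> 0} \<subseteq> Nonarch -` S" by auto
  moreover have "finite (Nonarch -` S)" using insert(1) by (intro finite_vimageI) (auto intro: injI)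
  ultimately have fS: "fin_supp (\<lambda>w. if Nonarch w \<in> S then n (Nonarch w) else 0)"
    unfolding fin_supp_def by (rule finite_subset)
  have "finprod (ideal_group K) (\<lambda>p. prime_at K p [^]\<^bsub>ideal_group K\<^esub> n p) (insert p S) =
     ideal_of (\<lambda>w. if w = v then n p else 0) \<otimes>\<^bsub>ideal_group K\<^esub> ideal_of (\<lambda>w. if Nonarch w \<in> S then n (Nonarch w) else 0)"
  proof (subst G.finprod_insert)
    have "prime_at K p [^]\<^bsub>ideal_group K\<^esub> n p = ideal_of (\<lambda>w. if w = v then n p else 0)"
      unfolding v(2) by (rule pow[OF v(1)])
    thus "prime_at K p [^]\<^bsub>ideal_group K\<^esub> n p \<otimes>\<^bsub>ideal_group K\<^esub>
      finprod (ideal_group K) (\<lambda>p. prime_at K p [^]\<^bsub>ideal_group K\<^esub> n p) S =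
      ideal_of (\<lambda>w. if w = v then n p else 0) \<otimes>\<^bsub>ideal_group K\<^esub> ideal_of (\<lambda>w. if Nonarch w \<in> S then n (Nonarch w) else 0)"
      using insert by simp
  qed (use insert car in auto)
  also have "\<dots> = ideal_of (\<lambda>w. (if w = v then n p else 0) + (if Nonarch w \<in> S then n (Nonarch w) else 0))"
    by (rule ideal_group_mult[OF fsk fS])
  also have "\<dots> = ideal_of (\<lambda>w. if Nonarch w \<in> insert p S then n (Nonarch w) else 0)"
    using insert(2) v by (intro ideal_of_cong) auto
  finally show ?case .
qed

text \<open>Resolves the definite description in \<open>ideal_exponents\<close>: a finite product of
  prime powers is an \<open>ideal_of\<close>, and \<open>ideal_of\<close> determines its exponents
  on \<open>V\<close>.\<close>

lemma ideal_exponents_eq: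
  assumes n: "finite {p. n p \<noteq> 0}" "{p. n p \<noteq> 0} \<subseteq> Nonarch ` V"
  shows "ideal_exponents K (ideal_of (\<lambda>v. n (Nonarch v))) = n"
proof -
  define Q where "Q n \<longleftrightarrow> finite {p. n p \<noteq> 0} \<and> {p. n p \<noteq> 0} \<subseteq> all_places K - set (inf_places K) \<and>
             ideal_of (\<lambda>v. n (Nonarch v)) = finprod (ideal_group K) (\<lambda>p. prime_at K p [^]\<^bsub>ideal_group K\<^esub> n p) {p. n p \<noteq> 0}"
    for n :: "'a place \<Rightarrow> int"
  have fp: "finprod (ideal_group K) (\<lambda>p. prime_at K p [^]\<^bsub>ideal_group K\<^esub> m p) {p. m p \<noteq> 0} = ideal_of (\<lambda>v. m (Nonarch v))"
    if "finite {p. m p \<noteq> 0}" "{p. m p \<noteq> 0} \<subseteq> Nonarch ` V" for m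
    using finprod_primes[OF that] by (auto intro!: ideal_of_cong)
  have fs: "fin_supp (\<lambda>v. m (Nonarch v))" if "finite {p. m p \<noteq> 0}" for m :: "'a place \<Rightarrow> int"
  proof -
    have "finite (Nonarch -` {p. m p \<noteq> 0})" using that by (intro finite_vimageI) (auto intro: injI)
    thus ?thesis unfolding fin_supp_def by (rule rev_finite_subset) auto
  qed
  show ?thesis unfolding ideal_exponents_def finite_places
  proof (rule the_equality)
    show "finite {p. n p \<noteq> 0} \<and> {p. n p \<noteq> 0} \<subseteq> Nonarch ` V \<and> ideal_of (\<lambda>v. n (Nonarch v)) =
      finprod (ideal_group K) (\<lambda>p. prime_at K p [^]\<^bsub>ideal_group K\<^esub> n p) {p. n p \<noteq> 0}"
      using n fp[OF n] by simp
  next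
    fix m :: "'a place \<Rightarrow> int"
    assume m: "finite {p. m p \<noteq> 0} \<and> {p. m p \<noteq> 0} \<subseteq> Nonarch ` V \<and> ideal_of (\<lambda>v. n (Nonarch v)) =
      finprod (ideal_group K) (\<lambda>p. prime_at K p [^]\<^bsub>ideal_group K\<^esub> m p) {p. m p \<noteq> 0}"
    hence eq: "ideal_of (\<lambda>v. n (Nonarch v)) = ideal_of (\<lambda>v. m (Nonarch v))" using fp[of m] by simp
    have "n (Nonarch v) = m (Nonarch v)" if "v \<in> V" for v
      by (rule ideal_of_inj[OF fs fs eq that]) (use n m in auto)
    moreover have "n p = 0" "m p = 0" if "p \<notin> Nonarch ` V" for p using that n m by blast+
    ultimately have "m p = n p" for p by (cases "p \<in> Nonarch ` V") auto
    thus "m = n" by blast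
  qed
qed

lemma frac_idealE:
  assumes "frac_ideal K I"
  obtains "finite {p. ideal_exponents K I p \<noteq> 0}" "{p. ideal_exponents K I p \<noteq> 0} \<subseteq> Nonarch ` V"
    "I = ideal_of (\<lambda>v. ideal_exponents K I (Nonarch v))"
proof -
  obtain n where n: "fin_supp n" "I = ideal_of n" using assms fractionalE by (auto simp: frac_ideal_iff)
  define m where "m p = (case p of Nonarch v \<Rightarrow> if v \<in> V then n v else 0 | Arch s \<Rightarrow> 0)" for p
  have "p \<in> Nonarch ` {v \<in> V. n v \<noteq> 0}" if "m p \<noteq> 0" for p
    using that by (cases p) (auto simp: m_def split: if_splits)
  hence "{p. m p \<noteq> 0} \<subseteq> Nonarch ` {v \<in> V. n v \<noteq> 0}" by blast
  hence m: "finite {p. m p \<noteq> 0}" "{p. m p \<noteq> 0} \<subseteq> Nonarch ` V"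
    using n(1) unfolding fin_supp_def by (auto intro: finite_subset)
  have I: "I = ideal_of (\<lambda>v. m (Nonarch v))" unfolding n(2) by (intro ideal_of_cong) (simp add: m_def)
  hence "ideal_exponents K I = m" using ideal_exponents_eq[OF m] by simp
  thus thesis using that m I by simp
qed

lemma frac_ideal_ideal_of:
  assumes n: "finite {p. n p \<noteq> 0}" shows "frac_ideal K (ideal_of (\<lambda>v. n (Nonarch v)))"
proof -
  have "finite (Nonarch -` {p. n p \<noteq> 0})" using n by (intro finite_vimageI) (auto intro: injI)
  hence "fin_supp (\<lambda>v. n (Nonarch v))" unfolding fin_supp_def by (rule rev_finite_subset) auto
  thus ?thesis by (simp add: frac_ideal_iff fractional_ideal_of)
qed

end

section \<open>Reduced ideals and divisor classes\<close>

text \<open>The first entry of the vector and of its entrywise reciprocal are both at least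
  \<open>1\<close>, hence both equal \<open>1\<close>, and the comparison moves on to the
  tails.\<close>

lemma lexordp_eq_ones_reciprocal:
  fixes f g :: "'b \<Rightarrow> real"
  assumes "lexordp_eq (map (\<lambda>_. 1) xs) (map f xs)" "lexordp_eq (map (\<lambda>_. 1) xs) (map g xs)"
    and "\<And>x. x \<in> set xs \<Longrightarrow> 0 < f x \<and> f x * g x = 1"
  shows "\<forall>x\<in>set xs. f x = 1"
  using assms
proof (induction xs)
  case (Cons x xs)
  have fg: "0 < f x" "f x * g x = 1" using Cons.prems(3)[of x] by auto
  have "1 \<le> f x" "1 \<le> g x" using Cons.prems(1,2) by auto
  moreover from this have "f x * 1 \<le> f x * g x" by (intro mult_left_mono) auto
  ultimately have 1: "f x = 1" "g x = 1" using fg by auto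
  thus ?case using Cons by auto
qed simp

lemma lexordp_eq_ones_le:
  fixes f :: "'b \<Rightarrow> real"
  assumes "lexordp_eq (map (\<lambda>_. 1) xs) (map f xs)" "\<And>x. x \<in> set xs \<Longrightarrow> f x \<le> 1"
  shows "\<forall>x\<in>set xs. f x = 1"
  using assms
proof (induction xs)
  case (Cons x xs)
  have "f x = 1" using Cons.prems(1) Cons.prems(2)[of x] by auto
  thus ?case using Cons by auto
qed simp

lemma lexordp_eq_scale:
  fixes f g c :: "'b \<Rightarrow> real"
  assumes "\<And>x. x \<in> set xs \<Longrightarrow> 0 < c x"
  shows "lexordp_eq (map (\<lambda>x. c x * f x) xs) (map (\<lambda>x. c x * g x) xs) \<longleftrightarrow> lexordp_eq (map f xs) (map g xs)"
  using assms by (induction xs) auto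

lemma lexordp_eq_finite_min:
  assumes "finite L" "L \<noteq> {}"
  shows "\<exists>x\<in>L. \<forall>y\<in>L. lexordp_eq x (y :: real list)"
  using assms
proof (induction L rule: finite_ne_induct)
  case (singleton x)
  thus ?case by (simp add: lexordp_eq_refl)
next
  case (insert y L)
  then obtain x where x: "x \<in> L" "\<And>z. z \<in> L \<Longrightarrow> lexordp_eq x z" by blast
  show ?case
  proof (cases "lexordp_eq x y")
    case True
    thus ?thesis using x by auto
  next
    case False
    hence "lexordp_eq y x" using lexordp_eq_linear by blast
    thus ?thesis using x lexordp_eq_refl lexordp_eq_trans by (intro bexI[of _ y]) blast+
  qed
qed

lemma (in group) coset_eq_iff:
  assumes H: "subgroup H G" and "a \<in> carrier G" "b \<in> carrier G"
  shows "H #> a = H #> b \<longleftrightarrow> b \<otimes> inv a \<in> H"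
proof
  assume "H #> a = H #> b"
  hence "b \<in> H #> a" using rcos_self[OF assms(3) H] by simp
  thus "b \<otimes> inv a \<in> H" using subgroup.rcos_module[OF H is_group assms(2,3)] by simp
next
  assume "b \<otimes> inv a \<in> H"
  hence "b \<in> H #> a" using subgroup.rcos_module[OF H is_group assms(2,3)] by simp
  thus "H #> a = H #> b" by (rule repr_independence[OF _ assms(2) H])
qed

text \<open>The common ground of the two cases. The last two assumptions carry the analytic content.
  \<open>finite_values\<close> speaks of vectors of values and not of elements, because over an
  infinite constant field the bounded sets of elements may be infinite.\<close>

locale class_setting = arith_setting A N K for A :: "'a::field set" and N and K :: "'a arith_data" +
  assumes places_nonempty: "inf_places K \<noteq> []"
    and distinct_places: "distinct (inf_places K)"
    and inf_places_subset: "set (inf_places K) \<subseteq> all_places K"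
    and base_gt_1: "1 < abs_base K"
    and place_deg_pos: "p \<in> set (inf_places K) \<Longrightarrow> 0 < place_deg K p"
    and place_val_mult: "p \<in> set (inf_places K) \<Longrightarrow> a \<noteq> 0 \<Longrightarrow> b \<noteq> 0 \<Longrightarrow> place_val p (a * b) = place_val p a + place_val p b"
    and place_val_coef: "p \<in> set (inf_places K) \<Longrightarrow> a \<noteq> 0 \<Longrightarrow> place_val p a \<in> coef_group K"
    and coef_group_ops: "0 \<in> coef_group K" "1 \<in> coef_group K" "c \<in> coef_group K \<Longrightarrow> d \<in> coef_group K \<Longrightarrow> c + d \<in> coef_group K"
      "c \<in> coef_group K \<Longrightarrow> - c \<in> coef_group K"
    and exists_small: "frac_ideal K I \<Longrightarrow> \<exists>h\<in>I - {0}. \<forall>p\<in>set (inf_places K) - {last (inf_places K)}. C p \<le> place_val p h"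
    and finite_values: "frac_ideal K I \<Longrightarrow>
      finite ((\<lambda>h. map (\<lambda>p. place_val p h) (inf_places K)) ` {h \<in> I - {0}. \<forall>p\<in>set (inf_places K). C p \<le> place_val p h})"
begin

definition S where "S = set (inf_places K)"
definition pl where "pl = last (inf_places K)"
definition nn where "nn = length (inf_places K) - 1"
definition pp where "pp i = inf_places K ! i"

lemma places_facts:
  shows length_inf_places: "length (inf_places K) = Suc nn"
    and pp_nn: "pp nn = pl"
    and pl_in_S: "pl \<in> S"
    and pp_in_S: "i \<le> nn \<Longrightarrow> pp i \<in> S"
    and pp_ne_pl: "i < nn \<Longrightarrow> pp i \<noteq> pl"
    and pp_inj: "i \<le> nn \<Longrightarrow> j \<le> nn \<Longrightarrow> pp i = pp j \<longleftrightarrow> i = j"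
    and S_cases: "p \<in> S \<Longrightarrow> p = pl \<or> (\<exists>i<nn. p = pp i)"
proof -
  show 1: "length (inf_places K) = Suc nn" using places_nonempty by (cases "inf_places K") (auto simp: nn_def)
  show 2: "pp nn = pl" using places_nonempty by (simp add: pp_def pl_def nn_def last_conv_nth)
  show "pl \<in> S" using places_nonempty by (simp add: S_def pl_def)
  show "i \<le> nn \<Longrightarrow> pp i \<in> S" using 1 by (simp add: S_def pp_def)
  show 3: "i \<le> nn \<Longrightarrow> j \<le> nn \<Longrightarrow> pp i = pp j \<longleftrightarrow> i = j" for i j
    using 1 distinct_places by (simp add: pp_def nth_eq_iff_index_eq)
  show "i < nn \<Longrightarrow> pp i \<noteq> pl" using 3[of i nn] 2 by auto
  show "p \<in> S \<Longrightarrow> p = pl \<or> (\<exists>i<nn. p = pp i)"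
    using 1 2 unfolding S_def by (metis in_set_conv_nth less_Suc_eq pp_def)
qed

lemma all_places_eq: "all_places K = Nonarch ` V \<union> S"
  using finite_places inf_places_subset by (auto simp: S_def)

lemma finite_places_disjoint: "v \<in> V \<Longrightarrow> Nonarch v \<notin> S"
  using finite_places by (auto simp: S_def)

lemma place_val_S:
  assumes "p \<in> S"
  shows place_val_1: "place_val p 1 = 0"
    and place_val_inverse: "a \<noteq> 0 \<Longrightarrow> place_val p (inverse a) = - place_val p a"
proof -
  note m = place_val_mult[OF assms[unfolded S_def]]
  show 1: "place_val p 1 = 0" using m[of 1 1] by simp
  show "place_val p (inverse a) = - place_val p a" if "a \<noteq> 0"
    using m[of a "inverse a"] 1 that by simp
qed

lemma place_val_mult_all:
  assumes "p \<in> all_places K" "a \<noteq> 0" "b \<noteq> 0"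
  shows "place_val p (a * b) = place_val p a + place_val p b"
  using assms place_val_mult unfolding all_places_eq S_def by (auto simp: nv_mult V_nv)

lemma place_val_inverse_all:
  assumes "p \<in> all_places K" "a \<noteq> 0"
  shows "place_val p (inverse a) = - place_val p a"
  using assms place_val_inverse unfolding all_places_eq by (auto simp: nv_inverse V_nv)

lemma place_abs_eq_1_iff: "p \<in> S \<Longrightarrow> h \<noteq> 0 \<Longrightarrow> place_abs K p h = 1 \<longleftrightarrow> place_val p h = 0"
  using base_gt_1 place_deg_pos[of p] powr_eq_one_iff[OF base_gt_1]
  by (auto simp: place_abs_def S_def)

lemma place_abs_le_iff: "p \<in> S \<Longrightarrow> h \<noteq> 0 \<Longrightarrow> place_abs K p h \<le> abs_base K powr (c * place_deg K p) \<longleftrightarrow> - c \<le> place_val p h"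
proof -
  assume p: "p \<in> S" "h \<noteq> 0"
  have "place_abs K p h \<le> abs_base K powr (c * place_deg K p) \<longleftrightarrow> - place_val p h * place_deg K p \<le> c * place_deg K p"
    using base_gt_1 p by (simp add: place_abs_def)
  also have "\<dots> \<longleftrightarrow> - place_val p h \<le> c" by (rule mult_le_cancel_right_pos) (use place_deg_pos p in \<open>simp add: S_def\<close>)
  finally show ?thesis by linarith
qed

lemma place_abs_le_1_iff: "p \<in> S \<Longrightarrow> h \<noteq> 0 \<Longrightarrow> place_abs K p h \<le> 1 \<longleftrightarrow> 0 \<le> place_val p h"
  using place_abs_le_iff[of p h 0] base_gt_1 by simp

lemma place_abs_mult: "p \<in> S \<Longrightarrow> a \<noteq> 0 \<Longrightarrow> b \<noteq> 0 \<Longrightarrow> place_abs K p (a * b) = place_abs K p a * place_abs K p b"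
  using place_val_mult base_gt_1 by (simp add: place_abs_def S_def powr_add [symmetric] algebra_simps)

lemma place_abs_pos: "a \<noteq> 0 \<Longrightarrow> 0 < place_abs K p a"
  using base_gt_1 by (simp add: place_abs_def)

lemma place_abs_1: "p \<in> S \<Longrightarrow> place_abs K p 1 = 1"
  by (simp add: place_abs_eq_1_iff place_val_1)

definition key where "key h = map (\<lambda>p. place_abs K p h) (pl # butlast (inf_places K))"

lemma elt_le_key: "elt_le K h h' \<longleftrightarrow> lexordp_eq (key h) (key h')"
  by (simp add: elt_le_def key_def pl_def Let_def)

lemma set_key_places: "set (pl # butlast (inf_places K)) = S"
  using places_nonempty by (cases "inf_places K" rule: rev_cases) (auto simp: pl_def S_def)

lemma key_1: "key 1 = map (\<lambda>_. 1) (pl # butlast (inf_places K))"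
  unfolding key_def using place_abs_1 set_key_places by (intro map_cong) auto

lemma elt_le_1_imp: "h \<noteq> 0 \<Longrightarrow> elt_le K 1 h \<Longrightarrow> place_val pl h \<le> 0"
proof -
  assume h: "h \<noteq> 0" "elt_le K 1 h"
  hence "1 \<le> place_abs K pl h" unfolding elt_le_key key_1 by (auto simp: key_def)
  hence "0 \<le> - place_val pl h * place_deg K pl"
    using h powr_less_mono[of "- place_val pl h * place_deg K pl" 0, OF _ base_gt_1] base_gt_1
    by (auto simp: place_abs_def not_le[symmetric])
  thus ?thesis using place_deg_pos[of pl] pl_in_S by (simp add: S_def mult_le_0_iff)
qed

lemma elt_le_1_nonneg:
  assumes h: "h \<noteq> 0" "elt_le K 1 h" "\<And>p. p \<in> S \<Longrightarrow> 0 \<le> place_val p h" and p: "p \<in> S"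
  shows "place_val p h = 0"
proof -
  have "\<forall>p\<in>set (pl # butlast (inf_places K)). place_abs K p h = 1"
  proof (rule lexordp_eq_ones_le)
    show "lexordp_eq (map (\<lambda>_. 1) (pl # butlast (inf_places K))) (map (\<lambda>p. place_abs K p h) (pl # butlast (inf_places K)))"
      using h(2) unfolding elt_le_key key_1 by (simp only: key_def)
    show "place_abs K p h \<le> 1" if "p \<in> set (pl # butlast (inf_places K))" for p
      using that h place_abs_le_1_iff unfolding set_key_places by auto
  qed
  thus ?thesis using p h(1) place_abs_eq_1_iff unfolding set_key_places by auto
qed

lemma elt_le_1_inverse:
  assumes h: "h \<noteq> 0" "elt_le K 1 h" "elt_le K 1 (inverse h)" and p: "p \<in> S"
  shows "place_val p h = 0"
proof -
  have "\<forall>p\<in>set (pl # butlast (inf_places K)). place_abs K p h = 1"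
  proof (rule lexordp_eq_ones_reciprocal)
    show "lexordp_eq (map (\<lambda>_. 1) (pl # butlast (inf_places K))) (map (\<lambda>p. place_abs K p h) (pl # butlast (inf_places K)))"
      using h(2) unfolding elt_le_key key_1 by (simp only: key_def)
    show "lexordp_eq (map (\<lambda>_. 1) (pl # butlast (inf_places K))) (map (\<lambda>p. place_abs K p (inverse h)) (pl # butlast (inf_places K)))"
      using h(3) unfolding elt_le_key key_1 by (simp only: key_def)
    show "0 < place_abs K p h \<and> place_abs K p h * place_abs K p (inverse h) = 1" if "p \<in> set (pl # butlast (inf_places K))" for p
      using that h place_abs_pos place_abs_mult[of p h "inverse h"] place_abs_1 unfolding set_key_places by auto
  qed
  thus ?thesis using p h(1) place_abs_eq_1_iff unfolding set_key_places by auto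
qed

lemma elt_le_scale:
  assumes "c \<noteq> 0" "a \<noteq> 0" "b \<noteq> 0"
  shows "elt_le K (c * a) (c * b) \<longleftrightarrow> elt_le K a b"
proof -
  have "key (c * h) = map (\<lambda>p. place_abs K p c * place_abs K p h) (pl # butlast (inf_places K))" if "h \<noteq> 0" for h
    unfolding key_def using place_abs_mult set_key_places assms that by (intro map_cong) auto
  note e = this
  show ?thesis unfolding elt_le_key e[OF assms(2)] e[OF assms(3)]
    by (subst lexordp_eq_scale) (simp_all only: place_abs_pos[OF assms(1)] key_def)
qed

text \<open>The condition on a representative in \<open>Rep_of\<close>, rewritten in terms of
  valuations: absolute value at most \<open>q ^ (t_i * deg)\<close> becomes valuation at least
  \<open>- t_i\<close>, and \<open>1\<close> lies in the box exactly when \<open>1\<close> is in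
  \<open>I\<close> and all \<open>t_i\<close> are nonnegative. Reducedness follows, see
  \<open>minimal_pair_reduced\<close>.\<close>

definition minimal_pair where
  "minimal_pair I t \<longleftrightarrow> frac_ideal K I \<and> length t = nn \<and> 1 \<in> I \<and> (\<forall>i<nn. 0 \<le> t ! i) \<and>
     (\<forall>h\<in>I - {0}. (\<forall>i<nn. - (t ! i) \<le> place_val (pp i) h) \<longrightarrow> 0 \<le> place_val pl h \<longrightarrow> elt_le K 1 h)"

lemma in_box_iff:
  assumes "length t = nn" "h \<noteq> 0"
  shows "h \<in> box K I (t @ [0]) \<longleftrightarrow> h \<in> I \<and> (\<forall>i<nn. - (t ! i) \<le> place_val (pp i) h) \<and> 0 \<le> place_val pl h"
proof -
  have "h \<in> box K I (t @ [0]) \<longleftrightarrow> h \<in> I \<and> (\<forall>i\<le>nn. - ((t @ [0]) ! i) \<le> place_val (pp i) h)"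
    using assms(2) pp_in_S by (auto simp: box_def length_inf_places less_Suc_eq_le place_abs_le_iff simp flip: pp_def)
  also have "\<dots> \<longleftrightarrow> h \<in> I \<and> (\<forall>i<nn. - (t ! i) \<le> place_val (pp i) h) \<and> 0 \<le> place_val pl h"
    using assms(1) pp_nn by (auto simp: le_less nth_append)
  finally show ?thesis .
qed

lemma minimal_pair_iff:
  assumes "frac_ideal K I" "length t = nn"
  shows "minimal_pair I t \<longleftrightarrow> 1 \<in> box K I (t @ [0]) - {0} \<and> (\<forall>h \<in> box K I (t @ [0]) - {0}. elt_le K 1 h)"
proof -
  have "1 \<in> box K I (t @ [0]) - {0} \<longleftrightarrow> 1 \<in> I \<and> (\<forall>i<nn. 0 \<le> t ! i)"
    using in_box_iff[OF assms(2), of 1] pp_in_S pl_in_S place_val_1 by auto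
  moreover have "(\<forall>h\<in>box K I (t @ [0]) - {0}. elt_le K 1 h) \<longleftrightarrow>
     (\<forall>h\<in>I - {0}. (\<forall>i<nn. - (t ! i) \<le> place_val (pp i) h) \<longrightarrow> 0 \<le> place_val pl h \<longrightarrow> elt_le K 1 h)"
    using in_box_iff[OF assms(2)] by (metis (no_types, lifting) Diff_iff singletonI)
  ultimately show ?thesis using assms by (simp add: minimal_pair_def)
qed

text \<open>As \<open>t\<close> is nonnegative, the box with all bounds \<open>0\<close> is part of
  the box of \<open>t\<close>. An element of it has all absolute values at most \<open>1\<close> and
  yet is not below \<open>1\<close> in the lexicographic order, so all of them equal
  \<open>1\<close>.\<close>

lemma minimal_pair_reduced:
  assumes "minimal_pair I t" shows "reduced K I"
  unfolding reduced_def
proof (intro conjI ballI)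
  show "1 \<in> I" using assms by (simp add: minimal_pair_def)
  fix h p assume h: "h \<in> box K I (replicate (length (inf_places K)) 0) - {0}" and p: "p \<in> set (inf_places K)"
  have hI: "h \<in> I" "h \<noteq> 0" and le: "\<And>i. i \<le> nn \<Longrightarrow> 0 \<le> place_val (pp i) h"
    using h pp_in_S place_abs_le_iff[where c = 0]
    by (auto simp: box_def length_inf_places less_Suc_eq_le simp flip: pp_def simp del: replicate_Suc)
  have pos: "0 \<le> place_val p h" if "p \<in> S" for p using S_cases[OF that] le pp_nn by fastforce
  have "elt_le K 1 h" using assms hI pos pp_in_S pl_in_S unfolding minimal_pair_def
    by (smt (verit) DiffI less_imp_le_nat singletonD)
  thus "place_abs K p h = 1"
    using elt_le_1_nonneg[OF hI(2) _ pos] p place_abs_eq_1_iff hI(2) by (simp add: S_def)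
qed

subsection \<open>The representing set\<close>

definition sim_class where "sim_class I = {J. reduced K J \<and> ideal_sim K I J}"

lemma ideal_sim_refl: "ideal_sim K I I"
  unfolding ideal_sim_def using place_abs_1 by (intro exI[of _ 1]) (auto simp: S_def)

lemma ideal_sim_sym: assumes "ideal_sim K I J" shows "ideal_sim K J I"
proof -
  obtain h where h: "h \<noteq> 0" "I = (\<lambda>z. h * z) ` J" "\<forall>p\<in>S. place_abs K p h = 1"
    using assms by (auto simp: ideal_sim_def S_def)
  have "J = (\<lambda>z. inverse h * z) ` I" using h by (simp add: image_image flip: mult.assoc)
  moreover have "\<forall>p\<in>S. place_abs K p (inverse h) = 1"
    using h by (simp add: place_abs_eq_1_iff place_val_inverse)
  ultimately show ?thesis using h by (auto simp: ideal_sim_def S_def intro!: exI[of _ "inverse h"])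
qed

lemma ideal_sim_trans: assumes "ideal_sim K I J" "ideal_sim K J L" shows "ideal_sim K I L"
proof -
  obtain h where h: "h \<noteq> 0" "I = (\<lambda>z. h * z) ` J" "\<forall>p\<in>S. place_abs K p h = 1"
    using assms by (auto simp: ideal_sim_def S_def)
  obtain g where g: "g \<noteq> 0" "J = (\<lambda>z. g * z) ` L" "\<forall>p\<in>S. place_abs K p g = 1"
    using assms by (auto simp: ideal_sim_def S_def)
  have "I = (\<lambda>z. (h * g) * z) ` L" using h g by (simp add: image_image mult.assoc)
  thus ?thesis using h g unfolding ideal_sim_def
    by (intro exI[of _ "h * g"]) (auto simp: S_def place_abs_mult)
qed

lemma frac_ideal_scale:
  assumes I: "frac_ideal K I" and h: "h \<noteq> 0"
  shows "frac_ideal K ((\<lambda>z. h * z) ` I)"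
    and "v \<in> V \<Longrightarrow> ideal_exponents K ((\<lambda>z. h * z) ` I) (Nonarch v) = ideal_exponents K I (Nonarch v) + v h"
proof -
  let ?n = "ideal_exponents K I"
  define m where "m p = (case p of Nonarch v \<Rightarrow> if v \<in> V then ?n p + v h else 0 | Arch s \<Rightarrow> 0)" for p
  have n: "finite {p. ?n p \<noteq> 0}" "{p. ?n p \<noteq> 0} \<subseteq> Nonarch ` V" "I = ideal_of (\<lambda>v. ?n (Nonarch v))"
    using frac_idealE[OF I] by auto
  have "p \<in> {p. ?n p \<noteq> 0} \<union> Nonarch ` {v \<in> V. v h \<noteq> 0}" if "m p \<noteq> 0" for p
    using that by (cases p) (auto simp: m_def split: if_splits)
  hence "{p. m p \<noteq> 0} \<subseteq> {p. ?n p \<noteq> 0} \<union> Nonarch ` {v \<in> V. v h \<noteq> 0}" by blast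
  hence m: "finite {p. m p \<noteq> 0}" using n(1) finite_support[of h] by (auto elim: finite_subset)
  have "p \<in> Nonarch ` V" if "m p \<noteq> 0" for p
    using that by (cases p) (auto simp: m_def split: if_splits)
  hence m2: "{p. m p \<noteq> 0} \<subseteq> Nonarch ` V" by blast
  have eq: "(\<lambda>z. h * z) ` I = ideal_of (\<lambda>v. m (Nonarch v))"
    by (subst n(3), subst scale_ideal_of[OF h]) (intro ideal_of_cong, simp add: m_def)
  show "frac_ideal K ((\<lambda>z. h * z) ` I)" unfolding eq by (rule frac_ideal_ideal_of[OF m])
  show "ideal_exponents K ((\<lambda>z. h * z) ` I) (Nonarch v) = ideal_exponents K I (Nonarch v) + v h" if "v \<in> V"
    unfolding eq ideal_exponents_eq[OF m m2] using that by (simp add: m_def)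
qed

text \<open>Eliminates the base ideal: a reduced fractional ideal \<open>I\<close> can serve as its
  own base, and the class of \<open>I\<close> inside \<open>Red K A\<close> is its class among all
  reduced ideals, because similar ideals are multiples of each other.\<close>

lemma Rep_iff:
  "(C, t) \<in> Rep K \<longleftrightarrow> (\<exists>I. minimal_pair I t \<and> set t \<subseteq> coef_group K \<and> C = sim_class I)"
proof
  assume "(C, t) \<in> Rep K"
  then obtain B where B: "frac_ideal K B" "C \<in> Red_classes K B" "length t = nn" "set t \<subseteq> coef_group K"
    "\<exists>I\<in>C. 1 \<in> box K I (t @ [0]) - {0} \<and> (\<forall>h\<in>box K I (t @ [0]) - {0}. elt_le K 1 h)"
    by (auto simp: Rep_def Rep_of_def ideal_group_def nn_def)
  then obtain I where I: "I \<in> C" "1 \<in> box K I (t @ [0]) - {0}" "\<forall>h\<in>box K I (t @ [0]) - {0}. elt_le K 1 h" by blast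
  obtain I0 where I0: "I0 \<in> Red K B" "C = {J \<in> Red K B. ideal_sim K I0 J}"
    using B(2) by (auto simp: Red_classes_def quotient_def)
  have IB: "I \<in> Red K B" "ideal_sim K I0 I" using I(1) I0 by auto
  then obtain \<mu> where \<mu>: "\<mu> \<noteq> 0" "I = (\<lambda>z. inverse \<mu> * z) ` B" by (auto simp: Red_def divide_inverse)
  have fI: "frac_ideal K I" unfolding \<mu>(2) using frac_ideal_scale(1)[OF B(1)] \<mu>(1) by simp
  have "J \<in> Red K B \<longleftrightarrow> reduced K J" if sim: "ideal_sim K I J" for J
  proof -
    obtain h where h: "h \<noteq> 0" "J = (\<lambda>z. h * z) ` I" using ideal_sim_sym[OF sim] by (auto simp: ideal_sim_def)
    have "J = (\<lambda>z. 1 / (\<mu> / h) * z) ` B" unfolding h(2) \<mu>(2) using h \<mu> by (simp add: image_image field_simps)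
    thus ?thesis using h \<mu> by (auto simp: Red_def intro!: exI[of _ "\<mu> / h"])
  qed
  moreover have "ideal_sim K I0 J \<longleftrightarrow> ideal_sim K I J" for J
    using IB(2) ideal_sim_sym ideal_sim_trans by blast
  ultimately have "C = sim_class I" unfolding I0(2) sim_class_def by blast
  moreover have "minimal_pair I t" using minimal_pair_iff[OF fI B(3)] I by blast
  ultimately show "\<exists>I. minimal_pair I t \<and> set t \<subseteq> coef_group K \<and> C = sim_class I" using B(4) by blast
next
  assume "\<exists>I. minimal_pair I t \<and> set t \<subseteq> coef_group K \<and> C = sim_class I"
  then obtain I where I: "minimal_pair I t" "set t \<subseteq> coef_group K" "C = sim_class I" by blast
  have f: "frac_ideal K I" "length t = nn" using I(1) by (auto simp: minimal_pair_def)
  have r: "reduced K I" by (rule minimal_pair_reduced[OF I(1)])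
  have II: "I \<in> Red K I" using r by (auto simp: Red_def intro!: exI[of _ 1])
  have "J \<in> Red K I" if sim: "ideal_sim K I J" and "reduced K J" for J
  proof -
    obtain h where h: "h \<noteq> 0" "J = (\<lambda>z. h * z) ` I" using ideal_sim_sym[OF sim] by (auto simp: ideal_sim_def)
    thus ?thesis using \<open>reduced K J\<close> by (auto simp: Red_def intro!: exI[of _ "1 / h"])
  qed
  hence "sim_class I = {J \<in> Red K I. ideal_sim K I J}" by (auto simp: sim_class_def Red_def)
  hence "C \<in> Red_classes K I" unfolding I(3) Red_classes_def quotient_def using II by auto
  moreover have "I \<in> C" using r ideal_sim_refl by (simp add: I(3) sim_class_def)
  moreover have "1 \<in> box K I (t @ [0]) - {0} \<and> (\<forall>h\<in>box K I (t @ [0]) - {0}. elt_le K 1 h)"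
    using minimal_pair_iff[OF f] I(1) by blast
  ultimately have "(C, t) \<in> Rep_of K I" unfolding Rep_of_def using f(2) I(2) by (auto simp: nn_def)
  thus "(C, t) \<in> Rep K" unfolding Rep_def using f(1) by (auto simp: ideal_group_def)
qed

lemma sim_class_eq: "ideal_sim K I J \<Longrightarrow> sim_class I = sim_class J"
  unfolding sim_class_def using ideal_sim_sym ideal_sim_trans by blast

subsection \<open>Injectivity and surjectivity up to principal divisors\<close>

definition pair_div where
  "pair_div I t = (\<lambda>p. ideal_div K I p + (\<Sum>i<nn. t ! i * prime_div (pp i) p))"

lemma sum_prime_div:
  shows "i < nn \<Longrightarrow> (\<Sum>j<nn. t ! j * prime_div (pp j) (pp i)) = t ! i"
    and "p \<notin> S - {pl} \<Longrightarrow> (\<Sum>j<nn. t ! j * prime_div (pp j) p) = 0"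
proof -
  assume i: "i < nn"
  have "(\<Sum>j<nn. t ! j * prime_div (pp j) (pp i)) = (\<Sum>j<nn. if j = i then t ! j else 0)"
    using i by (intro sum.cong) (auto simp: prime_div_def pp_inj)
  thus "(\<Sum>j<nn. t ! j * prime_div (pp j) (pp i)) = t ! i" using i by simp
next
  assume "p \<notin> S - {pl}"
  hence "p \<noteq> pp j" if "j < nn" for j using pp_in_S[of j] pp_ne_pl[of j] that by auto
  thus "(\<Sum>j<nn. t ! j * prime_div (pp j) p) = 0" by (intro sum.neutral) (auto simp: prime_div_def)
qed

lemma ideal_div_S:
  assumes "frac_ideal K I" "p \<notin> Nonarch ` V" shows "ideal_div K I p = 0"
proof -
  from frac_idealE[OF assms(1)] have "{p. ideal_exponents K I p \<noteq> 0} \<subseteq> Nonarch ` V" by blast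
  thus ?thesis using assms(2) by (auto simp: ideal_div_def)
qed

lemma pair_div_values:
  assumes "frac_ideal K I"
  shows "v \<in> V \<Longrightarrow> pair_div I t (Nonarch v) = - real_of_int (ideal_exponents K I (Nonarch v))"
    and "i < nn \<Longrightarrow> pair_div I t (pp i) = t ! i"
    and "pair_div I t pl = 0"
    and "p \<notin> all_places K \<Longrightarrow> pair_div I t p = 0"
proof -
  have nS: "p \<notin> Nonarch ` V" if "p \<in> S" for p using that finite_places_disjoint by blast
  show "pair_div I t (Nonarch v) = - real_of_int (ideal_exponents K I (Nonarch v))" if "v \<in> V"
    using sum_prime_div(2)[of "Nonarch v" t] finite_places_disjoint[OF that] by (simp add: pair_div_def ideal_div_def)
  show "pair_div I t (pp i) = t ! i" if "i < nn"
    using sum_prime_div(1)[OF that] ideal_div_S[OF assms nS[OF pp_in_S]] that by (simp add: pair_div_def)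
  show "pair_div I t pl = 0"
    using sum_prime_div(2)[of pl t] ideal_div_S[OF assms nS[OF pl_in_S]] by (simp add: pair_div_def)
  show "pair_div I t p = 0" if "p \<notin> all_places K"
    using sum_prime_div(2)[of p t] ideal_div_S[OF assms] that unfolding all_places_eq by (simp add: pair_div_def)
qed

text \<open>Equality of the divisors away from \<open>pl\<close> means \<open>J = h * I\<close> and
  \<open>t_i - s_i = v_i(h)\<close>. Hence \<open>h\<close> is in \<open>J\<close> and
  \<open>1/h\<close> is in \<open>I\<close>, and by nonnegativity of \<open>t\<close> and
  \<open>s\<close> they respect the bounds of \<open>s\<close> and \<open>t\<close> at the first
  \<open>nn\<close> places. Depending on the sign of the valuation of \<open>h\<close> at
  \<open>pl\<close>, minimality of \<open>1\<close> applies to \<open>h\<close> or to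
  \<open>1/h\<close>.\<close>

lemma minimal_pair_unique:
  assumes m: "minimal_pair I t" "minimal_pair J s" and h: "h \<noteq> 0"
    and eq: "\<And>p. p \<in> all_places K - {pl} \<Longrightarrow> pair_div I t p - pair_div J s p = place_val p h"
  shows "t = s" "sim_class I = sim_class J"
proof -
  have f: "frac_ideal K I" "frac_ideal K J" "length t = nn" "length s = nn" "1 \<in> I" "1 \<in> J"
    using m by (auto simp: minimal_pair_def)
  have fin: "ideal_exponents K J (Nonarch v) = ideal_exponents K I (Nonarch v) + v h" if "v \<in> V" for v
  proof -
    have "Nonarch v \<in> all_places K - {pl}" using that finite_places_disjoint[OF that] pl_in_S by (auto simp: all_places_eq)
    from eq[OF this] have "real_of_int (ideal_exponents K J (Nonarch v)) = real_of_int (ideal_exponents K I (Nonarch v) + v h)"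
      using f that by (simp add: pair_div_values)
    thus ?thesis by (simp only: of_int_eq_iff)
  qed
  have ts: "t ! i - s ! i = place_val (pp i) h" if "i < nn" for i
    using eq[of "pp i"] that pp_in_S pp_ne_pl f by (simp add: all_places_eq pair_div_values)
  have I: "I = ideal_of (\<lambda>v. ideal_exponents K I (Nonarch v))" using frac_idealE[OF f(1)] by blast
  have J: "J = ideal_of (\<lambda>v. ideal_exponents K J (Nonarch v))" using frac_idealE[OF f(2)] by blast
  have JhI: "J = (\<lambda>z. h * z) ` I"
    by (subst I, subst scale_ideal_of[OF h], subst J) (rule ideal_of_cong, simp add: fin)
  have hJ: "h \<in> J" using f(5) unfolding JhI by (auto intro!: image_eqI[of _ _ 1])
  have hI: "inverse h \<in> I" using f(6) h unfolding JhI by (auto simp: inverse_unique)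
  have t0: "0 \<le> t ! i" "0 \<le> s ! i" if "i < nn" for i using m that by (auto simp: minimal_pair_def)
  have 1: "elt_le K 1 h" if "0 \<le> place_val pl h"
  proof -
    have "- (s ! i) \<le> place_val (pp i) h" if "i < nn" for i using ts[OF that] t0[OF that] by linarith
    thus ?thesis using m(2) hJ h that unfolding minimal_pair_def by blast
  qed
  have 2: "elt_le K 1 (inverse h)" if "place_val pl h \<le> 0"
  proof -
    have "- (t ! i) \<le> place_val (pp i) (inverse h)" if "i < nn" for i
      using ts[OF that] t0[OF that] place_val_inverse[OF pp_in_S h, of i] that by simp
    moreover have "0 \<le> place_val pl (inverse h)" using that place_val_inverse[OF pl_in_S h] by simp
    moreover have "inverse h \<noteq> 0" using h by simp
    ultimately show ?thesis using m(1) hI unfolding minimal_pair_def by blast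
  qed
  \<comment> \<open>Since \<open>pl\<close> is compared first, \<open>1 \<le> h\<close> rules out a
    positive valuation at \<open>pl\<close>; the symmetric argument for \<open>1/h\<close> rules out
    a negative one. With valuation \<open>0\<close> at \<open>pl\<close>, both minimality statements
    become available.\<close>
  have "place_val pl h \<le> 0" using 1 elt_le_1_imp[OF h] by linarith
  moreover have "0 \<le> place_val pl h"
    using 2 elt_le_1_imp[of "inverse h"] h place_val_inverse[OF pl_in_S h] by fastforce
  ultimately have "elt_le K 1 h" "elt_le K 1 (inverse h)" using 1 2 by auto
  hence v0: "place_val p h = 0" if "p \<in> S" for p using elt_le_1_inverse[OF h] that by blast
  show "t = s" using f ts v0 pp_in_S by (intro nth_equalityI) auto
  have "ideal_sim K J I" unfolding ideal_sim_def
    using h JhI v0 place_abs_eq_1_iff by (intro exI[of _ h]) (auto simp: S_def)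
  thus "sim_class I = sim_class J" using sim_class_eq by metis
qed

text \<open>There is no bound at \<open>pl\<close>, so finiteness is lacking at first. Any
  admissible \<open>h0\<close> provides one: an element with smaller valuation than
  \<open>h0\<close> at \<open>pl\<close> is larger than \<open>h0\<close> in the order, since
  \<open>pl\<close> is compared first. Among the rest only finitely many keys occur.\<close>

lemma exists_smallest:
  assumes I: "frac_ideal K I"
  obtains \<mu> where "\<mu> \<in> I" "\<mu> \<noteq> 0" "\<And>i. i < nn \<Longrightarrow> C (pp i) \<le> place_val (pp i) \<mu>"
    "\<And>h. h \<in> I \<Longrightarrow> h \<noteq> 0 \<Longrightarrow> (\<And>i. i < nn \<Longrightarrow> C (pp i) \<le> place_val (pp i) h) \<Longrightarrow> elt_le K \<mu> h"
proof -
  obtain h0 where h0: "h0 \<in> I" "h0 \<noteq> 0" "\<And>p. p \<in> S - {pl} \<Longrightarrow> C p \<le> place_val p h0"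
    using exists_small[OF I, of C] by (auto simp: S_def pl_def)
  define D where "D p = (if p = pl then place_val pl h0 else C p)" for p
  define H where "H = {h \<in> I - {0}. \<forall>p\<in>S. D p \<le> place_val p h}"
  have "finite ((\<lambda>h. map (\<lambda>p. place_val p h) (inf_places K)) ` H)"
    unfolding H_def S_def by (rule finite_values[OF I])
  \<comment> \<open>\<open>F\<close> recomputes the key from the vector of valuations, with the last
    entry moved to the front, so that finiteness of the vectors of valuations passes to the
    keys.\<close>
  moreover define F where "F l = map (\<lambda>(p, x). abs_base K powr (- x * place_deg K p)) ((pl, last l) # zip (butlast (inf_places K)) (butlast l))" for l
  have "key h = F (map (\<lambda>p. place_val p h) (inf_places K))" if "h \<in> H" for h
    using that places_nonempty
    by (cases "inf_places K" rule: rev_cases) (auto simp: key_def F_def H_def place_abs_def pl_def zip_map2 zip_same_conv_map)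
  hence "key ` H = F ` (\<lambda>h. map (\<lambda>p. place_val p h) (inf_places K)) ` H"
    unfolding image_image by (intro image_cong) auto
  ultimately have "finite (key ` H)" by simp
  moreover have h0H: "h0 \<in> H" using h0 by (auto simp: H_def D_def)
  ultimately obtain x where x: "x \<in> key ` H" "\<And>y. y \<in> key ` H \<Longrightarrow> lexordp_eq x y"
    using lexordp_eq_finite_min[of "key ` H"] by blast
  then obtain \<mu> where \<mu>: "\<mu> \<in> H" "\<And>h. h \<in> H \<Longrightarrow> elt_le K \<mu> h" by (auto simp: elt_le_key)
  show thesis
  proof (rule that[of \<mu>])
    show "\<mu> \<in> I" "\<mu> \<noteq> 0" using \<mu>(1) by (auto simp: H_def)
    show "C (pp i) \<le> place_val (pp i) \<mu>" if "i < nn" for i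
      using \<mu>(1) pp_in_S[of i] pp_ne_pl[OF that] that by (auto simp: H_def D_def)
    fix h assume h: "h \<in> I" "h \<noteq> 0" "\<And>i. i < nn \<Longrightarrow> C (pp i) \<le> place_val (pp i) h"
    show "elt_le K \<mu> h"
    proof (cases "place_val pl h0 \<le> place_val pl h")
      case True
      have "D p \<le> place_val p h" if "p \<in> S" for p using S_cases[OF that] h(3) True by (auto simp: D_def pp_ne_pl)
      hence "h \<in> H" using h by (auto simp: H_def)
      thus ?thesis by (rule \<mu>(2))
    next
      case False
      hence "- place_val pl h0 * place_deg K pl < - place_val pl h * place_deg K pl"
        using place_deg_pos[of pl] pl_in_S by (simp add: S_def)
      hence "place_abs K pl h0 < place_abs K pl h" using h(2) h0(2) base_gt_1 by (simp add: place_abs_def)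
      hence "elt_le K h0 h" unfolding elt_le_key by (simp add: key_def)
      thus ?thesis using \<mu>(2)[OF h0H] lexordp_eq_trans unfolding elt_le_key by blast
    qed
  qed
qed

text \<open>Let \<open>B\<close> be the ideal with divisor \<open>E\<close> at the finite places and
  \<mu> a smallest element of \<open>B\<close> with valuation at least \<open>- E\<close> at the
  first \<open>nn\<close> infinite places. Division by \<mu> turns it into \<open>1\<close>: the
  pair is \<open>I = B / \<mu>\<close> with \<open>t_i = E p_i + v_i(\<mu>)\<close>.\<close>

lemma pair_div_surj:
  assumes E: "E \<in> carrier (Div K)"
  obtains I t \<mu> where "minimal_pair I t" "set t \<subseteq> coef_group K" "\<mu> \<noteq> 0"
    "\<And>p. p \<in> all_places K - {pl} \<Longrightarrow> pair_div I t p = E p + place_val p \<mu>"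
proof -
  have E: "finite {p. E p \<noteq> 0}" "{p. E p \<noteq> 0} \<subseteq> all_places K" "\<And>p. p \<in> S \<Longrightarrow> E p \<in> coef_group K" "\<And>p. p \<notin> S \<Longrightarrow> E p \<in> \<int>"
    using E by (auto simp: Div_def S_def split: if_splits)
  \<comment> \<open>At finite places \<open>E p\<close> is an integer; the floor only changes the
    type.\<close>
  define n where "n p = (if p \<in> Nonarch ` V then - \<lfloor>E p\<rfloor> else 0)" for p
  have "{p. n p \<noteq> 0} \<subseteq> {p. E p \<noteq> 0}" by (auto simp: n_def)
  hence n: "finite {p. n p \<noteq> 0}" "{p. n p \<noteq> 0} \<subseteq> Nonarch ` V" using E(1) by (auto simp: n_def elim: finite_subset[rotated])
  define B where "B = ideal_of (\<lambda>v. n (Nonarch v))"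
  have B: "frac_ideal K B" "ideal_exponents K B = n" using frac_ideal_ideal_of[OF n(1)] ideal_exponents_eq[OF n] by (auto simp: B_def)
  have nE: "real_of_int (n (Nonarch v)) = - E (Nonarch v)" if "v \<in> V" for v
    using E(4)[of "Nonarch v"] finite_places_disjoint[OF that] that by (auto simp: n_def elim: Ints_cases)
  obtain \<mu> where \<mu>: "\<mu> \<in> B" "\<mu> \<noteq> 0" "\<And>i. i < nn \<Longrightarrow> - E (pp i) \<le> place_val (pp i) \<mu>"
    "\<And>h. h \<in> B \<Longrightarrow> h \<noteq> 0 \<Longrightarrow> (\<And>i. i < nn \<Longrightarrow> - E (pp i) \<le> place_val (pp i) h) \<Longrightarrow> elt_le K \<mu> h"
    using exists_smallest[OF B(1), of "\<lambda>p. - E p"] by blast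
  define I where "I = (\<lambda>z. inverse \<mu> * z) ` B"
  define t where "t = map (\<lambda>i. E (pp i) + place_val (pp i) \<mu>) [0..<nn]"
  have \<mu>': "inverse \<mu> \<noteq> 0" using \<mu> by simp
  have I: "frac_ideal K I" and eI: "\<And>v. v \<in> V \<Longrightarrow> ideal_exponents K I (Nonarch v) = n (Nonarch v) - v \<mu>"
    unfolding I_def using frac_ideal_scale[OF B(1) \<mu>'] B(2) by (auto simp: nv_inverse V_nv)
  have t: "length t = nn" "\<And>i. i < nn \<Longrightarrow> t ! i = E (pp i) + place_val (pp i) \<mu>" by (auto simp: t_def)
  show thesis
  proof (rule that[of I t \<mu>])
    show "\<mu> \<noteq> 0" by (rule \<mu>)
    show "set t \<subseteq> coef_group K"
      using E(3) place_val_coef coef_group_ops \<mu>(2) pp_in_S by (auto simp: t_def S_def)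
    show "minimal_pair I t" unfolding minimal_pair_def
    proof (intro conjI ballI impI allI)
      show "1 \<in> I" using \<mu>(1,2) by (auto simp: I_def intro!: image_eqI[of _ _ \<mu>])
      show "0 \<le> t ! i" if "i < nn" for i using t(2)[OF that] \<mu>(3)[OF that] by simp
      fix h assume h: "h \<in> I - {0}" "\<forall>i<nn. - (t ! i) \<le> place_val (pp i) h"
      then obtain g where g: "g \<in> B" "h = inverse \<mu> * g" "g \<noteq> 0" by (auto simp: I_def)
      have gh: "g = \<mu> * h" using g \<mu>(2) by simp
      have "- E (pp i) \<le> place_val (pp i) g" if "i < nn" for i
        using h t(2)[OF that] that place_val_mult[of "pp i" \<mu> h] pp_in_S[of i] \<mu>(2) unfolding gh
        by (fastforce simp: S_def)
      hence "elt_le K (\<mu> * 1) (\<mu> * h)" using \<mu>(4)[OF g(1,3)] gh by simp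
      thus "elt_le K 1 h" using elt_le_scale[of \<mu> 1 h] \<mu>(2) h by simp
    qed (use I t in auto)
    fix p assume p: "p \<in> all_places K - {pl}"
    show "pair_div I t p = E p + place_val p \<mu>"
    proof (cases "p \<in> S")
      case True
      then obtain i where "i < nn" "p = pp i" using S_cases p by blast
      thus ?thesis using t pair_div_values(2)[OF I] by simp
    next
      case False
      then obtain v where "v \<in> V" "p = Nonarch v" using p by (auto simp: all_places_eq)
      thus ?thesis using pair_div_values(1)[OF I, of v t] eI[of v] nE[of v] by simp
    qed
  qed
qed

end

section \<open>Degrees, the divisor group and equality of divisor classes\<close>

lemma div_deg_eq_sum:
  assumes "finite T" "\<And>p. D p \<noteq> 0 \<Longrightarrow> p \<in> T"
  shows "div_deg K D = (\<Sum>p\<in>T. D p * place_deg K p)"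
  unfolding div_deg_def using assms by (intro sum.mono_neutral_left) auto

lemma div_deg_add:
  assumes "finite {p. D p \<noteq> 0}" "finite {p. E p \<noteq> 0}"
  shows "div_deg K (\<lambda>p. D p + E p) = div_deg K D + div_deg K E"
proof -
  let ?T = "{p. D p \<noteq> 0} \<union> {p. E p \<noteq> 0}"
  have "finite ?T" using assms by simp
  note * = div_deg_eq_sum[OF this]
  have "div_deg K (\<lambda>p. D p + E p) = (\<Sum>p\<in>?T. (D p + E p) * place_deg K p)" by (rule *) auto
  moreover have "div_deg K D = (\<Sum>p\<in>?T. D p * place_deg K p)" by (rule *) auto
  moreover have "div_deg K E = (\<Sum>p\<in>?T. E p * place_deg K p)" by (rule *) auto
  ultimately show ?thesis by (simp add: distrib_right sum.distrib)
qed

lemma div_deg_scaled_prime: "div_deg K (\<lambda>p. c * prime_div q p) = c * place_deg K q"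
  by (subst div_deg_eq_sum[of "{q}"]) (auto simp: prime_div_def split: if_splits)

lemma finite_supp_sum_prime_div: "finite {p. (\<Sum>i<(n::nat). t i * prime_div (f i) p) \<noteq> 0}"
proof (rule finite_subset)
  show "{p. (\<Sum>i<n. t i * prime_div (f i) p) \<noteq> 0} \<subseteq> f ` {..<n}"
  proof
    fix p assume "p \<in> {p. (\<Sum>i<n. t i * prime_div (f i) p) \<noteq> 0}"
    then obtain i where "i < n" "t i * prime_div (f i) p \<noteq> 0"
      by (metis (mono_tags, lifting) lessThan_iff mem_Collect_eq sum.neutral)
    thus "p \<in> f ` {..<n}" by (auto simp: prime_div_def split: if_splits)
  qed
qed simp

lemma div_deg_sum_prime_div:
  "div_deg K (\<lambda>p. \<Sum>i<(n::nat). t i * prime_div (f i) p) = (\<Sum>i<n. t i * place_deg K (f i))"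
proof (induction n)
  case (Suc n)
  have "finite {p. t n * prime_div (f n) p \<noteq> 0}" by (rule finite_subset[of _ "{f n}"]) (auto simp: prime_div_def)
  from div_deg_add[OF finite_supp_sum_prime_div this, of K]
  show ?case using Suc by (simp add: div_deg_scaled_prime)
qed (simp add: div_deg_def)

context class_setting
begin

lemma Div_simps:
  "D \<in> carrier (Div K) \<longleftrightarrow> finite {p. D p \<noteq> 0} \<and> {p. D p \<noteq> 0} \<subseteq> all_places K \<and> (\<forall>p\<in>S. D p \<in> coef_group K) \<and> (\<forall>p. p \<notin> S \<longrightarrow> D p \<in> \<int>)"
  "D \<otimes>\<^bsub>Div K\<^esub> E = (\<lambda>p. D p + E p)" "\<one>\<^bsub>Div K\<^esub> = (\<lambda>p. 0)"
  by (auto simp: Div_def S_def split: if_splits)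

lemma Div_add:
  assumes "D \<in> carrier (Div K)" "E \<in> carrier (Div K)" shows "(\<lambda>p. D p + E p) \<in> carrier (Div K)"
proof -
  have sub: "{p. D p + E p \<noteq> 0} \<subseteq> {p. D p \<noteq> 0} \<union> {p. E p \<noteq> 0}" by auto
  have "finite ({p. D p \<noteq> 0} \<union> {p. E p \<noteq> 0})" using assms by (simp add: Div_simps)
  hence "finite {p. D p + E p \<noteq> 0}" using sub by (rule rev_finite_subset)
  moreover have "{p. D p + E p \<noteq> 0} \<subseteq> all_places K" using sub assms unfolding Div_simps(1) by blast
  ultimately show ?thesis using assms coef_group_ops(3) by (auto simp: Div_simps(1))
qed

lemma Div_uminus:
  assumes "D \<in> carrier (Div K)" shows "(\<lambda>p. - D p) \<in> carrier (Div K)"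
  using assms coef_group_ops(4) by (auto simp: Div_simps)

lemma Div_scaled_prime_int:
  assumes "p \<in> all_places K" shows "(\<lambda>r. of_int m * prime_div p r) \<in> carrier (Div K)"
proof -
  have n: "of_nat j \<in> coef_group K" for j
    by (induction j) (auto intro: coef_group_ops)
  have m: "of_int m \<in> coef_group K"
  proof (cases m)
    case (nonneg j)
    thus ?thesis using n[of j] by simp
  next
    case (neg j)
    thus ?thesis using coef_group_ops(4)[OF n[of "Suc j"]] by (simp del: of_nat_Suc)
  qed
  have "{r. of_int m * prime_div p r \<noteq> 0} \<subseteq> {p}" by (auto simp: prime_div_def)
  moreover from this have "finite {r. of_int m * prime_div p r \<noteq> 0}" by (rule finite_subset) simp
  ultimately show ?thesis using assms coef_group_ops(1) m unfolding Div_simps(1) by (auto simp: prime_div_def)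
qed

lemma comm_group_Div: "comm_group (Div K)"
proof (rule comm_groupI)
  show "\<one>\<^bsub>Div K\<^esub> \<in> carrier (Div K)" using coef_group_ops by (auto simp: Div_simps)
  fix D assume D: "D \<in> carrier (Div K)"
  show "\<exists>E\<in>carrier (Div K). E \<otimes>\<^bsub>Div K\<^esub> D = \<one>\<^bsub>Div K\<^esub>"
    using Div_uminus[OF D] by (intro bexI[of _ "\<lambda>p. - D p"]) (auto simp: Div_simps(2,3))
qed (use Div_add in \<open>auto simp: Div_simps(2,3) add.assoc add.commute\<close>)

lemma Div_inv: assumes D: "D \<in> carrier (Div K)" shows "inv\<^bsub>Div K\<^esub> D = (\<lambda>p. - D p)"
proof -
  interpret comm_group "Div K" by (rule comm_group_Div)
  show ?thesis using D Div_uminus[OF D] by (intro inv_equality) (auto simp: Div_simps(2,3))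
qed

lemma principal_div_in_Div:
  assumes f: "f \<noteq> 0" shows "principal_div K f \<in> carrier (Div K)"
proof -
  have "{p. principal_div K f p \<noteq> 0} \<subseteq> Nonarch ` {v \<in> V. v f \<noteq> 0} \<union> S"
    by (auto simp: principal_div_def all_places_eq)
  hence "finite {p. principal_div K f p \<noteq> 0}"
    by (rule finite_subset) (use finite_support[of f] in \<open>auto simp: S_def\<close>)
  thus ?thesis using place_val_coef[OF _ f] coef_group_ops(1)
    by (auto simp: Div_simps principal_div_def all_places_eq S_def)
qed

lemma subgroup_Princ: "subgroup (Princ K) (Div K)"
proof -
  interpret comm_group "Div K" by (rule comm_group_Div)
  show ?thesis
  proof (rule subgroupI)
    show "Princ K \<subseteq> carrier (Div K)" using principal_div_in_Div by (auto simp: Princ_def)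
    have "principal_div K 1 \<in> Princ K" by (simp add: Princ_def)
    thus "Princ K \<noteq> {}" by blast
    fix a assume "a \<in> Princ K"
    then obtain f where f: "f \<noteq> 0" "a = principal_div K f" by (auto simp: Princ_def)
    have "inv\<^bsub>Div K\<^esub> a = principal_div K (inverse f)"
      using f Div_inv[OF principal_div_in_Div[OF f(1)]] place_val_inverse_all by (auto simp: principal_div_def)
    thus "inv\<^bsub>Div K\<^esub> a \<in> Princ K" using f by (auto simp: Princ_def)
    fix b assume "b \<in> Princ K"
    then obtain g where g: "g \<noteq> 0" "b = principal_div K g" by (auto simp: Princ_def)
    have "a \<otimes>\<^bsub>Div K\<^esub> b = principal_div K (f * g)"
      using f g place_val_mult_all by (auto simp: principal_div_def Div_simps(2))
    thus "a \<otimes>\<^bsub>Div K\<^esub> b \<in> Princ K" using f g by (auto simp: Princ_def)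
  qed
qed

lemma in_Princ_iff:
  assumes D: "D \<in> carrier (Div K)"
  shows "D \<in> Princ K \<longleftrightarrow> (\<exists>f. f \<noteq> 0 \<and> (\<forall>p\<in>all_places K. D p = place_val p f))"
proof -
  have "D = principal_div K f \<longleftrightarrow> (\<forall>p\<in>all_places K. D p = place_val p f)" for f
  proof -
    have "D p = 0" if "p \<notin> all_places K" for p using D that by (auto simp: Div_simps)
    thus ?thesis by (auto simp: principal_div_def fun_eq_iff)
  qed
  thus ?thesis unfolding Princ_def image_iff Bex_def by auto
qed

lemma div_class_eq_iff:
  assumes D: "D \<in> carrier (Div K)" and E: "E \<in> carrier (Div K)"
  shows "div_class K D = div_class K E \<longleftrightarrow> (\<exists>f. f \<noteq> 0 \<and> (\<forall>p\<in>all_places K. E p - D p = place_val p f))"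
proof -
  interpret comm_group "Div K" by (rule comm_group_Div)
  have "(\<lambda>p. E p + - D p) \<in> carrier (Div K)" by (rule Div_add[OF E Div_uminus[OF D]])
  thus ?thesis unfolding div_class_def coset_eq_iff[OF subgroup_Princ D E]
    using in_Princ_iff[of "\<lambda>p. E p + - D p"] by (simp add: Div_inv[OF D] Div_simps(2))
qed

lemma pair_div_in_Div:
  assumes I: "frac_ideal K I" and t: "length t = nn" "set t \<subseteq> coef_group K"
  shows "pair_div I t \<in> carrier (Div K)"
proof -
  have "finite {p. ideal_div K I p \<noteq> 0}"
    using frac_idealE[OF I] by (auto simp: ideal_div_def)
  hence "finite ({p. ideal_div K I p \<noteq> 0} \<union> {p. (\<Sum>i<nn. t ! i * prime_div (pp i) p) \<noteq> 0})"
    using finite_supp_sum_prime_div[of "\<lambda>i. t ! i" pp nn] by simp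
  moreover have "{p. pair_div I t p \<noteq> 0} \<subseteq> {p. ideal_div K I p \<noteq> 0} \<union> {p. (\<Sum>i<nn. t ! i * prime_div (pp i) p) \<noteq> 0}"
    by (auto simp: pair_div_def)
  ultimately have "finite {p. pair_div I t p \<noteq> 0}" by (rule rev_finite_subset)
  moreover have "pair_div I t p \<in> coef_group K" if "p \<in> S" for p
    using S_cases[OF that] pair_div_values(2,3)[OF I] t coef_group_ops(1) by auto
  moreover have "pair_div I t p \<in> \<int>" if "p \<notin> S" for p
    using sum_prime_div(2)[of p t] that by (simp add: pair_div_def ideal_div_def)
  moreover have "{p. pair_div I t p \<noteq> 0} \<subseteq> all_places K" using pair_div_values(4)[OF I] by blast
  ultimately show ?thesis by (simp add: Div_simps(1))
qed

text \<open>Shows that the values of \<Phi> do not depend on the representative: passing to a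
  similar ideal changes the divisor by a principal one whose coefficients on \<open>S\<close>
  vanish.\<close>

lemma pair_div_sim:
  assumes m: "minimal_pair I t" and J: "J \<in> sim_class I"
  obtains h where "h \<noteq> 0" "frac_ideal K J"
    "\<And>p. p \<in> all_places K \<Longrightarrow> pair_div J t p - pair_div I t p = place_val p h"
proof -
  have I: "frac_ideal K I" using m by (simp add: minimal_pair_def)
  have "ideal_sim K J I" using J ideal_sim_sym by (simp add: sim_class_def)
  then obtain g where g: "g \<noteq> 0" "J = (\<lambda>z. g * z) ` I" "\<forall>p\<in>S. place_abs K p g = 1"
    by (auto simp: ideal_sim_def S_def)
  have fJ: "frac_ideal K J" unfolding g(2) by (rule frac_ideal_scale(1)[OF I g(1)])
  have vg: "place_val p g = 0" if "p \<in> S" for p using g place_abs_eq_1_iff that by simp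
  show thesis
  proof (rule that[of "inverse g"])
    show "frac_ideal K J" by (rule fJ)
    fix p assume p: "p \<in> all_places K"
    show "pair_div J t p - pair_div I t p = place_val p (inverse g)"
    proof (cases "p \<in> S")
      case True
      thus ?thesis using S_cases[OF True] pair_div_values(2,3)[OF I] pair_div_values(2,3)[OF fJ] vg g(1)
        by (auto simp: place_val_inverse)
    next
      case False
      then obtain v where v: "v \<in> V" "p = Nonarch v" using p by (auto simp: all_places_eq)
      have "ideal_exponents K J (Nonarch v) = ideal_exponents K I (Nonarch v) + v g"
        unfolding g(2) by (rule frac_ideal_scale(2)[OF I g(1) v(1)])
      thus ?thesis using v g(1)
        by (simp add: pair_div_values(1)[OF I] pair_div_values(1)[OF fJ] nv_inverse V_nv)
    qed
  qed (use g in simp)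
qed

lemma self_in_sim_class: "minimal_pair I t \<Longrightarrow> I \<in> sim_class I"
  using minimal_pair_reduced ideal_sim_refl by (simp add: sim_class_def)

end

section \<open>Number fields: the bijection onto classes of degree zero\<close>

locale nf_setting = class_setting +
  assumes coef_UNIV: "coef_group K = UNIV"
    and product_formula: "f \<noteq> 0 \<Longrightarrow> div_deg K (principal_div K f) = 0"
begin

definition pair_div0 where
  "pair_div0 I t = (\<lambda>p. pair_div I t p - div_deg K (pair_div I t) / place_deg K pl * prime_div pl p)"

lemma nf_value_eq:
  assumes "frac_ideal K I" shows "nf_value K I t = div_class K (pair_div0 I t)"
proof -
  have "finite {p. ideal_div K I p \<noteq> 0}"
    using frac_idealE[OF assms] by (auto simp: ideal_div_def)
  from div_deg_add[OF this finite_supp_sum_prime_div, of K "\<lambda>i. t ! i" pp nn]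
  have "div_deg K (pair_div I t) = div_deg K (ideal_div K I) + (\<Sum>i<nn. t ! i * place_deg K (pp i))"
    by (simp add: pair_div_def[abs_def] div_deg_sum_prime_div)
  thus ?thesis unfolding nf_value_def pair_div0_def Let_def by (simp add: pair_div_def pp_def nn_def pl_def)
qed

lemma Div_scaled_prime: "(\<lambda>r. c * prime_div pl r) \<in> carrier (Div K)"
proof -
  have "{r. c * prime_div pl r \<noteq> 0} \<subseteq> {pl}" by (auto simp: prime_div_def)
  moreover from this have "finite {r. c * prime_div pl r \<noteq> 0}" by (rule finite_subset) simp
  ultimately show ?thesis using pl_in_S unfolding Div_simps(1) by (auto simp: prime_div_def coef_UNIV all_places_eq)
qed

lemma pair_div_in_Div': "frac_ideal K I \<Longrightarrow> length t = nn \<Longrightarrow> pair_div I t \<in> carrier (Div K)"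
  by (rule pair_div_in_Div) (auto simp: coef_UNIV)

lemma pair_div0_in_Div:
  assumes "frac_ideal K I" "length t = nn"
  shows "pair_div0 I t \<in> carrier (Div K)"
  using Div_add[OF pair_div_in_Div'[OF assms] Div_scaled_prime, of "- (div_deg K (pair_div I t) / place_deg K pl)"]
  by (simp add: pair_div0_def)

lemma div_deg_add_pl:
  assumes "D \<in> carrier (Div K)"
  shows "div_deg K (\<lambda>p. D p + c * prime_div pl p) = div_deg K D + c * place_deg K pl"
  using assms Div_scaled_prime[of c] by (subst div_deg_add) (simp_all add: Div_simps(1) div_deg_scaled_prime)

lemma div_deg_pair_div0:
  assumes "frac_ideal K I" "length t = nn"
  shows "div_deg K (pair_div0 I t) = 0"
  using div_deg_add_pl[OF pair_div_in_Div'[OF assms], of "- (div_deg K (pair_div I t) / place_deg K pl)"]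
    place_deg_pos[of pl] pl_in_S by (simp add: pair_div0_def S_def)

lemma div_deg_translate:
  assumes D: "D \<in> carrier (Div K)" and f: "f \<noteq> 0" and eq: "\<And>p. p \<in> all_places K \<Longrightarrow> E p = D p + place_val p f"
    and E: "E \<in> carrier (Div K)"
  shows "div_deg K E = div_deg K D"
proof -
  have "E p = D p + principal_div K f p" for p
  proof (cases "p \<in> all_places K")
    case False
    hence "E p = 0" "D p = 0" using D E by (auto simp: Div_simps)
    thus ?thesis using False by (simp add: principal_div_def)
  qed (simp add: eq principal_div_def)
  hence "E = (\<lambda>p. D p + principal_div K f p)" by blast
  thus ?thesis using div_deg_add[of D "principal_div K f" K] D principal_div_in_Div[OF f] product_formula[OF f]
    by (simp add: Div_simps(1))
qed

lemma nf_value_sim: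
  assumes m: "minimal_pair I t" and J: "J \<in> sim_class I"
  shows "nf_value K J t = nf_value K I t"
proof -
  have I: "frac_ideal K I" "length t = nn" using m by (auto simp: minimal_pair_def)
  obtain h where h: "h \<noteq> 0" "frac_ideal K J" "\<And>p. p \<in> all_places K \<Longrightarrow> pair_div J t p - pair_div I t p = place_val p h"
    using pair_div_sim[OF m J] by metis
  have "div_deg K (pair_div J t) = div_deg K (pair_div I t)"
    by (rule div_deg_translate[OF pair_div_in_Div'[OF I] h(1) _ pair_div_in_Div'[OF h(2) I(2)]])
      (simp add: algebra_simps flip: h(3))
  hence "\<forall>p\<in>all_places K. pair_div0 J t p - pair_div0 I t p = place_val p h" using h(3) by (simp add: pair_div0_def)
  hence "div_class K (pair_div0 I t) = div_class K (pair_div0 J t)"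
    using div_class_eq_iff[OF pair_div0_in_Div[OF I] pair_div0_in_Div[OF h(2) I(2)]] h(1) by blast
  thus ?thesis using nf_value_eq I h by simp
qed

lemma Phi_nf_eq:
  assumes m: "minimal_pair I t" and J: "J \<in> sim_class I"
  shows "Phi_nf K (sim_class I, t) = nf_value K J t"
proof -
  have "(\<lambda>I. nf_value K I t) ` sim_class I = {nf_value K J t}"
    using nf_value_sim[OF m] nf_value_sim[OF m J] J by auto
  thus ?thesis by (simp add: Phi_nf_def)
qed

theorem nf_bijection:
  "(C, t) \<in> Rep K \<Longrightarrow> I \<in> C \<Longrightarrow> Phi_nf K (C, t) = nf_value K I t"
  "bij_betw (Phi_nf K) (Rep K) (Pic0 K)"
proof -
  show "(C, t) \<in> Rep K \<Longrightarrow> I \<in> C \<Longrightarrow> Phi_nf K (C, t) = nf_value K I t"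
    using Phi_nf_eq by (auto simp: Rep_iff)
  have val: "Phi_nf K (sim_class I, t) = div_class K (pair_div0 I t)" if "minimal_pair I t" for I t
    using Phi_nf_eq[OF that self_in_sim_class[OF that]] nf_value_eq[of I t] that by (simp add: minimal_pair_def)
  show "bij_betw (Phi_nf K) (Rep K) (Pic0 K)"
  proof (rule bij_betwI')
    fix a b assume "a \<in> Rep K" "b \<in> Rep K"
    moreover obtain C t D s where ab: "a = (C, t)" "b = (D, s)" by (cases a, cases b)
    ultimately obtain I J where I: "minimal_pair I t" "C = sim_class I" and J: "minimal_pair J s" "D = sim_class J"
      by (auto simp: Rep_iff)
    have f: "frac_ideal K I" "length t = nn" "frac_ideal K J" "length s = nn"
      using I J by (auto simp: minimal_pair_def)
    show "(Phi_nf K a = Phi_nf K b) = (a = b)"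
    proof
      assume "Phi_nf K a = Phi_nf K b"
      hence "div_class K (pair_div0 J s) = div_class K (pair_div0 I t)" using val I J ab by simp
      then obtain h where h: "h \<noteq> 0" "\<And>p. p \<in> all_places K \<Longrightarrow> pair_div0 I t p - pair_div0 J s p = place_val p h"
        using div_class_eq_iff[OF pair_div0_in_Div[OF f(3,4)] pair_div0_in_Div[OF f(1,2)]] by blast
      have "pair_div I t p - pair_div J s p = place_val p h" if "p \<in> all_places K - {pl}" for p
        using h(2)[of p] that by (simp add: pair_div0_def prime_div_def)
      from minimal_pair_unique[OF I(1) J(1) h(1) this] show "a = b" using ab I J by simp
    qed simp
  next
    fix a assume a: "a \<in> Rep K"
    obtain C t where ct: "a = (C, t)" by (cases a)
    then obtain I where I: "minimal_pair I t" "C = sim_class I" using a by (auto simp: Rep_iff)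
    have f: "frac_ideal K I" "length t = nn" using I by (auto simp: minimal_pair_def)
    show "Phi_nf K a \<in> Pic0 K" unfolding Pic0_def
      using val[OF I(1)] pair_div0_in_Div[OF f] div_deg_pair_div0[OF f] I ct by auto
  next
    fix c assume "c \<in> Pic0 K"
    then obtain E where E: "E \<in> carrier (Div K)" "div_deg K E = 0" "c = div_class K E" by (auto simp: Pic0_def)
    obtain I t \<mu> where I: "minimal_pair I t" "set t \<subseteq> coef_group K" "\<mu> \<noteq> 0"
      "\<And>p. p \<in> all_places K - {pl} \<Longrightarrow> pair_div I t p = E p + place_val p \<mu>"
      using pair_div_surj[OF E(1)] by metis
    have f: "frac_ideal K I" "length t = nn" using I by (auto simp: minimal_pair_def)
    \<comment> \<open>\<open>F\<close> is \<open>E\<close> plus the divisor of \<mu>, written as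
      \<open>pair_div I t\<close> with its missing coefficient at \<open>pl\<close> added. By the
      product formula its degree is \<open>0\<close>, and this forces that coefficient to be the one
      in \<open>pair_div0\<close>.\<close>
    define F where "F = (\<lambda>p. pair_div I t p + (E pl + place_val pl \<mu>) * prime_div pl p)"
    have FD: "F \<in> carrier (Div K)"
      unfolding F_def by (rule Div_add[OF pair_div_in_Div[OF f I(2)] Div_scaled_prime])
    have eqF: "F p = E p + place_val p \<mu>" if "p \<in> all_places K" for p
      using I(4)[of p] pair_div_values(3)[OF f(1), of t] that by (cases "p = pl") (auto simp: F_def prime_div_def)
    have "div_deg K F = 0" using div_deg_translate[OF E(1) I(3) eqF FD] E(2) by simp
    moreover have "div_deg K F = div_deg K (pair_div I t) + (E pl + place_val pl \<mu>) * place_deg K pl"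
      unfolding F_def by (rule div_deg_add_pl[OF pair_div_in_Div'[OF f]])
    ultimately have "E pl + place_val pl \<mu> = - (div_deg K (pair_div I t) / place_deg K pl)"
      using place_deg_pos[of pl] pl_in_S by (simp add: S_def field_simps)
    hence "pair_div0 I t = F" by (auto simp: F_def pair_div0_def)
    hence "div_class K E = div_class K (pair_div0 I t)"
      using div_class_eq_iff[OF E(1) FD] eqF I(3) by auto
    moreover have "(sim_class I, t) \<in> Rep K" using I by (auto simp: Rep_iff)
    ultimately show "\<exists>a\<in>Rep K. c = Phi_nf K a" using val[OF I(1)] E(3) by (intro bexI[of _ "(sim_class I, t)"]) auto
  qed
qed

end

section \<open>Function fields: the bijection onto classes modulo the last place\<close>

locale ff_setting = class_setting +
  assumes coef_Ints: "coef_group K = \<int>"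
begin

lemma ff_value_eq: "ff_value K I t = last_class_group K #>\<^bsub>Pic K\<^esub> div_class K (pair_div I t)"
  by (simp add: ff_value_def Let_def pair_div_def[abs_def] pp_def nn_def)

lemma comm_group_Pic: "comm_group (Pic K)"
  unfolding Pic_def by (rule comm_group.abelian_FactGroup[OF comm_group_Div subgroup_Princ])

lemma div_class_hom: "group_hom (Div K) (Pic K) (div_class K)"
proof -
  interpret comm_group "Div K" by (rule comm_group_Div)
  have n: "Princ K \<lhd> Div K" by (rule subgroup_imp_normal[OF subgroup_Princ])
  have "div_class K \<in> hom (Div K) (Pic K)"
    using normal.r_coset_hom_Mod[OF n] unfolding Pic_def div_class_def[abs_def] .
  thus ?thesis using comm_group_Pic by (simp add: group_hom_def group_hom_axioms_def comm_group_def is_group)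
qed

lemma carrier_Pic: "carrier (Pic K) = div_class K ` carrier (Div K)"
  by (auto simp: Pic_def FactGroup_def RCOSETS_def div_class_def)

lemma Div_int_pow:
  assumes D: "D \<in> carrier (Div K)" shows "D [^]\<^bsub>Div K\<^esub> (m::int) = (\<lambda>p. of_int m * D p)"
proof -
  interpret comm_group "Div K" by (rule comm_group_Div)
  have nat: "D [^]\<^bsub>Div K\<^esub> (j::nat) = (\<lambda>p. of_nat j * D p)" for j
    by (induction j) (auto simp: Div_simps(2,3) algebra_simps)
  show ?thesis
  proof (cases m)
    case (nonneg j)
    thus ?thesis using nat[of j] by (simp add: int_pow_int)
  next
    case (neg j)
    have "D [^]\<^bsub>Div K\<^esub> (Suc j) \<in> carrier (Div K)" using D by (rule nat_pow_closed)
    thus ?thesis using neg nat[of "Suc j"] int_pow_neg_int[OF D, of "Suc j"] Div_inv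
      by (simp del: nat_pow_Suc of_nat_Suc)
  qed
qed

lemma prime_div_in_Div: "prime_div pl \<in> carrier (Div K)"
  using Div_scaled_prime_int[of pl 1] pl_in_S by (simp add: all_places_eq)

lemma last_class_group_eq:
  "last_class_group K = {div_class K (\<lambda>p. of_int m * prime_div pl p) |m. True}"
proof -
  interpret h: group_hom "Div K" "Pic K" "div_class K" by (rule div_class_hom)
  note pd = prime_div_in_Div
  have "div_class K (prime_div pl) [^]\<^bsub>Pic K\<^esub> m = div_class K (\<lambda>p. of_int m * prime_div pl p)" for m :: int
    using h.hom_int_pow[OF pd, of m] by (simp add: Div_int_pow[OF pd])
  thus ?thesis unfolding last_class_group_def pl_def[symmetric] h.H.generate_pow[OF h.hom_closed[OF pd]] by auto
qed

lemma subgroup_last: "subgroup (last_class_group K) (Pic K)"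
proof -
  interpret h: group_hom "Div K" "Pic K" "div_class K" by (rule div_class_hom)
  show ?thesis unfolding last_class_group_def pl_def[symmetric] using h.hom_closed[OF prime_div_in_Div]
    by (intro h.H.generate_is_subgroup) auto
qed

lemma last_coset_eq_iff:
  assumes D: "D \<in> carrier (Div K)" and E: "E \<in> carrier (Div K)"
  shows "last_class_group K #>\<^bsub>Pic K\<^esub> div_class K D = last_class_group K #>\<^bsub>Pic K\<^esub> div_class K E \<longleftrightarrow>
    (\<exists>m f. f \<noteq> 0 \<and> (\<forall>p\<in>all_places K. E p - D p = place_val p f + of_int m * prime_div pl p))"
proof -
  interpret h: group_hom "Div K" "Pic K" "div_class K" by (rule div_class_hom)
  have ED: "(\<lambda>p. E p - D p) \<in> carrier (Div K)" using Div_add[OF E Div_uminus[OF D]] by simp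
  have m: "(\<lambda>p. of_int m * prime_div pl p) \<in> carrier (Div K)" for m
    using Div_scaled_prime_int[of pl m] pl_in_S by (simp add: all_places_eq)
  have "div_class K E \<otimes>\<^bsub>Pic K\<^esub> inv\<^bsub>Pic K\<^esub> div_class K D = div_class K (E \<otimes>\<^bsub>Div K\<^esub> inv\<^bsub>Div K\<^esub> D)"
    using D E by simp
  also have "E \<otimes>\<^bsub>Div K\<^esub> inv\<^bsub>Div K\<^esub> D = (\<lambda>p. E p - D p)" by (simp add: Div_inv[OF D] Div_simps(2))
  finally have e: "div_class K E \<otimes>\<^bsub>Pic K\<^esub> inv\<^bsub>Pic K\<^esub> div_class K D = div_class K (\<lambda>p. E p - D p)" .
  have "last_class_group K #>\<^bsub>Pic K\<^esub> div_class K D = last_class_group K #>\<^bsub>Pic K\<^esub> div_class K E \<longleftrightarrow>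
     div_class K (\<lambda>p. E p - D p) \<in> last_class_group K"
    unfolding h.H.coset_eq_iff[OF subgroup_last h.hom_closed[OF D] h.hom_closed[OF E]] e ..
  also have "\<dots> \<longleftrightarrow> (\<exists>m. div_class K (\<lambda>p. of_int m * prime_div pl p) = div_class K (\<lambda>p. E p - D p))"
    unfolding last_class_group_eq by auto
  also have "\<dots> \<longleftrightarrow> (\<exists>m f. f \<noteq> 0 \<and> (\<forall>p\<in>all_places K. E p - D p - of_int m * prime_div pl p = place_val p f))"
    using div_class_eq_iff[OF m ED] by simp
  finally show ?thesis by (simp add: diff_eq_eq)
qed

lemma ff_value_sim:
  assumes m: "minimal_pair I t" "set t \<subseteq> coef_group K" and J: "J \<in> sim_class I"
  shows "ff_value K J t = ff_value K I t"
proof -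
  have I: "frac_ideal K I" "length t = nn" using m by (auto simp: minimal_pair_def)
  obtain h where h: "h \<noteq> 0" "frac_ideal K J" "\<And>p. p \<in> all_places K \<Longrightarrow> pair_div J t p - pair_div I t p = place_val p h"
    using pair_div_sim[OF m(1) J] by metis
  have "div_class K (pair_div I t) = div_class K (pair_div J t)"
    using div_class_eq_iff[OF pair_div_in_Div[OF I m(2)] pair_div_in_Div[OF h(2) I(2) m(2)]] h by blast
  thus ?thesis unfolding ff_value_eq by simp
qed

lemma Phi_ff_eq:
  assumes m: "minimal_pair I t" "set t \<subseteq> coef_group K" and J: "J \<in> sim_class I"
  shows "Phi_ff K (sim_class I, t) = ff_value K J t"
proof -
  have "(\<lambda>I. ff_value K I t) ` sim_class I = {ff_value K J t}"
    using ff_value_sim[OF m] ff_value_sim[OF m J] J by auto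
  thus ?thesis by (simp add: Phi_ff_def)
qed

theorem ff_bijection:
  "(C, t) \<in> Rep K \<Longrightarrow> I \<in> C \<Longrightarrow> Phi_ff K (C, t) = ff_value K I t"
  "bij_betw (Phi_ff K) (Rep K) (carrier (Pic_mod_last K))"
proof -
  show "(C, t) \<in> Rep K \<Longrightarrow> I \<in> C \<Longrightarrow> Phi_ff K (C, t) = ff_value K I t"
    using Phi_ff_eq by (auto simp: Rep_iff)
  have val: "Phi_ff K (sim_class I, t) = last_class_group K #>\<^bsub>Pic K\<^esub> div_class K (pair_div I t)"
    if "minimal_pair I t" "set t \<subseteq> coef_group K" for I t
    using Phi_ff_eq[OF that self_in_sim_class[OF that(1)]] ff_value_eq by simp
  have car: "carrier (Pic_mod_last K) = (\<lambda>D. last_class_group K #>\<^bsub>Pic K\<^esub> div_class K D) ` carrier (Div K)"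
    by (auto simp: Pic_mod_last_def FactGroup_def RCOSETS_def carrier_Pic)
  show "bij_betw (Phi_ff K) (Rep K) (carrier (Pic_mod_last K))"
  proof (rule bij_betwI')
    fix a b assume "a \<in> Rep K" "b \<in> Rep K"
    moreover obtain C t D s where ab: "a = (C, t)" "b = (D, s)" by (cases a, cases b)
    ultimately obtain I J where I: "minimal_pair I t" "set t \<subseteq> coef_group K" "C = sim_class I"
      and J: "minimal_pair J s" "set s \<subseteq> coef_group K" "D = sim_class J"
      by (auto simp: Rep_iff)
    have f: "frac_ideal K I" "length t = nn" "frac_ideal K J" "length s = nn"
      using I J by (auto simp: minimal_pair_def)
    show "(Phi_ff K a = Phi_ff K b) = (a = b)"
    proof
      assume "Phi_ff K a = Phi_ff K b"
      hence "last_class_group K #>\<^bsub>Pic K\<^esub> div_class K (pair_div J s) = last_class_group K #>\<^bsub>Pic K\<^esub> div_class K (pair_div I t)"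
        using val I J ab by simp
      then obtain h and m :: int where h: "h \<noteq> 0" "\<And>p. p \<in> all_places K \<Longrightarrow> pair_div I t p - pair_div J s p = place_val p h + of_int m * prime_div pl p"
        using last_coset_eq_iff[OF pair_div_in_Div[OF f(3,4) J(2)] pair_div_in_Div[OF f(1,2) I(2)]] by blast
      have "pair_div I t p - pair_div J s p = place_val p h" if "p \<in> all_places K - {pl}" for p
        using h(2)[of p] that by (simp add: prime_div_def)
      from minimal_pair_unique[OF I(1) J(1) h(1) this] show "a = b" using ab I J by simp
    qed simp
  next
    fix a assume a: "a \<in> Rep K"
    obtain C t where ct: "a = (C, t)" by (cases a)
    then obtain I where I: "minimal_pair I t" "set t \<subseteq> coef_group K" "C = sim_class I" using a by (auto simp: Rep_iff)
    have f: "frac_ideal K I" "length t = nn" using I by (auto simp: minimal_pair_def)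
    show "Phi_ff K a \<in> carrier (Pic_mod_last K)"
      unfolding car using val[OF I(1,2)] pair_div_in_Div[OF f I(2)] I ct by auto
  next
    fix c assume "c \<in> carrier (Pic_mod_last K)"
    then obtain E where E: "E \<in> carrier (Div K)" "c = last_class_group K #>\<^bsub>Pic K\<^esub> div_class K E" by (auto simp: car)
    obtain I t \<mu> where I: "minimal_pair I t" "set t \<subseteq> coef_group K" "\<mu> \<noteq> 0"
      "\<And>p. p \<in> all_places K - {pl} \<Longrightarrow> pair_div I t p = E p + place_val p \<mu>"
      using pair_div_surj[OF E(1)] by metis
    have f: "frac_ideal K I" "length t = nn" using I by (auto simp: minimal_pair_def)
    \<comment> \<open>The coefficient at \<open>pl\<close> is an integer, hence a multiple of
      \<open>prime_div pl\<close> that the quotient forgets.\<close>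
    have "E pl + place_val pl \<mu> \<in> \<int>"
      using E(1) pl_in_S place_val_coef[of pl \<mu>] I(3) coef_Ints by (auto simp: Div_simps S_def)
    then obtain m where m: "E pl + place_val pl \<mu> = of_int m" by (auto elim: Ints_cases)
    have "\<forall>p\<in>all_places K. pair_div I t p - E p = place_val p \<mu> + of_int (- m) * prime_div pl p"
    proof
      fix p assume "p \<in> all_places K"
      thus "pair_div I t p - E p = place_val p \<mu> + of_int (- m) * prime_div pl p"
        using I(4)[of p] pair_div_values(3)[OF f(1), of t] m by (cases "p = pl") (auto simp: prime_div_def)
    qed
    hence "c = last_class_group K #>\<^bsub>Pic K\<^esub> div_class K (pair_div I t)"
      unfolding E(2) using last_coset_eq_iff[OF E(1) pair_div_in_Div[OF f I(2)]] I(3) by blast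
    moreover have "(sim_class I, t) \<in> Rep K" using I by (auto simp: Rep_iff)
    ultimately show "\<exists>a\<in>Rep K. c = Phi_ff K a" using val[OF I(1,2)] by (intro bexI[of _ "(sim_class I, t)"]) auto
  qed
qed

end

section \<open>Linear dependence in finite extensions\<close>

lemma struct_on_simps [simp]:
  "carrier (struct_on B) = B" "x \<otimes>\<^bsub>struct_on B\<^esub> y = x * y" "x \<oplus>\<^bsub>struct_on B\<^esub> y = x + y"
  "\<one>\<^bsub>struct_on B\<^esub> = 1" "\<zero>\<^bsub>struct_on B\<^esub> = 0"
  by (simp_all add: struct_on_def)

lemma cring_struct_on:
  assumes "subring_set B" shows "cring (struct_on B)"
proof (rule cringI)
  show "abelian_group (struct_on B)"
    using assms by (intro abelian_groupI) (auto intro: subring_add subring_0 subring_uminus bexI[of _ "- _"])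
  show "Group.comm_monoid (struct_on B)"
    using assms by (intro comm_monoidI) (auto intro: subring_mult subring_1)
qed (auto simp: distrib_right)

lemma field_struct_on: "field (struct_on (UNIV :: 'a::field set))"
proof -
  have "subring_set (UNIV :: 'a set)" by (simp add: subring_set_def)
  then interpret cring "struct_on (UNIV :: 'a set)" by (rule cring_struct_on)
  have "Units (struct_on (UNIV :: 'a set)) = UNIV - {0}"
    by (auto simp: Units_def) (metis left_inverse right_inverse)
  thus ?thesis by (intro cring_fieldI) simp
qed

lemma struct_on_uminus: "a \<in> B \<Longrightarrow> subring_set B \<Longrightarrow> \<ominus>\<^bsub>struct_on B\<^esub> a = - a"
proof -
  assume a: "a \<in> B" "subring_set B"
  interpret cring "struct_on B" by (rule cring_struct_on[OF a(2)])
  show ?thesis using a by (intro minus_equality) (auto intro: subring_uminus)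
qed

lemma subring_struct_iff:
  assumes B: "subring_set B" and "k \<subseteq> B"
  shows "subring k (struct_on B) \<longleftrightarrow> subring_set k"
proof -
  interpret cring "struct_on B" by (rule cring_struct_on[OF B])
  show ?thesis
  proof
    assume k: "subring k (struct_on B)"
    show "subring_set k" unfolding subring_set_def
    proof (intro conjI ballI)
      fix a b assume ab: "a \<in> k" "b \<in> k"
      have "a \<oplus>\<^bsub>struct_on B\<^esub> (\<ominus>\<^bsub>struct_on B\<^esub> b) \<in> k" using subringE(5,7)[OF k] ab by blast
      moreover have "b \<in> B" using ab assms by auto
      ultimately show "a - b \<in> k" using struct_on_uminus[OF _ B] by simp
      show "a * b \<in> k" using subringE(6)[OF k ab] by simp
    qed (use subringE(3)[OF k] in simp)
  next
    assume k: "subring_set k"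
    show "subring k (struct_on B)"
      by (rule subringI) (use k assms struct_on_uminus[OF _ B] in \<open>auto simp: subset_iff intro: subring_1 subring_add subring_mult subring_uminus\<close>)
  qed
qed

lemma subfield_struct_iff:
  "subfield k (struct_on (UNIV :: 'a::field set)) \<longleftrightarrow> subring_set k \<and> (\<forall>a\<in>k. inverse a \<in> k)"
proof -
  interpret field "struct_on (UNIV :: 'a set)" by (rule field_struct_on)
  have U: "subring_set (UNIV :: 'a set)" by (simp add: subring_set_def)
  have inv: "inv\<^bsub>struct_on UNIV\<^esub> a = inverse a" if "a \<noteq> 0" for a :: 'a
    using that by (intro inv_char) auto
  show ?thesis
  proof
    assume k: "subfield k (struct_on UNIV)"
    have s: "subring_set k" using subfieldE(1)[OF k] subring_struct_iff[OF U] by simp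
    moreover have "inverse a \<in> k" if "a \<in> k" for a
      using subfield_m_inv(1)[OF k, of a] that inv[of a] by (cases "a = 0") auto
    ultimately show "subring_set k \<and> (\<forall>a\<in>k. inverse a \<in> k)" by blast
  next
    assume k: "subring_set k \<and> (\<forall>a\<in>k. inverse a \<in> k)"
    show "subfield k (struct_on UNIV)"
      by (rule subfieldI') (use k inv subring_struct_iff[OF U, of k] in auto)
  qed
qed

lemma combine_struct_on:
  assumes B: "subring_set B"
  shows "length Ks = length Us \<Longrightarrow> ring.combine (struct_on B) Ks Us = (\<Sum>i<length Us. Ks ! i * Us ! i)"
proof (induction Us arbitrary: Ks)
  case Nil
  interpret cring "struct_on B" by (rule cring_struct_on[OF B])
  show ?case using Nil by simp
next
  case (Cons u Us)
  interpret cring "struct_on B" by (rule cring_struct_on[OF B])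
  obtain k Ks' where "Ks = k # Ks'" "length Ks' = length Us" using Cons.prems by (cases Ks) auto
  thus ?case using Cons.IH[of Ks'] by (simp add: sum.lessThan_Suc_shift del: sum.lessThan_Suc)
qed

text \<open>For a subring \<open>A\<close> this says that the field has degree at most
  \<open>N\<close> over the fractions of \<open>A\<close>. The form is that of the assumption
  \<open>dependent_seq\<close> in \<open>pid_extension\<close>.\<close>

definition bounded_rank :: "'a::field set \<Rightarrow> nat \<Rightarrow> bool" where
  "bounded_rank A N \<longleftrightarrow> (\<forall>u::nat \<Rightarrow> 'a. \<exists>c. (\<forall>i. c i \<in> A) \<and> (\<exists>i\<le>N. c i \<noteq> 0) \<and> (\<Sum>i\<le>N. c i * u i) = 0)"

lemma bounded_rank_finite_dimension:
  assumes F: "subfield F (struct_on (UNIV :: 'a::field set))"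
    and fin: "ring.finite_dimension (struct_on (UNIV :: 'a set)) F UNIV"
  shows "\<exists>N. bounded_rank F N"
proof -
  interpret field "struct_on (UNIV :: 'a set)" by (rule field_struct_on)
  have U: "subring_set (UNIV :: 'a set)" by (simp add: subring_set_def)
  have F0: "0 \<in> F" using F subfield_struct_iff subring_0 by blast
  obtain n where n: "dimension n F UNIV" using fin by (auto simp: finite_dimension_def)
  have "\<exists>c. (\<forall>i. c i \<in> F) \<and> (\<exists>i\<le>n. c i \<noteq> 0) \<and> (\<Sum>i\<le>n. c i * u i) = 0" for u :: "nat \<Rightarrow> 'a"
  proof -
    define Us where "Us = map u [0..<Suc n]"
    have len: "length Us = Suc n" by (simp add: Us_def)
    have "dependent F Us" using independent_length_le_dimension[OF F n, of Us] len by auto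
    then obtain Ks where Ks: "length Ks = length Us" "combine Ks Us = 0" "set Ks \<subseteq> F" "set Ks \<noteq> {0}"
      using dependent_imp_non_trivial_combine[OF F, of Us] by auto
    define c where "c i = (if i \<le> n then Ks ! i else 0)" for i
    have "(\<Sum>i\<le>n. c i * u i) = (\<Sum>i<length Us. Ks ! i * Us ! i)"
      unfolding len lessThan_Suc_atMost by (intro sum.cong) (auto simp: c_def Us_def nth_append simp del: upt_Suc)
    hence "(\<Sum>i\<le>n. c i * u i) = 0" using combine_struct_on[OF U Ks(1)] Ks(2) by simp
    moreover have "\<forall>i. c i \<in> F" using Ks F0 len by (auto simp: c_def subset_iff)
    moreover have "\<exists>i\<le>n. c i \<noteq> 0"
    proof (rule ccontr)
      assume "\<not> ?thesis"
      hence "Ks ! i = 0" if "i < length Ks" for i using that Ks(1) len by (auto simp: c_def)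
      hence "set Ks \<subseteq> {0}" by (auto simp: in_set_conv_nth)
      moreover have "set Ks \<noteq> {}" using Ks(1) len by auto
      ultimately show False using Ks(4) by (metis subset_singletonD)
    qed
    ultimately show ?thesis by blast
  qed
  thus ?thesis unfolding bounded_rank_def by blast
qed

lemma common_denominator:
  assumes A: "subring_set A" and F: "\<And>c. c \<in> F \<Longrightarrow> \<exists>a\<in>A. \<exists>b\<in>A. b \<noteq> 0 \<and> c = a / b"
    and "finite I" "\<And>i. i \<in> I \<Longrightarrow> c i \<in> F"
  shows "\<exists>b\<in>A. b \<noteq> 0 \<and> (\<forall>i\<in>I. b * c i \<in> A)"
  using assms(3,4)
proof (induction I)
  case empty
  thus ?case using subring_1[OF A] by (intro bexI[of _ 1]) auto
next
  case (insert j I)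
  then obtain b where b: "b \<in> A" "b \<noteq> 0" "\<And>i. i \<in> I \<Longrightarrow> b * c i \<in> A" by auto
  obtain a d where ad: "a \<in> A" "d \<in> A" "d \<noteq> 0" "c j = a / d" using F[OF insert.prems[of j]] by blast
  have "b * d * c i \<in> A" if "i \<in> insert j I" for i
  proof (cases "i = j")
    case True
    thus ?thesis using ad b subring_mult[OF A] by simp
  next
    case False
    hence "d * (b * c i) \<in> A" using that by (intro subring_mult[OF A ad(2)] b(3)) auto
    moreover have "d * (b * c i) = b * d * c i" by simp
    ultimately show ?thesis by (simp only:)
  qed
  thus ?case using b ad subring_mult[OF A] by (intro bexI[of _ "b * d"]) auto
qed

lemma bounded_rank_fractions:
  assumes A: "subring_set A" and F: "\<And>c. c \<in> F \<Longrightarrow> \<exists>a\<in>A. \<exists>b\<in>A. b \<noteq> 0 \<and> c = a / b"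
    and N: "bounded_rank F N"
  shows "bounded_rank A N"
  unfolding bounded_rank_def
proof
  fix u :: "nat \<Rightarrow> 'a"
  obtain c where c: "\<And>i. c i \<in> F" "\<exists>i\<le>N. c i \<noteq> 0" "(\<Sum>i\<le>N. c i * u i) = 0" using N unfolding bounded_rank_def by blast
  obtain b where b: "b \<in> A" "b \<noteq> 0" "\<And>i. i \<le> N \<Longrightarrow> b * c i \<in> A"
    using common_denominator[of A F "{..N}" c] A F c(1) by auto
  define d where "d i = (if i \<le> N then b * c i else 0)" for i
  have "(\<Sum>i\<le>N. d i * u i) = b * (\<Sum>i\<le>N. c i * u i)" by (simp add: d_def sum_distrib_left mult.assoc)
  thus "\<exists>c. (\<forall>i. c i \<in> A) \<and> (\<exists>i\<le>N. c i \<noteq> 0) \<and> (\<Sum>i\<le>N. c i * u i) = 0"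
    using b c subring_0[OF A] by (intro exI[of _ d]) (auto simp: d_def)
qed

text \<open>The least bound is the exact degree: failure of the bound \<open>N - 1\<close> produces
  \<open>N\<close> elements that are independent over \<open>A\<close>.\<close>

lemma bounded_rank_minimal:
  assumes A: "subring_set A" and "bounded_rank A M"
  obtains N and b :: "nat \<Rightarrow> 'a::field" where "bounded_rank A N" "N > 0"
    "\<And>c i. (\<And>i. c i \<in> A) \<Longrightarrow> (\<Sum>i<N. c i * b i) = 0 \<Longrightarrow> i < N \<Longrightarrow> c i = 0"
proof -
  define N where "N = (LEAST N. bounded_rank A N)"
  have N: "bounded_rank A N" unfolding N_def using assms(2) by (rule LeastI)
  have N0: "N \<noteq> 0"
  proof
    assume "N = 0"
    then obtain c where "c (0::nat) \<noteq> 0" "c 0 * (1::'a) = 0"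
      using N[unfolded bounded_rank_def, rule_format, of "\<lambda>_. 1"] by auto
    thus False by simp
  qed
  hence "\<not> bounded_rank A (N - 1)" using not_less_Least[of "N - 1" "bounded_rank A"] N_def by auto
  then obtain b :: "nat \<Rightarrow> 'a" where b: "\<And>c. (\<forall>i. c i \<in> A) \<Longrightarrow> (\<Sum>i\<le>N - 1. c i * b i) = 0 \<Longrightarrow> \<forall>i\<le>N - 1. c i = 0"
    unfolding bounded_rank_def by blast
  have *: "{..N - 1} = {..<N}" "\<And>i. i \<le> N - 1 \<longleftrightarrow> i < N" using N0 by auto
  show thesis by (rule that[of N b]) (use N N0 b[unfolded *] in auto)
qed

lemma principal_Ints:
  assumes "ideal_in (\<int> :: 'a::field_char_0 set) J"
  shows "\<exists>d\<in>\<int>. J = (\<lambda>a. d * a) ` \<int>"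
proof -
  define I where "I = {n::int. of_int n \<in> J}"
  have J: "J = of_int ` I" using ideal_in_subset[OF assms] by (auto simp: I_def elim!: Ints_cases)
  have add: "a + b \<in> I" if "a \<in> I" "b \<in> I" for a b using that ideal_in_add[OF assms] by (auto simp: I_def)
  have mult: "r * a \<in> I" if "a \<in> I" for r a using that ideal_in_mult[OF assms, of "of_int r" "of_int a"] by (auto simp: I_def)
  have zero: "0 \<in> I" using ideal_in_0[OF assms] by (simp add: I_def)
  have "\<exists>d. I = range (\<lambda>a. d * a)"
  proof (cases "I = {0}")
    case True
    thus ?thesis by (intro exI[of _ 0]) auto
  next
    case False
    then obtain a where a: "a \<in> I" "a \<noteq> 0" using zero by auto
    define P where "P n \<longleftrightarrow> n > 0 \<and> int n \<in> I" for n
    have "P (nat \<bar>a\<bar>)" using a mult[of a "-1"] by (auto simp: P_def abs_if)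
    hence d: "P (LEAST n. P n)" by (rule LeastI)
    define d where "d = int (LEAST n. P n)"
    have dI: "d > 0" "d \<in> I" using d by (auto simp: P_def d_def)
    have "x \<in> range (\<lambda>a. d * a)" if x: "x \<in> I" for x
    proof (rule ccontr)
      assume n: "x \<notin> range (\<lambda>a. d * a)"
      have "x mod d = x + (- (x div d)) * d" by (simp add: minus_mult_div_eq_mod [symmetric] mult.commute)
      hence "x mod d \<in> I" using add[OF x mult[OF dI(2), of "- (x div d)"]] by simp
      moreover have "x mod d \<noteq> 0" using n by (auto simp: mod_eq_0_iff_dvd dvd_def)
      moreover have "0 \<le> x mod d" "x mod d < d" using dI by auto
      ultimately have "P (nat (x mod d))" by (simp add: P_def)
      hence "(LEAST n. P n) \<le> nat (x mod d)" by (rule Least_le)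
      thus False using \<open>x mod d < d\<close> \<open>0 \<le> x mod d\<close> by (simp add: d_def)
    qed
    thus ?thesis using mult[OF dI(2)] by (intro exI[of _ d]) (auto simp: mult.commute)
  qed
  then obtain d where "I = range (\<lambda>a. d * a)" by blast
  hence "J = (\<lambda>a. of_int d * a) ` \<int>" unfolding J by (auto simp: Ints_def image_image)
  thus ?thesis by (intro bexI[of _ "of_int d"]) auto
qed

definition coeffs_in :: "'a::zero set \<Rightarrow> 'a poly \<Rightarrow> bool" where
  "coeffs_in k f \<longleftrightarrow> (\<forall>i. coeff f i \<in> k)"

lemma poly_ring_at_eq: "poly_ring_at k y = {poly f y |f. coeffs_in k f}"
  by (simp add: poly_ring_at_def coeffs_in_def)

lemma coeffs_in_pCons: "coeffs_in k (pCons a f) \<longleftrightarrow> a \<in> k \<and> coeffs_in k f"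
proof
  assume h: "coeffs_in k (pCons a f)"
  have "coeff (pCons a f) 0 \<in> k" "\<And>i. coeff (pCons a f) (Suc i) \<in> k"
    using h unfolding coeffs_in_def by blast+
  thus "a \<in> k \<and> coeffs_in k f" by (simp add: coeffs_in_def)
qed (auto simp: coeffs_in_def coeff_pCons split: nat.split)

lemma coeffs_in_ops:
  assumes "subring_set k"
  shows "coeffs_in k 0" "coeffs_in k f \<Longrightarrow> coeffs_in k g \<Longrightarrow> coeffs_in k (f + g)"
    "coeffs_in k f \<Longrightarrow> coeffs_in k g \<Longrightarrow> coeffs_in k (f - g)"
    "coeffs_in k f \<Longrightarrow> coeffs_in k g \<Longrightarrow> coeffs_in k (f * g)"
    "a \<in> k \<Longrightarrow> coeffs_in k (monom a n)"
  using assms by (auto simp: coeffs_in_def coeff_mult Polynomial.coeff_monom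
      intro!: subring_sum subring_mult subring_add subring_diff subring_0)

text \<open>Long division that keeps quotient and remainder over \<open>k\<close>, where
  \<open>k\<close> is merely a subset of the coefficient type.\<close>

lemma coeffs_in_division:
  assumes k: "subring_set k" "\<And>a. a \<in> k \<Longrightarrow> inverse a \<in> k" and g: "coeffs_in k g" "g \<noteq> 0"
  shows "coeffs_in k f \<Longrightarrow> \<exists>q r. coeffs_in k q \<and> coeffs_in k r \<and> f = q * g + r \<and> (r = 0 \<or> degree r < degree g)"
proof (induction "degree f" arbitrary: f rule: less_induct)
  case less
  show ?case
  proof (cases "degree f < degree g")
    case True
    thus ?thesis using less.prems coeffs_in_ops(1)[OF k(1)] by (intro exI[of _ 0] exI[of _ f]) auto
  next
    case False
    define n where "n = degree f - degree g"
    define c where "c = lead_coeff f * inverse (lead_coeff g)"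
    have c: "c \<in> k" unfolding c_def using less.prems g k by (intro subring_mult) (auto simp: coeffs_in_def)
    define f' where "f' = f - monom c n * g"
    have f': "coeffs_in k f'" unfolding f'_def using less.prems g c by (intro coeffs_in_ops[OF k(1)])
    show ?thesis
    proof (cases "f' = 0")
      case True
      thus ?thesis using c coeffs_in_ops(1,5)[OF k(1)] unfolding f'_def
        by (intro exI[of _ "monom c n"] exI[of _ 0]) auto
    next
      case nz: False
      show ?thesis
      proof (cases "f = 0")
        case True
        thus ?thesis using coeffs_in_ops(1)[OF k(1)] by (intro exI[of _ 0]) auto
      next
        case f0: False
        have cne: "c \<noteq> 0" using f0 g by (simp add: c_def)
        have dm: "degree (monom c n * g) = degree f"
          using False cne g by (simp add: degree_mult_eq Polynomial.degree_monom_eq n_def)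
        have "coeff (monom c n * g) (degree f) = lead_coeff (monom c n * g)"
          by (simp add: dm)
        also have "\<dots> = c * lead_coeff g"
          using cne by (simp add: lead_coeff_mult Polynomial.degree_monom_eq)
        also have "\<dots> = lead_coeff f" using g by (simp add: c_def)
        finally have "coeff f' (degree f) = 0" by (simp add: f'_def)
        moreover have "degree f' \<le> degree f" unfolding f'_def using dm by (intro degree_diff_le) auto
        ultimately have "degree f' < degree f" using nz
          by (metis le_neq_implies_less leading_coeff_0_iff)
        from less.hyps[OF this f'] obtain q r where qr: "coeffs_in k q" "coeffs_in k r" "f' = q * g + r"
          "r = 0 \<or> degree r < degree g" by blast
        have "f = (monom c n + q) * g + r" using qr(3) by (simp add: f'_def algebra_simps)
        thus ?thesis using qr c coeffs_in_ops(2,5)[OF k(1)] by blast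
      qed
    qed
  qed
qed

lemma principal_poly_ring:
  assumes k: "subring_set k" "\<And>a. a \<in> k \<Longrightarrow> inverse a \<in> k" and J: "ideal_in (poly_ring_at k y) J"
  shows "\<exists>d\<in>poly_ring_at k y. J = (\<lambda>a. d * a) ` poly_ring_at k y"
proof (cases "\<exists>f. coeffs_in k f \<and> f \<noteq> 0 \<and> poly f y \<in> J")
  case False
  have "J \<subseteq> {0}"
  proof
    fix z assume z: "z \<in> J"
    then obtain f where "coeffs_in k f" "z = poly f y" using ideal_in_subset[OF J] by (auto simp: poly_ring_at_eq)
    thus "z \<in> {0}" using False z by (cases "f = 0") auto
  qed
  hence "J = {0}" using ideal_in_0[OF J] by auto
  thus ?thesis using subring_0[OF subring_poly_ring_at[OF k(1)], of y] by (intro bexI[of _ 0]) auto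
next
  case True
  define P where "P f \<longleftrightarrow> coeffs_in k f \<and> f \<noteq> 0 \<and> poly f y \<in> J" for f
  define g where "g = arg_min degree P"
  obtain f0 where "P f0" using True by (auto simp: P_def)
  hence g: "P g" "\<And>f. P f \<Longrightarrow> degree g \<le> degree f"
    using arg_min_nat_lemma[of P f0 degree] by (auto simp: g_def)
  have gA: "poly g y \<in> poly_ring_at k y" using g(1) by (auto simp: P_def poly_ring_at_eq)
  show ?thesis
  proof (intro bexI[OF _ gA] subset_antisym subsetI)
    fix z assume "z \<in> (\<lambda>a. poly g y * a) ` poly_ring_at k y"
    thus "z \<in> J" using ideal_in_mult[OF J, of _ "poly g y"] g(1) by (auto simp: P_def mult.commute)
  next
    fix z assume z: "z \<in> J"
    then obtain f where f: "coeffs_in k f" "z = poly f y" using ideal_in_subset[OF J] by (auto simp: poly_ring_at_eq)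
    obtain q r where qr: "coeffs_in k q" "coeffs_in k r" "f = q * g + r" "r = 0 \<or> degree r < degree g"
      using coeffs_in_division[OF k _ _ f(1), of g] g(1) by (auto simp: P_def)
    have q: "poly q y \<in> poly_ring_at k y" "poly (- q) y \<in> poly_ring_at k y"
      using qr(1) coeffs_in_ops(3)[OF k(1) coeffs_in_ops(1)[OF k(1)] qr(1)]
      unfolding poly_ring_at_eq by (auto simp del: poly_minus)
    have "z + poly (- q) y * poly g y \<in> J"
      using ideal_in_add[OF J z ideal_in_mult[OF J q(2)]] g(1) by (simp add: P_def)
    moreover have "z + poly (- q) y * poly g y = poly r y" unfolding f(2) qr(3) by simp
    ultimately have "poly r y \<in> J" by simp
    hence "r = 0 \<or> P r" using qr(2) by (auto simp: P_def)
    hence "r = 0" using g(2)[of r] qr(4) by auto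
    hence "z = poly g y * poly q y" unfolding f(2) qr(3) by simp
    thus "z \<in> (\<lambda>a. poly g y * a) ` poly_ring_at k y" using q(1) by blast
  qed
qed

section \<open>Change of the transcendental element\<close>

lemma not_algebraic_iff:
  "\<not> algebraic_over k x \<longleftrightarrow> (\<forall>f. coeffs_in k f \<longrightarrow> poly f x = 0 \<longrightarrow> f = 0)"
  by (auto simp: algebraic_over_def coeffs_in_def)

lemma subfield_rat_field_at:
  fixes x :: "'a::field"
  assumes k: "subring_set k"
  shows "subfield (rat_field_at k x) (struct_on UNIV)" "poly_ring_at k x \<subseteq> rat_field_at k x"
proof -
  note P = subring_poly_ring_at[OF k, of x]
  show sub: "poly_ring_at k x \<subseteq> rat_field_at k x"
  proof
    fix z assume "z \<in> poly_ring_at k x"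
    thus "z \<in> rat_field_at k x" unfolding rat_field_at_def
      using subring_1[OF P] by (intro CollectI exI[of _ z] exI[of _ 1]) auto
  qed
  have "a - b \<in> rat_field_at k x \<and> a * b \<in> rat_field_at k x" if a: "a \<in> rat_field_at k x" and b: "b \<in> rat_field_at k x" for a b
  proof -
    obtain p q where pq: "p \<in> poly_ring_at k x" "q \<in> poly_ring_at k x" "q \<noteq> 0" "a = p / q"
      using a unfolding rat_field_at_def by blast
    obtain r s where rs: "r \<in> poly_ring_at k x" "s \<in> poly_ring_at k x" "s \<noteq> 0" "b = r / s"
      using b unfolding rat_field_at_def by blast
    have "a - b = (p * s - r * q) / (q * s)" "a * b = (p * r) / (q * s)" using pq rs by (simp_all add: diff_frac_eq)
    moreover have "p * s - r * q \<in> poly_ring_at k x" "q * s \<in> poly_ring_at k x" "p * r \<in> poly_ring_at k x" "q * s \<noteq> 0"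
      using pq rs by (auto intro!: subring_diff[OF P] subring_mult[OF P])
    ultimately show ?thesis unfolding rat_field_at_def by blast
  qed
  moreover have "inverse a \<in> rat_field_at k x" if a: "a \<in> rat_field_at k x" for a
  proof (cases "a = 0")
    case False
    obtain p q where pq: "p \<in> poly_ring_at k x" "q \<in> poly_ring_at k x" "q \<noteq> 0" "a = p / q"
      using a unfolding rat_field_at_def by blast
    hence "inverse a = q / p" "p \<noteq> 0" using False by auto
    thus ?thesis using pq unfolding rat_field_at_def by blast
  qed (use a in simp)
  moreover have "1 \<in> rat_field_at k x" using sub subring_1[OF P] by blast
  ultimately show "subfield (rat_field_at k x) (struct_on UNIV)"
    unfolding subfield_struct_iff subring_set_def by blast
qed

lemma algebraic_over_relation:
  fixes y :: "'a::field"
  assumes F: "subfield F (struct_on UNIV)" and c: "\<And>i::nat. c i \<in> F" "c d \<noteq> 0" "(\<Sum>i\<le>d. c i * y ^ i) = 0"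
  shows "((ring.algebraic (struct_on UNIV)) over F) y"
proof -
  interpret field "struct_on (UNIV :: 'a set)" by (rule field_struct_on)
  have pow: "y [^]\<^bsub>struct_on UNIV\<^esub> (n::nat) = y ^ n" for n by (induction n) (auto simp: mult.commute)
  \<comment> \<open>Polynomials are lists with the leading coefficient in front, and this
    coefficient has to be nonzero; hence the reversal and the hypothesis on
    \<open>c d\<close>.\<close>
  define p where "p n = map c (rev [0..<n])" for n
  have ev: "eval (p n) y = (\<Sum>i<n. c i * y ^ i)" for n
    by (induction n) (auto simp: p_def pow)
  show ?thesis
  proof (rule algebraicI[of "p (Suc d)"])
    show "p (Suc d) \<in> carrier (F [X]\<^bsub>struct_on UNIV\<^esub>)"
      using c by (auto simp: p_def univ_poly_def polynomial_def)
    show "p (Suc d) \<noteq> []" by (simp add: p_def)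
    show "eval (p (Suc d)) y = \<zero>\<^bsub>struct_on UNIV\<^esub>" using c(3) ev by (simp add: lessThan_Suc_atMost)
  qed
qed

text \<open>The definition of a function field supplies some \<open>x0\<close>, whereas finiteness
  is wanted over the given \<open>x\<close>. A relation between powers of \<open>x\<close> over
  \<open>k[x0]\<close> is read as a relation between powers of \<open>x0\<close> over
  \<open>k[x]\<close>, so \<open>x0\<close> is algebraic over \<open>k(x)\<close>. The field
  \<open>L = k(x)(x0)\<close> is finite over \<open>k(x)\<close> and contains \<open>k(x0)\<close>,
  over which the whole field is finite.\<close>

lemma bounded_rank_change_variable:
  fixes x x0 :: "'a::field"
  assumes k: "subfield k (struct_on UNIV)" and x: "\<not> algebraic_over k x"
    and fin: "ring.finite_dimension (struct_on UNIV) (rat_field_at k x0) UNIV"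
  shows "\<exists>N. bounded_rank (poly_ring_at k x) N"
proof -
  interpret field "struct_on (UNIV :: 'a set)" by (rule field_struct_on)
  have ks: "subring_set k" using k subfield_struct_iff by blast
  have U: "subring_set (UNIV :: 'a set)" by (simp add: subring_set_def)
  let ?G = "rat_field_at k x0"
  let ?F = "rat_field_at k x"
  note F0 = subfield_rat_field_at[OF ks, of x0] and F = subfield_rat_field_at[OF ks, of x]
  have frac: "\<exists>a\<in>poly_ring_at k z. \<exists>b\<in>poly_ring_at k z. b \<noteq> 0 \<and> c = a / b" if "c \<in> rat_field_at k z" for c z
    using that unfolding rat_field_at_def by blast
  obtain N0 where N0: "bounded_rank (poly_ring_at k x0) N0"
    using bounded_rank_finite_dimension[OF F0(1) fin] bounded_rank_fractions[OF subring_poly_ring_at[OF ks] frac] by blast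
  obtain c where c: "\<And>i. c i \<in> poly_ring_at k x0" "\<exists>i\<le>N0. c i \<noteq> 0" "(\<Sum>i\<le>N0. c i * x ^ i) = 0"
    using N0 unfolding bounded_rank_def by blast
  have "\<forall>i. \<exists>g. coeffs_in k g \<and> c i = poly g x0" using c(1) by (auto simp: poly_ring_at_eq)
  then obtain g where g: "\<And>i. coeffs_in k (g i)" "\<And>i. c i = poly (g i) x0" by metis
  define D where "D = Max ((\<lambda>i. Polynomial.degree (g i)) ` {..N0})"
  have D: "Polynomial.degree (g i) \<le> D" if "i \<le> N0" for i unfolding D_def using that by (intro Max_ge) auto
  \<comment> \<open>The coefficient matrix is transposed: the sum of \<open>g i (x0) * x ^ i\<close>
    equals the sum of \<open>h j (x) * x0 ^ j\<close>. Transcendence of \<open>x\<close> keeps a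
    nonzero \<open>h j\<close> nonzero after evaluation.\<close>
  define h where "h j = (\<Sum>i\<le>N0. Polynomial.monom (Polynomial.coeff (g i) j) i)" for j
  have hk: "coeffs_in k (h j)" for j
  proof -
    have "Polynomial.coeff (h j) l \<in> k" for l
      unfolding h_def coeff_sum using g(1) subring_0[OF ks]
      by (intro subring_sum[OF ks]) (auto simp: coeffs_in_def Polynomial.coeff_monom)
    thus ?thesis by (simp add: coeffs_in_def)
  qed
  have ph: "poly (h j) x = (\<Sum>i\<le>N0. Polynomial.coeff (g i) j * x ^ i)" for j
    by (simp add: h_def poly_sum poly_monom)
  have coeff_h: "Polynomial.coeff (h j) i = Polynomial.coeff (g i) j" if "i \<le> N0" for i j
    using that by (simp add: h_def coeff_sum Polynomial.coeff_monom)
  have "(\<Sum>j\<le>D. poly (h j) x * x0 ^ j) = (\<Sum>j\<le>D. \<Sum>i\<le>N0. Polynomial.coeff (g i) j * x0 ^ j * x ^ i)"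
    by (simp add: ph sum_distrib_left sum_distrib_right mult_ac)
  also have "\<dots> = (\<Sum>i\<le>N0. \<Sum>j\<le>D. Polynomial.coeff (g i) j * x0 ^ j * x ^ i)" by (rule sum.swap)
  also have "\<dots> = (\<Sum>i\<le>N0. c i * x ^ i)"
    using poly_eq_sum_upto[OF D] by (intro sum.cong) (auto simp: g(2) sum_distrib_right)
  finally have rel: "(\<Sum>j\<le>D. poly (h j) x * x0 ^ j) = 0" using c(3) by simp
  obtain i where i: "i \<le> N0" "c i \<noteq> 0" using c(2) by blast
  hence "g i \<noteq> 0" using g(2)[of i] by auto
  then obtain j where j: "Polynomial.coeff (g i) j \<noteq> 0" by (meson leading_coeff_0_iff)
  hence "j \<le> Polynomial.degree (g i)" by (rule le_degree)
  hence "j \<le> D" using D[OF i(1)] by simp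
  have "h j \<noteq> 0" using coeff_h[OF i(1), of j] j by auto
  hence hj: "poly (h j) x \<noteq> 0" using x hk unfolding not_algebraic_iff by blast
  define E where "E = {j. j \<le> D \<and> poly (h j) x \<noteq> 0}"
  have E: "finite E" "E \<noteq> {}" using hj \<open>j \<le> D\<close> by (auto simp: E_def)
  define d where "d = Max E"
  have d: "d \<le> D" "poly (h d) x \<noteq> 0" using Max_in[OF E] by (auto simp: d_def E_def)
  have "poly (h j) x = 0" if "j \<le> D" "d < j" for j
    using Max_ge[OF E(1), of j] that by (fastforce simp: d_def E_def)
  hence "(\<Sum>j\<le>D. poly (h j) x * x0 ^ j) = (\<Sum>j\<le>d. poly (h j) x * x0 ^ j)"
    using d by (intro sum.mono_neutral_right) auto
  hence rel': "(\<Sum>j\<le>d. poly (h j) x * x0 ^ j) = 0" using rel by simp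
  have hF: "poly (h j) x \<in> ?F" for j using hk[of j] F(2) by (auto simp: poly_ring_at_eq)
  have alg: "(algebraic over ?F) x0" by (rule algebraic_over_relation[OF F(1) hF d(2) rel'])
  define L where "L = simple_extension ?F x0"
  have L: "subfield L (struct_on UNIV)" unfolding L_def using simple_extension_is_subfield[OF F(1)] alg by simp
  have finL: "finite_dimension ?F L" unfolding L_def using finite_dimension_simple_extension[OF F(1)] alg by simp
  have Ls: "subring_set L" "\<And>a. a \<in> L \<Longrightarrow> inverse a \<in> L" using L subfield_struct_iff by blast+
  have "k \<subseteq> poly_ring_at k x" by (rule subset_poly_ring_at[OF subring_0[OF ks]])
  hence kL: "k \<subseteq> L" unfolding L_def using F(2) simple_extension_incl[of ?F x0] by auto
  have x0L: "x0 \<in> L" unfolding L_def using simple_extension_mem[OF subfieldE(1)[OF F(1)], of x0] by simp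
  have "poly f x0 \<in> L" if "coeffs_in k f" for f
    using that kL x0L by (intro poly_in_subring[OF Ls(1)]) (auto simp: coeffs_in_def)
  hence pL: "poly_ring_at k x0 \<subseteq> L" by (auto simp: poly_ring_at_eq)
  have F0L: "?G \<subseteq> L"
  proof
    fix z assume "z \<in> ?G"
    from frac[OF this] obtain a b where "a \<in> poly_ring_at k x0" "b \<in> poly_ring_at k x0" "z = a / b" by blast
    thus "z \<in> L" unfolding divide_inverse using pL Ls(2) subring_mult[OF Ls(1)] by blast
  qed
  obtain n where n: "dimension n ?G UNIV" using fin by (auto simp: finite_dimension_def)
  obtain Us where Us: "Span ?G Us = UNIV" using exists_base[OF F0(1) n] by blast
  have "Span ?G Us \<subseteq> Span L Us"
  proof
    fix z assume "z \<in> Span ?G Us"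
    then obtain Ks where "set Ks \<subseteq> ?G" "length Ks = length Us" "z = combine Ks Us"
      using Span_mem_iff_length_version[OF F0(1), of Us z] by auto
    thus "z \<in> Span L Us" using Span_mem_iff_length_version[OF L, of Us z] F0L by auto
  qed
  hence "Span L Us = UNIV" using Us by blast
  hence "finite_dimension L UNIV" using Span_finite_dimension[OF L, of Us] by simp
  hence "finite_dimension ?F UNIV" using telescopic_base_dim(1)[OF F(1) L finL] by simp
  from bounded_rank_finite_dimension[OF F(1) this] show ?thesis
    using bounded_rank_fractions[OF subring_poly_ring_at[OF ks] frac] by blast
qed

section \<open>Function fields\<close>

text \<open>For subspaces, this states that the quotient of \<open>U\<close> by its intersection
  with \<open>W\<close> has dimension at most \<open>f\<close> over \<open>k\<close>, expressed
  through linear combinations of families.\<close>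

definition codim_le :: "'a::field set \<Rightarrow> 'a set \<Rightarrow> 'a set \<Rightarrow> nat \<Rightarrow> bool" where
  "codim_le k U W f \<longleftrightarrow> (\<forall>(I::nat set) u. finite I \<longrightarrow> f < card I \<longrightarrow> (\<forall>i\<in>I. u i \<in> U) \<longrightarrow>
     (\<exists>c. (\<forall>i\<in>I. c i \<in> k) \<and> (\<exists>i\<in>I. c i \<noteq> 0) \<and> (\<Sum>i\<in>I. c i * u i) \<in> W))"

lemma codim_leD:
  assumes "codim_le k U W f" "finite I" "f < card I" "\<And>i. i \<in> I \<Longrightarrow> u i \<in> U"
  obtains c where "\<And>i. i \<in> I \<Longrightarrow> c i \<in> k" "\<exists>i\<in>I. c i \<noteq> 0" "(\<Sum>i\<in>I. c i * u (i::nat)) \<in> W"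
proof -
  have "\<exists>c. (\<forall>i\<in>I. c i \<in> k) \<and> (\<exists>i\<in>I. c i \<noteq> 0) \<and> (\<Sum>i\<in>I. c i * u i) \<in> W"
    using assms(1)[unfolded codim_le_def, rule_format, OF assms(2,3), of u] assms(4) by blast
  thus thesis using that by blast
qed

text \<open>A maximal subfamily \<open>J\<close> independent modulo \<open>V\<close> has at most
  \<open>f\<close> members. Every further index \<open>l\<close> completes \<open>J\<close> to a
  vector in \<open>V\<close> with nonzero coefficient at \<open>l\<close>. More than
  \<open>g\<close> such vectors have a combination in \<open>W\<close>, and the nonzero diagonal
  coefficients keep the resulting combination nontrivial.\<close>

lemma codim_le_trans:
  assumes k: "subring_set k" and UV: "codim_le k U V f" and VW: "codim_le k V W g"
  shows "codim_le k U W (f + g)"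
  unfolding codim_le_def
proof (intro allI impI)
  fix I :: "nat set" and u :: "nat \<Rightarrow> 'a"
  assume I: "finite I" "f + g < card I" and u: "\<forall>i\<in>I. u i \<in> U"
  define indep where "indep J \<longleftrightarrow> J \<subseteq> I \<and> \<not> (\<exists>c. (\<forall>i\<in>J. c i \<in> k) \<and> (\<exists>i\<in>J. c i \<noteq> 0) \<and> (\<Sum>i\<in>J. c i * u i) \<in> V)" for J
  have "indep {}" by (simp add: indep_def)
  have "finite {J. indep J}" by (rule finite_subset[of _ "Pow I"]) (use I in \<open>auto simp: indep_def\<close>)
  then obtain J where J: "indep J" "\<And>J'. indep J' \<Longrightarrow> J \<subseteq> J' \<Longrightarrow> J' = J"
    using finite_has_maximal[of "{J. indep J}"] \<open>indep {}\<close> by (metis empty_iff mem_Collect_eq)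
  have fJ: "finite J" "J \<subseteq> I" using J(1) I finite_subset by (auto simp: indep_def)
  have "card J \<le> f"
  proof (rule ccontr)
    assume "\<not> card J \<le> f"
    hence "\<exists>c. (\<forall>i\<in>J. c i \<in> k) \<and> (\<exists>i\<in>J. c i \<noteq> 0) \<and> (\<Sum>i\<in>J. c i * u i) \<in> V"
      using UV[unfolded codim_le_def, rule_format, of J u] u fJ by auto
    thus False using J(1) by (auto simp: indep_def)
  qed
  hence card: "g < card (I - J)" using I fJ by (simp add: card_Diff_subset)
  have "\<forall>l\<in>I - J. \<exists>c. (\<forall>i. c i \<in> k) \<and> c l \<noteq> 0 \<and> (\<Sum>i\<in>J. c i * u i) + c l * u l \<in> V"
  proof
    fix l assume l: "l \<in> I - J"
    hence "\<not> indep (insert l J)" using J(2)[of "insert l J"] by auto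
    then obtain c where c: "\<forall>i\<in>insert l J. c i \<in> k" "\<exists>i\<in>insert l J. c i \<noteq> 0" "(\<Sum>i\<in>insert l J. c i * u i) \<in> V"
      using l fJ by (auto simp: indep_def)
    have s: "(\<Sum>i\<in>insert l J. c i * u i) = c l * u l + (\<Sum>i\<in>J. c i * u i)" using l fJ by simp
    have "c l \<noteq> 0"
    proof
      assume "c l = 0"
      hence "(\<Sum>i\<in>J. c i * u i) \<in> V" "\<exists>i\<in>J. c i \<noteq> 0" using c s by auto
      thus False using J(1) c(1) by (auto simp: indep_def)
    qed
    define c' where "c' i = (if i \<in> insert l J then c i else 0)" for i
    have "(\<Sum>i\<in>J. c' i * u i) = (\<Sum>i\<in>J. c i * u i)" by (intro sum.cong) (auto simp: c'_def)
    hence "(\<forall>i. c' i \<in> k) \<and> c' l \<noteq> 0 \<and> (\<Sum>i\<in>J. c' i * u i) + c' l * u l \<in> V"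
      using c s \<open>c l \<noteq> 0\<close> subring_0[OF k] by (auto simp: c'_def add.commute)
    thus "\<exists>c. (\<forall>i. c i \<in> k) \<and> c l \<noteq> 0 \<and> (\<Sum>i\<in>J. c i * u i) + c l * u l \<in> V" by blast
  qed
  then obtain C where C: "\<And>l. l \<in> I - J \<Longrightarrow> (\<forall>i. C l i \<in> k) \<and> C l l \<noteq> 0 \<and> (\<Sum>i\<in>J. C l i * u i) + C l l * u l \<in> V"
    by metis
  obtain d where d: "\<And>l. l \<in> I - J \<Longrightarrow> d l \<in> k" "\<exists>l\<in>I - J. d l \<noteq> 0"
    "(\<Sum>l\<in>I - J. d l * ((\<Sum>i\<in>J. C l i * u i) + C l l * u l)) \<in> W"
    by (rule codim_leD[OF VW _ card, of "\<lambda>l. (\<Sum>i\<in>J. C l i * u i) + C l l * u l"]) (use I C in auto)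
  define e where "e i = (if i \<in> J then (\<Sum>l\<in>I - J. d l * C l i) else d i * C i i)" for i
  have "(\<Sum>i\<in>I. e i * u i) = (\<Sum>i\<in>J. e i * u i) + (\<Sum>i\<in>I - J. e i * u i)"
    using I fJ by (metis add.commute sum.subset_diff)
  also have "(\<Sum>i\<in>J. e i * u i) = (\<Sum>i\<in>J. \<Sum>l\<in>I - J. d l * C l i * u i)"
    by (intro sum.cong) (auto simp: e_def sum_distrib_right)
  also have "\<dots> = (\<Sum>l\<in>I - J. \<Sum>i\<in>J. d l * C l i * u i)" by (rule sum.swap)
  also have "(\<Sum>i\<in>I - J. e i * u i) = (\<Sum>l\<in>I - J. d l * C l l * u l)" by (intro sum.cong) (auto simp: e_def)
  also have "(\<Sum>l\<in>I - J. \<Sum>i\<in>J. d l * C l i * u i) + (\<Sum>l\<in>I - J. d l * C l l * u l) =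
     (\<Sum>l\<in>I - J. d l * ((\<Sum>i\<in>J. C l i * u i) + C l l * u l))"
    by (simp add: sum.distrib[symmetric] distrib_left sum_distrib_left mult.assoc)
  finally have "(\<Sum>i\<in>I. e i * u i) \<in> W" using d(3) by simp
  moreover have "\<forall>i\<in>I. e i \<in> k"
    using d(1) C by (auto simp: e_def intro!: subring_sum[OF k] subring_mult[OF k])
  moreover have "\<exists>i\<in>I. e i \<noteq> 0" using d(2) C by (auto simp: e_def)
  ultimately show "\<exists>c. (\<forall>i\<in>I. c i \<in> k) \<and> (\<exists>i\<in>I. c i \<noteq> 0) \<and> (\<Sum>i\<in>I. c i * u i) \<in> W" by blast
qed

lemma coeffs_in_reflect:
  assumes "subring_set k" "coeffs_in k f" shows "coeffs_in k (reflect_poly f)"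
  using assms by (auto simp: coeffs_in_def coeff_reflect_poly subring_0)

lemma not_algebraic_inverse:
  fixes x :: "'a::field"
  assumes "subring_set k" "\<not> algebraic_over k x" shows "\<not> algebraic_over k (inverse x)" "x \<noteq> 0"
proof -
  show x0: "x \<noteq> 0"
  proof
    assume "x = 0"
    moreover have "coeffs_in k [:0, 1:]" using assms(1) by (simp add: coeffs_in_pCons subring_0 subring_1 coeffs_in_ops)
    ultimately show False using assms(2) unfolding not_algebraic_iff by force
  qed
  show "\<not> algebraic_over k (inverse x)" unfolding not_algebraic_iff
  proof (intro allI impI)
    fix f assume f: "coeffs_in k f" "poly f (inverse x) = 0"
    hence "poly (reflect_poly f) x = 0" using x0 by (simp add: poly_reflect_poly_nz)
    thus "f = 0" using assms(2) coeffs_in_reflect[OF assms(1) f(1)] unfolding not_algebraic_iff by auto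
  qed
qed

lemma inverse_not_in_poly_ring_at:
  fixes y :: "'a::field"
  assumes k: "subring_set k" and y: "\<not> algebraic_over k y"
  shows "inverse y \<notin> poly_ring_at k y"
proof
  assume "inverse y \<in> poly_ring_at k y"
  then obtain f where f: "coeffs_in k f" "inverse y = poly f y" by (auto simp: poly_ring_at_eq)
  have y0: "y \<noteq> 0" using not_algebraic_inverse[OF assms] by simp
  have "poly (1 - pCons 0 f) y = 0" using f(2) y0 by (simp flip: f(2))
  moreover have "coeffs_in k (1 - pCons 0 f)"
    using f(1) k by (intro coeffs_in_ops) (auto simp: coeffs_in_pCons one_pCons subring_0 subring_1 coeffs_in_ops)
  ultimately have "1 - pCons 0 f = 0" using y unfolding not_algebraic_iff by blast
  hence "coeff (1 - pCons 0 f) 0 = 0" by simp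
  thus False by simp
qed

text \<open>At a pole of \<open>x\<close> the leading term dominates, as the constants have value
  \<open>0\<close>.\<close>

lemma valuation_of_poly:
  assumes v: "normalized_valuation v" and k: "\<And>c. c \<in> k \<Longrightarrow> c \<noteq> 0 \<Longrightarrow> v c = 0" and x: "v x < 0" "x \<noteq> 0"
  shows "coeffs_in k f \<Longrightarrow> f \<noteq> 0 \<Longrightarrow> poly f x \<noteq> 0 \<and> v (poly f x) = int (degree f) * v x"
proof (induction f)
  case (pCons a f)
  show ?case
  proof (cases "f = 0")
    case True
    thus ?thesis using pCons.prems k[of a] by (auto simp: coeffs_in_pCons)
  next
    case False
    have IH: "poly f x \<noteq> 0" "v (poly f x) = int (degree f) * v x"
      using pCons False by (auto simp: coeffs_in_pCons)
    have vx: "v (x * poly f x) = int (Suc (degree f)) * v x"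
      using IH x by (simp add: nv_mult v algebra_simps)
    also have "\<dots> < 0" using x by (simp add: mult_pos_neg)
    finally have "vge v (v (x * poly f x) + 1) a"
      using k[of a] pCons.prems by (cases "a = 0") (auto simp: vge_def coeffs_in_pCons)
    from nv_add_eq[OF v _ this] IH(1) x(2) vx False show ?thesis by (simp add: add.commute)
  qed
qed simp

text \<open>\<open>N\<close> is the degree over \<open>k(x)\<close>: \<open>rank\<close> bounds it
  from above and the independent family \<open>b\<close> from below. The dimension count needs both,
  with the same \<open>N\<close>.\<close>

locale function_field_setting =
  fixes k :: "'a::field set" and x :: 'a and N :: nat and b :: "nat \<Rightarrow> 'a"
  assumes k: "subring_set k" and k_inverse: "a \<in> k \<Longrightarrow> inverse a \<in> k"
    and exact_constants: "algebraic_over k z \<Longrightarrow> z \<in> k"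
    and transcendental: "\<not> algebraic_over k x"
    and rank: "bounded_rank (poly_ring_at k x) N" and N_pos: "0 < N"
    and basis_independent: "(\<And>i. c i \<in> poly_ring_at k x) \<Longrightarrow> (\<Sum>i<N. c i * b i) = 0 \<Longrightarrow> i < N \<Longrightarrow> c i = 0"
begin

definition y where "y = inverse x"

lemma x_nonzero: "x \<noteq> 0" and y_nonzero: "y \<noteq> 0" and y_transcendental: "\<not> algebraic_over k y"
  using not_algebraic_inverse[OF k transcendental] by (auto simp: y_def)

text \<open>A relation over \<open>k[x]\<close>, multiplied by \<open>y ^ m\<close> for the largest
  degree \<open>m\<close> of its coefficients, becomes a relation over \<open>k[y]\<close> with
  reversed polynomials.\<close>

lemma rank_y: "bounded_rank (poly_ring_at k y) N"
  unfolding bounded_rank_def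
proof
  fix u :: "nat \<Rightarrow> 'a"
  obtain c where c: "\<And>i. c i \<in> poly_ring_at k x" "\<exists>i\<le>N. c i \<noteq> 0" "(\<Sum>i\<le>N. c i * u i) = 0"
    using rank unfolding bounded_rank_def by blast
  have "\<forall>i. \<exists>g. coeffs_in k g \<and> c i = poly g x" using c(1) by (auto simp: poly_ring_at_eq)
  then obtain g where g: "\<And>i. coeffs_in k (g i)" "\<And>i. c i = poly (g i) x" by metis
  define m where "m = Max ((\<lambda>i. degree (g i)) ` {..N})"
  have m: "degree (g i) \<le> m" if "i \<le> N" for i unfolding m_def using that by (intro Max_ge) auto
  define d where "d i = (if i \<le> N then y ^ m * c i else 0)" for i
  have P: "subring_set (poly_ring_at k y)" by (rule subring_poly_ring_at[OF k])
  have yP: "y \<in> poly_ring_at k y" by (rule generator_in_poly_ring_at[OF k])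
  have "d i \<in> poly_ring_at k y" for i
  proof (cases "i \<le> N")
    case True
    have "poly (reflect_poly (g i)) y = y ^ degree (g i) * poly (g i) x"
      using poly_reflect_poly_nz[OF y_nonzero, of "g i"] by (simp add: y_def)
    hence "d i = y ^ (m - degree (g i)) * poly (reflect_poly (g i)) y"
      using m[OF True] True by (simp add: d_def g(2) flip: power_add mult.assoc)
    moreover have "poly (reflect_poly (g i)) y \<in> poly_ring_at k y"
      using coeffs_in_reflect[OF k g(1)] by (auto simp: poly_ring_at_eq)
    ultimately show ?thesis using subring_mult[OF P] subring_power[OF P yP] by simp
  next
    case False
    thus ?thesis using subring_0[OF P] by (simp add: d_def)
  qed
  moreover have "(\<Sum>i\<le>N. d i * u i) = y ^ m * (\<Sum>i\<le>N. c i * u i)" by (simp add: d_def sum_distrib_left mult.assoc)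
  ultimately show "\<exists>c. (\<forall>i. c i \<in> poly_ring_at k y) \<and> (\<exists>i\<le>N. c i \<noteq> 0) \<and> (\<Sum>i\<le>N. c i * u i) = 0"
    using c(2,3) y_nonzero by (intro exI[of _ d]) (auto simp: d_def)
qed

sublocale fin: pid_extension "poly_ring_at k x" N
proof
  show "subring_set (poly_ring_at k x)" by (rule subring_poly_ring_at[OF k])
  show "\<exists>d\<in>poly_ring_at k x. J = (*) d ` poly_ring_at k x" if "ideal_in (poly_ring_at k x) J" for J
    using principal_poly_ring[OF k k_inverse that] .
qed (use rank in \<open>simp add: bounded_rank_def\<close>)

sublocale inf: pid_extension "poly_ring_at k y" N
proof
  show "subring_set (poly_ring_at k y)" by (rule subring_poly_ring_at[OF k])
  show "\<exists>d\<in>poly_ring_at k y. J = (*) d ` poly_ring_at k y" if "ideal_in (poly_ring_at k y) J" for J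
    using principal_poly_ring[OF k k_inverse that] .
qed (use rank_y in \<open>simp add: bounded_rank_def\<close>)

definition trivial_on_k where "trivial_on_k v \<longleftrightarrow> (\<forall>c\<in>k - {0}. v c = (0::int))"

definition inf_vals where "inf_vals = {v. normalized_valuation v \<and> trivial_on_k v \<and> v x < 0}"

lemma k_subset: "k \<subseteq> poly_ring_at k z"
  by (rule subset_poly_ring_at[OF subring_0[OF k]])

lemma trivial_on_k_if:
  assumes v: "normalized_valuation v" and "k \<subseteq> val_ring v" shows "trivial_on_k v"
  unfolding trivial_on_k_def
proof
  fix c assume c: "c \<in> k - {0}"
  hence "c \<in> val_ring v" "inverse c \<in> val_ring v" using assms k_inverse by auto
  thus "v c = 0" using c by (auto simp: in_val_ring_iff vge_def nv_inverse v)
qed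

lemma poly_ring_subset_val_ring:
  assumes v: "normalized_valuation v" "trivial_on_k v" and z: "vge v 0 z"
  shows "poly_ring_at k z \<subseteq> val_ring v"
proof
  fix w assume "w \<in> poly_ring_at k z"
  then obtain f where f: "coeffs_in k f" "w = poly f z" by (auto simp: poly_ring_at_eq)
  have "k \<subseteq> val_ring v" using v(2) by (force simp: trivial_on_k_def val_ring_def)
  thus "w \<in> val_ring v" unfolding f(2)
    using f(1) z by (intro poly_in_subring valuation_subringD(1)[OF valuation_subring_val_ring(1)[OF v(1)]])
      (auto simp: coeffs_in_def in_val_ring_iff)
qed

lemma fin_V_iff: "v \<in> fin.V \<longleftrightarrow> normalized_valuation v \<and> trivial_on_k v \<and> 0 \<le> v x"
proof -
  have "0 \<le> v x" if "poly_ring_at k x \<subseteq> val_ring v"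
    using generator_in_poly_ring_at[OF k, of x] that x_nonzero by (auto simp: val_ring_def)
  moreover have "trivial_on_k v" if "poly_ring_at k x \<subseteq> val_ring v" "normalized_valuation v"
    using trivial_on_k_if[OF that(2)] k_subset that(1) by blast
  moreover have "poly_ring_at k x \<subseteq> val_ring v" if "normalized_valuation v" "trivial_on_k v" "0 \<le> v x"
    using poly_ring_subset_val_ring[OF that(1,2), of x] that by (simp add: vge_def)
  ultimately show ?thesis unfolding fin.V_def by blast
qed

lemma inf_V_iff: "v \<in> inf_vals \<longleftrightarrow> v \<in> inf.V \<and> 0 < v y"
proof -
  have "v \<in> inf.V \<longleftrightarrow> normalized_valuation v \<and> trivial_on_k v \<and> 0 \<le> v y"
  proof -
    have "0 \<le> v y" if "poly_ring_at k y \<subseteq> val_ring v"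
      using generator_in_poly_ring_at[OF k, of y] that y_nonzero by (auto simp: val_ring_def)
    moreover have "trivial_on_k v" if "poly_ring_at k y \<subseteq> val_ring v" "normalized_valuation v"
      using trivial_on_k_if[OF that(2)] k_subset that(1) by blast
    moreover have "poly_ring_at k y \<subseteq> val_ring v" if "normalized_valuation v" "trivial_on_k v" "0 \<le> v y"
      using poly_ring_subset_val_ring[OF that(1,2), of y] that by (simp add: vge_def)
    ultimately show ?thesis unfolding inf.V_def by blast
  qed
  thus ?thesis by (auto simp: inf_vals_def y_def nv_inverse)
qed

lemma inf_vals_nv: "v \<in> inf_vals \<Longrightarrow> normalized_valuation v"
  by (simp add: inf_vals_def)

lemma inf_vals_nonempty: "inf_vals \<noteq> {}"
proof -
  note P = subring_poly_ring_at[OF k, of y]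
  define C where "C = (\<lambda>a. y * a) ` poly_ring_at k y"
  have yP: "y \<in> poly_ring_at k y" by (rule generator_in_poly_ring_at[OF k])
  have id: "ideal_in (poly_ring_at k y) C" unfolding ideal_in_def C_def
  proof (intro conjI ballI)
    show "(*) y ` poly_ring_at k y \<subseteq> poly_ring_at k y" using subring_mult[OF P yP] by auto
    show "0 \<in> (*) y ` poly_ring_at k y" using subring_0[OF P] by (auto intro!: image_eqI[of _ _ 0])
    fix a b assume "a \<in> (*) y ` poly_ring_at k y" "b \<in> (*) y ` poly_ring_at k y"
    thus "a + b \<in> (*) y ` poly_ring_at k y" using subring_add[OF P] by (auto simp flip: distrib_left)
  next
    fix a b assume "a \<in> poly_ring_at k y" "b \<in> (*) y ` poly_ring_at k y"
    thus "a * b \<in> (*) y ` poly_ring_at k y" using subring_mult[OF P] by (auto simp: mult.left_commute)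
  qed
  have "1 \<notin> C"
  proof
    assume "1 \<in> C"
    then obtain a where "a \<in> poly_ring_at k y" "y * a = 1" by (auto simp: C_def)
    thus False using inverse_not_in_poly_ring_at[OF k y_transcendental] by (metis inverse_unique)
  qed
  moreover have "y \<in> C" using subring_1[OF P] by (auto simp: C_def intro!: image_eqI[of _ _ 1])
  ultimately obtain v where "v \<in> inf.V" "\<And>a. a \<in> C \<Longrightarrow> vge v 1 a"
    using inf.V_exists[OF P order_refl id _ _ y_nonzero] by metis
  thus ?thesis using inf_V_iff \<open>y \<in> C\<close> y_nonzero by (fastforce simp: vge_def)
qed

lemma finite_inf_vals: "finite inf_vals"
proof -
  have "inf_vals = {v \<in> inf.V. 0 < v y}" using inf_V_iff by blast
  thus ?thesis using inf.finite_V_over[OF generator_in_poly_ring_at[OF k] y_nonzero] by simp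
qed

text \<open>A pole at \<open>x\<close> determines \<open>v\<close> on \<open>k(x)\<close> as a
  multiple of the degree. Conversely \<open>x\<close> is no quotient \<open>f(x) / g(x)\<close> with
  \<open>degree f \<le> degree g\<close>, by transcendence, so it cannot belong to the valuation
  ring of an infinite place.\<close>

lemma ff_inf_places_eq: "ff_inf_places k x = Nonarch ` inf_vals"
proof -
  have "val_ring v \<inter> rat_field_at k x = inf_val_ring k x \<longleftrightarrow> v x < 0"
    if v: "normalized_valuation v" "trivial_on_k v" for v
  proof
    assume eq: "val_ring v \<inter> rat_field_at k x = inf_val_ring k x"
    show "v x < 0"
    proof (rule ccontr)
      assume "\<not> v x < 0"
      hence "x \<in> val_ring v" by (simp add: val_ring_def)
      moreover have "x \<in> rat_field_at k x"
        using generator_in_poly_ring_at[OF k] subfield_rat_field_at(2)[OF k] by blast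
      ultimately have "x \<in> inf_val_ring k x" using eq by blast
      then obtain f g where fg: "coeffs_in k f" "coeffs_in k g" "g \<noteq> 0" "x = poly f x / poly g x"
        "degree f \<le> degree g"
        unfolding inf_val_ring_def by (auto simp: coeffs_in_def)
      have gx: "poly g x \<noteq> 0" using transcendental fg unfolding not_algebraic_iff by blast
      hence "poly (pCons 0 g - f) x = 0" using fg(4) by (simp add: field_simps)
      moreover have "coeffs_in k (pCons 0 g - f)" using fg k by (intro coeffs_in_ops) (auto simp: coeffs_in_pCons subring_0)
      ultimately have "pCons 0 g = f" using transcendental unfolding not_algebraic_iff by (metis eq_iff_diff_eq_0)
      thus False using fg by auto
    qed
  next
    assume vx: "v x < 0"
    have val: "poly f x \<noteq> 0 \<and> v (poly f x) = int (degree f) * v x" if "coeffs_in k f" "f \<noteq> 0" for f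
      by (rule valuation_of_poly[OF v(1) _ vx x_nonzero that]) (use v(2) in \<open>auto simp: trivial_on_k_def\<close>)
    have key: "poly f x / poly g x \<in> val_ring v \<longleftrightarrow> f = 0 \<or> degree f \<le> degree g"
      if "coeffs_in k f" "coeffs_in k g" "g \<noteq> 0" for f g
    proof (cases "f = 0")
      case False
      have "v (poly f x / poly g x) = (int (degree f) - int (degree g)) * v x"
        using val[OF that(1) False] val[OF that(2,3)] by (simp add: nv_divide v left_diff_distrib)
      thus ?thesis using vx val[OF that(1) False] val[OF that(2,3)] False
        by (auto simp: val_ring_def zero_le_mult_iff)
    qed (simp add: val_ring_def)
    show "val_ring v \<inter> rat_field_at k x = inf_val_ring k x"
    proof (intro subset_antisym subsetI)
      fix z assume z: "z \<in> val_ring v \<inter> rat_field_at k x"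
      then obtain f g where fg: "coeffs_in k f" "coeffs_in k g" "z = poly f x / poly g x" "poly g x \<noteq> 0"
        unfolding rat_field_at_def poly_ring_at_eq by blast
      have g0: "g \<noteq> 0" using fg by auto
      have "f = 0 \<or> degree f \<le> degree g" using key[OF fg(1,2) g0] z fg by auto
      hence "degree f \<le> degree g" by auto
      moreover note g0
      ultimately show "z \<in> inf_val_ring k x" unfolding inf_val_ring_def using fg by (auto simp: coeffs_in_def)
    next
      fix z assume "z \<in> inf_val_ring k x"
      then obtain f g where fg: "coeffs_in k f" "coeffs_in k g" "g \<noteq> 0" "z = poly f x / poly g x"
        "degree f \<le> degree g"
        unfolding inf_val_ring_def by (auto simp: coeffs_in_def)
      have "z \<in> val_ring v" using key[OF fg(1,2,3)] fg by simp
      moreover have "z \<in> rat_field_at k x" unfolding rat_field_at_def poly_ring_at_eq using fg val[OF fg(2,3)] by blast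
      ultimately show "z \<in> val_ring v \<inter> rat_field_at k x" by blast
    qed
  qed
  thus ?thesis unfolding ff_inf_places_def ff_places_def inf_vals_def trivial_on_k_def by auto
qed

lemma ff_places_eq: "ff_places k = Nonarch ` fin.V \<union> Nonarch ` inf_vals" "Nonarch ` fin.V \<inter> Nonarch ` inf_vals = {}"
proof -
  have "Nonarch v \<in> ff_places k \<longleftrightarrow> normalized_valuation v \<and> trivial_on_k v" for v
    by (simp add: ff_places_def trivial_on_k_def)
  moreover have "p \<in> ff_places k \<Longrightarrow> \<exists>v. p = Nonarch v" for p by (auto simp: ff_places_def)
  ultimately show "ff_places k = Nonarch ` fin.V \<union> Nonarch ` inf_vals"
    unfolding set_eq_iff Un_iff image_iff fin_V_iff inf_vals_def by (metis (mono_tags, lifting) mem_Collect_eq not_less fin_V_iff)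
  show "Nonarch ` fin.V \<inter> Nonarch ` inf_vals = {}" by (auto simp: fin_V_iff inf_vals_def)
qed

subsection \<open>Existence of elements with prescribed zeros\<close>

text \<open>Modulo \<open>y\<close> the integral functions at all infinite places have dimension at
  most \<open>N\<close>. Omitting the place \<open>w\<close> saves at least one dimension, and this
  saving is the whole source of small elements. The \<open>N\<close>-th direction is occupied by
  \<open>e\<close>, so that \<open>N\<close> elements \<open>u i\<close> already have a combination
  that is divisible by one more \<open>y\<close> away from \<open>w\<close>.\<close>

lemma codim_inf_vals:
  assumes w: "w \<in> inf_vals"
  shows "codim_le k {z. \<forall>v\<in>inf_vals - {w}. vge v (j * v y) z} {z. \<forall>v\<in>inf_vals - {w}. vge v ((j + 1) * v y) z} (N - 1)"
  unfolding codim_le_def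
proof (intro allI impI)
  fix I :: "nat set" and u :: "nat \<Rightarrow> 'a"
  let ?T = "inf_vals - {w}"
  assume I: "finite I" "N - 1 < card I" and u: "\<forall>i\<in>I. u i \<in> {z. \<forall>v\<in>?T. vge v (j * v y) z}"
  have T: "finite ?T" "finite inf_vals" "\<And>v. v \<in> inf_vals \<Longrightarrow> normalized_valuation v" "\<And>v. v \<in> inf_vals \<Longrightarrow> 0 < v y"
    using finite_inf_vals inf_V_iff inf_vals_nv by auto
  have V: "v \<in> inf.V" if "v \<in> inf_vals" for v using that inf_V_iff by blast
  have nw: "normalized_valuation w" "0 < w y" using T w by auto
  \<comment> \<open>Rescale to \<open>j = 0\<close>, and make all \<open>u i\<close> vanish at \<open>w\<close>; an extra element \<open>e\<close> lives at \<open>w\<close> only.\<close>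
  define u0 where "u0 i = y powi (- j) * u i" for i
  have u0: "vge v 0 (u0 i)" if "i \<in> I" "v \<in> ?T" for i v
  proof -
    have "vge v (- j * v y + j * v y) (u0 i)" unfolding u0_def
      using that u T by (intro vge_mult) (auto simp: vge_def nv_power_int)
    thus ?thesis by simp
  qed
  define M where "M = (\<Sum>v\<in>inf_vals. v y) + 1"
  have M: "v y \<le> M" "1 \<le> M" if "v \<in> inf_vals" for v
    using member_le_sum[of v inf_vals "\<lambda>v. v y"] sum_nonneg[of inf_vals "\<lambda>v. v y"] that T less_imp_le by (force simp: M_def)+
  have "\<forall>i. \<exists>z. \<forall>v\<in>inf_vals. vge v M (z - (if v = w then 0 else u0 i))"
    by (intro allI weak_approximation[OF T(2,3)])
  then obtain U where U: "\<And>i v. v \<in> inf_vals \<Longrightarrow> vge v M (U i - (if v = w then 0 else u0 i))" by metis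
  obtain e where e: "\<And>v. v \<in> inf_vals \<Longrightarrow> vge v M (e - (if v = w then 1 else 0))"
    using weak_approximation[OF T(2,3), of M "\<lambda>v. if v = w then 1 else 0"] by blast
  have UT: "vge v M (U i - u0 i)" if "v \<in> ?T" for i v using U[of v i] that by auto
  have Uw: "vge w 1 (U i)" for i using U[OF w, of i] M(2)[OF w] by (auto intro: vge_mono)
  have eT: "vge v M e" if "v \<in> ?T" for v using e[of v] that by auto
  have ew: "vge w 1 (e - 1)" using e[OF w] M(2)[OF w] by (auto intro: vge_mono)
  define n where "n = Suc (Max (insert 0 I))"
  have nI: "n \<notin> I"
  proof
    assume "n \<in> I"
    hence "n \<le> Max (insert 0 I)" using I by (intro Max_ge) auto
    thus False by (simp add: n_def)
  qed
  define U' where "U' i = (if i = n then e else U i)" for i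
  have U'n: "U' n = e" and U'I: "\<And>i. i \<in> I \<Longrightarrow> U' i = U i" using nI by (auto simp: U'_def)
  have "N < card (insert n I)" using I nI by simp
  moreover have "finite (insert n I)" using I by simp
  ultimately obtain c where c: "\<And>i. i \<in> insert n I \<Longrightarrow> c i \<in> poly_ring_at k y" "\<exists>i\<in>insert n I. c i / y \<notin> poly_ring_at k y"
      "(\<Sum>i\<in>insert n I. c i * U' i) = 0"
    using inf.primitive_dependent[OF generator_in_poly_ring_at[OF k] inverse_not_in_poly_ring_at[OF k y_transcendental], of "insert n I" U']
    by metis
  have "\<forall>i\<in>insert n I. \<exists>a g. a \<in> k \<and> g \<in> poly_ring_at k y \<and> c i = a + y * g"
  proof
    fix i assume "i \<in> insert n I"
    then obtain f where f: "coeffs_in k f" "c i = poly f y" using c(1)[of i] by (auto simp: poly_ring_at_eq)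
    obtain a g where "f = pCons a g" by (cases f)
    thus "\<exists>a g. a \<in> k \<and> g \<in> poly_ring_at k y \<and> c i = a + y * g"
      using f by (auto simp: coeffs_in_pCons poly_ring_at_eq)
  qed
  then obtain a g where ag: "\<And>i. i \<in> insert n I \<Longrightarrow> a i \<in> k" "\<And>i. i \<in> insert n I \<Longrightarrow> g i \<in> poly_ring_at k y"
    "\<And>i. i \<in> insert n I \<Longrightarrow> c i = a i + y * g i" by metis
  \<comment> \<open>Reduction modulo \<open>y\<close>: the constant terms \<open>a i\<close> do not
    all vanish, because the relation is primitive at \<open>y\<close>.\<close>
  obtain i0 where i0: "i0 \<in> insert n I" "a i0 \<noteq> 0"
  proof -
    obtain i where i: "i \<in> insert n I" "c i / y \<notin> poly_ring_at k y" using c(2) by blast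
    have "a i \<noteq> 0"
    proof
      assume "a i = 0"
      hence "c i / y = g i" using ag(3)[OF i(1)] y_nonzero by simp
      thus False using i ag(2) by simp
    qed
    thus thesis using that i by blast
  qed
  have kv: "vge v 0 z" if "z \<in> k" "v \<in> inf_vals" for z v
    using inf.V_nonneg[OF V[OF that(2)]] that k_subset by blast
  have gv: "vge v 0 (g i)" if "i \<in> insert n I" "v \<in> inf_vals" for i v
    using inf.V_nonneg[OF V[OF that(2)] ag(2)[OF that(1)]] .
  have rel: "(\<Sum>i\<in>insert n I. a i * U' i) = - (y * (\<Sum>i\<in>insert n I. g i * U' i))"
  proof -
    have "(\<Sum>i\<in>insert n I. c i * U' i) = (\<Sum>i\<in>insert n I. a i * U' i + y * (g i * U' i))"
      using ag(3) by (intro sum.cong) (auto simp: algebra_simps)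
    also have "\<dots> = (\<Sum>i\<in>insert n I. a i * U' i) + y * (\<Sum>i\<in>insert n I. g i * U' i)"
      by (simp only: sum.distrib sum_distrib_left)
    finally show ?thesis using c(3) by (simp add: eq_neg_iff_add_eq_0)
  qed
  have sumT: "vge v (v y) (\<Sum>i\<in>I. a i * u0 i)" if v: "v \<in> ?T" for v
  proof -
    have nv: "normalized_valuation v" "0 < v y" and vi: "v \<in> inf_vals" using v T by auto
    have U0: "vge v 0 (U' i)" if "i \<in> insert n I" for i
    proof (cases "i = n")
      case True
      thus ?thesis using eT[OF v] M(2)[OF vi] U'n by (auto intro: vge_mono)
    next
      case False
      hence i: "i \<in> I" using that by simp
      have "vge v 0 (U i - u0 i)" using UT[OF v, of i] M(2)[OF vi] by (auto intro: vge_mono)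
      from vge_add[OF nv(1) this u0[OF i v]] show ?thesis using U'I[OF i] by simp
    qed
    have s: "(\<Sum>i\<in>I. a i * u0 i) = - (y * (\<Sum>i\<in>insert n I. g i * U' i)) - a n * e - (\<Sum>i\<in>I. a i * (U i - u0 i))"
    proof -
      have "(\<Sum>i\<in>insert n I. a i * U' i) = a n * e + (\<Sum>i\<in>I. a i * U i)"
        using I nI U'n U'I by simp
      moreover have "(\<Sum>i\<in>I. a i * (U i - u0 i)) = (\<Sum>i\<in>I. a i * U i) - (\<Sum>i\<in>I. a i * u0 i)"
        by (simp add: right_diff_distrib sum_subtractf)
      ultimately show ?thesis using rel by (simp add: algebra_simps)
    qed
    have 1: "vge v (v y + 0) (y * (\<Sum>i\<in>insert n I. g i * U' i))"
      using vge_mult[OF nv(1) gv[OF _ vi] U0] by (intro vge_mult[OF nv(1)] vge_sum[OF nv(1)]) auto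
    have 2: "vge v (0 + v y) (a n * e)"
      using M(1)[OF vi] ag(1) kv[OF _ vi] by (intro vge_mult[OF nv(1)] vge_mono[OF eT[OF v]]) auto
    have 3: "vge v (v y) (\<Sum>i\<in>I. a i * (U i - u0 i))"
    proof (rule vge_sum[OF nv(1)])
      fix i assume i: "i \<in> I"
      have "vge v (0 + v y) (a i * (U i - u0 i))"
        using M(1)[OF vi] ag(1)[of i] i kv[OF _ vi] by (intro vge_mult[OF nv(1)] vge_mono[OF UT[OF v]]) auto
      thus "vge v (v y) (a i * (U i - u0 i))" by simp
    qed
    show ?thesis unfolding s using 1 2 3 by (intro vge_diff[OF nv(1)]) (auto simp: vge_uminus[OF nv(1)])
  qed
  \<comment> \<open>If \<open>e\<close> alone had a nonzero constant term, the relation would make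
    \<open>a n * e\<close> vanish at \<open>w\<close>, where \<open>e\<close> is congruent to
    \<open>1\<close>.\<close>
  have "\<exists>i\<in>I. a i \<noteq> 0"
  proof (rule ccontr)
    assume "\<not> ?thesis"
    hence a0: "\<And>i. i \<in> I \<Longrightarrow> a i = 0" and an: "a n \<noteq> 0" using i0 by auto
    have U0: "vge w 0 (U' i)" if "i \<in> insert n I" for i
    proof (cases "i = n")
      case True
      have "vge w 0 (e - 1)" using ew by (rule vge_mono) simp
      moreover have "vge w 0 1" by (simp add: vge_def nv_1 nw)
      ultimately have "vge w 0 (e - 1 + 1)" by (rule vge_add[OF nw(1)])
      thus ?thesis using True U'n by simp
    next
      case False
      thus ?thesis using that Uw[of i] U'I[of i] by (auto intro: vge_mono)
    qed
    have "a n * e = - (y * (\<Sum>i\<in>insert n I. g i * U' i))"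
      using rel a0 I nI U'n by simp
    moreover have "vge w (1 + 0) (y * (\<Sum>i\<in>insert n I. g i * U' i))"
      using vge_mult[OF nw(1) gv[OF _ w] U0] nw by (intro vge_mult[OF nw(1)] vge_sum[OF nw(1)]) (auto simp: vge_def)
    ultimately have 1: "vge w 1 (a n * e)" by (simp add: vge_uminus nw)
    have "vge w (w 1 + 1) (e - 1)" using ew by (simp add: nv_1 nw)
    from nv_add_eq[OF nw(1) _ this] have "e \<noteq> 0" "w e = 0" by (simp_all add: nv_1 nw)
    moreover have "w (a n) = 0" using ag(1)[of n] an w by (auto simp: inf_vals_def trivial_on_k_def)
    ultimately show False using 1 an by (simp add: vge_def nv_mult nw)
  qed
  moreover have "(\<Sum>i\<in>I. a i * u i) \<in> {z. \<forall>v\<in>?T. vge v ((j + 1) * v y) z}"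
  proof (intro CollectI ballI)
    fix v assume v: "v \<in> ?T"
    have nv: "normalized_valuation v" using v T by auto
    have "u i = y powi j * u0 i" for i using y_nonzero by (simp add: u0_def power_int_minus)
    hence "(\<Sum>i\<in>I. a i * u i) = y powi j * (\<Sum>i\<in>I. a i * u0 i)" by (simp add: sum_distrib_left mult.left_commute)
    moreover have "vge v (j * v y + v y) (y powi j * (\<Sum>i\<in>I. a i * u0 i))"
      by (intro vge_mult[OF nv] sumT[OF v]) (simp add: vge_def nv_power_int nv)
    ultimately show "vge v ((j + 1) * v y) (\<Sum>i\<in>I. a i * u i)" by (simp add: algebra_simps)
  qed
  ultimately show "\<exists>c. (\<forall>i\<in>I. c i \<in> k) \<and> (\<exists>i\<in>I. c i \<noteq> 0) \<and> (\<Sum>i\<in>I. c i * u i) \<in> {z. \<forall>v\<in>?T. vge v ((j + 1) * v y) z}"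
    using ag(1) by (intro exI[of _ a]) auto
qed

lemma codim_inf_vals_iterate:
  assumes w: "w \<in> inf_vals"
  shows "codim_le k {z. \<forall>v\<in>inf_vals - {w}. vge v (j * v y) z} {z. \<forall>v\<in>inf_vals - {w}. vge v ((j + int m) * v y) z} (m * (N - 1))"
proof (induction m)
  case 0
  have "\<exists>c. (\<forall>i\<in>I. c i \<in> k) \<and> (\<exists>i\<in>I. c i \<noteq> 0) \<and> (\<Sum>i\<in>I. c i * u i) \<in> {z. \<forall>v\<in>inf_vals - {w}. vge v (j * v y) z}"
    if I: "finite I" "0 < card I" "\<forall>i\<in>I. u i \<in> {z. \<forall>v\<in>inf_vals - {w}. vge v (j * v y) z}" for I :: "nat set" and u
    using that subring_1[OF k] by (intro exI[of _ "\<lambda>_. 1"]) (auto intro!: vge_sum inf_vals_nv simp: card_gt_0_iff)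
  thus ?case by (simp add: codim_le_def)
next
  case (Suc m)
  have "codim_le k {z. \<forall>v\<in>inf_vals - {w}. vge v (j * v y) z} {z. \<forall>v\<in>inf_vals - {w}. vge v ((j + int m + 1) * v y) z} (m * (N - 1) + (N - 1))"
    by (rule codim_le_trans[OF k Suc codim_inf_vals[OF w]])
  moreover have "j + int m + 1 = j + int (Suc m)" "m * (N - 1) + (N - 1) = Suc m * (N - 1)" by simp_all
  ultimately show ?case by (simp only:)
qed

text \<open>Dimension count with the \<open>(m + 1) * N\<close> elements
  \<open>x ^ i * b' j\<close>, where \<open>i \<le> m\<close>. Away from \<open>w\<close> their
  poles are bounded by \<open>m + D\<close> in units of \<open>y\<close>. Removing these poles and
  gaining a zero of order \<open>D'\<close> imposes at most \<open>(m + D + D') * (N - 1)\<close>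
  conditions, fewer than the number of elements for large \<open>m\<close>.\<close>

lemma exists_small_ff:
  assumes I: "fin.fractional I" and w: "w \<in> inf_vals"
  shows "\<exists>h\<in>I - {0}. \<forall>v\<in>inf_vals - {w}. C v \<le> v h"
proof -
  note P = subring_poly_ring_at[OF k, of x]
  let ?T = "inf_vals - {w}"
  have T: "finite ?T" "\<And>v. v \<in> ?T \<Longrightarrow> normalized_valuation v" "\<And>v. v \<in> ?T \<Longrightarrow> 0 < v y"
    using finite_inf_vals inf_V_iff inf_vals_nv by auto
  obtain b' where b': "\<And>i. b' i \<in> I"
    "\<And>c i. (\<And>i. c i \<in> poly_ring_at k x) \<Longrightarrow> (\<Sum>i<N. c i * b' i) = 0 \<Longrightarrow> i < N \<Longrightarrow> c i = 0"
    by (rule fin.basis_in_fractional[where n = N and b = b, OF I]) (use basis_independent in blast)+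
  define D where "D = nat (\<Sum>(v, i)\<in>?T \<times> {..<N}. \<bar>v (b' i)\<bar>)"
  define D' where "D' = nat (\<Sum>v\<in>?T. \<bar>C v\<bar>)"
  have D: "- int D \<le> v (b' i)" if "v \<in> ?T" "i < N" for v i
  proof -
    have "\<bar>v (b' i)\<bar> \<le> (\<Sum>(v, i)\<in>?T \<times> {..<N}. \<bar>v (b' i)\<bar>)"
      using member_le_sum[of "(v, i)" "?T \<times> {..<N}" "\<lambda>(v, i). \<bar>v (b' i)\<bar>"] T(1) that by force
    thus ?thesis unfolding D_def by linarith
  qed
  have D': "C v \<le> int D'" if "v \<in> ?T" for v
  proof -
    have "\<bar>C v\<bar> \<le> (\<Sum>v\<in>?T. \<bar>C v\<bar>)" using member_le_sum[of v ?T "\<lambda>v. \<bar>C v\<bar>"] T(1) that by force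
    thus ?thesis unfolding D'_def by linarith
  qed
  \<comment> \<open>With this \<open>m\<close> the term \<open>(D + D') * (N - 1)\<close> is at most
    \<open>m\<close>, so the number of conditions is at most \<open>m * N\<close>, below
    \<open>(m + 1) * N\<close>.\<close>
  define m where "m = (D + D') * N"
  define u where "u n = x ^ (n div N) * b' (n mod N)" for n
  have dm: "n div N \<le> m" "n mod N < N" if "n < Suc m * N" for n
    using that N_pos by (auto simp: less_mult_imp_div_less less_Suc_eq_le[symmetric])
  have uI: "u n \<in> I" for n
  proof -
    have "x ^ (n div N) \<in> integral_closure (poly_ring_at k x)"
      using fin.A_subset_integral subring_power[OF P generator_in_poly_ring_at[OF k]] by blast
    thus ?thesis unfolding u_def using fin.fractionalD(3)[OF I] b'(1) N_pos by simp
  qed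
  have uU: "u n \<in> {z. \<forall>v\<in>?T. vge v (- int (m + D) * v y) z}" if n: "n \<in> {..<Suc m * N}" for n
  proof (intro CollectI ballI)
    fix v assume v: "v \<in> ?T"
    note nv = T(2)[OF v]
    have "n div N \<le> m" "n mod N < N" using dm n by auto
    have "v x = - v y" using nv by (simp add: y_def nv_inverse)
    hence 1: "vge v (- (int m * v y)) (x ^ (n div N))"
      using \<open>n div N \<le> m\<close> T(3)[OF v] by (auto simp: vge_def nv_power nv mult_right_mono)
    have "int D \<le> int D * v y" using T(3)[OF v] by (simp add: mult_le_cancel_left1)
    hence 2: "vge v (- (int D * v y)) (b' (n mod N))"
      using D[OF v \<open>n mod N < N\<close>] by (simp add: vge_def)
    show "vge v (- int (m + D) * v y) (u n)" unfolding u_def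
      using vge_mult[OF nv 1 2] by (simp add: algebra_simps)
  qed
  have "codim_le k {z. \<forall>v\<in>?T. vge v (- int (m + D) * v y) z}
     {z. \<forall>v\<in>?T. vge v ((- int (m + D) + int (m + D + D')) * v y) z} ((m + D + D') * (N - 1))"
    by (rule codim_inf_vals_iterate[OF w])
  moreover have "(m + D + D') * (N - 1) < card {..<Suc m * N}"
  proof -
    have "(m + D + D') * (N - 1) \<le> m * (N - 1) + (D + D') * N"
      using mult_le_mono2[of "N - 1" N "D + D'"] by (simp add: add_mult_distrib)
    also have "\<dots> = m * (N - 1) + m" by (simp add: m_def)
    also have "\<dots> = m * N" using N_pos by (metis Suc_pred' add.commute mult_Suc_right)
    also have "\<dots> < card {..<Suc m * N}" using N_pos by simp
    finally show ?thesis .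
  qed
  ultimately have "\<exists>c. (\<forall>n\<in>{..<Suc m * N}. c n \<in> k) \<and> (\<exists>n\<in>{..<Suc m * N}. c n \<noteq> 0) \<and>
    (\<Sum>n\<in>{..<Suc m * N}. c n * u n) \<in> {z. \<forall>v\<in>?T. vge v ((- int (m + D) + int (m + D + D')) * v y) z}"
    using uU unfolding codim_le_def by blast
  then obtain c where c: "\<And>n. n \<in> {..<Suc m * N} \<Longrightarrow> c n \<in> k" "\<exists>n\<in>{..<Suc m * N}. c n \<noteq> 0"
    "(\<Sum>n\<in>{..<Suc m * N}. c n * u n) \<in> {z. \<forall>v\<in>?T. vge v ((- int (m + D) + int (m + D + D')) * v y) z}"
    by blast
  define h where "h = (\<Sum>n<Suc m * N. c n * u n)"
  have hI: "h \<in> I"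
  proof -
    have "c n * u n \<in> I" if "n < Suc m * N" for n
      using c(1)[of n] that k_subset fin.A_subset_integral by (intro fin.fractionalD(3)[OF I _ uI]) auto
    hence "sum (\<lambda>n. c n * u n) J \<in> I" if "J \<subseteq> {..<Suc m * N}" for J
      using that fin.fractionalD(1,2)[OF I] by (induction J rule: infinite_finite_induct) auto
    thus ?thesis unfolding h_def by blast
  qed
  have hT: "C v \<le> v h" if "v \<in> ?T" "h \<noteq> 0" for v
  proof -
    have "vge v (int D' * v y) h" using c(3) that(1) by (auto simp: h_def)
    moreover have "int D' \<le> int D' * v y" using T(3)[OF that(1)] by (simp add: mult_le_cancel_left1)
    ultimately show ?thesis using D'[OF that(1)] that(2) by (simp add: vge_def)
  qed
  have "h \<noteq> 0"
  proof
    assume h0: "h = 0"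
    \<comment> \<open>The enumeration \<open>n = i * N + j\<close> is undone: collecting the
      coefficient of each \<open>b' j\<close> as a polynomial in \<open>x\<close> turns
      \<open>h = 0\<close> into a relation over \<open>k[x]\<close>, which independence and
      transcendence exclude.\<close>
    define p where "p j = (\<Sum>i\<le>m. monom (if j < N then c (i * N + j) else 0) i)" for j
    have idx: "i * N + j < Suc m * N" if "i \<le> m" "j < N" for i j
    proof -
      have "i * N + j < i * N + N" using that by simp
      also have "\<dots> \<le> Suc m * N" using that by (simp add: add.commute)
      finally show ?thesis .
    qed
    have cp: "coeffs_in k (p j)" for j
    proof -
      have "coeff (p j) l \<in> k" for l unfolding p_def coeff_sum
        using c(1) idx subring_0[OF k] by (intro subring_sum[OF k]) (auto simp: Polynomial.coeff_monom)
      thus ?thesis by (simp add: coeffs_in_def)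
    qed
    have "(\<Sum>j<N. poly (p j) x * b' j) = (\<Sum>j<N. \<Sum>i<Suc m. c (i * N + j) * (x ^ i * b' j))"
      by (intro sum.cong) (auto simp: p_def poly_sum poly_monom sum_distrib_right mult.assoc lessThan_Suc_atMost)
    also have "\<dots> = (\<Sum>i<Suc m. \<Sum>j<N. c (i * N + j) * (x ^ i * b' j))" by (rule sum.swap)
    also have "\<dots> = (\<Sum>i<Suc m. \<Sum>j<N. c (j + i * N) * u (j + i * N))"
      by (intro sum.cong) (auto simp: u_def add.commute)
    also have "\<dots> = (\<Sum>i<Suc m. sum (\<lambda>n. c n * u n) {i * N..<i * N + N})"
    proof (rule sum.cong[OF refl])
      fix i
      show "(\<Sum>j<N. c (j + i * N) * u (j + i * N)) = sum (\<lambda>n. c n * u n) {i * N..<i * N + N}"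
        using sum.shift_bounds_nat_ivl[of "\<lambda>n. c n * u n" 0 "i * N" N] by (simp only: atLeast0LessThan add_0 add.commute)
    qed
    also have "\<dots> = h" unfolding h_def by (rule sum.nat_group)
    finally have "(\<Sum>j<N. poly (p j) x * b' j) = 0" using h0 by simp
    hence pz: "poly (p j) x = 0" if "j < N" for j
      using b'(2)[of "\<lambda>j. poly (p j) x" j] that cp by (auto simp: poly_ring_at_eq)
    hence p0: "p j = 0" if "j < N" for j using cp transcendental that unfolding not_algebraic_iff by blast
    obtain n where n: "n < Suc m * N" "c n \<noteq> 0" using c(2) by auto
    have "coeff (p (n mod N)) (n div N) = c n"
      using dm[OF n(1)] by (simp add: p_def coeff_sum Polynomial.coeff_monom)
    thus False using p0[of "n mod N"] n N_pos by simp
  qed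
  thus ?thesis using hI hT by blast
qed

text \<open>A nonconstant \<open>f\<close> is transcendental by exactness of \<open>k\<close>, so it
  is not integral over \<open>k\<close>, and some valuation ring over \<open>k\<close> misses it.
  This ring contains \<open>x\<close> or \<open>1/x\<close>, hence is discrete and belongs to a
  place at which \<open>f\<close> has a pole.\<close>

lemma no_poles_constant:
  assumes "\<And>v. v \<in> fin.V \<Longrightarrow> vge v 0 f" "\<And>v. v \<in> inf_vals \<Longrightarrow> vge v 0 f"
  shows "f \<in> k"
proof (rule ccontr)
  assume "f \<notin> k"
  hence tr: "\<not> algebraic_over k f" using exact_constants by blast
  have f0: "f \<noteq> 0" using not_algebraic_inverse[OF k tr] by simp
  have "f \<notin> integral_closure k"
  proof
    assume "f \<in> integral_closure k"
    then obtain g where "lead_coeff g = 1" "\<forall>i. coeff g i \<in> k" "poly g f = 0"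
      unfolding integral_closure_def by blast
    moreover from this have "g \<noteq> 0" by auto
    ultimately show False using tr unfolding algebraic_over_def by blast
  qed
  then obtain R where R: "valuation_subring R" "k \<subseteq> R" "f \<notin> R"
    using not_integral_imp_valuation_ring[OF k] by metis
  have pR: "poly_ring_at k z \<subseteq> R" if "z \<in> R" for z
    using poly_in_subring[OF valuation_subringD(1)[OF R(1)] _ that] R(2) by (auto simp: poly_ring_at_def)
  have "x \<in> R \<or> y \<in> R" using valuation_subringD(2)[OF R(1)] by (auto simp: y_def)
  moreover have "R \<noteq> UNIV" using R(3) by blast
  ultimately obtain v where v: "normalized_valuation v" "val_ring v = R"
    using fin.valuation_ring_discrete[OF R(1)] inf.valuation_ring_discrete[OF R(1)] pR by metis
  have "trivial_on_k v" using trivial_on_k_if[OF v(1)] v R by simp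
  hence "v \<in> fin.V \<or> v \<in> inf_vals" using v by (auto simp: fin_V_iff inf_vals_def)
  hence "vge v 0 f" using assms by blast
  thus False using v R by (simp flip: in_val_ring_iff)
qed

text \<open>Multiply \<open>h\<close> by an element \<open>g\<close> of the inverse ideal whose
  zeros absorb the permitted poles of \<open>h\<close> at all infinite places but \<open>w\<close>.
  If the valuation of \<open>h\<close> at \<open>w\<close> exceeded \<open>- w g\<close>, then
  \<open>g * h\<close> would have no pole and a zero at \<open>w\<close>, although a nonzero
  constant has no zeros.\<close>

lemma bounded_values_ff:
  assumes n: "fin.fin_supp n" and w: "w \<in> inf_vals"
  shows "\<exists>M. \<forall>h\<in>fin.ideal_of n - {0}. (\<forall>v\<in>inf_vals. C v \<le> v h) \<longrightarrow> w h \<le> M"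
proof -
  obtain g where g: "g \<in> fin.ideal_of (\<lambda>v. - n v)" "g \<noteq> 0" "\<And>v. v \<in> inf_vals - {w} \<Longrightarrow> - C v \<le> v g"
    using exists_small_ff[OF fin.fractional_ideal_of[OF fin.fin_supp_minus[OF n]] w, of "\<lambda>v. - C v"] by blast
  have "w h \<le> - w g" if h: "h \<in> fin.ideal_of n" "h \<noteq> 0" "\<forall>v\<in>inf_vals. C v \<le> v h" for h
  proof (rule ccontr)
    assume a: "\<not> w h \<le> - w g"
    have "vge v 0 (g * h)" if v: "v \<in> fin.V" for v
    proof -
      have "vge v (- n v + n v) (g * h)"
        using g(1) h(1) v by (intro vge_mult fin.V_nv) (auto simp: fin.ideal_of_def)
      thus ?thesis by simp
    qed
    moreover have vi: "vge v 0 (g * h)" if v: "v \<in> inf_vals" for v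
      using g(2) h(2,3) a g(3)[of v] v by (cases "v = w") (fastforce simp: vge_def nv_mult inf_vals_nv)+
    ultimately have "g * h \<in> k" by (rule no_poles_constant)
    moreover have "g * h \<noteq> 0" using g h by simp
    ultimately have "w (g * h) = 0" using w by (auto simp: inf_vals_def trivial_on_k_def)
    thus False using a g(2) h(2) by (simp add: nv_mult inf_vals_nv w)
  qed
  thus ?thesis by (intro exI[of _ "- w g"]) auto
qed

end

section \<open>Residue fields at the infinite places and their degrees\<close>

lemma field_struct_on_subfield:
  assumes "subring_set k" "\<And>a. a \<in> k \<Longrightarrow> inverse a \<in> k"
  shows "field (struct_on k)"
proof -
  interpret cring "struct_on k" by (rule cring_struct_on[OF assms(1)])
  have "Units (struct_on k) = k - {0}"
    using assms(2) by (auto simp: Units_def) (metis left_inverse right_inverse)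
  thus ?thesis by (intro cring_fieldI) simp
qed

lemma subfield_struct_on:
  assumes B: "subring_set B" and k: "subring_set k" "\<And>a. a \<in> k \<Longrightarrow> inverse a \<in> k" "k \<subseteq> B"
  shows "subfield k (struct_on B)"
proof -
  interpret cring "struct_on B" by (rule cring_struct_on[OF B])
  have "(struct_on B)\<lparr>carrier := k\<rparr> = struct_on k" by (simp add: struct_on_def)
  thus ?thesis using field_struct_on_subfield[OF k(1,2)] k(3) by (intro subfield_iff(1)) auto
qed

lemma ideal_val_ideal:
  assumes v: "normalized_valuation v"
  shows "ideal (val_ideal v) (struct_on (val_ring v))"
proof -
  have B: "subring_set (val_ring v)" using valuation_subringD(1)[OF valuation_subring_val_ring(1)[OF v]] .
  interpret cring "struct_on (val_ring v)" by (rule cring_struct_on[OF B])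
  have sub: "val_ideal v \<subseteq> val_ring v" by (auto simp: val_ideal_def val_ring_def)
  show ?thesis
  proof (rule idealI)
    show "subgroup (val_ideal v) (add_monoid (struct_on (val_ring v)))"
    proof (rule add.subgroupI)
      have "0 \<in> val_ideal v" by (simp add: val_ideal_def)
      thus "val_ideal v \<noteq> {}" by blast
    next
      fix a assume a: "a \<in> val_ideal v"
      hence "\<ominus>\<^bsub>struct_on (val_ring v)\<^esub> a = - a" using struct_on_uminus[OF _ B] sub by auto
      thus "\<ominus>\<^bsub>struct_on (val_ring v)\<^esub> a \<in> val_ideal v"
        using a by (simp add: in_val_ideal_iff vge_uminus v)
    qed (use sub in \<open>auto simp: in_val_ideal_iff intro: vge_add[OF v]\<close>)
    fix a z assume "a \<in> val_ideal v" "z \<in> carrier (struct_on (val_ring v))"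
    thus "z \<otimes>\<^bsub>struct_on (val_ring v)\<^esub> a \<in> val_ideal v" "a \<otimes>\<^bsub>struct_on (val_ring v)\<^esub> z \<in> val_ideal v"
      using vge_mult[OF v, of 0 z 1 a] vge_mult[OF v, of 1 a 0 z] by (auto simp: in_val_ideal_iff in_val_ring_iff)
  qed (rule ring_axioms)
qed

text \<open>\<open>dim\<close> carries information only in finite dimension. A bound on the length
  of independent lists yields a longest one, which spans; it is nonempty as the ring is not
  zero.\<close>

lemma (in ring) dim_pos:
  assumes K: "subfield K R" and ne: "\<one> \<noteq> \<zero>"
    and bound: "\<And>Us. set Us \<subseteq> carrier R \<Longrightarrow> independent K Us \<Longrightarrow> length Us \<le> N"
  shows "0 < dim K (carrier R)"
proof -
  define P where "P n \<longleftrightarrow> (\<exists>Us. set Us \<subseteq> carrier R \<and> independent K Us \<and> length Us = n)" for n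
  have "P 0" by (auto simp: P_def)
  moreover have "\<And>n. P n \<Longrightarrow> n \<le> N" using bound by (auto simp: P_def)
  ultimately have mx: "P (GREATEST n. P n)" "\<And>n. P n \<Longrightarrow> n \<le> (GREATEST n. P n)"
    using GreatestI_nat[of P 0 N] Greatest_le_nat[of P _ N] by blast+
  then obtain Us where Us: "set Us \<subseteq> carrier R" "independent K Us" "length Us = (GREATEST n. P n)" by (auto simp: P_def)
  have "Span K Us = carrier R"
  proof (rule ccontr)
    assume "Span K Us \<noteq> carrier R"
    then obtain v where v: "v \<in> carrier R" "v \<notin> Span K Us"
      using Span_in_carrier[OF subfieldE(3)[OF K] Us(1)] by blast
    hence "P (Suc (length Us))" unfolding P_def using Us li_Cons[OF v Us(2)] by (intro exI[of _ "v # Us"]) auto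
    thus False using mx(2) Us(3) by fastforce
  qed
  hence d: "dimension (length Us) K (carrier R)" using dimensionI[OF K Us(2)] by simp
  hence "dim K (carrier R) = length Us" using dimI[OF K d] by (simp add: over_def)
  moreover have "length Us \<noteq> 0"
  proof
    assume "length Us = 0"
    hence "carrier R = {\<zero>}" using d dimension_zero[OF K] by simp
    thus False using ne one_closed by blast
  qed
  ultimately show ?thesis by simp
qed

context function_field_setting
begin

text \<open>The residue degree is at most \<open>N\<close>: lift independent residues, take a
  relation over \<open>k[y]\<close> that is primitive at \<open>y\<close>, and reduce. The terms
  with a factor \<open>y\<close> vanish in the residue field, and the constant terms give a
  nontrivial relation over \<open>k\<close>.\<close>

lemma ff_deg_pos:
  assumes v: "v \<in> inf_vals" shows "0 < ff_deg k (Nonarch v)"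
proof -
  let ?R = "struct_on (val_ring v)"
  let ?h = "\<lambda>c. val_ideal v +>\<^bsub>?R\<^esub> c"
  note nv = inf_vals_nv[OF v]
  have vV: "v \<in> inf.V" "0 < v y" using v inf_V_iff by auto
  have B: "subring_set (val_ring v)" using valuation_subringD(1)[OF valuation_subring_val_ring(1)[OF nv]] .
  interpret I: ideal "val_ideal v" ?R by (rule ideal_val_ideal[OF nv])
  have Q: "residue_field v = ?R Quot val_ideal v" by (simp add: residue_field_def)
  interpret h: ring_hom_ring ?R "residue_field v" ?h unfolding Q by (rule I.rcos_ring_hom_ring)
  have ksub: "k \<subseteq> val_ring v" using vV(1) k_subset by (auto simp: inf.V_def)
  have kf: "subfield k ?R" by (rule subfield_struct_on[OF B k k_inverse ksub])
  have zero: "\<zero>\<^bsub>residue_field v\<^esub> = val_ideal v" by (simp add: Q FactRing_def)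
  have h0: "?h c = \<zero>\<^bsub>residue_field v\<^esub> \<longleftrightarrow> c \<in> val_ideal v" if "c \<in> val_ring v" for c
    unfolding zero using that I.a_rcos_const I.a_rcos_self by (metis struct_on_simps(1))
  have "1 \<notin> val_ideal v" by (simp add: val_ideal_def nv_1 nv)
  hence ne: "\<one>\<^bsub>residue_field v\<^esub> \<noteq> \<zero>\<^bsub>residue_field v\<^esub>"
    using h0[of 1] h.hom_one subring_1[OF B] by simp
  have inj: "inj_on ?h k" and Kf: "subfield (?h ` k) (residue_field v)" using h.img_is_subfield[OF kf ne] by auto
  have "length Us \<le> N" if Us: "set Us \<subseteq> carrier (residue_field v)" "h.S.independent (?h ` k) Us" for Us
  proof (rule ccontr)
    assume len: "\<not> length Us \<le> N"
    have "\<forall>U\<in>carrier (residue_field v). \<exists>u\<in>val_ring v. ?h u = U"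
      by (auto simp: Q FactRing_def A_RCOSETS_def' )
    then obtain r where r: "\<And>U. U \<in> carrier (residue_field v) \<Longrightarrow> r U \<in> val_ring v \<and> ?h (r U) = U" by metis
    define us where "us = map r Us"
    have us: "map ?h us = Us" "set us \<subseteq> val_ring v" "length us = length Us"
      using r Us(1) by (auto simp: us_def subset_iff intro!: map_idI)
    define n where "n = length Us"
    have "finite {..<n}" "N < card {..<n}" using len by (auto simp: n_def)
    from inf.primitive_dependent[OF generator_in_poly_ring_at[OF k] inverse_not_in_poly_ring_at[OF k y_transcendental] this, of "\<lambda>i. us ! i"]
    obtain c where c: "\<And>i. i \<in> {..<n} \<Longrightarrow> c i \<in> poly_ring_at k y" "\<exists>i\<in>{..<n}. c i / y \<notin> poly_ring_at k y"
      "(\<Sum>i\<in>{..<n}. c i * us ! i) = 0" by metis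
    have "\<forall>i\<in>{..<n}. \<exists>a g. a \<in> k \<and> g \<in> poly_ring_at k y \<and> c i = a + y * g"
    proof
      fix i assume "i \<in> {..<n}"
      then obtain f where f: "coeffs_in k f" "c i = poly f y" using c(1)[of i] by (auto simp: poly_ring_at_eq)
      obtain a g where "f = pCons a g" by (cases f)
      thus "\<exists>a g. a \<in> k \<and> g \<in> poly_ring_at k y \<and> c i = a + y * g"
        using f by (auto simp: coeffs_in_pCons poly_ring_at_eq)
    qed
    then obtain a g where ag: "\<And>i. i \<in> {..<n} \<Longrightarrow> a i \<in> k" "\<And>i. i \<in> {..<n} \<Longrightarrow> g i \<in> poly_ring_at k y"
      "\<And>i. i \<in> {..<n} \<Longrightarrow> c i = a i + y * g i" by metis
    obtain i0 where i0: "i0 \<in> {..<n}" "a i0 \<noteq> 0"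
    proof -
      obtain i where i: "i \<in> {..<n}" "c i / y \<notin> poly_ring_at k y" using c(2) by blast
      have "a i \<noteq> 0"
      proof
        assume "a i = 0"
        hence "c i / y = g i" using ag(3)[OF i(1)] y_nonzero by simp
        thus False using i ag(2) by simp
      qed
      thus thesis using that i by blast
    qed
    have "(\<Sum>i\<in>{..<n}. c i * us ! i) = (\<Sum>i\<in>{..<n}. a i * us ! i) + y * (\<Sum>i\<in>{..<n}. g i * us ! i)"
      unfolding sum_distrib_left sum.distrib[symmetric] using ag(3) by (intro sum.cong) (auto simp: algebra_simps)
    hence e: "(\<Sum>i<n. a i * us ! i) = - (y * (\<Sum>i<n. g i * us ! i))" using c(3) by (simp add: eq_neg_iff_add_eq_0)
    have "vge v (1 + 0) (y * (\<Sum>i<n. g i * us ! i))"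
    proof (intro vge_mult[OF nv] vge_sum[OF nv])
      show "vge v 1 y" using vV by (simp add: vge_def)
      fix i assume i: "i \<in> {..<n}"
      have "vge v 0 (us ! i)" using us(2,3) i by (auto simp: n_def in_val_ring_iff[symmetric])
      from vge_mult[OF nv inf.V_nonneg[OF vV(1) ag(2)[OF i]] this] show "vge v 0 (g i * us ! i)" by simp
    qed
    hence mem: "(\<Sum>i<n. a i * us ! i) \<in> val_ideal v" unfolding e by (simp add: in_val_ideal_iff vge_uminus nv)
    define as where "as = map a [0..<n]"
    have as: "length as = length us" "set as \<subseteq> k" "set as \<subseteq> val_ring v" using ag(1) ksub us(3) by (auto simp: as_def n_def)
    have "ring.combine ?R as us = (\<Sum>i<n. a i * us ! i)"
      unfolding combine_struct_on[OF B as(1)] using us(3) by (intro sum.cong) (auto simp: n_def as_def)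
    moreover have "h.S.combine (map ?h as) (map ?h us) = ?h (ring.combine ?R as us)"
      by (rule h.combine_hom) (use as(3) us(2) in simp_all)
    moreover have "(\<Sum>i<n. a i * us ! i) \<in> val_ring v" using mem by (auto simp: val_ideal_def val_ring_def)
    ultimately have "h.S.combine (map ?h as) Us = \<zero>\<^bsub>residue_field v\<^esub>"
      using h0 mem us(1) by metis
    moreover have "set (map ?h as) \<subseteq> ?h ` k" using as(2) by auto
    ultimately have "set (take (length Us) (map ?h as)) \<subseteq> {\<zero>\<^bsub>residue_field v\<^esub>}"
      using h.S.independent_imp_trivial_combine[OF Kf Us(2)] by blast
    moreover have "take (length Us) (map ?h as) = map ?h as" using as(1) us(3) by simp
    moreover have "?h (a i0) \<in> set (map ?h as)" using i0 by (auto simp: as_def)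
    ultimately have "?h (a i0) = \<zero>\<^bsub>residue_field v\<^esub>" by auto
    hence "a i0 \<in> val_ideal v" using h0 ag(1)[OF i0(1)] ksub by blast
    moreover have "v (a i0) = 0" using v ag(1)[OF i0(1)] i0(2) by (auto simp: inf_vals_def trivial_on_k_def)
    ultimately show False using i0(2) by (simp add: val_ideal_def)
  qed
  from h.S.dim_pos[OF Kf ne this] show ?thesis by simp
qed

lemma ff_setting_ff_data:
  assumes q: "1 < q" and qs: "distinct qs" "set qs = ff_inf_places k x"
  shows "ff_setting (poly_ring_at k x) N (ff_data k x q qs)"
proof -
  let ?X = "ff_data k x q qs"
  have S: "set qs = Nonarch ` inf_vals" using qs ff_inf_places_eq by simp
  interpret ar: arith_setting "poly_ring_at k x" N ?X
    by unfold_locales (use S ff_places_eq in \<open>auto simp: ff_data_def\<close>)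
  have ne: "qs \<noteq> []" using S inf_vals_nonempty by auto
  show ?thesis
  proof unfold_locales
    show "inf_places ?X \<noteq> []" "distinct (inf_places ?X)" "1 < abs_base ?X" using ne qs q by (auto simp: ff_data_def)
    show "set (inf_places ?X) \<subseteq> all_places ?X" using S ff_places_eq by (auto simp: ff_data_def)
    show "coef_group ?X = \<int>" by (simp add: ff_data_def)
    show "0 \<in> coef_group ?X" "1 \<in> coef_group ?X" by (simp_all add: ff_data_def)
    show "c + d \<in> coef_group ?X" if "c \<in> coef_group ?X" "d \<in> coef_group ?X" for c d using that by (simp add: ff_data_def)
    show "- c \<in> coef_group ?X" if "c \<in> coef_group ?X" for c using that by (simp add: ff_data_def)
  next
    fix p assume "p \<in> set (inf_places ?X)"
    then obtain v where v: "v \<in> inf_vals" "p = Nonarch v" using S by (auto simp: ff_data_def)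
    show "0 < place_deg ?X p" using ff_deg_pos[OF v(1)] v(2) by (simp add: ff_data_def del: ff_deg.simps)
    show "place_val p (a * b) = place_val p a + place_val p b" if "a \<noteq> 0" "b \<noteq> 0" for a b
      using that v by (simp add: nv_mult inf_vals_nv)
    show "place_val p a \<in> coef_group ?X" for a using v by (simp add: ff_data_def)
  next
    fix I :: "'a set" and C :: "'a place \<Rightarrow> real"
    assume "frac_ideal ?X I"
    hence I: "fin.fractional I" by (simp add: ar.frac_ideal_iff)
    have "last qs \<in> set qs" using ne by simp
    then obtain w where w: "w \<in> inf_vals" "last qs = Nonarch w" unfolding S by auto
    \<comment> \<open>The bounds \<open>C\<close> are real and the valuations integral, so the
      bounds are rounded up.\<close>
    obtain h where h: "h \<in> I - {0}" "\<And>v. v \<in> inf_vals - {w} \<Longrightarrow> \<lceil>C (Nonarch v)\<rceil> \<le> v h"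
      using exists_small_ff[OF I w(1), of "\<lambda>v. \<lceil>C (Nonarch v)\<rceil>"] by blast
    have "C (Nonarch v) \<le> place_val (Nonarch v) h" if "v \<in> inf_vals" "v \<noteq> w" for v
      using h(2)[of v] that by (simp add: ceiling_le_iff)
    note hC = this
    show "\<exists>h\<in>I - {0}. \<forall>p\<in>set (inf_places ?X) - {last (inf_places ?X)}. C p \<le> place_val p h"
    proof (intro bexI[OF _ h(1)] ballI)
      fix p assume p: "p \<in> set (inf_places ?X) - {last (inf_places ?X)}"
      hence "p \<in> Nonarch ` inf_vals" "p \<noteq> Nonarch w" using S w(2) by (simp_all add: ff_data_def)
      thus "C p \<le> place_val p h" using hC by blast
    qed
  next
    fix I :: "'a set" and C :: "'a place \<Rightarrow> real"
    assume "frac_ideal ?X I"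
    hence I: "fin.fractional I" by (simp add: ar.frac_ideal_iff)
    obtain n where n: "fin.fin_supp n" "I = fin.ideal_of n" using fin.fractionalE[OF I] by metis
    have "\<forall>w\<in>inf_vals. \<exists>M. \<forall>h\<in>I - {0}. (\<forall>v\<in>inf_vals. \<lceil>C (Nonarch v)\<rceil> \<le> v h) \<longrightarrow> w h \<le> M"
      using bounded_values_ff[OF n(1), of _ "\<lambda>v. \<lceil>C (Nonarch v)\<rceil>"] unfolding n(2) by blast
    then obtain M where M: "\<And>w h. w \<in> inf_vals \<Longrightarrow> h \<in> I - {0} \<Longrightarrow> (\<forall>v\<in>inf_vals. \<lceil>C (Nonarch v)\<rceil> \<le> v h) \<Longrightarrow> w h \<le> M w"
      by metis
    define B where "B = (\<Union>w\<in>inf_vals. real_of_int ` {\<lceil>C (Nonarch w)\<rceil>..M w})"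
    have "finite B" using finite_inf_vals by (simp add: B_def)
    have "map (\<lambda>p. place_val p h) qs \<in> {l. set l \<subseteq> B \<and> length l = length qs}"
      if h: "h \<in> I - {0}" "\<forall>p\<in>set qs. C p \<le> place_val p h" for h
    proof -
      have c: "\<forall>v\<in>inf_vals. \<lceil>C (Nonarch v)\<rceil> \<le> v h" using h(2) unfolding S by (auto simp: ceiling_le_iff)
      have "place_val p h \<in> B" if "p \<in> set qs" for p
      proof -
        obtain w where w: "w \<in> inf_vals" "p = Nonarch w" using \<open>p \<in> set qs\<close> unfolding S by auto
        hence "w h \<in> {\<lceil>C (Nonarch w)\<rceil>..M w}" using M[OF _ h(1) c] c by simp
        hence "place_val p h \<in> real_of_int ` {\<lceil>C (Nonarch w)\<rceil>..M w}" using w(2) by (simp add: image_iff)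
        thus ?thesis using w(1) unfolding B_def by blast
      qed
      thus ?thesis by auto
    qed
    hence "(\<lambda>h. map (\<lambda>p. place_val p h) (inf_places ?X)) ` {h \<in> I - {0}. \<forall>p\<in>set (inf_places ?X). C p \<le> place_val p h}
       \<subseteq> {l. set l \<subseteq> B \<and> length l = length qs}" unfolding ff_data_def by (simp only: arith_data.simps) blast
    thus "finite ((\<lambda>h. map (\<lambda>p. place_val p h) (inf_places ?X)) ` {h \<in> I - {0}. \<forall>p\<in>set (inf_places ?X). C p \<le> place_val p h})"
      using finite_lists_length_eq[OF \<open>finite B\<close>] by (rule finite_subset)
  qed
qed

end

theorem function_field_bijection:
  fixes k :: "'b::field set"
  assumes ff: "function_field k" and x: "\<not> algebraic_over k x" and q: "1 < q"
    and qs: "distinct qs" "set qs = ff_inf_places k x"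
  shows "(C, t) \<in> Rep (ff_data k x q qs) \<Longrightarrow> I \<in> C \<Longrightarrow> Phi_ff (ff_data k x q qs) (C, t) = ff_value (ff_data k x q qs) I t"
    and "bij_betw (Phi_ff (ff_data k x q qs)) (Rep (ff_data k x q qs)) (carrier (Pic_mod_last (ff_data k x q qs)))"
proof -
  have sub: "subfield k (struct_on UNIV)" using ff by (simp add: function_field_def)
  have k: "subring_set k" "\<And>a. a \<in> k \<Longrightarrow> inverse a \<in> k" using sub subfield_struct_iff by blast+
  obtain x0 where "ring.finite_dimension (struct_on UNIV) (rat_field_at k x0) UNIV"
    using ff by (auto simp: function_field_def)
  from bounded_rank_change_variable[OF sub x this] obtain M where M: "bounded_rank (poly_ring_at k x) M" by blast
  obtain N b where N: "bounded_rank (poly_ring_at k x) N" "N > 0"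
    "\<And>c i. (\<And>i. c i \<in> poly_ring_at k x) \<Longrightarrow> (\<Sum>i<N. c i * b i) = 0 \<Longrightarrow> i < N \<Longrightarrow> c i = 0"
    by (rule bounded_rank_minimal[OF subring_poly_ring_at[OF k(1)] M]) blast
  interpret function_field_setting k x N b
    by unfold_locales (use k x N ff in \<open>auto simp: function_field_def\<close>)
  interpret ff_setting "poly_ring_at k x" N "ff_data k x q qs" by (rule ff_setting_ff_data[OF q qs])
  show "(C, t) \<in> Rep (ff_data k x q qs) \<Longrightarrow> I \<in> C \<Longrightarrow> Phi_ff (ff_data k x q qs) (C, t) = ff_value (ff_data k x q qs) I t"
    by (rule ff_bijection(1))
  show "bij_betw (Phi_ff (ff_data k x q qs)) (Rep (ff_data k x q qs)) (carrier (Pic_mod_last (ff_data k x q qs)))"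
    by (rule ff_bijection(2))
qed

section \<open>Embeddings of number fields\<close>

text \<open>Integer coefficients allow one polynomial to be evaluated both in the number field and
  in the complex numbers.\<close>

definition ev :: "int poly \<Rightarrow> 'a::field_char_0 \<Rightarrow> 'a" where
  "ev p z = poly (map_poly of_int p) z"

lemma map_poly_of_int_ops:
  "map_poly of_int (p + q) = (map_poly of_int p + map_poly of_int q :: 'a::field_char_0 poly)"
  "map_poly of_int (p - q) = (map_poly of_int p - map_poly of_int q :: 'a::field_char_0 poly)"
  "map_poly of_int (p * q) = (map_poly of_int p * map_poly of_int q :: 'a::field_char_0 poly)"
  by (auto intro!: poly_eqI simp: coeff_map_poly coeff_mult)

lemma ev_simps [simp]:
  "ev (p + q) z = ev p z + ev q z" "ev (p - q) z = ev p z - ev q z" "ev (p * q) z = ev p z * ev q z"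
  "ev [:c:] z = of_int c" "ev 0 z = 0" "ev 1 z = 1" "ev (pCons c p) z = of_int c + z * ev p z"
  by (simp_all add: ev_def map_poly_of_int_ops map_poly_pCons)

lemma ev_smult [simp]: "ev (smult c p) z = of_int c * ev p z"
  using ev_simps(3)[of "[:c:]" p z] by (simp del: ev_simps(3) add: mult.commute)

definition field_emb :: "('a::field_char_0 \<Rightarrow> complex) \<Rightarrow> bool" where
  "field_emb \<sigma> \<longleftrightarrow> \<sigma> \<in> ring_hom (struct_on UNIV) (struct_on UNIV)"

lemma field_emb_iff:
  "field_emb \<sigma> \<longleftrightarrow> \<sigma> 1 = 1 \<and> (\<forall>a b. \<sigma> (a + b) = \<sigma> a + \<sigma> b) \<and> (\<forall>a b. \<sigma> (a * b) = \<sigma> a * \<sigma> b)"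
  by (auto simp: field_emb_def ring_hom_def)

lemma field_embD:
  assumes "field_emb \<sigma>"
  shows "\<sigma> 1 = 1" "\<sigma> (a + b) = \<sigma> a + \<sigma> b" "\<sigma> (a * b) = \<sigma> a * \<sigma> b" "\<sigma> 0 = 0" "\<sigma> (- a) = - \<sigma> a" "\<sigma> (a - b) = \<sigma> a - \<sigma> b"
    "\<sigma> (of_int m) = of_int m" "\<sigma> (a ^ n) = \<sigma> a ^ n" "\<sigma> (sum f I) = (\<Sum>i\<in>I. \<sigma> (f i))" "\<sigma> a = 0 \<longleftrightarrow> a = 0"
    "\<sigma> (inverse a) = inverse (\<sigma> a)" "\<sigma> (ev p a) = ev p (\<sigma> a)"
proof -
  show 1: "\<sigma> 1 = 1" and add: "\<sigma> (a + b) = \<sigma> a + \<sigma> b" and mult: "\<sigma> (a * b) = \<sigma> a * \<sigma> b" for a b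
    using assms by (auto simp: field_emb_iff)
  show 0: "\<sigma> 0 = 0" using add[of 0 0] by simp
  show m: "\<sigma> (- a) = - \<sigma> a" for a using add[of a "- a"] 0 by (simp add: eq_neg_iff_add_eq_0 add.commute)
  show d: "\<sigma> (a - b) = \<sigma> a - \<sigma> b" for a b using add[of a "- b"] m[of b] by simp
  have nat: "\<sigma> (of_nat k) = of_nat k" for k by (induction k) (auto simp: 0 1 add)
  show i: "\<sigma> (of_int m) = of_int m" for m by (cases m rule: int_diff_cases) (simp add: d nat)
  show "\<sigma> (a ^ n) = \<sigma> a ^ n" by (induction n) (auto simp: 1 mult)
  show "\<sigma> (sum f I) = (\<Sum>i\<in>I. \<sigma> (f i))" by (induction I rule: infinite_finite_induct) (auto simp: 0 add)
  show z: "\<sigma> a = 0 \<longleftrightarrow> a = 0" for a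
    using mult[of a "inverse a"] 0 1 by (cases "a = 0") auto
  show "\<sigma> (inverse a) = inverse (\<sigma> a)"
  proof (cases "a = 0")
    case False
    thus ?thesis using mult[of a "inverse a"] 1 by (simp add: inverse_unique)
  qed (simp add: 0)
  show "\<sigma> (ev p a) = ev p (\<sigma> a)" by (induction p) (auto simp: add mult i 0)
qed

lemma field_emb_cnj: "field_emb \<sigma> \<Longrightarrow> field_emb (cnj \<circ> \<sigma>)"
  by (simp add: field_emb_iff)

text \<open>The graph of a ring homomorphism from a subring into the complex numbers. Partial
  homomorphisms become sets of pairs, so that extension is inclusion; the condition at
  \<open>0\<close> makes the relation single-valued.\<close>

definition hom_graph :: "('a::field_char_0 \<times> complex) set \<Rightarrow> bool" where
  "hom_graph G \<longleftrightarrow> (1, 1) \<in> G \<and> (\<forall>w. (0, w) \<in> G \<longrightarrow> w = 0) \<and>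
     (\<forall>a b c d. (a, b) \<in> G \<longrightarrow> (c, d) \<in> G \<longrightarrow> (a - c, b - d) \<in> G \<and> (a * c, b * d) \<in> G)"

lemma hom_graphD:
  assumes "hom_graph G"
  shows "(1, 1) \<in> G" "(0, w) \<in> G \<Longrightarrow> w = 0" "(a, b) \<in> G \<Longrightarrow> (c, d) \<in> G \<Longrightarrow> (a - c, b - d) \<in> G"
    "(a, b) \<in> G \<Longrightarrow> (c, d) \<in> G \<Longrightarrow> (a * c, b * d) \<in> G" "(0, 0) \<in> G"
    "(a, b) \<in> G \<Longrightarrow> (- a, - b) \<in> G" "(a, b) \<in> G \<Longrightarrow> (c, d) \<in> G \<Longrightarrow> (a + c, b + d) \<in> G"
    "(of_int m, of_int m) \<in> G" "(a, b) \<in> G \<Longrightarrow> (a, b') \<in> G \<Longrightarrow> b = b'"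
proof -
  show 1: "(1, 1) \<in> G" and z: "(0, w) \<in> G \<Longrightarrow> w = 0"
    and d: "(a, b) \<in> G \<Longrightarrow> (c, d) \<in> G \<Longrightarrow> (a - c, b - d) \<in> G"
    and "(a, b) \<in> G \<Longrightarrow> (c, d) \<in> G \<Longrightarrow> (a * c, b * d) \<in> G" for a b c d w
    using assms unfolding hom_graph_def by blast+
  show 0: "(0, 0) \<in> G" using d[OF 1 1] by simp
  show m: "(a, b) \<in> G \<Longrightarrow> (- a, - b) \<in> G" for a b using d[OF 0, of a b] by simp
  show add: "(a, b) \<in> G \<Longrightarrow> (c, d) \<in> G \<Longrightarrow> (a + c, b + d) \<in> G" for a b c d using d[OF _ m, of a b c d] by simp
  have nat: "(of_nat k, of_nat k) \<in> G" for k by (induction k) (auto simp: 0 intro: add 1)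
  show "(of_int m, of_int m) \<in> G" by (cases m rule: int_diff_cases) (simp add: d nat)
  show "(a, b) \<in> G \<Longrightarrow> (a, b') \<in> G \<Longrightarrow> b = b'" using d[of a b a b'] z by force
qed

lemma hom_graph_ev:
  assumes G: "hom_graph G" and ab: "(a, b) \<in> G" shows "(ev p a, ev p b) \<in> G"
proof (induction p)
  case (pCons c p)
  thus ?case using hom_graphD(4)[OF G ab] hom_graphD(7,8)[OF G] by simp
qed (use hom_graphD(5)[OF G] in simp)

text \<open>Polynomials over the domain of the partial homomorphism, each paired with its image
  under coefficientwise transport.\<close>

definition poly_pairs :: "('a::field_char_0 \<times> complex) set \<Rightarrow> ('a poly \<times> complex poly) set" where
  "poly_pairs G = {(f, g). \<forall>i. (coeff f i, coeff g i) \<in> G}"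

lemma hom_graph_sum:
  assumes "hom_graph G" "\<And>i. i \<in> I \<Longrightarrow> (f i, g i) \<in> G" shows "(sum f I, sum g I) \<in> G"
  using assms(2) by (induction I rule: infinite_finite_induct) (auto intro: hom_graphD(5,7)[OF assms(1)])

lemma poly_pairs_ops:
  assumes G: "hom_graph G"
  shows "(f, g) \<in> poly_pairs G \<Longrightarrow> (f', g') \<in> poly_pairs G \<Longrightarrow> (f - f', g - g') \<in> poly_pairs G"
    "(f, g) \<in> poly_pairs G \<Longrightarrow> (f', g') \<in> poly_pairs G \<Longrightarrow> (f * f', g * g') \<in> poly_pairs G"
    "(a, b) \<in> G \<Longrightarrow> (monom a n, monom b n) \<in> poly_pairs G"
  using hom_graphD[OF G]
  by (auto simp: poly_pairs_def coeff_mult Polynomial.coeff_monom intro!: hom_graph_sum[OF G])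

text \<open>Take a polynomial \<open>f\<close> of least degree over the domain that vanishes at
  \<open>z\<close>, and send \<open>z\<close> to a root \<open>w\<close> of its transport
  \<open>g\<close>. To see that this is well defined, any \<open>f'\<close> vanishing at
  \<open>z\<close> is reduced by \<open>f\<close>. The domain is only a ring, so the leading
  coefficients are multiplied crosswise; this is harmless because the transported leading
  coefficient is nonzero.\<close>

lemma hom_graph_extend:
  fixes G :: "('a::field_char_0 \<times> complex) set"
  assumes G: "hom_graph G" and alg: "\<And>z::'a. \<exists>p. p \<noteq> 0 \<and> ev p z = 0"
  shows "\<exists>w G'. hom_graph G' \<and> G \<subseteq> G' \<and> (z, w) \<in> G'"
proof -
  \<comment> \<open>Injectivity: if a nonzero \<open>a\<close> were sent to \<open>0\<close>, an
    integer polynomial of least degree vanishing at \<open>a\<close> would have constant term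
    \<open>0\<close>, and removing the factor \<open>X\<close> would lower its degree.\<close>
  have nonzero: "b \<noteq> 0" if ab: "(a, b) \<in> G" "a \<noteq> 0" for a b
  proof
    assume b: "b = 0"
    define P where "P p \<longleftrightarrow> p \<noteq> 0 \<and> ev p a = 0" for p
    define p where "p = arg_min degree P"
    obtain p0 where "P p0" using alg[of a] by (auto simp: P_def)
    hence p: "P p" "\<And>q. P q \<Longrightarrow> degree p \<le> degree q"
      using arg_min_nat_lemma[of P p0 degree] by (auto simp: p_def)
    obtain c q where cq: "p = pCons c q" by (cases p)
    have "(ev p a, ev p b) \<in> G" by (rule hom_graph_ev[OF G ab(1)])
    hence "ev p b = 0" using p(1) hom_graphD(2)[OF G] by (simp add: P_def)
    hence "c = 0" using b cq by simp
    hence "ev q a = 0" "q \<noteq> 0" using p(1) cq ab(2) by (auto simp: P_def)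
    hence "degree p \<le> degree q" using p(2) by (simp add: P_def)
    thus False using cq \<open>q \<noteq> 0\<close> by simp
  qed
  define Q where "Q f \<longleftrightarrow> f \<noteq> 0 \<and> (\<exists>g. (f, g) \<in> poly_pairs G) \<and> poly f z = 0" for f
  define f where "f = arg_min degree Q"
  have "Ex Q"
  proof -
    obtain p where p: "p \<noteq> 0" "ev p z = 0" using alg by blast
    have "(map_poly of_int p, map_poly of_int p) \<in> poly_pairs G"
      using hom_graphD(8)[OF G] by (simp add: poly_pairs_def coeff_map_poly)
    moreover have "map_poly of_int p \<noteq> (0 :: 'a poly)" using p(1) by (simp add: map_poly_eq_0_iff)
    moreover have "poly (map_poly of_int p) z = 0" using p(2) by (simp add: ev_def)
    ultimately have "Q (map_poly of_int p)" unfolding Q_def by blast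
    thus ?thesis ..
  qed
  hence f: "Q f" "\<And>h. Q h \<Longrightarrow> degree f \<le> degree h"
    unfolding f_def using arg_min_nat_lemma[of Q _ degree] by auto
  obtain g where g: "(f, g) \<in> poly_pairs G" using f(1) by (auto simp: Q_def)
  define d where "d = degree f"
  have d0: "d \<noteq> 0"
  proof
    assume "d = 0"
    then obtain a where "f = [:a:]" unfolding d_def by (metis degree_eq_zeroE)
    thus False using f(1) by (auto simp: Q_def)
  qed
  have gd: "coeff g d \<noteq> 0"
    using nonzero[of "coeff f d" "coeff g d"] g f(1) by (auto simp: poly_pairs_def Q_def d_def)
  have "coeff g i = 0" if "i > d" for i
  proof -
    have "(coeff f i, coeff g i) \<in> G" using g by (simp add: poly_pairs_def)
    thus ?thesis using hom_graphD(2)[OF G] that by (simp add: d_def coeff_eq_0)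
  qed
  hence dg: "degree g = d" using gd by (intro antisym degree_le le_degree) auto
  hence "\<not> constant (poly g)" using d0 by (simp add: constant_degree)
  then obtain w where w: "poly g w = 0" using fundamental_theorem_of_algebra by blast
  have key: "poly g' w = 0" if "(f', g') \<in> poly_pairs G" "poly f' z = 0" for f' g'
    using that
  proof (induction "degree f'" arbitrary: f' g' rule: less_induct)
    case less
    show ?case
    proof (cases "f' = 0")
      case True
      hence "coeff g' i = 0" for i
        using less.prems(1) hom_graphD(2)[OF G] by (auto simp: poly_pairs_def)
      hence "g' = 0" by (simp add: poly_eqI)
      thus ?thesis by simp
    next
      case False
      hence le: "d \<le> degree f'" using f(2)[of f'] less.prems by (auto simp: Q_def d_def)
      define m where "m = degree f'"
      define a b a' b' where ab: "a = coeff f d" "b = coeff g d" "a' = coeff f' m" "b' = coeff g' m"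
      have G1: "(a, b) \<in> G" "(a', b') \<in> G" using g less.prems(1) by (auto simp: poly_pairs_def ab)
      define f2 where "f2 = monom a 0 * f' - monom a' (m - d) * f"
      define g2 where "g2 = monom b 0 * g' - monom b' (m - d) * g"
      have p2: "(f2, g2) \<in> poly_pairs G" unfolding f2_def g2_def
        by (intro poly_pairs_ops[OF G] G1 less.prems(1) g)
      have z2: "poly f2 z = 0" using less.prems(2) f(1) by (simp add: f2_def Q_def poly_monom)
      have "degree f2 < m"
      proof -
        have a0: "a \<noteq> 0" "a' \<noteq> 0" using f(1) False by (auto simp: ab d_def m_def Q_def)
        have c1: "coeff (monom a 0 * f') m = a * a'" by (simp add: ab monom_0)
        have "coeff (monom a' (m - d) * f) m = a' * a"
          using le by (simp add: coeff_monom_mult ab m_def)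
        hence "coeff f2 m = 0" using c1 by (simp add: f2_def)
        moreover have "degree f2 \<le> m" unfolding f2_def
        proof (rule degree_diff_le)
          show "degree (monom a 0 * f') \<le> m" by (simp add: monom_0 m_def)
          have "degree (monom a' (m - d) * f) \<le> (m - d) + d"
            by (rule order_trans[OF degree_mult_le]) (use Polynomial.degree_monom_le[of a' "m - d"] in \<open>simp add: d_def\<close>)
          thus "degree (monom a' (m - d) * f) \<le> m" using le by (simp add: m_def)
        qed
        moreover have "m \<noteq> 0" using le d0 by (simp add: m_def)
        ultimately show ?thesis by (metis degree_0 le_neq_implies_less leading_coeff_0_iff not_gr_zero)
      qed
      hence "poly g2 w = 0" using less.hyps[OF _ p2 z2] by (simp add: m_def)
      hence "b * poly g' w = 0" using w by (simp add: g2_def poly_monom)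
      thus ?thesis using gd by (simp add: ab)
    qed
  qed
  define G' where "G' = (\<lambda>(f, g). (poly f z, poly g w)) ` poly_pairs G"
  have "hom_graph G'" unfolding hom_graph_def
  proof (intro conjI allI impI)
    have "(monom 1 0, monom 1 0) \<in> poly_pairs G" by (intro poly_pairs_ops[OF G] hom_graphD[OF G])
    thus "(1, 1) \<in> G'" unfolding G'_def by (rule rev_image_eqI) (simp add: poly_monom)
    show "u = 0" if "(0, u) \<in> G'" for u using that key by (auto simp: G'_def)
    fix a b c e assume "(a, b) \<in> G'" "(c, e) \<in> G'"
    then obtain f1 g1 f2 g2 where h: "(f1, g1) \<in> poly_pairs G" "(f2, g2) \<in> poly_pairs G"
      "a = poly f1 z" "b = poly g1 w" "c = poly f2 z" "e = poly g2 w" by (auto simp: G'_def)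
    show "(a - c, b - e) \<in> G'" unfolding G'_def
      using poly_pairs_ops(1)[OF G h(1,2)] h by (intro rev_image_eqI) auto
    show "(a * c, b * e) \<in> G'" unfolding G'_def
      using poly_pairs_ops(2)[OF G h(1,2)] h by (intro rev_image_eqI) auto
  qed
  moreover have "G \<subseteq> G'"
  proof
    fix r assume "r \<in> G"
    then obtain a b where r: "r = (a, b)" "(a, b) \<in> G" by (cases r) auto
    from poly_pairs_ops(3)[OF G r(2), of 0] show "r \<in> G'"
      unfolding G'_def r(1) by (rule rev_image_eqI) (simp add: poly_monom)
  qed
  moreover have "(z, w) \<in> G'"
  proof -
    have "(monom 1 1, monom 1 1) \<in> poly_pairs G" by (intro poly_pairs_ops[OF G] hom_graphD[OF G])
    thus ?thesis unfolding G'_def by (rule rev_image_eqI) (simp add: poly_monom)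
  qed
  ultimately show ?thesis by blast
qed

text \<open>Every complex number that satisfies all integer relations of \<open>h\<close> is the
  image of \<open>h\<close> under an embedding. Start from the homomorphism defined on \<int>[h] and
  extend maximally; \<open>hom_graph_extend\<close> makes a maximal graph total.\<close>

lemma field_emb_extension:
  fixes h :: "'a::field_char_0"
  assumes alg: "\<And>z::'a. \<exists>p. p \<noteq> 0 \<and> ev p z = 0" and \<beta>: "\<And>p. ev p h = 0 \<Longrightarrow> ev p \<beta> = 0"
  obtains \<sigma> where "field_emb \<sigma>" "\<sigma> h = \<beta>"
proof -
  define G0 where "G0 = range (\<lambda>p. (ev p h, ev p \<beta>))"
  have G0: "hom_graph G0" unfolding hom_graph_def
  proof (intro conjI allI impI)
    show "(1, 1) \<in> G0" unfolding G0_def by (rule range_eqI[of _ _ 1]) simp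
    show "w = 0" if "(0, w) \<in> G0" for w using that \<beta> by (force simp: G0_def)
    fix a b c d assume "(a, b) \<in> G0" "(c, d) \<in> G0"
    then obtain p q where pq: "a = ev p h" "b = ev p \<beta>" "c = ev q h" "d = ev q \<beta>" by (auto simp: G0_def)
    show "(a - c, b - d) \<in> G0" unfolding G0_def pq by (rule range_eqI[of _ _ "p - q"]) simp
    show "(a * c, b * d) \<in> G0" unfolding G0_def pq by (rule range_eqI[of _ _ "p * q"]) simp
  qed
  define F where "F = {G. hom_graph G \<and> G0 \<subseteq> G}"
  have "\<exists>G\<in>F. \<forall>H\<in>F. G \<subseteq> H \<longrightarrow> H = G"
  proof (rule subset_Zorn_nonempty)
    show "F \<noteq> {}" using G0 by (auto simp: F_def)
    fix \<C> assume ne: "\<C> \<noteq> {}" and ch: "subset.chain F \<C>"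
    have CF: "\<And>G. G \<in> \<C> \<Longrightarrow> hom_graph G" "\<And>G. G \<in> \<C> \<Longrightarrow> G0 \<subseteq> G" and lin: "\<And>H H'. H \<in> \<C> \<Longrightarrow> H' \<in> \<C> \<Longrightarrow> H \<subseteq> H' \<or> H' \<subseteq> H"
      using ch by (auto simp: subset_chain_def F_def)
    have two: "\<exists>H\<in>\<C>. a \<in> H \<and> b \<in> H" if "a \<in> \<Union>\<C>" "b \<in> \<Union>\<C>" for a b
      using that lin by (meson UnionE subsetD)
    have "hom_graph (\<Union>\<C>)" unfolding hom_graph_def
    proof (intro conjI allI impI)
      show "(1, 1) \<in> \<Union>\<C>" using ne CF(1) hom_graphD(1) by blast
      show "w = 0" if "(0, w) \<in> \<Union>\<C>" for w using that CF(1) hom_graphD(2) by blast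
      fix a b c d assume "(a, b) \<in> \<Union>\<C>" "(c, d) \<in> \<Union>\<C>"
      then obtain H where "H \<in> \<C>" "(a, b) \<in> H" "(c, d) \<in> H" using two by blast
      thus "(a - c, b - d) \<in> \<Union>\<C>" "(a * c, b * d) \<in> \<Union>\<C>" using hom_graphD(3,4)[OF CF(1)] by blast+
    qed
    thus "\<Union>\<C> \<in> F" using ne CF(2) by (auto simp: F_def)
  qed
  then obtain G where G: "hom_graph G" "G0 \<subseteq> G" and mx: "\<And>H. hom_graph H \<Longrightarrow> G \<subseteq> H \<Longrightarrow> H = G"
    unfolding F_def by (metis (no_types, lifting) mem_Collect_eq subset_trans)
  have "\<exists>w. (z, w) \<in> G" for z
  proof -
    obtain w G' where "hom_graph G'" "G \<subseteq> G'" "(z, w) \<in> G'" using hom_graph_extend[OF G(1) alg] by blast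
    thus ?thesis using mx by blast
  qed
  then obtain \<sigma> where \<sigma>: "\<And>z. (z, \<sigma> z) \<in> G" by metis
  have eq: "\<sigma> z = w" if "(z, w) \<in> G" for z w using hom_graphD(9)[OF G(1) \<sigma> that] .
  show thesis
  proof (rule that[of \<sigma>])
    show "field_emb \<sigma>" unfolding field_emb_iff
      using eq hom_graphD(1)[OF G(1)] hom_graphD(4,7)[OF G(1) \<sigma> \<sigma>] by blast
    have "(ev [:0, 1:] h, ev [:0, 1:] \<beta>) \<in> G0" unfolding G0_def by blast
    thus "\<sigma> h = \<beta>" using G(2) eq by auto
  qed
qed

section \<open>Algebraic integers of bounded size\<close>

lemma algebraic_int_iff_integral_closure: "algebraic_int z \<longleftrightarrow> z \<in> integral_closure \<int>"
  by (auto simp: integral_closure_def algebraic_int.simps)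

lemma subring_Ints: "subring_set (\<int> :: 'a::field_char_0 set)"
  by (simp add: subring_set_def)

text \<open>Algebraic integers form the intersection of all valuation rings that contain \<int>. The
  general type matters: the lemma also serves for the complex conjugates of an element.\<close>

lemma subring_algebraic_int: "subring_set {z :: 'a::field_char_0. algebraic_int z}"
proof -
  have *: "z \<in> integral_closure \<int> \<longleftrightarrow> (\<forall>R. valuation_subring R \<longrightarrow> \<int> \<subseteq> R \<longrightarrow> z \<in> R)" for z :: 'a
    using integral_in_valuation_ring not_integral_imp_valuation_ring[OF subring_Ints, of z] by metis
  show ?thesis unfolding subring_set_def algebraic_int_iff_integral_closure mem_Collect_eq *
  proof (intro conjI ballI allI impI)
    fix a b :: 'a and R assume a: "a \<in> {z. \<forall>R. valuation_subring R \<longrightarrow> \<int> \<subseteq> R \<longrightarrow> z \<in> R}"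
      and b: "b \<in> {z. \<forall>R. valuation_subring R \<longrightarrow> \<int> \<subseteq> R \<longrightarrow> z \<in> R}"
      and R: "valuation_subring R" "(\<int> :: 'a set) \<subseteq> R"
    have "a \<in> R" "b \<in> R" using a b R by auto
    thus "a - b \<in> R" "a * b \<in> R"
      using subring_diff subring_mult valuation_subringD(1)[OF R(1)] by auto
  qed (use subring_1 valuation_subringD(1) in auto)
qed

text \<open>By pseudo-division, an integer polynomial \<open>q\<close> vanishing at \<open>z\<close>
  is, up to a nonzero integer factor, a multiple of one of least degree. So every complex root of
  \<open>p\<close> satisfies all integer relations of \<open>z\<close>.\<close>

lemma minimal_int_poly:
  fixes z :: "'a::field_char_0"
  assumes "p0 \<noteq> 0" "ev p0 z = 0"
  obtains p where "p \<noteq> 0" "ev p z = 0" "degree p \<le> degree p0"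
    "\<And>q w. ev q z = 0 \<Longrightarrow> ev p (w :: complex) = 0 \<Longrightarrow> ev q w = 0"
proof -
  define P where "P p \<longleftrightarrow> p \<noteq> 0 \<and> ev p z = 0" for p
  define p where "p = arg_min degree P"
  have "P p0" using assms by (simp add: P_def)
  hence p: "P p" "\<And>q. P q \<Longrightarrow> degree p \<le> degree q"
    using arg_min_nat_lemma[of P p0 degree] by (auto simp: p_def)
  show thesis
  proof (rule that[of p])
    fix q and w :: complex assume q: "ev q z = 0" "ev p w = 0"
    have p0: "p \<noteq> 0" "ev p z = 0" using p(1) by (auto simp: P_def)
    obtain a s where as: "a \<noteq> 0" "smult a q = p * s + pseudo_mod q p" using pseudo_mod(1)[OF p0(1)] by blast
    have "ev (smult a q) z = ev (p * s + pseudo_mod q p) z" using as by simp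
    hence "ev (pseudo_mod q p) z = 0" using q p0 by simp
    hence "pseudo_mod q p = 0" using p(2)[of "pseudo_mod q p"] pseudo_mod(2)[OF p0(1), of q] by (force simp: P_def)
    hence "ev (smult a q) w = ev (p * s) w" using as by (metis add.right_neutral)
    hence "of_int a * ev q w = ev p w * ev s w" by (simp only: ev_smult ev_simps(3))
    thus "ev q w = 0" using as(1) q by simp
  qed (use p \<open>P p0\<close> in \<open>auto simp: P_def\<close>)
qed

lemma coeff_linear_factor_bound:
  assumes "\<And>i. cmod (coeff f i) \<le> B" "cmod \<beta> \<le> T" "0 \<le> B"
  shows "cmod (coeff ([:- \<beta>, 1:] * f) i) \<le> B * (1 + T)"
proof -
  have "cmod (coeff ([:- \<beta>, 1:] * f) i) \<le> cmod (\<beta> * coeff f i) + cmod (coeff (pCons 0 f) i)"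
    using norm_triangle_ineq[of "- (\<beta> * coeff f i)" "coeff (pCons 0 f) i"] by simp
  also have "cmod (\<beta> * coeff f i) \<le> T * B"
    unfolding norm_mult using assms by (intro mult_mono) (auto intro: order_trans[OF norm_ge_zero assms(2)])
  also have "cmod (coeff (pCons 0 f) i) \<le> B" using assms by (simp add: coeff_pCons split: nat.split)
  finally show ?thesis by (simp add: algebra_simps)
qed

text \<open>Each linear factor keeps the coefficients algebraic integers and multiplies their bound
  by at most \<open>1 + T\<close>.\<close>

lemma split_poly_coeffs:
  fixes R :: "complex set"
  assumes T: "0 \<le> T" and "finite R" and R: "\<And>\<beta>. \<beta> \<in> R \<Longrightarrow> algebraic_int \<beta> \<and> cmod \<beta> \<le> T"
  shows "(\<forall>i. algebraic_int (coeff (\<Prod>\<beta>\<in>R. [:- \<beta>, 1:] ^ n \<beta>) i)) \<and>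
    (\<forall>i. cmod (coeff (\<Prod>\<beta>\<in>R. [:- \<beta>, 1:] ^ n \<beta>) i) \<le> (1 + T) ^ (\<Sum>\<beta>\<in>R. n \<beta>))"
proof -
  define good where "good f m \<longleftrightarrow> coeffs_in {z. algebraic_int z} f \<and> (\<forall>i. cmod (coeff f i) \<le> (1 + T) ^ m)" for f m
  have step: "good ([:- \<beta>, 1:] * f) (Suc m)" if "\<beta> \<in> R" "good f m" for \<beta> f m
  proof -
    have "coeffs_in {z. algebraic_int z} [:- \<beta>, 1:]" using R[OF that(1)] coeffs_in_ops(1)[OF subring_algebraic_int] by (simp add: coeffs_in_pCons)
    moreover have "cmod (coeff ([:- \<beta>, 1:] * f) i) \<le> (1 + T) ^ m * (1 + T)" for i
      using that R[OF that(1)] T by (intro coeff_linear_factor_bound) (auto simp: good_def)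
    ultimately show ?thesis using that(2) coeffs_in_ops(4)[OF subring_algebraic_int]
      unfolding good_def power_Suc2 by blast
  qed
  have pow: "good ([:- \<beta>, 1:] ^ k * f) (k + m)" if "\<beta> \<in> R" "good f m" for \<beta> f m k
    by (induction k) (use that step in \<open>auto simp: mult.assoc simp del: mult_pCons_left\<close>)
  have "good (\<Prod>\<beta>\<in>S. [:- \<beta>, 1:] ^ n \<beta>) (\<Sum>\<beta>\<in>S. n \<beta>)" if "finite S" "S \<subseteq> R" for S
    using that
  proof (induction S)
    case empty
    show ?case by (auto simp: good_def coeffs_in_def)
  next
    case (insert \<beta> S)
    thus ?case using pow by simp
  qed
  from this[OF assms(2) order_refl] show ?thesis by (auto simp: good_def coeffs_in_def)
qed

lemma finite_bounded_int_polys: "finite {p :: int poly. degree p \<le> N \<and> (\<forall>i. \<bar>coeff p i\<bar> \<le> B)}"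
proof (rule finite_subset)
  show "finite (Poly ` {l. set l \<subseteq> {-B..B} \<and> length l = Suc N})" by (intro finite_imageI finite_lists_length_eq) simp
  show "{p. degree p \<le> N \<and> (\<forall>i. \<bar>coeff p i\<bar> \<le> B)} \<subseteq> Poly ` {l. set l \<subseteq> {-B..B} \<and> length l = Suc N}"
  proof
    fix p assume p: "p \<in> {p. degree p \<le> N \<and> (\<forall>i. \<bar>coeff p i\<bar> \<le> B)}"
    have "p = Poly (map (coeff p) [0..<Suc N])"
      using p by (intro poly_eqI) (auto simp: coeff_Poly_eq nth_default_def coeff_eq_0 simp del: upt_Suc)
    thus "p \<in> Poly ` {l. set l \<subseteq> {-B..B} \<and> length l = Suc N}"
      using p by (intro image_eqI[of _ _ "map (coeff p) [0..<Suc N]"]) (auto simp: abs_le_iff minus_le_iff simp del: upt_Suc)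
  qed
qed

lemma bounded_rank_algebraic:
  fixes z :: "'a::field_char_0"
  assumes rank: "bounded_rank (\<int> :: 'a set) N"
  shows "\<exists>p. p \<noteq> 0 \<and> degree p \<le> N \<and> ev p z = 0"
proof -
  obtain c where c: "\<And>i. c i \<in> (\<int> :: 'a set)" "\<exists>i\<le>N. c i \<noteq> 0" "(\<Sum>i\<le>N. c i * z ^ i) = 0"
    using rank unfolding bounded_rank_def by blast
  have "\<forall>i. \<exists>m. c i = of_int m" using c(1) by (auto elim: Ints_cases)
  then obtain m where m: "\<And>i. c i = of_int (m i)" by metis
  define p where "p = (\<Sum>i\<le>N. monom (m i) i)"
  have cp: "coeff p i = (if i \<le> N then m i else 0)" for i
    by (simp add: p_def coeff_sum Polynomial.coeff_monom)
  have dp: "degree p \<le> N" by (rule degree_le) (simp add: cp)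
  have "ev p z = (\<Sum>i\<le>N. of_int (coeff p i) * z ^ i)"
    unfolding ev_def using poly_eq_sum_upto[of "map_poly of_int p" N z] dp
    by (simp add: coeff_map_poly degree_map_poly)
  also have "\<dots> = (\<Sum>i\<le>N. c i * z ^ i)" by (intro sum.cong) (auto simp: cp m)
  finally have "ev p z = 0" using c by simp
  moreover have "p \<noteq> 0" using c(2) m cp by (metis coeff_0 of_int_0)
  ultimately show ?thesis using dp by blast
qed

text \<open>The roots of the polynomial of \<open>z\<close> are the conjugates \<sigma>(z), hence
  algebraic integers of modulus at most \<open>T\<close>. Its monic form then has integer
  coefficients bounded in terms of \<open>T\<close> and \<open>N\<close>, and there are finitely
  many such polynomials with finitely many roots each.\<close>

lemma finite_bounded_algebraic_ints:
  assumes rank: "bounded_rank (\<int> :: 'a::field_char_0 set) N"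
  shows "finite {z :: 'a. algebraic_int z \<and> (\<forall>\<sigma>. field_emb \<sigma> \<longrightarrow> cmod (\<sigma> z) \<le> T)}"
proof -
  note alg = bounded_rank_algebraic[OF rank]
  define B where "B = \<lceil>(1 + \<bar>T\<bar>) ^ N\<rceil>"
  define F where "F = {p :: int poly. degree p \<le> N \<and> (\<forall>i. \<bar>coeff p i\<bar> \<le> B)}"
  have "z \<in> (\<Union>p\<in>F - {0}. {z. poly (map_poly of_int p) z = 0})"
    if z: "algebraic_int z" "\<And>\<sigma>. field_emb \<sigma> \<Longrightarrow> cmod (\<sigma> z) \<le> T" for z :: 'a
  proof -
    obtain p0 where p0: "p0 \<noteq> 0" "degree p0 \<le> N" "ev p0 z = 0" using alg by blast
    obtain p where p: "p \<noteq> 0" "ev p z = 0" "degree p \<le> degree p0"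
      "\<And>q w. ev q z = 0 \<Longrightarrow> ev p (w :: complex) = 0 \<Longrightarrow> ev q w = 0"
      by (rule minimal_int_poly[OF p0(1,3)]) blast
    define P where "P = (map_poly of_int p :: complex poly)"
    define R where "R = {\<beta>. poly P \<beta> = 0}"
    have P0: "P \<noteq> 0" using p(1) by (simp add: P_def map_poly_eq_0_iff)
    have fR: "finite R" using poly_roots_finite[OF P0] by (simp add: R_def)
    have Rp: "algebraic_int \<beta> \<and> cmod \<beta> \<le> \<bar>T\<bar>" if "\<beta> \<in> R" for \<beta>
    proof -
      have b: "ev p \<beta> = 0" using that by (simp add: R_def P_def ev_def)
      obtain \<sigma> where s: "field_emb \<sigma>" "\<sigma> z = \<beta>"
      proof (rule field_emb_extension[of z \<beta>])
        show "\<exists>p. p \<noteq> 0 \<and> ev p w = 0" for w :: 'a using alg by blast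
      qed (use p(4) b in auto)
      obtain q where q: "ev q z = 0" "lead_coeff q = 1"
        using z(1) unfolding algebraic_int_altdef_ipoly ev_def by blast
      have "ev q \<beta> = 0" using field_embD(12)[OF s(1), of q z] field_embD(4)[OF s(1)] s(2) q(1) by simp
      hence "algebraic_int \<beta>" using q(2) unfolding algebraic_int_altdef_ipoly ev_def by blast
      thus ?thesis using z(2)[OF s(1)] s(2) by simp
    qed
    define L where "L = lead_coeff P"
    define D where "D = (\<Prod>\<beta>\<in>R. [:- \<beta>, 1:] ^ order \<beta> P)"
    have PD: "P = smult L D" unfolding L_def D_def R_def by (rule complex_poly_decompose[symmetric])
    have L0: "L \<noteq> 0" using P0 by (simp add: L_def)
    have lD: "lead_coeff D = 1" using PD L0 L_def by (metis lead_coeff_smult mult_cancel_left1)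
    have "degree P = degree p" by (simp add: P_def degree_map_poly)
    hence dD: "degree D = degree p" using PD L0 by simp
    have so: "(\<Sum>\<beta>\<in>R. order \<beta> P) = degree D"
      unfolding D_def by (simp add: degree_prod_sum_eq degree_power_eq)
    have good: "algebraic_int (coeff D i)" "cmod (coeff D i) \<le> (1 + \<bar>T\<bar>) ^ (\<Sum>\<beta>\<in>R. order \<beta> P)" for i
      using split_poly_coeffs[of "\<bar>T\<bar>" R "\<lambda>\<beta>. order \<beta> P"] fR Rp unfolding D_def by auto
    have Lp: "L = of_int (lead_coeff p)" by (simp add: L_def P_def degree_map_poly coeff_map_poly)
    have cD: "coeff D i = of_int (coeff p i) / of_int (lead_coeff p)" for i
    proof -
      have "of_int (coeff p i) = L * coeff D i" using arg_cong[OF PD, of "\<lambda>F. coeff F i"] by (simp add: P_def coeff_map_poly)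
      thus ?thesis using L0 Lp by (simp add: field_simps)
    qed
    \<comment> \<open>A coefficient of \<open>D\<close> is a quotient of integers and an algebraic
      integer, therefore an integer.\<close>
    have "coeff D i \<in> \<int>" for i
      using good(1)[of i] by (rule rational_algebraic_int_is_int) (simp add: cD)
    hence "\<forall>i. \<exists>m. coeff D i = of_int m" by (auto elim: Ints_cases)
    then obtain m where m: "\<And>i. coeff D i = of_int (m i)" by metis
    define q where "q = Poly (map m [0..<Suc N])"
    have dN: "degree D \<le> N" using dD p(3) p0(2) by simp
    have cq: "coeff q i = m i" for i
    proof (cases "i \<le> N")
      case False
      hence "coeff D i = 0" using dN by (simp add: coeff_eq_0)
      thus ?thesis using False m[of i] by (simp add: q_def coeff_Poly_eq nth_default_def)
    qed (simp add: q_def coeff_Poly_eq nth_default_def nth_append less_Suc_eq_le del: upt_Suc)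
    have "\<bar>m i\<bar> \<le> B" for i
    proof -
      have "real_of_int \<bar>m i\<bar> = cmod (coeff D i)" by (simp add: m)
      also have "\<dots> \<le> (1 + \<bar>T\<bar>) ^ (\<Sum>\<beta>\<in>R. order \<beta> P)" by (rule good)
      also have "\<dots> \<le> (1 + \<bar>T\<bar>) ^ N" unfolding so using dN by (intro power_increasing) auto
      finally show ?thesis unfolding B_def by linarith
    qed
    moreover have "degree q \<le> N"
      by (rule degree_le) (simp add: q_def coeff_Poly_eq nth_default_def)
    moreover have "q \<noteq> 0"
    proof
      assume "q = 0"
      hence "m i = 0" for i using cq[of i] by simp
      hence "lead_coeff D = 0" using m by simp
      thus False using lD by simp
    qed
    moreover have "poly (map_poly of_int q) z = 0"
    proof -
      have "of_int (coeff p i) = (of_int (lead_coeff p * m i) :: complex)" for i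
        using cD[of i] m[of i] L0 Lp by (simp add: field_simps)
      hence e: "coeff p i = lead_coeff p * coeff q i" for i
        unfolding cq by (rule of_int_eq_iff[THEN iffD1])
      have "p = smult (lead_coeff p) q"
        by (rule poly_eqI, subst coeff_smult, rule e)
      from arg_cong[OF this, of "\<lambda>f. ev f z"]
      have "ev p z = of_int (lead_coeff p) * ev q z" by (simp only: ev_smult)
      hence "ev q z = 0" using p(1,2) by simp
      thus ?thesis by (simp add: ev_def)
    qed
    ultimately show ?thesis unfolding F_def cq[symmetric] by auto
  qed
  hence "{z :: 'a. algebraic_int z \<and> (\<forall>\<sigma>. field_emb \<sigma> \<longrightarrow> cmod (\<sigma> z) \<le> T)} \<subseteq> (\<Union>p\<in>F - {0}. {z. poly (map_poly of_int p) z = 0})"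
    by blast
  moreover have "finite (\<Union>p\<in>F - {0}. {z :: 'a. poly (map_poly of_int p) z = 0})"
    using finite_bounded_int_polys[of N B] by (auto simp: F_def map_poly_eq_0_iff intro!: poly_roots_finite)
  ultimately show ?thesis by (rule finite_subset)
qed

section \<open>Indices of ideals in number fields\<close>

definition transversal :: "'a::ab_group_add set \<Rightarrow> 'a set \<Rightarrow> 'a set \<Rightarrow> bool" where
  "transversal M M' T \<longleftrightarrow> T \<subseteq> M \<and> finite T \<and> (\<forall>z\<in>M. \<exists>x\<in>T. z - x \<in> M') \<and> (\<forall>x\<in>T. \<forall>y\<in>T. x - y \<in> M' \<longrightarrow> x = y)"

text \<open>Multiplicativity of the index: the sums of representatives of the two stages are
  pairwise distinct and represent \<open>M\<close> modulo \<open>M''\<close>.\<close>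

lemma transversal_trans:
  assumes T: "transversal M M' T" and U: "transversal M' M'' U"
    and sub: "M' \<subseteq> M" "M'' \<subseteq> M'"
    and add: "\<And>a b. a \<in> M \<Longrightarrow> b \<in> M \<Longrightarrow> a + b \<in> M" "\<And>a b. a \<in> M' \<Longrightarrow> b \<in> M' \<Longrightarrow> a + b \<in> M'"
    and neg: "\<And>a. a \<in> M' \<Longrightarrow> - a \<in> M'"
  shows "\<exists>W. transversal M M'' W \<and> card W = card T * card U"
proof -
  have diff: "a - b \<in> M'" if "a \<in> M'" "b \<in> M'" for a b using add(2)[OF that(1) neg[OF that(2)]] by simp
  have key: "x = x' \<and> y = y'" if "x \<in> T" "x' \<in> T" "y \<in> U" "y' \<in> U" "(x + y) - (x' + y') \<in> M''" for x x' y y'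
  proof -
    have yy: "y' - y \<in> M'" using that U diff by (auto simp: transversal_def)
    have "x - x' = ((x + y) - (x' + y')) + (y' - y)" by simp
    also have "\<dots> \<in> M'" using that(5) sub yy by (intro add) auto
    finally have "x = x'" using T that by (auto simp: transversal_def)
    moreover from this have "y = y'" using U that by (auto simp: transversal_def)
    ultimately show ?thesis ..
  qed
  \<comment> \<open>\<open>M''\<close> is not assumed to contain \<open>0\<close>. The
    representative of an element \<open>u\<close> of \<open>U\<close> can only be \<open>u\<close>,
    which places \<open>u - u\<close> in \<open>M''\<close>.\<close>
  have M0: "0 \<in> M''" if ne: "U \<noteq> {}"
  proof -
    obtain y where "y \<in> U" using ne by blast
    hence "y \<in> M'" using U by (auto simp: transversal_def)
    hence "y - y \<in> M'" using diff by blast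
    then obtain u where "u \<in> U" "0 - u \<in> M''" using U by (auto simp: transversal_def)
    have "(0::'a) - u \<in> M''" "u \<in> M'" using \<open>0 - u \<in> M''\<close> \<open>u \<in> U\<close> U by (auto simp: transversal_def)
    obtain w where "w \<in> U" "u - w \<in> M''" using \<open>u \<in> M'\<close> U by (auto simp: transversal_def)
    moreover from this have "u = w" using \<open>u \<in> U\<close> U by (auto simp: transversal_def)
    ultimately show ?thesis by simp
  qed
  define W where "W = (\<lambda>(x, y). x + y) ` (T \<times> U)"
  have inj: "inj_on (\<lambda>(x, y). x + y) (T \<times> U)"
  proof (rule inj_onI, clarify)
    fix x y x' y' assume h: "x \<in> T" "y \<in> U" "x' \<in> T" "y' \<in> U" "x + y = x' + y'"
    hence "U \<noteq> {}" by blast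
    hence "(x + y) - (x' + y') \<in> M''" unfolding h(5) diff_self by (rule M0)
    thus "x = x' \<and> y = y'" by (rule key[OF h(1,3,2,4)])
  qed
  have "card W = card T * card U"
    unfolding W_def using card_image[OF inj] by (simp add: card_cartesian_product)
  moreover have "transversal M M'' W" unfolding transversal_def
  proof (intro conjI ballI impI)
    show "W \<subseteq> M" unfolding W_def
    proof clarify
      fix x y assume "x \<in> T" "y \<in> U"
      thus "x + y \<in> M" using T U sub by (intro add) (auto simp: transversal_def)
    qed
    show "finite W" using T U by (auto simp: W_def transversal_def)
    show "\<exists>w\<in>W. z - w \<in> M''" if z: "z \<in> M" for z
    proof -
      obtain x where x: "x \<in> T" "z - x \<in> M'" using T z by (auto simp: transversal_def)
      obtain y where y: "y \<in> U" "z - x - y \<in> M''" using U x by (auto simp: transversal_def)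
      show ?thesis using x y by (intro bexI[of _ "x + y"]) (auto simp: W_def algebra_simps)
    qed
    show "w = w'" if ww: "w \<in> W" "w' \<in> W" "w - w' \<in> M''" for w w'
    proof -
      obtain x y x' y' where h: "x \<in> T" "y \<in> U" "w = x + y" "x' \<in> T" "y' \<in> U" "w' = x' + y'"
        using ww(1,2) unfolding W_def by auto
      have "x = x' \<and> y = y'" using ww(3) unfolding h(3,6) by (rule key[OF h(1,4,2,5)])
      thus ?thesis using h(3,6) by simp
    qed
  qed
  ultimately show ?thesis by blast
qed

lemma coprime_multiple_mem:
  fixes M' :: "'a::field_char_0 set"
  assumes p: "prime (p::nat)"
    and add: "\<And>a b. a \<in> M' \<Longrightarrow> b \<in> M' \<Longrightarrow> a + b \<in> M'" and scale: "\<And>m a. a \<in> M' \<Longrightarrow> of_int m * a \<in> M'"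
    and c: "\<not> int p dvd c" "of_int c * z \<in> M'" and pz: "of_nat p * z \<in> M'"
  shows "z \<in> M'"
proof -
  have "coprime (int p) c" using c(1) p by (simp add: prime_imp_coprime)
  then obtain d k where dk: "d * c + k * int p = 1" by (metis bezout_int coprime_imp_gcd_eq_1 add.commute)
  have "of_int d * (of_int c * z) + of_int k * (of_nat p * z) \<in> M'" by (intro add scale c pz)
  moreover have "of_int d * (of_int c * z) + of_int k * (of_nat p * z) = of_int (d * c + k * int p) * z"
    by (simp add: algebra_simps)
  ultimately show ?thesis by (simp add: dk)
qed

text \<open>In effect \<open>M\<close> modulo \<open>M'\<close> is a vector space over the field
  with \<open>p\<close> elements in which \<open>N + 1\<close> vectors are always dependent, so
  \<open>p ^ N\<close> classes suffice. The induction adjoins one vector \<open>w\<close> outside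
  \<open>M'\<close> to the submodule and lowers \<open>N\<close>.\<close>

lemma cover_modulo:
  fixes M M' :: "'a::field_char_0 set" and p :: nat
  assumes p: "prime p"
    and M': "0 \<in> M'" "\<And>a b. a \<in> M' \<Longrightarrow> b \<in> M' \<Longrightarrow> a + b \<in> M'" "\<And>m a. a \<in> M' \<Longrightarrow> of_int m * a \<in> M'"
    and pM: "\<And>z. z \<in> M \<Longrightarrow> of_nat p * z \<in> M'"
    and dep: "\<And>u. (\<And>i. i \<le> N \<Longrightarrow> u i \<in> M) \<Longrightarrow> \<exists>c. (\<exists>i\<le>N. \<not> int p dvd c i) \<and> (\<Sum>i\<le>N. of_int (c i) * u (i::nat)) \<in> M'"
  shows "\<exists>R. finite R \<and> card R \<le> p ^ N \<and> (\<forall>z\<in>M. \<exists>r\<in>R. z - r \<in> M')"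
  using M' pM dep
proof (induction N arbitrary: M')
  case (0 M')
  have "z \<in> M'" if z: "z \<in> M" for z
  proof -
    obtain c where "\<not> int p dvd c 0" "of_int (c 0) * z \<in> M'" using 0(5)[of "\<lambda>_. z"] z by auto
    thus ?thesis using coprime_multiple_mem[OF p 0(2,3)] 0(4)[OF z] by blast
  qed
  thus ?case by (intro exI[of _ "{0}"]) simp
next
  case (Suc N M')
  have multiple: "of_int (int p * m) * z \<in> M'" if "z \<in> M" for z m
    using Suc.prems(3)[OF Suc.prems(4)[OF that], of m] by (simp add: mult_ac)
  show ?case
  proof (cases "M \<subseteq> M'")
    case True
    thus ?thesis using prime_gt_0_nat[OF p] by (intro exI[of _ "{0}"]) auto
  next
    case False
    then obtain w where w: "w \<in> M" "w \<notin> M'" by blast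
    define M2 where "M2 = {a + of_int m * w |a m. a \<in> M'}"
    have M2: "a + of_int m * w \<in> M2" if "a \<in> M'" for a m using that unfolding M2_def by blast
    have "\<exists>R. finite R \<and> card R \<le> p ^ N \<and> (\<forall>z\<in>M. \<exists>r\<in>R. z - r \<in> M2)"
    proof (rule Suc.IH)
      show "0 \<in> M2" using M2[OF Suc.prems(1), of 0] by simp
      show "a + b \<in> M2" if ab: "a \<in> M2" "b \<in> M2" for a b
      proof -
        obtain a' m b' n where "a = a' + of_int m * w" "b = b' + of_int n * w" "a' \<in> M'" "b' \<in> M'"
          using ab unfolding M2_def by blast
        thus ?thesis using M2[of "a' + b'" "m + n"] Suc.prems(2) by (simp add: algebra_simps)
      qed
      show "of_int k * a \<in> M2" if a: "a \<in> M2" for k a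
      proof -
        obtain a' m where "a = a' + of_int m * w" "a' \<in> M'" using a unfolding M2_def by blast
        thus ?thesis using M2[of "of_int k * a'" "k * m"] Suc.prems(3) by (simp add: algebra_simps)
      qed
      show "of_nat p * z \<in> M2" if "z \<in> M" for z using M2[OF Suc.prems(4)[OF that], of 0] by simp
      fix u :: "nat \<Rightarrow> 'a" assume u: "\<And>i. i \<le> N \<Longrightarrow> u i \<in> M"
      define u' where "u' = u(Suc N := w)"
      have "u' i \<in> M" if "i \<le> Suc N" for i using that u w(1) by (auto simp: u'_def)
      from Suc.prems(5)[of u', OF this] obtain c where c: "\<exists>i\<le>Suc N. \<not> int p dvd c i" "(\<Sum>i\<le>Suc N. of_int (c i) * u' i) \<in> M'"
        by blast
      hence sum: "(\<Sum>i\<le>N. of_int (c i) * u i) + of_int (c (Suc N)) * w \<in> M'" by (simp add: u'_def)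
      \<comment> \<open>Otherwise the coefficient of \<open>w\<close> alone is prime to
        \<open>p\<close>, and \<open>w\<close> would already lie in \<open>M'\<close>.\<close>
      have "\<exists>i\<le>N. \<not> int p dvd c i"
      proof (rule ccontr)
        assume dvd: "\<not> ?thesis"
        have "(\<Sum>i\<in>I. - of_int (c i) * u i) \<in> M'" if "I \<subseteq> {..N}" for I
          using that
        proof (induction I rule: infinite_finite_induct)
          case (insert i I)
          hence "int p dvd c i" using dvd by auto
          then obtain k where "c i = int p * k" by (rule dvdE)
          hence "- of_int (c i) * u i \<in> M'" using multiple[OF u, of i "- k"] insert.prems by simp
          moreover have "(\<Sum>i\<in>I. - of_int (c i) * u i) \<in> M'" using insert by simp
          ultimately have "- of_int (c i) * u i + (\<Sum>i\<in>I. - of_int (c i) * u i) \<in> M'" by (rule Suc.prems(2))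
          thus ?case using insert.hyps by simp
        qed (use Suc.prems(1) in auto)
        from Suc.prems(2)[OF sum this[of "{..N}"]] have "of_int (c (Suc N)) * w \<in> M'" by (simp add: sum_negf)
        moreover have "\<not> int p dvd c (Suc N)" using c(1) dvd by (auto simp: le_Suc_eq)
        ultimately show False using coprime_multiple_mem[OF p Suc.prems(2,3)] Suc.prems(4)[OF w(1)] w(2) by blast
      qed
      moreover have "(\<Sum>i\<le>N. of_int (c i) * u i) \<in> M2" using M2[OF sum, of "- c (Suc N)"] by simp
      ultimately show "\<exists>c. (\<exists>i\<le>N. \<not> int p dvd c i) \<and> (\<Sum>i\<le>N. of_int (c i) * u i) \<in> M2" by blast
    qed
    then obtain R where R: "finite R" "card R \<le> p ^ N" "\<And>z. z \<in> M \<Longrightarrow> \<exists>r\<in>R. z - r \<in> M2" by blast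
    define R' where "R' = (\<lambda>(r, i). r + of_int i * w) ` (R \<times> {0..<int p})"
    have "card R' \<le> card R * p"
      unfolding R'_def using card_image_le[of "R \<times> {0..<int p}"] R(1) by (simp add: card_cartesian_product)
    also have "\<dots> \<le> p ^ Suc N" using R(2) by simp
    finally have "card R' \<le> p ^ Suc N" .
    moreover have "\<exists>r\<in>R'. z - r \<in> M'" if z: "z \<in> M" for z
    proof -
      obtain r a m where r: "r \<in> R" "a \<in> M'" "z - r = a + of_int m * w" using R(3)[OF z] unfolding M2_def by blast
      have "z - (r + of_int (m mod int p) * w) = a + of_int (int p * (m div int p)) * w"
        using r(3) by (simp add: minus_mod_eq_mult_div[symmetric] algebra_simps)
      hence "z - (r + of_int (m mod int p) * w) \<in> M'" using Suc.prems(2)[OF r(2) multiple[OF w(1)]] by simp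
      moreover have "r + of_int (m mod int p) * w \<in> R'" unfolding R'_def
        using r(1) prime_gt_0_nat[OF p] by (intro image_eqI[of _ _ "(r, m mod int p)"]) auto
      ultimately show ?thesis by blast
    qed
    moreover have "finite R'" unfolding R'_def using R(1) by simp
    ultimately show ?thesis by blast
  qed
qed

lemma incongruent_bound:
  fixes M M' T :: "'a::field_char_0 set" and p :: nat
  assumes p: "prime p"
    and M': "0 \<in> M'" "\<And>a b. a \<in> M' \<Longrightarrow> b \<in> M' \<Longrightarrow> a + b \<in> M'" "\<And>m a. a \<in> M' \<Longrightarrow> of_int m * a \<in> M'"
    and pM: "\<And>z. z \<in> M \<Longrightarrow> of_nat p * z \<in> M'"
    and dep: "\<And>u. (\<And>i. i \<le> N \<Longrightarrow> u i \<in> M) \<Longrightarrow> \<exists>c. (\<exists>i\<le>N. \<not> int p dvd c i) \<and> (\<Sum>i\<le>N. of_int (c i) * u (i::nat)) \<in> M'"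
    and T: "T \<subseteq> M" "\<And>x y. x \<in> T \<Longrightarrow> y \<in> T \<Longrightarrow> x - y \<in> M' \<Longrightarrow> x = y"
  shows "finite T" "card T \<le> p ^ N"
proof -
  have "\<exists>R. finite R \<and> card R \<le> p ^ N \<and> (\<forall>z\<in>M. \<exists>r\<in>R. z - r \<in> M')" by (rule cover_modulo[OF p M' pM dep])
  then obtain R where R: "finite R" "card R \<le> p ^ N" "\<And>z. z \<in> M \<Longrightarrow> \<exists>r\<in>R. z - r \<in> M'" by blast
  have "\<forall>z\<in>T. \<exists>r. r \<in> R \<and> z - r \<in> M'" using R(3) T(1) by blast
  then obtain r where r: "\<And>z. z \<in> T \<Longrightarrow> r z \<in> R \<and> z - r z \<in> M'" by metis
  have inj: "inj_on r T"
  proof (rule inj_onI)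
    fix x y assume xy: "x \<in> T" "y \<in> T" "r x = r y"
    have "(x - r x) + of_int (- 1) * (y - r y) \<in> M'" using r[OF xy(1)] r[OF xy(2)] by (intro M'(2,3)) blast+
    thus "x = y" using T(2) xy by simp
  qed
  show "finite T" using inj_on_finite[OF inj _ R(1)] r by blast
  have "card T \<le> card R" using card_inj_on_le[OF inj _ R(1)] r by blast
  thus "card T \<le> p ^ N" using R(2) by linarith
qed

section \<open>Residue class counts and the index of a principal ideal\<close>

locale number_field_setting =
  fixes N :: nat and b :: "nat \<Rightarrow> 'a::field_char_0"
  assumes rank: "bounded_rank (\<int> :: 'a set) N" and N_pos: "0 < N"
    and basis_independent: "(\<And>i. c i \<in> \<int>) \<Longrightarrow> (\<Sum>i<N. c i * b i) = 0 \<Longrightarrow> i < N \<Longrightarrow> c i = 0"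
begin

sublocale pid_extension "\<int> :: 'a set" N
  by unfold_locales (use subring_Ints principal_Ints rank in \<open>auto simp: bounded_rank_def\<close>)

lemma V_eq: "V = {v. normalized_valuation v}"
proof -
  have "(\<int> :: 'a set) \<subseteq> val_ring v" if v: "normalized_valuation v" for v
  proof
    fix z :: 'a assume "z \<in> \<int>"
    then obtain m where m: "z = of_int m" by (auto elim: Ints_cases)
    note S = valuation_subringD(1)[OF valuation_subring_val_ring(1)[OF v]]
    have "of_nat k \<in> val_ring v" for k :: nat
      by (induction k) (auto intro: subring_0[OF S] subring_1[OF S] subring_add[OF S])
    thus "z \<in> val_ring v" unfolding m by (cases m rule: int_diff_cases) (auto intro: subring_diff[OF S])
  qed
  thus ?thesis by (auto simp: V_def)
qed

lemma V_residue_char: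
  assumes v: "v \<in> V"
  obtains p :: nat where "prime p" "\<And>m. vge v 1 (of_int m) \<longleftrightarrow> int p dvd m"
proof -
  note nv = V_nv[OF v]
  obtain r where r: "r \<in> \<int>" "r \<noteq> 0" "inverse r \<notin> \<int>" "0 < v r" "\<And>a. a \<in> \<int> \<Longrightarrow> vge v 1 a \<Longrightarrow> a / r \<in> \<int>"
    by (rule V_prime[OF v]) blast
  obtain m0 where m0: "r = of_int m0" using r(1) by (auto elim: Ints_cases)
  define p where "p = nat \<bar>m0\<bar>"
  have vneg: "vge v 1 (of_int \<bar>m\<bar>) \<longleftrightarrow> vge v 1 (of_int m)" for m
    using vge_uminus[OF nv, of 1 "of_int m"] by (cases "m \<ge> 0") auto
  have dv: "vge v 1 (of_int m) \<longleftrightarrow> int p dvd m" for m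
  proof
    assume "vge v 1 (of_int m)"
    then obtain k where "of_int m / r = of_int k" using r(5)[of "of_int m"] by (auto elim: Ints_cases)
    hence "(of_int m :: 'a) = of_int (m0 * k)" using r(2) m0 by (simp add: field_simps)
    hence "m = m0 * k" by (simp only: of_int_eq_iff)
    thus "int p dvd m" by (simp add: p_def)
  next
    assume "int p dvd m"
    then obtain k where k: "m = m0 * k" by (auto simp: p_def)
    have "vge v 1 r" using r(4) by (simp add: vge_def)
    hence "vge v (1 + 0) (r * of_int k)" using V_nonneg[OF v, of "of_int k"] by (intro vge_mult[OF nv]) auto
    thus "vge v 1 (of_int m)" by (simp add: k m0)
  qed
  have "prime p"
  proof (rule prime_natI)
    show "2 \<le> p"
    proof (rule ccontr)
      assume "\<not> 2 \<le> p"
      hence "p = 0 \<or> p = 1" by linarith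
      moreover have "p \<noteq> 0" using r(2) m0 by (auto simp: p_def)
      moreover have "p \<noteq> 1" using dv[of 1] by (auto simp: vge_def nv_1 nv)
      ultimately show False by blast
    qed
    fix c d assume "p dvd c * d"
    hence "int p dvd int c * int d" by (simp flip: of_nat_mult)
    hence vv: "vge v 1 (of_int (int c * int d))" using dv by blast
    show "p dvd c \<or> p dvd d"
    proof (cases "c = 0 \<or> d = 0")
      case False
      hence "v (of_int (int c) * of_int (int d)) = v (of_int (int c)) + v (of_int (int d))" by (intro nv_mult[OF nv]) auto
      moreover have "1 \<le> v (of_int (int c) * of_int (int d))" using vv False by (simp add: vge_def)
      moreover have "0 \<le> v (of_int (int c))" "0 \<le> v (of_int (int d))" using V_nonneg'[OF v] by auto
      ultimately have "1 \<le> v (of_int (int c)) \<or> 1 \<le> v (of_int (int d))" by linarith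
      hence "vge v 1 (of_int (int c)) \<or> vge v 1 (of_int (int d))" by (auto simp: vge_def)
      thus ?thesis by (simp only: dv int_dvd_int_iff)
    qed auto
  qed
  thus thesis using that dv by blast
qed

lemma primitive_relation:
  assumes p: "prime (p::nat)"
  shows "\<exists>c. (\<exists>i\<le>N. \<not> int p dvd c i) \<and> (\<Sum>i\<le>N. of_int (c i) * u i) = (0::'a)"
proof -
  have "inverse (of_nat p :: 'a) \<notin> \<int>"
  proof
    assume "inverse (of_nat p :: 'a) \<in> \<int>"
    then obtain k where "inverse (of_nat p :: 'a) = of_int k" by (auto elim: Ints_cases)
    hence "(of_int (int p * k) :: 'a) = of_int 1" using prime_gt_0_nat[OF p] by (simp add: field_simps)
    hence "int p * k = 1" by (simp only: of_int_eq_iff)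
    hence "int p = 1" using zmult_eq_1_iff by auto
    thus False using prime_gt_1_nat[OF p] by simp
  qed
  moreover have "(of_nat p :: 'a) \<in> \<int>" by simp
  moreover have "finite {..N}" "N < card {..N}" by auto
  ultimately obtain c where c: "\<And>i. i \<in> {..N} \<Longrightarrow> c i \<in> (\<int> :: 'a set)" "\<exists>i\<in>{..N}. c i / of_nat p \<notin> \<int>" "(\<Sum>i\<le>N. c i * u i) = 0"
    using primitive_dependent[of "of_nat p" "{..N}" u] by metis
  have "\<forall>i\<in>{..N}. \<exists>m. c i = of_int m" using c(1) by (auto elim: Ints_cases)
  then obtain m where m: "\<And>i. i \<le> N \<Longrightarrow> c i = of_int (m i)" by (metis atMost_iff)
  have "\<exists>i\<le>N. \<not> int p dvd m i"
  proof -
    obtain i where i: "i \<le> N" "c i / of_nat p \<notin> \<int>" using c by auto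
    have "\<not> int p dvd m i"
    proof
      assume "int p dvd m i"
      then obtain k where "m i = int p * k" by blast
      hence "c i / of_nat p = of_int k" using m[OF i(1)] prime_gt_0_nat[OF p] by simp
      thus False using i by simp
    qed
    thus ?thesis using i by blast
  qed
  moreover have "(\<Sum>i\<le>N. of_int (m i) * u i) = 0" using c(3) m by simp
  ultimately show ?thesis by blast
qed

definition residue_card :: "('a \<Rightarrow> int) \<Rightarrow> nat" where "residue_card v = card (carrier (residue_field v))"

lemma carrier_residue_field:
  "carrier (residue_field v) = (\<lambda>a. (\<lambda>h. h + a) ` val_ideal v) ` val_ring v"
  by (auto simp: residue_field_def FactRing_def A_RCOSETS_def' a_r_coset_def')

text \<open>The residue field has at most \<open>p ^ N\<close> elements, since over the prime field
  any \<open>N + 1\<close> of them satisfy the reduction of a primitive integer relation. Finiteness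
  is the point: on an infinite set \<open>card\<close> would return \<open>0\<close>.\<close>

lemma residue_transversal:
  assumes v: "v \<in> V"
  obtains T where "transversal (val_ring v) (val_ideal v) T" "card T = residue_card v"
proof -
  note nv = V_nv[OF v]
  let ?Q = "carrier (residue_field v)"
  have "\<forall>U\<in>?Q. \<exists>a. a \<in> val_ring v \<and> U = (\<lambda>h. h + a) ` val_ideal v" by (auto simp: carrier_residue_field)
  then obtain r where r: "\<And>U. U \<in> ?Q \<Longrightarrow> r U \<in> val_ring v \<and> U = (\<lambda>h. h + r U) ` val_ideal v" by metis
  define T where "T = r ` ?Q"
  have coset: "(\<lambda>h. h + a) ` val_ideal v = (\<lambda>h. h + c) ` val_ideal v" if "a - c \<in> val_ideal v" for a c
  proof -
    have "(\<lambda>h. h + a) ` val_ideal v \<subseteq> (\<lambda>h. h + c) ` val_ideal v" if "a - c \<in> val_ideal v" for a c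
    proof
      fix z assume "z \<in> (\<lambda>h. h + a) ` val_ideal v"
      then obtain h where "h \<in> val_ideal v" "z = h + a" by blast
      hence "h + (a - c) \<in> val_ideal v" "z = (h + (a - c)) + c"
        using that vge_add[OF nv] by (auto simp: in_val_ideal_iff)
      thus "z \<in> (\<lambda>h. h + c) ` val_ideal v" by blast
    qed
    moreover have "c - a \<in> val_ideal v" using that vge_uminus[OF nv, of 1 "a - c"] by (simp add: in_val_ideal_iff)
    ultimately show ?thesis using that by blast
  qed
  have inj: "inj_on r ?Q" using r by (metis inj_onI)
  have incong: "x = y" if "x \<in> T" "y \<in> T" "x - y \<in> val_ideal v" for x y
  proof -
    from that obtain U W where UW: "U \<in> ?Q" "W \<in> ?Q" "x = r U" "y = r W" unfolding T_def by blast
    have "U = (\<lambda>h. h + x) ` val_ideal v" "W = (\<lambda>h. h + y) ` val_ideal v" using r UW by auto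
    hence "U = W" using coset[OF that(3)] by simp
    thus ?thesis using UW by simp
  qed
  have cover: "\<exists>x\<in>T. z - x \<in> val_ideal v" if "z \<in> val_ring v" for z
  proof -
    define U where "U = (\<lambda>h. h + z) ` val_ideal v"
    have U: "U \<in> ?Q" using that by (auto simp: U_def carrier_residue_field)
    have "0 \<in> val_ideal v" by (simp add: val_ideal_def)
    hence "z \<in> U" by (auto simp: U_def intro!: image_eqI[of _ _ 0])
    then obtain h where "h \<in> val_ideal v" "z = h + r U" using r[OF U] by blast
    thus ?thesis using U by (intro bexI[of _ "r U"]) (auto simp: T_def)
  qed
  obtain p :: nat where p: "prime p" "\<And>m. vge v 1 (of_int m) \<longleftrightarrow> int p dvd m" by (rule V_residue_char[OF v]) blast
  have TR: "T \<subseteq> val_ring v" using r by (auto simp: T_def)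
  have ints: "vge v 0 (of_int m)" for m using V_nonneg[OF v, of "of_int m"] by simp
  have "finite T"
  proof (rule incongruent_bound(1)[OF p(1), where M = "val_ring v" and M' = "val_ideal v" and N = N])
    show "of_nat p * z \<in> val_ideal v" if "z \<in> val_ring v" for z
      using vge_mult[OF nv, of 1 "of_nat p" 0 z] p(2)[of "int p"] that by (simp add: in_val_ideal_iff in_val_ring_iff)
    show "of_int m * a \<in> val_ideal v" if "a \<in> val_ideal v" for m a
      using vge_mult[OF nv ints[of m], of 1 a] that by (simp add: in_val_ideal_iff)
    show "\<exists>c. (\<exists>i\<le>N. \<not> int p dvd c i) \<and> (\<Sum>i\<le>N. of_int (c i) * u i) \<in> val_ideal v" for u
      using primitive_relation[OF p(1), of u] by (metis in_val_ideal_iff vge_0)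
  qed (use vge_add[OF nv] incong TR in \<open>auto simp: in_val_ideal_iff\<close>)
  hence "transversal (val_ring v) (val_ideal v) T" using TR cover incong by (auto simp: transversal_def)
  moreover have "card T = residue_card v" unfolding T_def residue_card_def by (rule card_image[OF inj])
  ultimately show thesis by (rule that)
qed

lemma residue_card_pos: "v \<in> V \<Longrightarrow> 0 < residue_card v"
proof -
  assume v: "v \<in> V"
  obtain T where T: "transversal (val_ring v) (val_ideal v) T" "card T = residue_card v" by (rule residue_transversal[OF v])
  have "0 \<in> val_ring v" by (simp add: val_ring_def)
  hence "T \<noteq> {}" "finite T" using T(1) by (auto simp: transversal_def)
  thus ?thesis using T(2) by (metis card_gt_0_iff)
qed

lemma ideal_of_closed:
  shows "0 \<in> ideal_of n" "a \<in> ideal_of n \<Longrightarrow> c \<in> ideal_of n \<Longrightarrow> a + c \<in> ideal_of n"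
    "a \<in> ideal_of n \<Longrightarrow> - a \<in> ideal_of n" "a \<in> ideal_of n \<Longrightarrow> c \<in> ideal_of n \<Longrightarrow> a - c \<in> ideal_of n"
    "a \<in> ideal_of n \<Longrightarrow> of_int m * a \<in> ideal_of n"
proof -
  show "0 \<in> ideal_of n" "a \<in> ideal_of n \<Longrightarrow> c \<in> ideal_of n \<Longrightarrow> a + c \<in> ideal_of n"
    "a \<in> ideal_of n \<Longrightarrow> - a \<in> ideal_of n" "a \<in> ideal_of n \<Longrightarrow> c \<in> ideal_of n \<Longrightarrow> a - c \<in> ideal_of n"
    using V_nv by (auto simp: ideal_of_def vge_uminus intro: vge_add vge_diff)
  show "of_int m * a \<in> ideal_of n" if "a \<in> ideal_of n"
    unfolding in_ideal_of_iff
  proof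
    fix v assume v: "v \<in> V"
    have "vge v (0 + n v) (of_int m * a)"
      using that v V_nonneg[OF v, of "of_int m"] by (intro vge_mult V_nv) (auto simp: ideal_of_def)
    thus "vge v (n v) (of_int m * a)" by simp
  qed
qed

text \<open>Raising the exponent at \<open>v\<close> by one has index \<open>residue_card v\<close>.
  With \<open>s\<close> of value exactly \<open>n v\<close>, strong approximation lifts each residue
  \<rho> to an element \<open>Z \<rho>\<close> of the ideal that is close to
  \<open>s * \<rho>\<close> at \<open>v\<close>; congruence modulo the smaller ideal then becomes
  congruence of \<open>z / s\<close> and \<rho> in the residue field.\<close>

lemma ideal_step_transversal:
  assumes n: "fin_supp n" and v: "v \<in> V"
  shows "\<exists>T. transversal (ideal_of n) (ideal_of (\<lambda>w. if w = v then n v + 1 else n w)) T \<and> card T = residue_card v"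
proof -
  let ?n' = "\<lambda>w. if w = v then n v + 1 else n w"
  note nv = V_nv[OF v]
  obtain s where s: "s \<in> ideal_of n" "s \<noteq> 0" "v s = n v" by (rule ideal_of_value_attained[OF n v])
  obtain R where R: "transversal (val_ring v) (val_ideal v) R" "card R = residue_card v" by (rule residue_transversal[OF v])
  define W where "W = insert v {w \<in> V. n w \<noteq> 0}"
  have W: "finite W" "W \<subseteq> V" using n v by (auto simp: W_def fin_supp_def)
  define M where "M = (\<Sum>w\<in>W. \<bar>n w\<bar>) + 1"
  have M: "n w + 1 \<le> M" if "w \<in> W" for w
    using member_le_sum[of w W "\<lambda>w. \<bar>n w\<bar>"] W(1) that unfolding M_def by auto
  have "\<forall>\<rho>. \<exists>z. (\<forall>w\<in>W. vge w M (z - (if w = v then s * \<rho> else 0))) \<and> (\<forall>w\<in>V - W. vge w 0 z)"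
    by (intro allI strong_approximation[OF W])
  then obtain Z where Z: "\<And>\<rho> w. w \<in> W \<Longrightarrow> vge w M (Z \<rho> - (if w = v then s * \<rho> else 0))" "\<And>\<rho> w. w \<in> V - W \<Longrightarrow> vge w 0 (Z \<rho>)" by metis
  have Zv: "vge v (n v + 1) (Z \<rho> - s * \<rho>)" for \<rho>
    using Z(1)[of v \<rho>] M[of v] by (auto simp: W_def intro: vge_mono)
  have ZJ: "Z \<rho> \<in> ideal_of n" if "\<rho> \<in> val_ring v" for \<rho>
    unfolding in_ideal_of_iff
  proof
    fix w assume w: "w \<in> V"
    consider "w = v" | "w \<noteq> v" "w \<in> W" | "w \<notin> W" by (auto simp: W_def)
    thus "vge w (n w) (Z \<rho>)"
    proof cases
      case 1
      have "vge v (n v) (Z \<rho> - s * \<rho>)" by (rule vge_mono[OF Zv]) simp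
      moreover have "vge v (n v + 0) (s * \<rho>)"
        using s that by (intro vge_mult[OF nv]) (auto simp: in_val_ring_iff vge_def)
      ultimately have "vge v (n v) ((Z \<rho> - s * \<rho>) + s * \<rho>)" by (intro vge_add[OF nv]) auto
      thus ?thesis using 1 by simp
    next
      case 2
      thus ?thesis using Z(1)[of w \<rho>] M[of w] by (auto intro: vge_mono)
    next
      case 3
      thus ?thesis using Z(2)[of w \<rho>] w by (auto simp: W_def)
    qed
  qed
  have cong: "z - Z \<rho> \<in> ideal_of ?n' \<longleftrightarrow> z / s - \<rho> \<in> val_ideal v" if z: "z \<in> ideal_of n" and \<rho>: "\<rho> \<in> val_ring v" for z \<rho>
  proof -
    have "z - Z \<rho> \<in> ideal_of n" using z ZJ[OF \<rho>] by (rule ideal_of_closed)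
    hence "z - Z \<rho> \<in> ideal_of ?n' \<longleftrightarrow> vge v (n v + 1) (z - Z \<rho>)"
      using v by (auto simp: ideal_of_def)
    also have "\<dots> \<longleftrightarrow> vge v (n v + 1) (z - s * \<rho>)"
    proof
      assume "vge v (n v + 1) (z - Z \<rho>)"
      from vge_add[OF nv this Zv[of \<rho>]] show "vge v (n v + 1) (z - s * \<rho>)" by simp
    next
      assume "vge v (n v + 1) (z - s * \<rho>)"
      from vge_diff[OF nv this Zv[of \<rho>]] show "vge v (n v + 1) (z - Z \<rho>)" by simp
    qed
    also have "z - s * \<rho> = s * (z / s - \<rho>)" using s(2) by (simp add: right_diff_distrib)
    also have "vge v (n v + 1) (s * (z / s - \<rho>)) \<longleftrightarrow> vge v 1 (z / s - \<rho>)"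
      using s nv_mult[OF nv s(2), of "z / s - \<rho>"] by (cases "z / s - \<rho> = 0") (auto simp: vge_def simp del: right_minus_eq)
    finally show ?thesis by (simp add: in_val_ideal_iff)
  qed
  have RR: "\<rho> \<in> val_ring v" if "\<rho> \<in> R" for \<rho> using R(1) that by (auto simp: transversal_def)
  have eq: "\<rho> = \<rho>'" if "\<rho> \<in> R" "\<rho>' \<in> R" "Z \<rho> - Z \<rho>' \<in> ideal_of ?n'" for \<rho> \<rho>'
  proof -
    have "Z \<rho> / s - \<rho>' \<in> val_ideal v" using cong[OF ZJ RR] that RR by blast
    moreover have "Z \<rho> / s - \<rho> \<in> val_ideal v" using cong[OF ZJ RR, of \<rho> \<rho>] ideal_of_closed(1) that RR by simp
    ultimately have "\<rho> - \<rho>' \<in> val_ideal v"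
      using vge_diff[OF nv, of 1 "Z \<rho> / s - \<rho>'" "Z \<rho> / s - \<rho>"] by (simp add: in_val_ideal_iff)
    thus ?thesis using R(1) that by (auto simp: transversal_def)
  qed
  have "inj_on Z R" using eq ideal_of_closed(1) by (auto intro!: inj_onI)
  hence "card (Z ` R) = residue_card v" using R(2) by (simp add: card_image)
  moreover have "transversal (ideal_of n) (ideal_of ?n') (Z ` R)" unfolding transversal_def
  proof (intro conjI ballI impI)
    show "Z ` R \<subseteq> ideal_of n" using ZJ RR by auto
    show "finite (Z ` R)" using R(1) by (simp add: transversal_def)
    show "\<exists>x\<in>Z ` R. z - x \<in> ideal_of ?n'" if z: "z \<in> ideal_of n" for z
    proof -
      have "vge v 0 (z / s)" using z s v by (cases "z = 0") (auto simp: ideal_of_def vge_def nv_divide nv)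
      hence "z / s \<in> val_ring v" by (simp add: in_val_ring_iff)
      then obtain \<rho> where "\<rho> \<in> R" "z / s - \<rho> \<in> val_ideal v" using R(1) unfolding transversal_def by blast
      thus ?thesis using cong[OF z RR] by blast
    qed
  qed (use eq in auto)
  ultimately show ?thesis by blast
qed

text \<open>Induction on the sum of the exponents, removing one prime factor at a time; indices
  multiply by \<open>transversal_trans\<close>.\<close>

lemma index_ideal_of:
  assumes W: "finite W" "W \<subseteq> V" and n: "\<And>v. 0 \<le> n v" "\<And>v. v \<notin> W \<Longrightarrow> n v = 0"
  shows "\<exists>T. transversal (integral_closure \<int>) (ideal_of n) T \<and> card T = (\<Prod>v\<in>W. residue_card v ^ nat (n v))"
  using n
proof (induction "\<Sum>v\<in>W. nat (n v)" arbitrary: n)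
  case 0
  hence "n v = 0" for v using W by (cases "v \<in> W") (auto simp: order_antisym)
  hence n0: "n = (\<lambda>v. 0)" by blast
  have "transversal (integral_closure \<int>) (ideal_of n) {0 :: 'a}"
    using subring_0[OF subring_integral_closure] unfolding n0 ideal_of_0 by (auto simp: transversal_def)
  thus ?case by (intro exI[of _ "{0}"]) (simp add: n0)
next
  case (Suc k)
  have "\<exists>v\<in>W. 0 < n v"
  proof (rule ccontr)
    assume "\<not> ?thesis"
    hence "(\<Sum>v\<in>W. nat (n v)) = 0" by (intro sum.neutral) auto
    thus False using Suc(2) by simp
  qed
  then obtain v where v: "v \<in> W" "0 < n v" by blast
  define n' where "n' w = (if w = v then n v - 1 else n w)" for w
  have "(\<Sum>w\<in>W. nat (n w)) = nat (n v) + (\<Sum>w\<in>W - {v}. nat (n w))" using W v by (simp add: sum.remove)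
  moreover have "(\<Sum>w\<in>W. nat (n' w)) = nat (n v - 1) + (\<Sum>w\<in>W - {v}. nat (n w))"
    using W v by (subst sum.remove[of _ v]) (auto simp: n'_def)
  ultimately have "k = (\<Sum>w\<in>W. nat (n' w))" using Suc(2) v by simp
  moreover have "0 \<le> n' w" for w using Suc(3)[of w] v by (simp add: n'_def)
  moreover have "n' w = 0" if "w \<notin> W" for w using Suc(4)[OF that] that v by (auto simp: n'_def)
  ultimately obtain T where T: "transversal (integral_closure \<int>) (ideal_of n') T" "card T = (\<Prod>v\<in>W. residue_card v ^ nat (n' v))"
    using Suc(1)[of n'] by blast
  have fs: "fin_supp n'" unfolding fin_supp_def
    by (rule finite_subset[OF _ W(1)]) (use \<open>\<And>w. w \<notin> W \<Longrightarrow> n' w = 0\<close> in auto)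
  have nn': "(\<lambda>w. if w = v then n' v + 1 else n' w) = n" by (auto simp: n'_def)
  obtain U where U: "transversal (ideal_of n') (ideal_of n) U" "card U = residue_card v"
    using ideal_step_transversal[OF fs, of v] v W unfolding nn' by blast
  have "\<exists>Z. transversal (integral_closure \<int>) (ideal_of n) Z \<and> card Z = card T * card U"
  proof (rule transversal_trans[OF T(1) U(1)])
    show "ideal_of n' \<subseteq> integral_closure \<int>" unfolding ideal_of_0[symmetric]
      using \<open>\<And>w. 0 \<le> n' w\<close> by (auto simp: ideal_of_def intro: vge_mono)
    show "ideal_of n \<subseteq> ideal_of n'" by (auto simp: ideal_of_def n'_def intro: vge_mono split: if_splits)
  qed (use ideal_of_closed subring_add[OF subring_integral_closure] in auto)
  moreover have "card T * card U = (\<Prod>v\<in>W. residue_card v ^ nat (n v))"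
  proof -
    have "(\<Prod>w\<in>W. residue_card w ^ nat (n' w)) = residue_card v ^ nat (n v - 1) * (\<Prod>w\<in>W - {v}. residue_card w ^ nat (n w))"
      using W v by (subst prod.remove[of _ v]) (auto simp: n'_def)
    moreover have "nat (n v) = Suc (nat (n v - 1))" using v by simp
    hence "residue_card v ^ nat (n v) = residue_card v ^ nat (n v - 1) * residue_card v" by simp
    moreover have "(\<Prod>w\<in>W. residue_card w ^ nat (n w)) = residue_card v ^ nat (n v) * (\<Prod>w\<in>W - {v}. residue_card w ^ nat (n w))"
      using W v by (simp add: prod.remove)
    ultimately show ?thesis using T(2) U(2) by simp
  qed
  ultimately show ?case by metis
qed

text \<open>For a nonzero integral \<open>f\<close> this is the logarithm of the index of
  \<open>f\<O>\<close> in the ring of integers \<O>, see \<open>log_index_index\<close>. The formula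
  extends it to a homomorphism on all nonzero elements.\<close>

definition log_index :: "'a \<Rightarrow> real" where
  "log_index f = (\<Sum>v\<in>{v \<in> V. v f \<noteq> 0}. of_int (v f) * ln (real (residue_card v)))"

lemma log_index_eq_sum:
  assumes "finite W" "W \<subseteq> V" "\<And>v. v \<in> V \<Longrightarrow> v f \<noteq> 0 \<Longrightarrow> v \<in> W"
  shows "log_index f = (\<Sum>v\<in>W. of_int (v f) * ln (real (residue_card v)))"
  unfolding log_index_def using assms by (intro sum.mono_neutral_left) auto

lemma log_index_mult:
  assumes "f \<noteq> 0" "g \<noteq> 0" shows "log_index (f * g) = log_index f + log_index g"
proof -
  let ?W = "{v \<in> V. v f \<noteq> 0} \<union> {v \<in> V. v g \<noteq> 0}"
  have W: "finite ?W" "?W \<subseteq> V" using finite_support by auto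
  have "log_index (f * g) = (\<Sum>v\<in>?W. of_int (v (f * g)) * ln (real (residue_card v)))"
    by (rule log_index_eq_sum[OF W]) (use assms in \<open>auto simp: nv_mult V_nv\<close>)
  also have "\<dots> = (\<Sum>v\<in>?W. of_int (v f) * ln (real (residue_card v)) + of_int (v g) * ln (real (residue_card v)))"
    using assms by (intro sum.cong) (auto simp: nv_mult V_nv distrib_right)
  also have "\<dots> = log_index f + log_index g"
    unfolding sum.distrib by (subst (1 2) log_index_eq_sum[OF W]) auto
  finally show ?thesis .
qed

lemma log_index_index:
  assumes f: "f \<in> integral_closure \<int>" "f \<noteq> 0"
  shows "\<exists>T. transversal (integral_closure \<int>) (ideal_of (\<lambda>v. v f)) T \<and> 0 < card T \<and> log_index f = ln (real (card T))"
proof -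
  define W where "W = {v \<in> V. v f \<noteq> 0}"
  have W: "finite W" "W \<subseteq> V" using finite_support by (auto simp: W_def)
  define n where "n v = (if v \<in> W then v f else 0)" for v
  have "0 \<le> n v" for v using f W by (auto simp: n_def integral_iff vge_def)
  then obtain T where T: "transversal (integral_closure \<int>) (ideal_of n) T" "card T = (\<Prod>v\<in>W. residue_card v ^ nat (n v))"
    using index_ideal_of[OF W, of n] by (auto simp: n_def)
  have "ideal_of n = ideal_of (\<lambda>v. v f)" by (rule ideal_of_cong) (auto simp: n_def W_def)
  moreover have pos: "0 < card T" unfolding T(2) using residue_card_pos W by (intro prod_pos ballI zero_less_power) blast
  moreover have "ln (real (card T)) = (\<Sum>v\<in>W. of_int (v f) * ln (real (residue_card v)))"
  proof -
    have "real (residue_card v ^ nat (n v)) \<noteq> 0" if "v \<in> W" for v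
      using that residue_card_pos W by (force simp: subset_iff)
    hence "ln (real (card T)) = (\<Sum>v\<in>W. ln (real (residue_card v ^ nat (n v))))"
      unfolding T(2) of_nat_prod using W by (intro ln_prod) simp
    also have "\<dots> = (\<Sum>v\<in>W. of_int (v f) * ln (real (residue_card v)))"
    proof (rule sum.cong[OF refl])
      fix v assume v: "v \<in> W"
      hence "0 < residue_card v" "0 \<le> v f" "n v = v f" using residue_card_pos W \<open>\<And>v. 0 \<le> n v\<close>[of v] by (auto simp: n_def)
      thus "ln (real (residue_card v ^ nat (n v))) = of_int (v f) * ln (real (residue_card v))" by (simp add: ln_realpow)
    qed
    finally show ?thesis .
  qed
  ultimately show ?thesis using T(1) by (auto simp: log_index_def W_def)
qed

text \<open>Modulo \<open>p\<close> the integers form a space of dimension at most \<open>N\<close>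
  over the field with \<open>p\<close> elements, so the index is at most
  \<open>p ^ N\<close>.\<close>

lemma log_index_prime_le:
  assumes p: "prime (p::nat)" shows "log_index (of_nat p) \<le> real N * ln (real p)"
proof -
  have pO: "of_nat p \<in> integral_closure (\<int> :: 'a set)" using A_subset_integral by auto
  have p0: "(of_nat p :: 'a) \<noteq> 0" using prime_gt_0_nat[OF p] by simp
  obtain T where T: "transversal (integral_closure \<int>) (ideal_of (\<lambda>v. v (of_nat p))) T" "0 < card T" "log_index (of_nat p) = ln (real (card T))"
    using log_index_index[OF pO p0] by blast
  have "card T \<le> p ^ N"
  proof (rule incongruent_bound(2)[OF p, where M = "integral_closure \<int>" and M' = "ideal_of (\<lambda>v. v (of_nat p))"])
    show "of_nat p * z \<in> ideal_of (\<lambda>v. v (of_nat p))" if "z \<in> integral_closure \<int>" for z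
      unfolding in_ideal_of_iff
    proof
      fix v assume v: "v \<in> V"
      have "vge v (v (of_nat p) + 0) (of_nat p * z)"
        using that v by (intro vge_mult V_nv) (auto simp: integral_iff)
      thus "vge v (v (of_nat p)) (of_nat p * z)" by simp
    qed
    show "\<exists>c. (\<exists>i\<le>N. \<not> int p dvd c i) \<and> (\<Sum>i\<le>N. of_int (c i) * u i) \<in> ideal_of (\<lambda>v. v (of_nat p))" for u
      using primitive_relation[OF p, of u] ideal_of_closed(1) by metis
  qed (use T(1) ideal_of_closed in \<open>auto simp: transversal_def\<close>)
  hence "real (card T) \<le> real p ^ N" by (metis of_nat_le_iff of_nat_power)
  hence "ln (real (card T)) \<le> ln (real p ^ N)" using T(2) by (intro ln_mono) auto
  thus ?thesis using T(3) prime_gt_0_nat[OF p] by (simp add: ln_realpow)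
qed

end

section \<open>Lattice points with small conjugates\<close>

definition embeddings :: "('a::field_char_0 \<Rightarrow> complex) set" where
  "embeddings = {\<sigma>. field_emb \<sigma>}"

definition conj_pair :: "('a \<Rightarrow> complex) \<Rightarrow> ('a \<Rightarrow> complex) set" where
  "conj_pair \<sigma> = {\<sigma>, cnj \<circ> \<sigma>}"

lemma cnj_comp_cnj [simp]: "cnj \<circ> (cnj \<circ> \<sigma>) = \<sigma>"
  by (simp add: fun_eq_iff)

lemma conj_pair_cnj: "conj_pair (cnj \<circ> \<sigma>) = conj_pair \<sigma>"
  by (auto simp: conj_pair_def)

text \<open>A real coordinate for each embedding: the real part at one member of a conjugate pair,
  the imaginary part at the other.\<close>

definition coord :: "('a \<Rightarrow> complex) \<Rightarrow> 'a \<Rightarrow> real" where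
  "coord \<sigma> z = (if \<sigma> = (SOME \<tau>. \<tau> \<in> conj_pair \<sigma>) then Re (\<sigma> z) else Im (\<sigma> z))"

lemma coord_le: "\<bar>coord \<sigma> z\<bar> \<le> cmod (\<sigma> z)"
  by (simp add: coord_def abs_Re_le_cmod abs_Im_le_cmod)

lemma coord_diff: "field_emb \<sigma> \<Longrightarrow> coord \<sigma> (a - c) = coord \<sigma> a - coord \<sigma> c"
  by (simp add: coord_def field_embD(6))

text \<open>The coordinates at an embedding and its conjugate are, up to sign, the real and the
  imaginary part. At a real embedding there is one coordinate, the real part, and the imaginary part
  vanishes.\<close>

lemma cmod_le_coord:
  assumes "\<bar>coord \<sigma> z\<bar> \<le> T" "\<bar>coord (cnj \<circ> \<sigma>) z\<bar> \<le> T" shows "cmod (\<sigma> z) \<le> 2 * T"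
proof -
  define \<rho> where "\<rho> = (SOME \<tau>. \<tau> \<in> conj_pair \<sigma>)"
  have "\<rho> \<in> conj_pair \<sigma>" unfolding \<rho>_def by (rule someI[of _ \<sigma>]) (simp add: conj_pair_def)
  hence \<rho>: "\<rho> = \<sigma> \<or> \<rho> = cnj \<circ> \<sigma>" by (simp add: conj_pair_def)
  have c: "coord \<sigma> z = (if \<sigma> = \<rho> then Re (\<sigma> z) else Im (\<sigma> z))"
    "coord (cnj \<circ> \<sigma>) z = (if cnj \<circ> \<sigma> = \<rho> then Re (\<sigma> z) else - Im (\<sigma> z))"
    by (simp_all only: coord_def conj_pair_cnj \<rho>_def comp_apply cnj.sel)
  have "\<bar>Re (\<sigma> z)\<bar> \<le> T \<and> \<bar>Im (\<sigma> z)\<bar> \<le> T"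
  proof (cases "cnj \<circ> \<sigma> = \<sigma>")
    case True
    hence "Im (\<sigma> z) = 0" by (metis comp_apply cnj.sel(2) neg_equal_zero)
    thus ?thesis using True \<rho> c assms by auto
  qed (use \<rho> c assms in \<open>auto split: if_splits\<close>)
  thus ?thesis using cmod_le[of "\<sigma> z"] by linarith
qed

text \<open>Induction over the pairs. The element \<open>h + m * z\<close> fails at a given pair for
  at most one natural number \<open>m\<close>, so some \<open>m\<close> works for all of
  them.\<close>

lemma separating_element:
  fixes P :: "(('a::field_char_0 \<Rightarrow> complex) \<times> ('a \<Rightarrow> complex)) set"
  assumes "finite P" "\<And>\<sigma> \<tau>. (\<sigma>, \<tau>) \<in> P \<Longrightarrow> field_emb \<sigma> \<and> field_emb \<tau> \<and> \<sigma> \<noteq> \<tau>"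
  shows "\<exists>h. \<forall>(\<sigma>, \<tau>)\<in>P. \<sigma> h \<noteq> \<tau> h"
  using assms
proof (induction P rule: finite_induct)
  case (insert r P)
  then obtain h where h: "\<And>\<sigma> \<tau>. (\<sigma>, \<tau>) \<in> P \<Longrightarrow> \<sigma> h \<noteq> \<tau> h" by blast
  obtain \<sigma>0 \<tau>0 where r: "r = (\<sigma>0, \<tau>0)" by (cases r)
  obtain z where z: "\<sigma>0 z \<noteq> \<tau>0 z" using insert.prems[of \<sigma>0 \<tau>0] r by (auto simp: fun_eq_iff)
  define bad where "bad s = {m::nat. fst s (h + of_nat m * z) = snd s (h + of_nat m * z)}" for s :: "('a \<Rightarrow> complex) \<times> ('a \<Rightarrow> complex)"
  have "finite (bad s)" if s: "s \<in> insert r P" for s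
  proof -
    obtain \<sigma> \<tau> where st: "s = (\<sigma>, \<tau>)" by (cases s)
    have emb: "field_emb \<sigma>" "field_emb \<tau>" using insert.prems s st by auto
    have nz: "\<sigma> h \<noteq> \<tau> h \<or> \<sigma> z \<noteq> \<tau> z" using s st h z r by auto
    have nat: "\<sigma> (of_nat m) = of_nat m" "\<tau> (of_nat m) = of_nat m" for m
      using field_embD(7)[OF emb(1), of "int m"] field_embD(7)[OF emb(2), of "int m"] by simp_all
    have eq: "m \<in> bad s \<longleftrightarrow> of_nat m * (\<sigma> z - \<tau> z) = \<tau> h - \<sigma> h" for m
      by (auto simp: bad_def st field_embD(2,3)[OF emb(1)] field_embD(2,3)[OF emb(2)] nat algebra_simps)
    have "m = m'" if "m \<in> bad s" "m' \<in> bad s" for m m'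
      using that nz unfolding eq by (cases "\<sigma> z = \<tau> z") (auto, metis mult_right_cancel of_nat_eq_iff right_minus_eq)
    hence "bad s = {} \<or> (\<exists>m. bad s = {m})" by blast
    thus ?thesis by auto
  qed
  hence "finite (\<Union>s\<in>insert r P. bad s)" using insert.hyps by blast
  then obtain m where m: "m \<notin> (\<Union>s\<in>insert r P. bad s)" using infinite_UNIV_nat by (metis ex_new_if_finite)
  thus ?case by (intro exI[of _ "h + of_nat m * z"]) (auto simp: bad_def)
qed auto

context number_field_setting
begin

text \<open>Finitely many embeddings are told apart by their values at one element \<open>h\<close>,
  and these values are roots of a nonzero integer polynomial of degree at most
  \<open>N\<close>.\<close>

lemma finite_embeddings: "finite (embeddings :: ('a \<Rightarrow> complex) set)"
  and card_embeddings_le: "card (embeddings :: ('a \<Rightarrow> complex) set) \<le> N"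
proof -
  have "card G \<le> N" if G: "G \<subseteq> embeddings" "finite G" for G :: "('a \<Rightarrow> complex) set"
  proof -
    have "\<exists>h. \<forall>(\<sigma>, \<tau>)\<in>{(\<sigma>, \<tau>) \<in> G \<times> G. \<sigma> \<noteq> \<tau>}. \<sigma> h \<noteq> \<tau> h"
      using G by (intro separating_element) (auto simp: embeddings_def intro: finite_subset[of _ "G \<times> G"])
    then obtain h where h: "\<And>\<sigma> \<tau>. \<sigma> \<in> G \<Longrightarrow> \<tau> \<in> G \<Longrightarrow> \<sigma> \<noteq> \<tau> \<Longrightarrow> \<sigma> h \<noteq> \<tau> h" by blast
    obtain p where p: "p \<noteq> 0" "degree p \<le> N" "ev p h = 0" using bounded_rank_algebraic[OF rank] by blast
    define Q where "Q = (map_poly of_int p :: complex poly)"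
    have Q: "Q \<noteq> 0" "degree Q \<le> N" using p by (auto simp: Q_def map_poly_eq_0_iff degree_map_poly)
    have "(\<lambda>\<sigma>. \<sigma> h) ` G \<subseteq> {w. poly Q w = 0}"
    proof clarify
      fix \<sigma> assume "\<sigma> \<in> G"
      hence s: "field_emb \<sigma>" using G by (auto simp: embeddings_def)
      show "poly Q (\<sigma> h) = 0" using field_embD(12)[OF s, of p h] field_embD(4)[OF s] p(3) by (simp add: ev_def Q_def)
    qed
    hence "card ((\<lambda>\<sigma>. \<sigma> h) ` G) \<le> card {w. poly Q w = 0}" by (intro card_mono poly_roots_finite Q)
    moreover have "card ((\<lambda>\<sigma>. \<sigma> h) ` G) = card G" using h by (intro card_image inj_onI) blast
    ultimately show ?thesis using card_poly_roots_bound[OF Q(1)] Q(2) by linarith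
  qed
  thus "finite (embeddings :: ('a \<Rightarrow> complex) set)" "card (embeddings :: ('a \<Rightarrow> complex) set) \<le> N"
    using finite_if_finite_subsets_card_bdd[of "embeddings :: ('a \<Rightarrow> complex) set" N] by auto
qed

lemma embeddings_nonempty: "(embeddings :: ('a \<Rightarrow> complex) set) \<noteq> {}"
proof -
  have "\<exists>p. p \<noteq> 0 \<and> ev p z = 0" for z :: 'a using bounded_rank_algebraic[OF rank] by blast
  moreover have "ev p (0::complex) = 0" if "ev p (0::'a) = 0" for p
    using that by (cases p) simp
  ultimately obtain \<sigma> :: "'a \<Rightarrow> complex" where "field_emb \<sigma>" using field_emb_extension[of "0::'a" 0] by blast
  thus ?thesis by (auto simp: embeddings_def)
qed

definition int_basis :: "(nat \<Rightarrow> 'a) \<Rightarrow> bool" where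
  "int_basis u \<longleftrightarrow> (\<forall>c i. (\<forall>i. c i \<in> \<int>) \<longrightarrow> (\<Sum>i<N. c i * u i) = 0 \<longrightarrow> i < N \<longrightarrow> c i = 0)"

lemma int_basis_in:
  assumes "fractional I" obtains u where "\<And>i. u i \<in> I" "int_basis u"
proof (rule basis_in_fractional[where n = N and b = b, OF assms(1)])
  show "c i = 0" if "\<And>i. c i \<in> \<int>" "(\<Sum>i<N. c i * b i) = 0" "i < N" for c i
    using basis_independent that by blast
  show thesis if "\<And>i. b' i \<in> I" "\<And>c i. (\<And>i. c i \<in> \<int>) \<Longrightarrow> (\<Sum>i<N. c i * b' i) = 0 \<Longrightarrow> i < N \<Longrightarrow> c i = 0" for b'
    using \<open>\<And>u. (\<And>i. u i \<in> I) \<Longrightarrow> int_basis u \<Longrightarrow> thesis\<close>[of b'] that unfolding int_basis_def by blast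
qed

text \<open>The \<open>M ^ N\<close> combinations with coefficients from \<open>0\<close> to
  \<open>M - 1\<close> have coordinates of size at most \<open>C * M\<close>. Cells with side
  \<open>T \<sigma>\<close> in direction \<sigma> cover this range, and the last inequality bounds
  their number by the product; \<open>Y\<close> is a fullest cell.\<close>

lemma lattice_pigeonhole:
  assumes u: "int_basis u" and T: "\<And>\<sigma>. \<sigma> \<in> embeddings \<Longrightarrow> 0 < T \<sigma>" and M: "0 < M"
    and C: "\<And>\<sigma>. \<sigma> \<in> embeddings \<Longrightarrow> (\<Sum>j<N. cmod (\<sigma> (u j))) \<le> C"
  obtains Y where "finite Y" "Y \<subseteq> range (\<lambda>a. \<Sum>j<N. of_int (a j) * u j)"
    "\<forall>y\<in>Y. \<forall>y'\<in>Y. \<forall>\<sigma>\<in>embeddings. \<bar>coord \<sigma> (y - y')\<bar> \<le> T \<sigma>"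
    "real M ^ N \<le> real (card Y) * (\<Prod>\<sigma>\<in>embeddings. 2 * (C * real M / T \<sigma>) + 3)"
proof -
  let ?E = "embeddings :: ('a \<Rightarrow> complex) set"
  define A where "A = {..<N} \<rightarrow>\<^sub>E {0..<int M}"
  define w where "w a = (\<Sum>j<N. of_int (a j) * u j)" for a :: "nat \<Rightarrow> int"
  have A: "finite A" "card A = M ^ N" by (auto simp: A_def card_PiE intro!: finite_PiE)
  have inj: "inj_on w A"
  proof (rule inj_onI)
    fix a a' assume aa: "a \<in> A" "a' \<in> A" "w a = w a'"
    have "(\<Sum>j<N. of_int (a j - a' j) * u j) = 0"
      using aa(3) by (simp add: w_def left_diff_distrib sum_subtractf)
    hence "\<forall>j<N. (of_int (a j - a' j) :: 'a) = 0"
      using u[unfolded int_basis_def, rule_format, of "\<lambda>j. of_int (a j - a' j)"] by simp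
    thus "a = a'" using aa unfolding A_def by (intro PiE_ext) auto
  qed
  define B where "B \<sigma> = \<lfloor>C * real M / T \<sigma>\<rfloor>" for \<sigma>
  \<comment> \<open>The floor of a real number in \<open>[-X, X]\<close> lies between
    \<open>- \<lfloor>X\<rfloor> - 1\<close> and \<open>\<lfloor>X\<rfloor>\<close>. These are
    \<open>2 * \<lfloor>X\<rfloor> + 2\<close> integers, which the constant \<open>3\<close> covers
    generously.\<close>
  define Q where "Q = (\<Pi>\<^sub>E \<sigma>\<in>?E. {- B \<sigma> - 1..B \<sigma>})"
  define q where "q a = (\<lambda>\<sigma>\<in>?E. \<lfloor>coord \<sigma> (w a) / T \<sigma>\<rfloor>)" for a
  have w_le: "\<bar>coord \<sigma> (w a)\<bar> \<le> C * real M" if "\<sigma> \<in> ?E" "a \<in> A" for \<sigma> a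
  proof -
    have e: "field_emb \<sigma>" using that by (simp add: embeddings_def)
    have "\<bar>coord \<sigma> (w a)\<bar> \<le> cmod (\<sigma> (w a))" by (rule coord_le)
    also have "\<sigma> (w a) = (\<Sum>j<N. of_int (a j) * \<sigma> (u j))" by (simp add: w_def field_embD(3,7,9)[OF e])
    also have "cmod \<dots> \<le> (\<Sum>j<N. cmod (of_int (a j) * \<sigma> (u j)))" by (rule norm_sum)
    also have "\<dots> \<le> (\<Sum>j<N. real M * cmod (\<sigma> (u j)))"
    proof (intro sum_mono)
      fix j assume "j \<in> {..<N}"
      hence "a j \<in> {0..<int M}" using PiE_mem[OF that(2)[unfolded A_def]] by simp
      hence "\<bar>real_of_int (a j)\<bar> \<le> real M" unfolding atLeastLessThan_iff by linarith
      thus "cmod (of_int (a j) * \<sigma> (u j)) \<le> real M * cmod (\<sigma> (u j))" by (simp add: norm_mult mult_right_mono)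
    qed
    also have "\<dots> = real M * (\<Sum>j<N. cmod (\<sigma> (u j)))" by (simp add: sum_distrib_left)
    also have "\<dots> \<le> real M * C" using C[OF that(1)] by (intro mult_left_mono) auto
    finally show ?thesis by (simp add: mult.commute)
  qed
  have floor: "\<lfloor>coord \<sigma> (w a) / T \<sigma>\<rfloor> \<in> {- B \<sigma> - 1..B \<sigma>}" if "\<sigma> \<in> ?E" "a \<in> A" for \<sigma> a
  proof -
    have "\<bar>coord \<sigma> (w a) / T \<sigma>\<bar> \<le> C * real M / T \<sigma>"
      using w_le[OF that] T[OF that(1)] by (simp add: abs_divide divide_right_mono)
    thus ?thesis unfolding B_def atLeastAtMost_iff by linarith
  qed
  have "0 \<le> C"
  proof -
    obtain \<sigma> where "\<sigma> \<in> ?E" using embeddings_nonempty by blast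
    from C[OF this] show ?thesis by (rule order_trans[rotated]) (simp add: sum_nonneg)
  qed
  hence B0: "0 \<le> B \<sigma>" if "\<sigma> \<in> ?E" for \<sigma> using T[OF that] by (simp add: B_def)
  have Q: "finite Q" unfolding Q_def using finite_embeddings by (intro finite_PiE) auto
  have cardQ: "real (card Q) \<le> (\<Prod>\<sigma>\<in>?E. 2 * (C * real M / T \<sigma>) + 3)"
    unfolding Q_def card_PiE[OF finite_embeddings] of_nat_prod
  proof (intro prod_mono conjI)
    fix \<sigma> assume s: "\<sigma> \<in> ?E"
    have "real (card {- B \<sigma> - 1..B \<sigma>}) = real_of_int (2 * B \<sigma> + 2)" using B0[OF s] by simp
    also have "\<dots> \<le> 2 * (C * real M / T \<sigma>) + 3" unfolding B_def by linarith
    finally show "real (card {- B \<sigma> - 1..B \<sigma>}) \<le> 2 * (C * real M / T \<sigma>) + 3" .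
  qed simp
  have "q \<in> A \<rightarrow> Q" using floor by (auto simp: q_def Q_def)
  moreover have "A \<noteq> {}" using A(2) M by (metis card.empty power_eq_0_iff less_irrefl)
  ultimately obtain y where y: "card A \<le> card (q -` {y} \<inter> A) * card Q"
    using pigeonhole_card[of q A Q] A(1) Q by blast
  define Y where "Y = w ` (q -` {y} \<inter> A)"
  have cY: "card Y = card (q -` {y} \<inter> A)" unfolding Y_def by (intro card_image inj_on_subset[OF inj]) auto
  show thesis
  proof (rule that[of Y], safe)
    show "finite Y" "\<And>y. y \<in> Y \<Longrightarrow> y \<in> range (\<lambda>a. \<Sum>j<N. of_int (a j) * u j)" using A(1) by (auto simp: Y_def w_def)
    have "real M ^ N \<le> real (card Y * card Q)" using y unfolding A(2) cY by (metis of_nat_le_iff of_nat_power)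
    also have "\<dots> \<le> real (card Y) * (\<Prod>\<sigma>\<in>?E. 2 * (C * real M / T \<sigma>) + 3)"
      using cardQ by (simp add: mult_left_mono)
    finally show "real M ^ N \<le> real (card Y) * (\<Prod>\<sigma>\<in>?E. 2 * (C * real M / T \<sigma>) + 3)" .
    fix \<sigma> z z' assume "z \<in> Y" "z' \<in> Y" and s: "\<sigma> \<in> ?E"
    then obtain a a' where a: "z = w a" "z' = w a'" "q a = y" "q a' = y" by (auto simp: Y_def)
    hence "q a \<sigma> = q a' \<sigma>" by simp
    hence "\<lfloor>coord \<sigma> z / T \<sigma>\<rfloor> = \<lfloor>coord \<sigma> z' / T \<sigma>\<rfloor>" using s a(1,2) by (simp add: q_def)
    hence "\<bar>coord \<sigma> z / T \<sigma> - coord \<sigma> z' / T \<sigma>\<bar> \<le> 1" by linarith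
    hence "\<bar>(coord \<sigma> z - coord \<sigma> z') / T \<sigma>\<bar> \<le> 1" by (simp add: diff_divide_distrib)
    hence "\<bar>coord \<sigma> z - coord \<sigma> z'\<bar> \<le> T \<sigma>" using T[OF s] by (simp add: abs_divide)
    thus "\<bar>coord \<sigma> (z - z')\<bar> \<le> T \<sigma>" using s by (simp add: coord_diff embeddings_def)
  qed
qed

lemma basis_bound:
  obtains C where "0 \<le> C" "\<And>\<sigma>. \<sigma> \<in> embeddings \<Longrightarrow> (\<Sum>j<N. cmod (\<sigma> (u j :: 'a))) \<le> C"
proof (rule that[of "\<Sum>\<sigma>\<in>embeddings. \<Sum>j<N. cmod (\<sigma> (u j))"])
  show "(\<Sum>j<N. cmod (\<sigma> (u j))) \<le> (\<Sum>\<sigma>\<in>embeddings. \<Sum>j<N. cmod (\<sigma> (u j)))" if "\<sigma> \<in> embeddings" for \<sigma>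
    using that finite_embeddings by (intro member_le_sum) (auto simp: sum_nonneg)
qed (simp add: sum_nonneg)

lemma coord_imp_cmod:
  assumes "\<forall>\<sigma>\<in>embeddings. \<bar>coord \<sigma> z\<bar> \<le> T \<sigma>" "\<And>\<sigma>. \<sigma> \<in> embeddings \<Longrightarrow> T (cnj \<circ> \<sigma>) = T \<sigma>" "\<sigma> \<in> embeddings"
  shows "cmod (\<sigma> z) \<le> 2 * T \<sigma>"
proof -
  have "cnj \<circ> \<sigma> \<in> embeddings" using assms(3) field_emb_cnj by (auto simp: embeddings_def)
  hence "\<bar>coord (cnj \<circ> \<sigma>) z\<bar> \<le> T \<sigma>" using assms by metis
  thus ?thesis using assms by (intro cmod_le_coord) auto
qed

lemma lattice_subset:
  assumes "fractional I" "\<And>i. u i \<in> I" shows "range (\<lambda>a. \<Sum>j<N. of_int (a j) * u j) \<subseteq> I"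
proof clarify
  fix a :: "nat \<Rightarrow> int"
  have "(\<Sum>j<n. of_int (a j) * u j) \<in> I" for n
    using A_subset_integral by (induction n) (auto intro!: fractionalD(1-3)[OF assms(1)] assms(2))
  thus "(\<Sum>j<N. of_int (a j) * u j) \<in> I" .
qed

lemma fractional_integral_closure: "fractional (integral_closure (\<int> :: 'a set))"
  using fractional_ideal_of[OF fin_supp_0] by (simp add: ideal_of_0)

lemma fractional_diff: "fractional I \<Longrightarrow> a \<in> I \<Longrightarrow> c \<in> I \<Longrightarrow> a - c \<in> I"
  using fractionalD(2)[of I a "-1 * c"] fractionalD(3)[of I "-1" c] subsetD[OF A_subset_integral, of "-1"] by simp

lemma finite_bounded_integral:
  "finite {z :: 'a. z \<in> integral_closure \<int> \<and> (\<forall>\<sigma>\<in>embeddings. cmod (\<sigma> z) \<le> T)}"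
  using finite_bounded_algebraic_ints[OF rank, of T] by (simp add: algebraic_int_iff_integral_closure embeddings_def)

text \<open>With \<open>d < N\<close> embeddings, \<open>M ^ N\<close> lattice points would be
  spread over a number of unit cells that grows only like \<open>M ^ d\<close>. But a cell contains
  at most as many points as there are integral elements with all conjugates at most
  \<open>2\<close>, a finite number independent of \<open>M\<close>.\<close>

lemma card_embeddings_ge: "N \<le> card (embeddings :: ('a \<Rightarrow> complex) set)"
proof (rule ccontr)
  let ?E = "embeddings :: ('a \<Rightarrow> complex) set" and ?O = "integral_closure (\<int> :: 'a set)"
  assume "\<not> ?thesis"
  then obtain d where d: "card ?E = d" "Suc d \<le> N" by auto
  obtain u where u: "\<And>i. u i \<in> ?O" "int_basis u" using int_basis_in[OF fractional_integral_closure] by blast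
  obtain C where C: "0 \<le> C" "\<And>\<sigma>. \<sigma> \<in> ?E \<Longrightarrow> (\<Sum>j<N. cmod (\<sigma> (u j))) \<le> C" by (rule basis_bound[of u]) blast
  define F where "F = {z \<in> ?O. \<forall>\<sigma>\<in>?E. cmod (\<sigma> z) \<le> 2}"
  have F: "finite F" unfolding F_def by (rule finite_bounded_integral)
  have bound: "real M \<le> real (card F) * (2 * C + 3) ^ d" if M: "0 < M" for M
  proof -
    obtain Y where Y: "finite Y" "Y \<subseteq> range (\<lambda>a. \<Sum>j<N. of_int (a j) * u j)"
      "\<forall>y\<in>Y. \<forall>y'\<in>Y. \<forall>\<sigma>\<in>?E. \<bar>coord \<sigma> (y - y')\<bar> \<le> 1"
      "real M ^ N \<le> real (card Y) * (\<Prod>\<sigma>\<in>?E. 2 * (C * real M / 1) + 3)"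
      by (rule lattice_pigeonhole[where T = "\<lambda>_. 1", OF u(2) zero_less_one M C(2)], assumption) (rule that; assumption)
    have YO: "Y \<subseteq> ?O" by (rule order_trans[OF Y(2) lattice_subset[OF fractional_integral_closure u(1)]])
    have "card Y \<le> card F"
    proof (cases "Y = {}")
      case False
      then obtain y0 where y0: "y0 \<in> Y" by blast
      have "(\<lambda>y. y - y0) ` Y \<subseteq> F" unfolding F_def
      proof clarify
        fix y assume y: "y \<in> Y"
        have "y - y0 \<in> ?O" using y y0 YO by (intro fractional_diff[OF fractional_integral_closure]) auto
        moreover have "cmod (\<sigma> (y - y0)) \<le> 2" if "\<sigma> \<in> ?E" for \<sigma>
          using coord_imp_cmod[of "y - y0" "\<lambda>_. 1" \<sigma>] Y(3) y y0 that by simp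
        ultimately show "y - y0 \<in> ?O \<and> (\<forall>\<sigma>\<in>?E. cmod (\<sigma> (y - y0)) \<le> 2)" by blast
      qed
      hence "card ((\<lambda>y. y - y0) ` Y) \<le> card F" by (rule card_mono[OF F])
      moreover have "inj_on (\<lambda>y. y - y0) Y" by (auto intro: inj_onI)
      ultimately show ?thesis by (simp add: card_image)
    qed simp
    hence "real (card Y) * (2 * (C * real M) + 3) ^ d \<le> real (card F) * (2 * (C * real M) + 3) ^ d"
      using C(1) by (intro mult_right_mono) auto
    also have "\<dots> \<le> real (card F) * ((2 * C + 3) * real M) ^ d"
      using C(1) M by (intro mult_left_mono power_mono) (auto simp: algebra_simps)
    finally have "real M ^ N \<le> real (card F) * (2 * C + 3) ^ d * real M ^ d"
      using Y(4) d(1) by (simp add: power_mult_distrib mult_ac)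
    moreover have "real M ^ Suc d \<le> real M ^ N" using M d(2) by (intro power_increasing) auto
    ultimately have "real M * real M ^ d \<le> (real (card F) * (2 * C + 3) ^ d) * real M ^ d" by simp
    thus ?thesis using M by (simp only: mult_le_cancel_right) auto
  qed
  obtain M :: nat where M: "real (card F) * (2 * C + 3) ^ d < real M" using reals_Archimedean2 by blast
  have "0 \<le> real (card F) * (2 * C + 3) ^ d" using C(1) by simp
  hence "0 < real M" using M by linarith
  hence "0 < M" by simp
  thus False using bound[of M] M by linarith
qed

lemma card_embeddings: "card (embeddings :: ('a \<Rightarrow> complex) set) = N"
  using card_embeddings_le card_embeddings_ge by (rule antisym)

text \<open>The constant is \<open>1 / (4 * C + 3) ^ N\<close>. For \<open>M\<close> above all
  \<open>T \<sigma>\<close> each factor of the cell count is at most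
  \<open>(4 * C + 3) * M / T \<sigma>\<close>. There are exactly \<open>N\<close> embeddings, so the
  powers of \<open>M\<close> cancel and the bound depends on \<open>T\<close> only through its
  product.\<close>

lemma lattice_count:
  assumes I: "fractional I"
  obtains c where "0 < c"
    "\<And>T. (\<And>\<sigma>. \<sigma> \<in> embeddings \<Longrightarrow> 0 < T \<sigma>) \<Longrightarrow> (\<And>\<sigma>. \<sigma> \<in> embeddings \<Longrightarrow> T (cnj \<circ> \<sigma>) = T \<sigma>) \<Longrightarrow>
      \<exists>Y\<subseteq>I. finite Y \<and> (\<forall>\<sigma>\<in>embeddings. \<forall>y\<in>Y. \<forall>y'\<in>Y. cmod (\<sigma> (y - y')) \<le> T \<sigma>) \<and> c * (\<Prod>\<sigma>\<in>embeddings. T \<sigma>) \<le> real (card Y)"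
proof -
  let ?E = "embeddings :: ('a \<Rightarrow> complex) set"
  obtain u where u: "\<And>i. u i \<in> I" "int_basis u" using int_basis_in[OF I] by blast
  obtain C where C: "0 \<le> C" "\<And>\<sigma>. \<sigma> \<in> ?E \<Longrightarrow> (\<Sum>j<N. cmod (\<sigma> (u j))) \<le> C" by (rule basis_bound[of u]) blast
  define c where "c = 1 / (4 * C + 3) ^ N"
  show thesis
  proof (rule that[of c])
    show "0 < c" using C(1) by (simp add: c_def)
    fix T :: "('a \<Rightarrow> complex) \<Rightarrow> real"
    assume T: "\<And>\<sigma>. \<sigma> \<in> ?E \<Longrightarrow> 0 < T \<sigma>" "\<And>\<sigma>. \<sigma> \<in> ?E \<Longrightarrow> T (cnj \<circ> \<sigma>) = T \<sigma>"
    \<comment> \<open>Positive and at least every \<open>T \<sigma>\<close>, which absorbs the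
      summand \<open>3\<close> into \<open>3 * M / T \<sigma>\<close>.\<close>
    define M where "M = nat \<lceil>\<Sum>\<sigma>\<in>?E. T \<sigma>\<rceil> + 1"
    have M: "T \<sigma> \<le> real M" if "\<sigma> \<in> ?E" for \<sigma>
    proof -
      have "T \<sigma> \<le> (\<Sum>\<sigma>\<in>?E. T \<sigma>)" using that T(1) finite_embeddings by (intro member_le_sum) (auto intro: less_imp_le)
      thus ?thesis unfolding M_def by linarith
    qed
    have M0: "0 < M" by (simp add: M_def)
    \<comment> \<open>Cells of side \<open>T \<sigma> / 2\<close>, because passing from coordinates
      to absolute values doubles the bound.\<close>
    obtain Y where Y: "finite Y" "Y \<subseteq> range (\<lambda>a. \<Sum>j<N. of_int (a j) * u j)"
      "\<forall>y\<in>Y. \<forall>y'\<in>Y. \<forall>\<sigma>\<in>?E. \<bar>coord \<sigma> (y - y')\<bar> \<le> T \<sigma> / 2"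
      "real M ^ N \<le> real (card Y) * (\<Prod>\<sigma>\<in>?E. 2 * (C * real M / (T \<sigma> / 2)) + 3)"
      by (rule lattice_pigeonhole[where T = "\<lambda>\<sigma>. T \<sigma> / 2", OF u(2) half_gt_zero[OF T(1)] M0 C(2)], assumption, assumption)
        (rule that; assumption)
    have "(\<Prod>\<sigma>\<in>?E. 2 * (C * real M / (T \<sigma> / 2)) + 3) \<le> (\<Prod>\<sigma>\<in>?E. (4 * C + 3) * real M / T \<sigma>)"
    proof (intro prod_mono conjI)
      fix \<sigma> assume s: "\<sigma> \<in> ?E"
      show "0 \<le> 2 * (C * real M / (T \<sigma> / 2)) + 3" using C(1) T(1)[OF s] by simp
      have "3 \<le> 3 * real M / T \<sigma>" using M[OF s] T(1)[OF s] by (simp add: field_simps)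
      thus "2 * (C * real M / (T \<sigma> / 2)) + 3 \<le> (4 * C + 3) * real M / T \<sigma>" by (simp add: algebra_simps add_divide_distrib)
    qed
    also have "\<dots> = (4 * C + 3) ^ N * real M ^ N / (\<Prod>\<sigma>\<in>?E. T \<sigma>)"
      by (simp add: prod_dividef card_embeddings power_mult_distrib)
    finally have "real M ^ N \<le> real (card Y) * ((4 * C + 3) ^ N * real M ^ N / (\<Prod>\<sigma>\<in>?E. T \<sigma>))"
      using Y(4) by (meson mult_left_mono of_nat_0_le_iff order_trans)
    moreover have P: "0 < (\<Prod>\<sigma>\<in>?E. T \<sigma>)" using T(1) by (intro prod_pos) auto
    ultimately have "real M ^ N * (\<Prod>\<sigma>\<in>?E. T \<sigma>) \<le> real M ^ N * (real (card Y) * (4 * C + 3) ^ N)"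
      by (simp add: field_simps)
    hence "(\<Prod>\<sigma>\<in>?E. T \<sigma>) \<le> real (card Y) * (4 * C + 3) ^ N" using M0 by simp
    hence "c * (\<Prod>\<sigma>\<in>?E. T \<sigma>) \<le> real (card Y)" using C(1) by (simp add: c_def pos_divide_le_eq)
    moreover have "cmod (\<sigma> (y - y')) \<le> T \<sigma>" if "\<sigma> \<in> ?E" "y \<in> Y" "y' \<in> Y" for \<sigma> y y'
      using coord_imp_cmod[of "y - y'" "\<lambda>\<sigma>. T \<sigma> / 2" \<sigma>] Y(3) that T(2) by simp
    moreover have "Y \<subseteq> I" by (rule order_trans[OF Y(2) lattice_subset[OF I u(1)]])
    ultimately show "\<exists>Y\<subseteq>I. finite Y \<and> (\<forall>\<sigma>\<in>?E. \<forall>y\<in>Y. \<forall>y'\<in>Y. cmod (\<sigma> (y - y')) \<le> T \<sigma>) \<and> c * (\<Prod>\<sigma>\<in>?E. T \<sigma>) \<le> real (card Y)"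
      using Y(1) by blast
  qed
qed

section \<open>The product formula\<close>

definition log_conjugates :: "'a \<Rightarrow> real" where
  "log_conjugates f = (\<Sum>\<sigma>\<in>embeddings. ln (cmod (\<sigma> f)))"

lemma emb_nonzero: "\<sigma> \<in> embeddings \<Longrightarrow> \<sigma> f = 0 \<longleftrightarrow> f = (0::'a)"
  by (auto simp: embeddings_def field_embD(10))

lemma log_conjugates_mult: "f \<noteq> 0 \<Longrightarrow> g \<noteq> 0 \<Longrightarrow> log_conjugates (f * g) = log_conjugates f + log_conjugates g"
  unfolding log_conjugates_def sum.distrib[symmetric]
  by (intro sum.cong) (auto simp: embeddings_def field_embD(3,10) norm_mult ln_mult)

definition defect :: "'a \<Rightarrow> real" where "defect f = log_index f - log_conjugates f"

lemma defect_mult: "f \<noteq> 0 \<Longrightarrow> g \<noteq> 0 \<Longrightarrow> defect (f * g) = defect f + defect g"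
  by (simp add: defect_def log_index_mult log_conjugates_mult)

lemma defect_power: "f \<noteq> 0 \<Longrightarrow> defect (f ^ Suc n) = (real n + 1) * defect f"
  by (induction n) (simp_all add: defect_mult algebra_simps)

text \<open>For \<open>z \<noteq> 0\<close> the powers of \<open>z\<close> would be infinitely many
  integral elements with all conjugates bounded by \<open>1\<close>.\<close>

lemma integral_small_conjugates:
  assumes z: "z \<in> integral_closure (\<int> :: 'a set)" and small: "\<And>\<sigma>. \<sigma> \<in> embeddings \<Longrightarrow> cmod (\<sigma> z) \<le> 1 / 2"
  shows "z = 0"
proof (rule ccontr)
  assume z0: "z \<noteq> 0"
  obtain \<sigma> where s: "\<sigma> \<in> (embeddings :: ('a \<Rightarrow> complex) set)" using embeddings_nonempty by blast
  have p: "\<tau> (z ^ k) = \<tau> z ^ k" if "\<tau> \<in> embeddings" for \<tau> and k using that by (simp add: embeddings_def field_embD(8))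
  have "range (\<lambda>k. z ^ k) \<subseteq> {z. z \<in> integral_closure \<int> \<and> (\<forall>\<sigma>\<in>embeddings. cmod (\<sigma> z) \<le> 1)}"
  proof clarify
    fix k
    have "cmod (\<tau> (z ^ k)) \<le> 1" if "\<tau> \<in> embeddings" for \<tau>
      using p[OF that] small[OF that] by (simp add: norm_power power_le_one)
    thus "z ^ k \<in> integral_closure \<int> \<and> (\<forall>\<sigma>\<in>embeddings. cmod (\<sigma> (z ^ k)) \<le> 1)"
      using subring_power[OF subring_integral_closure z] by blast
  qed
  hence "finite (range (\<lambda>k. z ^ k))" by (rule finite_subset) (rule finite_bounded_integral)
  moreover have "inj (\<lambda>k::nat. z ^ k)"
  proof (rule injI)
    fix i j :: nat assume "z ^ i = z ^ j"
    hence "cmod (\<sigma> z) ^ i = cmod (\<sigma> z) ^ j" using p[OF s, of i] p[OF s, of j] by (metis norm_power)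
    moreover have "0 < cmod (\<sigma> z)" "cmod (\<sigma> z) < 1" using emb_nonzero[OF s] z0 small[OF s] by auto
    ultimately show "i = j" using power_strict_decreasing_iff[of "cmod (\<sigma> z)"] by (metis less_irrefl linorder_neqE_nat)
  qed
  ultimately show False using finite_imageD[of "\<lambda>k. z ^ k" "UNIV :: nat set"] by simp
qed

text \<open>A uniform lower bound comes from the lattice points of a box with sides half as large as
  the conjugates of \<open>g\<close>. Two of them that are congruent modulo \<open>g\<close> have a
  difference whose quotient by \<open>g\<close> is integral with conjugates at most
  \<open>1/2\<close>, hence zero. So the index of \<open>g\<close> is at least the number of
  points.\<close>

lemma defect_nonneg:
  assumes f: "f \<in> integral_closure \<int>" "f \<noteq> 0" shows "0 \<le> defect f"
proof -
  let ?E = "embeddings :: ('a \<Rightarrow> complex) set" and ?O = "integral_closure (\<int> :: 'a set)"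
  obtain c where c: "0 < c" "\<And>T. (\<And>\<sigma>. \<sigma> \<in> ?E \<Longrightarrow> 0 < T \<sigma>) \<Longrightarrow> (\<And>\<sigma>. \<sigma> \<in> ?E \<Longrightarrow> T (cnj \<circ> \<sigma>) = T \<sigma>) \<Longrightarrow>
      \<exists>Y\<subseteq>?O. finite Y \<and> (\<forall>\<sigma>\<in>?E. \<forall>y\<in>Y. \<forall>y'\<in>Y. cmod (\<sigma> (y - y')) \<le> T \<sigma>) \<and> c * (\<Prod>\<sigma>\<in>?E. T \<sigma>) \<le> real (card Y)"
    by (rule lattice_count[OF fractional_integral_closure]) blast
  have lower: "ln (c / 2 ^ N) \<le> defect g" if g: "g \<in> ?O" "g \<noteq> 0" for g
  proof -
    have pos: "0 < cmod (\<sigma> g)" if "\<sigma> \<in> ?E" for \<sigma> using emb_nonzero[OF that] g(2) by simp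
    obtain Y where Y: "Y \<subseteq> ?O" "finite Y" "\<And>\<sigma> y y'. \<sigma> \<in> ?E \<Longrightarrow> y \<in> Y \<Longrightarrow> y' \<in> Y \<Longrightarrow> cmod (\<sigma> (y - y')) \<le> cmod (\<sigma> g) / 2"
      "c * (\<Prod>\<sigma>\<in>?E. cmod (\<sigma> g) / 2) \<le> real (card Y)"
      using c(2)[of "\<lambda>\<sigma>. cmod (\<sigma> g) / 2"] pos by auto
    obtain T where T: "transversal ?O (ideal_of (\<lambda>v. v g)) T" "0 < card T" "log_index g = ln (real (card T))"
      using log_index_index[OF g] by blast
    have "\<forall>y\<in>Y. \<exists>x\<in>T. y - x \<in> ideal_of (\<lambda>v. v g)" using T(1) Y(1) by (auto simp: transversal_def)
    then obtain r where r: "\<And>y. y \<in> Y \<Longrightarrow> r y \<in> T" "\<And>y. y \<in> Y \<Longrightarrow> y - r y \<in> ideal_of (\<lambda>v. v g)" by metis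
    have "inj_on r Y"
    proof (rule inj_onI)
      fix y y' assume y: "y \<in> Y" "y' \<in> Y" "r y = r y'"
      have "(y - r y) - (y' - r y') \<in> ideal_of (\<lambda>v. v g)" by (intro ideal_of_closed(4) r(2) y)
      hence mem: "y - y' \<in> ideal_of (\<lambda>v. v g)" using y(3) by simp
      have "(y - y') / g \<in> ?O" unfolding integral_iff
      proof
        fix v assume v: "v \<in> V"
        have "vge v (v g) (y - y')" using mem v by (simp add: ideal_of_def)
        thus "vge v 0 ((y - y') / g)" using g(2) v by (cases "y = y'") (auto simp: vge_def nv_divide V_nv)
      qed
      moreover have "cmod (\<sigma> ((y - y') / g)) \<le> 1 / 2" if s: "\<sigma> \<in> ?E" for \<sigma>
      proof -
        have "\<sigma> ((y - y') / g) = \<sigma> (y - y') / \<sigma> g"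
          using s by (simp add: embeddings_def divide_inverse field_embD(3,11))
        hence "cmod (\<sigma> ((y - y') / g)) = cmod (\<sigma> (y - y')) / cmod (\<sigma> g)" by (simp only: norm_divide)
        also have "\<dots> \<le> 1 / 2" using Y(3)[OF s y(1,2)] pos[OF s] by (simp add: pos_divide_le_eq)
        finally show ?thesis .
      qed
      ultimately have "(y - y') / g = 0" by (rule integral_small_conjugates)
      thus "y = y'" using g(2) by simp
    qed
    moreover have "r ` Y \<subseteq> T" using r(1) by blast
    ultimately have "card Y \<le> card T" using T(1) by (intro card_inj_on_le) (auto simp: transversal_def)
    hence "c * (\<Prod>\<sigma>\<in>?E. cmod (\<sigma> g) / 2) \<le> real (card T)" using Y(4) by linarith
    also have "c * (\<Prod>\<sigma>\<in>?E. cmod (\<sigma> g) / 2) = c / 2 ^ N * (\<Prod>\<sigma>\<in>?E. cmod (\<sigma> g))"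
      by (simp add: prod_dividef card_embeddings)
    finally have le: "c / 2 ^ N * (\<Prod>\<sigma>\<in>?E. cmod (\<sigma> g)) \<le> real (card T)" .
    have P: "0 < (\<Prod>\<sigma>\<in>?E. cmod (\<sigma> g))" using pos by (intro prod_pos) auto
    have "ln (c / 2 ^ N) + log_conjugates g = ln (c / 2 ^ N) + ln (\<Prod>\<sigma>\<in>?E. cmod (\<sigma> g))"
      unfolding log_conjugates_def using pos finite_embeddings by (subst ln_prod) (auto dest: less_imp_neq)
    also have "\<dots> = ln (c / 2 ^ N * (\<Prod>\<sigma>\<in>?E. cmod (\<sigma> g)))" using c(1) P by (subst ln_mult) auto
    also have "\<dots> \<le> ln (real (card T))" using le c(1) P by (intro ln_mono) auto
    finally show ?thesis using T(3) by (simp add: defect_def)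
  qed
  have "ln (c / 2 ^ N) \<le> (real n + 1) * defect f" for n
    using lower[of "f ^ Suc n"] defect_power[OF f(2), of n] subring_power[OF subring_integral_closure f(1), of "Suc n"] f(2) by simp
  show ?thesis
  proof (rule ccontr)
    assume "\<not> ?thesis"
    hence neg: "0 < - defect f" by simp
    obtain n :: nat where "- ln (c / 2 ^ N) / (- defect f) < real n" using reals_Archimedean2 by blast
    hence "- ln (c / 2 ^ N) < real n * (- defect f)" unfolding pos_divide_less_eq[OF neg] .
    moreover have "- ((real n + 1) * defect f) \<le> - ln (c / 2 ^ N)" using \<open>ln (c / 2 ^ N) \<le> (real n + 1) * defect f\<close> by simp
    ultimately show False using neg by (simp add: algebra_simps)
  qed
qed

text \<open>On prime numbers the opposite inequality holds, since the index is at most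
  \<open>p ^ N\<close> and there are exactly \<open>N\<close> embeddings, each fixing
  \<open>p\<close>. Multiplicativity carries it to all positive integers. For integral
  \<open>g\<close> the factorization \<open>m = g * (m / g)\<close> into integral factors splits
  \<open>0\<close> into two nonnegative defects.\<close>

lemma defect_zero:
  assumes f: "f \<noteq> 0" shows "defect f = 0"
proof -
  have one: "defect 1 = 0" using defect_mult[of 1 1] by simp
  have ZO: "of_int m \<in> integral_closure (\<int> :: 'a set)" for m using A_subset_integral by auto
  have prime: "defect (of_nat p) \<le> 0" if p: "prime p" for p
  proof -
    have "log_conjugates (of_nat p) = (\<Sum>\<sigma>\<in>(embeddings :: ('a \<Rightarrow> complex) set). ln (real p))" unfolding log_conjugates_def
    proof (intro sum.cong refl)
      fix \<sigma> :: "'a \<Rightarrow> complex" assume "\<sigma> \<in> embeddings"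
      thus "ln (cmod (\<sigma> (of_nat p))) = ln (real p)" using field_embD(7)[of \<sigma> "int p"] by (simp add: embeddings_def)
    qed
    thus ?thesis using log_index_prime_le[OF p] by (simp add: defect_def card_embeddings)
  qed
  have nat: "defect (of_nat n) \<le> 0" if "0 < n" for n :: nat
    using that
  proof (induction n rule: less_induct)
    case (less n)
    show ?case
    proof (cases "n = 1")
      case False
      then obtain p m where pm: "prime p" "n = p * m" using prime_factor_nat[of n] by blast
      hence "m < n" "0 < m" "0 < p" using less.prems prime_gt_1_nat[OF pm(1)] by auto
      thus ?thesis using pm less.IH[of m] prime[OF pm(1)] defect_mult[of "of_nat p" "of_nat m"] by simp
    qed (use one in simp)
  qed
  have m1: "defect (- 1) = 0" using defect_mult[of "- 1" "- 1"] one by simp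
  have int: "defect (of_int m) = 0" if "m \<noteq> 0" for m
  proof -
    have "defect (of_int m) \<le> 0"
    proof (cases m rule: int_cases2)
      case (nonneg n)
      thus ?thesis using nat[of n] that by simp
    next
      case (nonpos n)
      thus ?thesis using nat[of n] that m1 defect_mult[of "- 1" "of_nat n"] by simp
    qed
    moreover have "0 \<le> defect (of_int m)" using that by (intro defect_nonneg ZO) simp
    ultimately show ?thesis by linarith
  qed
  have clear: "\<exists>m. m \<noteq> 0 \<and> of_int m * z \<in> integral_closure \<int>" for z :: 'a
  proof -
    obtain a where "a \<in> \<int>" "a \<noteq> 0" "\<And>v. v \<in> V \<Longrightarrow> vge v 0 (a * z)" by (rule integral_multiple_V[of z]) blast
    thus ?thesis by (auto elim!: Ints_cases simp: integral_iff)
  qed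
  have integral: "defect g = 0" if g: "g \<in> integral_closure \<int>" "g \<noteq> 0" for g
  proof -
    obtain m where m: "m \<noteq> 0" "of_int m * (1 / g) \<in> integral_closure \<int>" using clear by blast
    have nz: "of_int m * (1 / g) \<noteq> 0" using m g by simp
    have "defect (g * (of_int m * (1 / g))) = 0" using int[OF m(1)] g(2) by simp
    hence "defect g + defect (of_int m * (1 / g)) = 0" using defect_mult[OF g(2) nz] by simp
    thus ?thesis using defect_nonneg[OF g] defect_nonneg[OF m(2) nz] by linarith
  qed
  obtain m where m: "m \<noteq> 0" "of_int m * f \<in> integral_closure \<int>" using clear by blast
  hence "defect (of_int m * f) = 0" using f by (intro integral) auto
  thus ?thesis using defect_mult[of "of_int m" f] int[OF m(1)] m(1) f by simp
qed

end

section \<open>Archimedean places and the number field instance\<close>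

definition arch_place :: "('a \<Rightarrow> complex) \<Rightarrow> 'a::field_char_0 place" where
  "arch_place \<sigma> = Arch (conj_pair \<sigma>)"

lemma arch_places_eq: "arch_places = arch_place ` embeddings"
  by (auto simp: arch_places_def arch_place_def conj_pair_def embeddings_def field_emb_def)

lemma arch_place_cnj: "arch_place (cnj \<circ> \<sigma>) = arch_place \<sigma>"
  by (simp add: arch_place_def conj_pair_cnj)

lemma place_val_arch: "place_val (arch_place \<sigma>) f = - ln (cmod (\<sigma> f))"
proof -
  have "(SOME \<tau>. \<tau> \<in> conj_pair \<sigma>) \<in> conj_pair \<sigma>" by (rule someI[of _ \<sigma>]) (simp add: conj_pair_def)
  hence "cmod ((SOME \<tau>. \<tau> \<in> conj_pair \<sigma>) f) = cmod (\<sigma> f)" by (auto simp: conj_pair_def)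
  thus ?thesis by (simp add: arch_place_def)
qed

text \<open>The degree counts the embeddings that belong to the place, so sums over embeddings
  become weighted sums over places.\<close>

lemma nf_deg_arch: "nf_deg (arch_place \<sigma>) = real (card (conj_pair \<sigma>))"
proof (cases "cnj \<circ> \<sigma> = \<sigma>")
  case True
  hence "cnj (\<sigma> z) = \<sigma> z" for z by (metis comp_apply)
  hence "range \<sigma> \<subseteq> \<real>" by (auto simp: Reals_cnj_iff)
  thus ?thesis using True by (simp add: arch_place_def conj_pair_def)
next
  case False
  then obtain z where "cnj (\<sigma> z) \<noteq> \<sigma> z" by (auto simp: fun_eq_iff)
  hence "\<not> range \<sigma> \<subseteq> \<real>" by (metis Reals_cnj_iff rangeI subsetD)
  moreover have "card {\<sigma>, cnj \<circ> \<sigma>} = 2" using False by (simp add: card_insert_if)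
  ultimately show ?thesis by (simp add: arch_place_def conj_pair_def)
qed

lemma arch_place_fibre:
  assumes "\<sigma> \<in> embeddings" shows "{\<tau> \<in> embeddings. arch_place \<tau> = arch_place \<sigma>} = conj_pair \<sigma>"
proof
  show "{\<tau> \<in> embeddings. arch_place \<tau> = arch_place \<sigma>} \<subseteq> conj_pair \<sigma>" by (auto simp: arch_place_def conj_pair_def)
  show "conj_pair \<sigma> \<subseteq> {\<tau> \<in> embeddings. arch_place \<tau> = arch_place \<sigma>}"
    using assms arch_place_cnj[of \<sigma>] field_emb_cnj by (auto simp: conj_pair_def embeddings_def)
qed

context number_field_setting
begin

lemma sum_arch_places:
  "(\<Sum>p\<in>(arch_places :: 'a place set). place_val p f * nf_deg p) = - log_conjugates f"
proof -
  let ?E = "embeddings :: ('a \<Rightarrow> complex) set"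
  have "log_conjugates f = (\<Sum>p\<in>arch_place ` ?E. \<Sum>\<tau>\<in>{\<tau> \<in> ?E. arch_place \<tau> = p}. ln (cmod (\<tau> f)))"
    unfolding log_conjugates_def by (rule sum.image_gen[OF finite_embeddings])
  also have "\<dots> = (\<Sum>p\<in>arch_place ` ?E. - (place_val p f * nf_deg p))"
  proof (rule sum.cong[OF refl])
    fix p assume "p \<in> arch_place ` ?E"
    then obtain \<sigma> where s: "\<sigma> \<in> ?E" "p = arch_place \<sigma>" by blast
    have "(\<Sum>\<tau>\<in>{\<tau> \<in> ?E. arch_place \<tau> = p}. ln (cmod (\<tau> f))) = (\<Sum>\<tau>\<in>conj_pair \<sigma>. ln (cmod (\<sigma> f)))"
      unfolding s(2) arch_place_fibre[OF s(1)] by (rule sum.cong) (auto simp: conj_pair_def)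
    thus "(\<Sum>\<tau>\<in>{\<tau> \<in> ?E. arch_place \<tau> = p}. ln (cmod (\<tau> f))) = - (place_val p f * nf_deg p)"
      unfolding s(2) place_val_arch nf_deg_arch by simp
  qed
  finally show ?thesis by (simp add: arch_places_eq sum_negf)
qed

text \<open>The sides of the box are prescribed at all places except \<open>p0\<close> and large at
  \<open>p0\<close>, so that the box count reaches \<open>2\<close>; the wanted element is the
  difference of two of the points.\<close>

lemma exists_small_nf:
  assumes I: "fractional I" and p0: "p0 \<in> arch_places"
  shows "\<exists>h\<in>I - {0}. \<forall>p\<in>arch_places - {p0}. C p \<le> place_val p h"
proof -
  let ?E = "embeddings :: ('a \<Rightarrow> complex) set"
  obtain c where c: "0 < c" "\<And>T. (\<And>\<sigma>. \<sigma> \<in> ?E \<Longrightarrow> 0 < T \<sigma>) \<Longrightarrow> (\<And>\<sigma>. \<sigma> \<in> ?E \<Longrightarrow> T (cnj \<circ> \<sigma>) = T \<sigma>) \<Longrightarrow>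
      \<exists>Y\<subseteq>I. finite Y \<and> (\<forall>\<sigma>\<in>?E. \<forall>y\<in>Y. \<forall>y'\<in>Y. cmod (\<sigma> (y - y')) \<le> T \<sigma>) \<and> c * (\<Prod>\<sigma>\<in>?E. T \<sigma>) \<le> real (card Y)"
    by (rule lattice_count[OF I]) blast
  define E0 where "E0 = {\<sigma> \<in> ?E. arch_place \<sigma> = p0}"
  define P where "P = (\<Prod>\<sigma>\<in>?E - E0. exp (- C (arch_place \<sigma>)))"
  \<comment> \<open>The quotient makes the guaranteed count at least \<open>2\<close>. The maximum
    with \<open>1\<close> ensures \<open>B \<le> B ^ card E0\<close>, whether one or two embeddings
    belong to \<open>p0\<close>.\<close>
  define B where "B = max 1 (2 / (c * P))"
  define T where "T \<sigma> = (if arch_place \<sigma> = p0 then B else exp (- C (arch_place \<sigma>)))" for \<sigma>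
  have P: "0 < P" unfolding P_def by (intro prod_pos) auto
  have E0: "E0 \<subseteq> ?E" "finite E0" "E0 \<noteq> {}" using p0 finite_embeddings by (auto simp: E0_def arch_places_eq)
  have "(\<Prod>\<sigma>\<in>?E. T \<sigma>) = (\<Prod>\<sigma>\<in>?E - E0. T \<sigma>) * (\<Prod>\<sigma>\<in>E0. T \<sigma>)"
    by (rule prod.subset_diff[OF E0(1) finite_embeddings])
  also have "(\<Prod>\<sigma>\<in>E0. T \<sigma>) = B ^ card E0" by (simp add: E0_def T_def)
  also have "(\<Prod>\<sigma>\<in>?E - E0. T \<sigma>) = P" unfolding P_def by (intro prod.cong) (auto simp: E0_def T_def)
  finally have "(\<Prod>\<sigma>\<in>?E. T \<sigma>) = P * B ^ card E0" .
  moreover have "B \<le> B ^ card E0" using E0 by (intro self_le_power) (auto simp: B_def card_gt_0_iff)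
  moreover have "2 / (c * P) \<le> B" by (simp add: B_def)
  ultimately have "P * (2 / (c * P)) \<le> (\<Prod>\<sigma>\<in>?E. T \<sigma>)"
    using P by (metis mult_left_mono less_imp_le order_trans)
  hence "c * (P * (2 / (c * P))) \<le> c * (\<Prod>\<sigma>\<in>?E. T \<sigma>)"
    using c(1) by (intro mult_left_mono) auto
  moreover have "c * (P * (2 / (c * P))) = 2" using c(1) P by simp
  moreover have Tpos: "0 < T \<sigma>" and Tcnj: "T (cnj \<circ> \<sigma>) = T \<sigma>" for \<sigma>
    by (simp add: T_def B_def less_max_iff_disj) (simp only: T_def arch_place_cnj)
  moreover obtain Y where Y: "Y \<subseteq> I" "finite Y" "\<And>\<sigma> y y'. \<sigma> \<in> ?E \<Longrightarrow> y \<in> Y \<Longrightarrow> y' \<in> Y \<Longrightarrow> cmod (\<sigma> (y - y')) \<le> T \<sigma>"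
    "c * (\<Prod>\<sigma>\<in>?E. T \<sigma>) \<le> real (card Y)"
    using c(2)[of T, OF Tpos Tcnj] by auto
  ultimately have "2 \<le> card Y" by linarith
  then obtain y y' where y: "y \<in> Y" "y' \<in> Y" "y \<noteq> y'" by (metis Y(2) card_le_Suc0_iff_eq not_less_eq_eq numeral_2_eq_2)
  show ?thesis
  proof (intro bexI[of _ "y - y'"] ballI)
    show "y - y' \<in> I - {0}" using y Y(1) fractional_diff[OF I] by auto
    fix p assume "p \<in> arch_places - {p0}"
    then obtain \<sigma> where s: "\<sigma> \<in> ?E" "p = arch_place \<sigma>" "arch_place \<sigma> \<noteq> p0" by (auto simp: arch_places_eq)
    have "0 < cmod (\<sigma> (y - y'))" using emb_nonzero[OF s(1), of "y - y'"] y(3) by simp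
    moreover have "cmod (\<sigma> (y - y')) \<le> exp (- C p)" using Y(3)[OF s(1) y(1,2)] s by (simp add: T_def)
    ultimately have "ln (cmod (\<sigma> (y - y'))) \<le> - C p" by (metis ln_exp ln_mono)
    thus "C p \<le> place_val p (y - y')" by (simp add: s(2) place_val_arch)
  qed
qed

text \<open>A common denominator \<open>d\<close> maps the set injectively into integral elements
  with bounded conjugates.\<close>

lemma finite_bounded_fractional:
  assumes I: "fractional I"
  shows "finite {h \<in> I - {0}. \<forall>p\<in>arch_places. C p \<le> place_val p h}" (is "finite ?H")
proof -
  let ?E = "embeddings :: ('a \<Rightarrow> complex) set"
  obtain d where d: "d \<in> integral_closure \<int>" "d \<noteq> 0" "\<And>a. a \<in> I \<Longrightarrow> d * a \<in> integral_closure \<int>"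
    using fractionalD(5)[OF I] by blast
  define B where "B = (\<Sum>\<sigma>\<in>?E. cmod (\<sigma> d) * exp (- C (arch_place \<sigma>)))"
  have "(\<lambda>h. d * h) ` ?H \<subseteq> {z. z \<in> integral_closure \<int> \<and> (\<forall>\<sigma>\<in>?E. cmod (\<sigma> z) \<le> B)}"
  proof (intro image_subsetI CollectI conjI ballI)
    fix h assume h: "h \<in> ?H"
    show "d * h \<in> integral_closure \<int>" using h d(3) by blast
    fix \<sigma> assume s: "\<sigma> \<in> ?E"
    have "0 < cmod (\<sigma> h)" using emb_nonzero[OF s, of h] h by simp
    moreover have "C (arch_place \<sigma>) \<le> - ln (cmod (\<sigma> h))"
      using h s unfolding place_val_arch[symmetric] by (auto simp: arch_places_eq)
    ultimately have "cmod (\<sigma> h) \<le> exp (- C (arch_place \<sigma>))"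
      by (metis exp_le_cancel_iff exp_ln le_minus_iff)
    hence "cmod (\<sigma> (d * h)) \<le> cmod (\<sigma> d) * exp (- C (arch_place \<sigma>))"
      using s by (simp add: embeddings_def field_embD(3) norm_mult mult_left_mono)
    also have "\<dots> \<le> B" unfolding B_def using s finite_embeddings by (intro member_le_sum) auto
    finally show "cmod (\<sigma> (d * h)) \<le> B" .
  qed
  hence "finite ((\<lambda>h. d * h) ` ?H)" by (rule finite_subset) (rule finite_bounded_integral)
  moreover have "inj_on (\<lambda>h. d * h) ?H" using d(2) by (auto intro: inj_onI)
  ultimately show ?thesis by (rule finite_imageD)
qed

lemma nf_setting_nf_data:
  assumes ps: "distinct ps" "set ps = (arch_places :: 'a place set)"
  shows "nf_setting (\<int> :: 'a set) N (nf_data ps)"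
proof -
  let ?X = "nf_data ps" and ?E = "embeddings :: ('a \<Rightarrow> complex) set"
  have X: "inf_places ?X = ps" "coef_group ?X = UNIV" "abs_base ?X = exp 1" "place_deg ?X = nf_deg"
    "int_ring ?X = integral_closure \<int>" "all_places ?X = arch_places \<union> Nonarch ` V"
    by (auto simp: nf_data_def algebraic_int_iff_integral_closure V_eq)
  interpret ar: arith_setting "\<int> :: 'a set" N ?X
  proof
    show "int_ring ?X = integral_closure \<int>" by (rule X)
    show "all_places ?X - set (inf_places ?X) = Nonarch ` V" by (auto simp: X ps(2) arch_places_def)
  qed
  have ne: "ps \<noteq> []" using embeddings_nonempty ps(2) by (auto simp: arch_places_eq)
  show ?thesis
  proof unfold_locales
    show "inf_places ?X \<noteq> []" "distinct (inf_places ?X)" "set (inf_places ?X) \<subseteq> all_places ?X" "1 < abs_base ?X"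
      using ne ps by (auto simp: X)
    show "coef_group ?X = UNIV" by (rule X)
    show "0 < place_deg ?X p" if "p \<in> set (inf_places ?X)" for p
      using that by (auto simp: X ps(2) arch_places_eq nf_deg_arch conj_pair_def card_gt_0_iff)
    show "place_val p (a * c) = place_val p a + place_val p c" if "p \<in> set (inf_places ?X)" "a \<noteq> 0" "c \<noteq> 0" for p a c
      using that by (auto simp: X ps(2) arch_places_eq place_val_arch embeddings_def field_embD(3,10) norm_mult ln_mult)
    show "\<exists>h\<in>I - {0}. \<forall>p\<in>set (inf_places ?X) - {last (inf_places ?X)}. C p \<le> place_val p h" if "frac_ideal ?X I" for I C
      using exists_small_nf[of I "last ps" C] that ne ps(2) last_in_set[OF ne] by (simp add: X ar.frac_ideal_iff)
    show "finite ((\<lambda>h. map (\<lambda>p. place_val p h) (inf_places ?X)) ` {h \<in> I - {0}. \<forall>p\<in>set (inf_places ?X). C p \<le> place_val p h})"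
      if "frac_ideal ?X I" for I C
      using finite_bounded_fractional[of I C] that by (simp add: X ps(2) ar.frac_ideal_iff)
    show "div_deg ?X (principal_div ?X f) = 0" if f: "f \<noteq> 0" for f
    proof -
      let ?W = "{v \<in> V. v f \<noteq> 0}"
      have fin: "finite (arch_places :: 'a place set)" using ps(2) by (metis finite_set)
      have "div_deg ?X (principal_div ?X f) = (\<Sum>p\<in>arch_places \<union> Nonarch ` ?W. principal_div ?X f p * place_deg ?X p)"
        using fin finite_support by (intro div_deg_eq_sum) (auto simp: principal_div_def X split: if_splits)
      also have "\<dots> = (\<Sum>p\<in>arch_places. principal_div ?X f p * place_deg ?X p) + (\<Sum>p\<in>Nonarch ` ?W. principal_div ?X f p * place_deg ?X p)"
        using fin finite_support by (intro sum.union_disjoint) (auto simp: arch_places_def)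
      also have "(\<Sum>p\<in>arch_places. principal_div ?X f p * place_deg ?X p) = - log_conjugates f"
        by (simp add: principal_div_def X flip: sum_arch_places)
      also have "(\<Sum>p\<in>Nonarch ` ?W. principal_div ?X f p * place_deg ?X p) = log_index f"
        by (subst sum.reindex) (auto simp: inj_on_def principal_div_def X log_index_def residue_card_def intro!: sum.cong)
      finally show ?thesis using defect_zero[OF f] by (simp add: defect_def)
    qed
  qed (simp_all add: X)
qed

end

section \<open>From finite degree over the rationals to the final statement\<close>

lemma number_field_bounded_rank:
  assumes "number_field TYPE('a::field_char_0)"
  obtains M where "bounded_rank (\<int> :: 'a set) M"
proof -
  have "subring_set (\<rat> :: 'a set)" by (simp add: subring_set_def)
  hence "subfield (\<rat> :: 'a set) (struct_on UNIV)" by (simp add: subfield_struct_iff Rats_inverse)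
  then obtain M where M: "bounded_rank (\<rat> :: 'a set) M"
    using bounded_rank_finite_dimension[of \<rat>] assms by (auto simp: number_field_def)
  have "\<exists>a\<in>\<int>. \<exists>b\<in>\<int>. b \<noteq> 0 \<and> c = a / b" if "c \<in> \<rat>" for c :: 'a
    using that by (auto elim!: Rats_cases' intro!: bexI[of _ "of_int _"])
  from bounded_rank_fractions[OF subring_Ints this M] show thesis by (rule that)
qed

lemma number_field_bijection:
  fixes ps :: "'a::field_char_0 place list"
  assumes K: "number_field TYPE('a)" and ps: "distinct ps" "set ps = arch_places"
  shows "(C, t) \<in> Rep (nf_data ps) \<Longrightarrow> I \<in> C \<Longrightarrow> Phi_nf (nf_data ps) (C, t) = nf_value (nf_data ps) I t"
    and "bij_betw (Phi_nf (nf_data ps)) (Rep (nf_data ps)) (Pic0 (nf_data ps))"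
proof -
  obtain M where M: "bounded_rank (\<int> :: 'a set) M" using number_field_bounded_rank[OF K] .
  obtain N and b :: "nat \<Rightarrow> 'a" where N: "bounded_rank (\<int> :: 'a set) N" "N > 0"
    "\<And>c i. (\<And>i. c i \<in> (\<int> :: 'a set)) \<Longrightarrow> (\<Sum>i<N. c i * b i) = 0 \<Longrightarrow> i < N \<Longrightarrow> c i = 0"
    by (rule bounded_rank_minimal[OF subring_Ints M]) blast
  interpret number_field_setting N b by unfold_locales (use N in auto)
  interpret nf_setting "\<int> :: 'a set" N "nf_data ps" by (rule nf_setting_nf_data[OF ps])
  show "(C, t) \<in> Rep (nf_data ps) \<Longrightarrow> I \<in> C \<Longrightarrow> Phi_nf (nf_data ps) (C, t) = nf_value (nf_data ps) I t"
    by (rule nf_bijection(1))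
  show "bij_betw (Phi_nf (nf_data ps)) (Rep (nf_data ps)) (Pic0 (nf_data ps))" by (rule nf_bijection(2))
qed

theorem theorem7p1:
  fixes ps :: "'a::field_char_0 place list"
    and k :: "'b::field set" and x :: 'b and q :: real and qs :: "'b place list"
  shows
    "(number_field TYPE('a) \<and> distinct ps \<and> set ps = arch_places \<longrightarrow>
        (\<forall>C t. (C, t) \<in> Rep (nf_data ps) \<longrightarrow>
           (\<forall>I \<in> C. Phi_nf (nf_data ps) (C, t) = nf_value (nf_data ps) I t)) \<and>
        bij_betw (Phi_nf (nf_data ps)) (Rep (nf_data ps)) (Pic0 (nf_data ps)))
     \<and>
     (function_field k \<and> \<not> algebraic_over k x \<and>
      1 < q \<and> (finite k \<longrightarrow> q = real (card k)) \<and>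
      distinct qs \<and> set qs = ff_inf_places k x \<longrightarrow>
        (\<forall>C t. (C, t) \<in> Rep (ff_data k x q qs) \<longrightarrow>
           (\<forall>I \<in> C. Phi_ff (ff_data k x q qs) (C, t) = ff_value (ff_data k x q qs) I t)) \<and>
        bij_betw (Phi_ff (ff_data k x q qs)) (Rep (ff_data k x q qs))
          (carrier (Pic_mod_last (ff_data k x q qs))))"
  using number_field_bijection[of ps] function_field_bijection[of k x q qs] by blast

end
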